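(* Let $A$ be a maximal indecomposable cyclotomic $\mathbb{Z}[\omega]$-matrix, where $\omega=1/2+\sqrt{-3}/2$, that has only zeros on the diagonal. Then $A$ is equivalent to an adjacency matrix of one of the graphs $T_{2k}$ ($k\geqslant3$), $T_{2k}^{(\omega)}$ ($k\geqslant3$), $S_2$, $S_4^{\ddagger}$, $S_{10}$, $S_{12}$, $S_{14}$, $S_{16}$.
   Context: **Matrices.** Let $R=\mathbb{Z}[\omega]$, $\omega=1/2+\sqrt{-3}/2$. A cyclotomic matrix over $R$ is a (finite, square) Hermitian matrix with entries in $R$ all of whose eigenvalues lie in $[-2,2]$. A Hermitian $R$-matrix is the adjacency matrix $(w(u,v))_{u,v}$ of a weighted directed graph ($R$-graph) with weight function $w$ satisfying $w(v,u)=\overline{w(u,v)}$; $w(v,v)$ is the charge of $v$. A matrix is indecomposable if its underlying graph (distinct $u,v$ adjacent iff $w(u,v)\neq 0$) is connected. An indecomposable cyclotomic $R$-matrix is maximal if it is not a (proper) principal submatrix of any other indecomposable cyclotomic $R$-matrix. Two $n\times n$ matrices $A,B$ over $R$ are equivalent if $A=\pm\sigma(QBQ^* )$ for some unitary matrix $Q$ with entries in $R$ ($QQ^*=Q^*Q=I$), some choice of sign, and $\sigma$ either the identity or complex conjugation applied entrywise. **Graphs.** Weights not determined by the listed ones via $w(v,u)=\overline{w(u,v)}$ are $0$. $T_{2k}$ ($k\ge 3$): vertices $t_j,b_j$, $j\in\mathbb{Z}/k$; for every $j$: $w(t_j,t_{j+1})=w(t_j,b_{j+1})=1$, $w(b_j,t_{j+1})=w(b_j,b_{j+1})=-1$.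 $T_{2k}^{(\omega)}$ ($k\ge3$): vertices $t_1,b_1,\dots,t_k,b_k$; for $1\le j\le k-1$ the same weights as in $T_{2k}$; and $w(t_k,t_1)=w(t_k,b_1)=\omega$, $w(b_k,t_1)=w(b_k,b_1)=-\omega$. $S_2$: two uncharged vertices joined by an edge of weight $2$. $S_4^{\ddagger}$: vertices $a,b,c,d$; $w(a,b)=w(c,d)=1$, $w(a,c)=-1-\omega$, $w(b,d)=1+\omega$. $S_{10}$: vertices $o_j,n_j$, $j\in\mathbb{Z}/5$; $w(o_j,n_j)=w(o_j,n_{j-1})=1$, $w(o_j,n_{j+1})=w(o_j,n_{j+3})=-\omega$. $S_{12}$: vertices $o_j,n_j$, $j\in\mathbb{Z}/6$; for $j$ even: $w(o_j,n_j)=1$, $w(o_j,n_{j-1})=w(o_j,n_{j+3})=-1$, $w(o_j,n_{j+1})=\omega$; for $j$ odd: $w(o_j,n_j)=w(o_j,n_{j+1})=w(o_j,n_{j+3})=1$, $w(n_{j-1},o_j)=-\omega$. $S_{14}$: vertices $o_j,n_j$, $j\in\mathbb{Z}/7$; $w(o_j,n_j)=w(o_j,n_{j+1})=w(o_j,n_{j+3})=1$, $w(o_j,n_{j-1})=-1$. $S_{16}$: vertices $o_j,n_j$, $j\in\mathbb{Z}/8$; $w(o_j,o_{j+1})=1$, $w(n_j,n_{j+3})=1$, $w(o_j,n_{j+1})=-1$, $w(o_j,n_{j-1})=1$. *)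

theory Defs
  imports
    "Jordan_Normal_Form.Char_Poly"
    "Jordan_Normal_Form.Schur_Decomposition"
    "Jordan_Normal_Form.DL_Submatrix"
begin

definition omega :: complex where
  "omega = Complex (1 / 2) (sqrt 3 / 2)"

definition Z_omega :: "complex set" where
  "Z_omega = {of_int a + of_int b * omega | a b. True}"

subsection \<open>Matrices\<close>

definition R_mat :: "nat \<Rightarrow> complex mat set" where
  "R_mat n = {A \<in> carrier_mat n n. elements_mat A \<subseteq> Z_omega}"

definition hermitian_mat :: "complex mat \<Rightarrow> bool" where
  "hermitian_mat A \<longleftrightarrow> square_mat A \<and> mat_adjoint A = A"

definition cyclotomic_mat :: "complex mat \<Rightarrow> bool" where
  "cyclotomic_mat A \<longleftrightarrow>
     A \<in> R_mat (dim_row A) \<and> hermitian_mat A \<and>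
     (\<forall>e. eigenvalue A e \<longrightarrow> e \<in> complex_of_real ` {-2..2})"

definition adjacent :: "complex mat \<Rightarrow> (nat \<times> nat) set" where
  "adjacent A = {(u, v). u < dim_row A \<and> v < dim_row A \<and> u \<noteq> v \<and> A $$ (u, v) \<noteq> 0}"

text \<open>Connected graphs are nonempty, so the \<open>0 \<times> 0\<close> matrix is not indecomposable.\<close>

definition indecomposable_mat :: "complex mat \<Rightarrow> bool" where
  "indecomposable_mat A \<longleftrightarrow>
     dim_row A > 0 \<and> (\<forall>u < dim_row A. \<forall>v < dim_row A. (u, v) \<in> (adjacent A)\<^sup>*)"

definition proper_principal_submatrix :: "complex mat \<Rightarrow> complex mat \<Rightarrow> bool" where
  "proper_principal_submatrix A B \<longleftrightarrow> (\<exists>I. I \<subset> {..<dim_row B} \<and> A = submatrix B I I)"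

definition maximal_indecomposable_cyclotomic_mat :: "complex mat \<Rightarrow> bool" where
  "maximal_indecomposable_cyclotomic_mat A \<longleftrightarrow>
     cyclotomic_mat A \<and> indecomposable_mat A \<and>
     \<not> (\<exists>B. cyclotomic_mat B \<and> indecomposable_mat B \<and> proper_principal_submatrix A B)"

definition R_unitary_mat :: "nat \<Rightarrow> complex mat set" where
  "R_unitary_mat n =
     {Q \<in> R_mat n. Q * mat_adjoint Q = 1\<^sub>m n \<and> mat_adjoint Q * Q = 1\<^sub>m n}"

definition R_equivalent :: "complex mat \<Rightarrow> complex mat \<Rightarrow> bool" where
  "R_equivalent A B \<longleftrightarrow>
     (\<exists>n. A \<in> R_mat n \<and> B \<in> R_mat n \<and>
       (\<exists>Q \<in> R_unitary_mat n. \<exists>s \<in> {1, -1}. \<exists>\<sigma> \<in> {id, cnj}.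
          A = s \<cdot>\<^sub>m map_mat \<sigma> (Q * B * mat_adjoint Q)))"

subsection \<open>Graphs\<close>

text \<open>A graph is a pair of a finite vertex set and a weight function. The functions named
  \<open>\<dots>_listed\<close> below give the weights of one orientation of each edge; \<open>hermitian_weight\<close> fills in
  the conjugate weights of the reversed edges.\<close>

definition hermitian_weight :: "('v \<Rightarrow> 'v \<Rightarrow> complex) \<Rightarrow> 'v \<Rightarrow> 'v \<Rightarrow> complex" where
  "hermitian_weight l u v = (if l u v \<noteq> 0 then l u v else cnj (l v u))"

definition adjacency_matrix_of :: "'v set \<times> ('v \<Rightarrow> 'v \<Rightarrow> complex) \<Rightarrow> complex mat \<Rightarrow> bool" where
  "adjacency_matrix_of G A \<longleftrightarrow>
     (\<exists>f. bij_betw f {..<card (fst G)} (fst G) \<and>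
       A = mat (card (fst G)) (card (fst G)) (\<lambda>(i, j). snd G (f i) (f j)))"

definition equivalent_to_graph :: "complex mat \<Rightarrow> 'v set \<times> ('v \<Rightarrow> 'v \<Rightarrow> complex) \<Rightarrow> bool" where
  "equivalent_to_graph A G \<longleftrightarrow> (\<exists>B. adjacency_matrix_of G B \<and> R_equivalent A B)"

datatype tb_vertex = Vt int | Vb int
datatype on_vertex = Vo int | Vn int
datatype abcd_vertex = VA | VB | VC | VD

text \<open>\<open>\<int>/m\<close> is represented by \<open>{0..<m}\<close>; the vertices of \<open>T_omega_graph\<close> are numbered
  from \<open>1\<close>.\<close>

fun T_listed :: "int \<Rightarrow> tb_vertex \<Rightarrow> tb_vertex \<Rightarrow> complex" where
  "T_listed k (Vt i) (Vt j) = (if j = (i + 1) mod k then 1 else 0)"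
| "T_listed k (Vt i) (Vb j) = (if j = (i + 1) mod k then 1 else 0)"
| "T_listed k (Vb i) (Vt j) = (if j = (i + 1) mod k then -1 else 0)"
| "T_listed k (Vb i) (Vb j) = (if j = (i + 1) mod k then -1 else 0)"

definition T_graph :: "int \<Rightarrow> tb_vertex set \<times> (tb_vertex \<Rightarrow> tb_vertex \<Rightarrow> complex)" where
  "T_graph k = (Vt ` {0..<k} \<union> Vb ` {0..<k}, hermitian_weight (T_listed k))"

fun T_omega_listed :: "int \<Rightarrow> tb_vertex \<Rightarrow> tb_vertex \<Rightarrow> complex" where
  "T_omega_listed k (Vt i) (Vt j) =
     (if i < k \<and> j = i + 1 then 1 else if i = k \<and> j = 1 then omega else 0)"
| "T_omega_listed k (Vt i) (Vb j) =
     (if i < k \<and> j = i + 1 then 1 else if i = k \<and> j = 1 then omega else 0)"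
| "T_omega_listed k (Vb i) (Vt j) =
     (if i < k \<and> j = i + 1 then -1 else if i = k \<and> j = 1 then - omega else 0)"
| "T_omega_listed k (Vb i) (Vb j) =
     (if i < k \<and> j = i + 1 then -1 else if i = k \<and> j = 1 then - omega else 0)"

definition T_omega_graph :: "int \<Rightarrow> tb_vertex set \<times> (tb_vertex \<Rightarrow> tb_vertex \<Rightarrow> complex)" where
  "T_omega_graph k = (Vt ` {1..k} \<union> Vb ` {1..k}, hermitian_weight (T_omega_listed k))"

fun S2_listed :: "abcd_vertex \<Rightarrow> abcd_vertex \<Rightarrow> complex" where
  "S2_listed VA VB = 2"
| "S2_listed _ _ = 0"

definition S2_graph :: "abcd_vertex set \<times> (abcd_vertex \<Rightarrow> abcd_vertex \<Rightarrow> complex)" where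
  "S2_graph = ({VA, VB}, hermitian_weight S2_listed)"

fun S4_listed :: "abcd_vertex \<Rightarrow> abcd_vertex \<Rightarrow> complex" where
  "S4_listed VA VB = 1"
| "S4_listed VC VD = 1"
| "S4_listed VA VC = -1 - omega"
| "S4_listed VB VD = 1 + omega"
| "S4_listed _ _ = 0"

text \<open>The graph written \<open>S\<^sub>4\<close> with a double dagger.\<close>

definition S4_graph :: "abcd_vertex set \<times> (abcd_vertex \<Rightarrow> abcd_vertex \<Rightarrow> complex)" where
  "S4_graph = ({VA, VB, VC, VD}, hermitian_weight S4_listed)"

definition on_vertices :: "int \<Rightarrow> on_vertex set" where
  "on_vertices m = Vo ` {0..<m} \<union> Vn ` {0..<m}"

fun S10_listed :: "on_vertex \<Rightarrow> on_vertex \<Rightarrow> complex" where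
  "S10_listed (Vo j) (Vn i) =
     (if i = j \<or> i = (j - 1) mod 5 then 1
      else if i = (j + 1) mod 5 \<or> i = (j + 3) mod 5 then - omega
      else 0)"
| "S10_listed _ _ = 0"

definition S10_graph :: "on_vertex set \<times> (on_vertex \<Rightarrow> on_vertex \<Rightarrow> complex)" where
  "S10_graph = (on_vertices 5, hermitian_weight S10_listed)"

fun S12_listed :: "on_vertex \<Rightarrow> on_vertex \<Rightarrow> complex" where
  "S12_listed (Vo j) (Vn i) =
     (if even j then
        (if i = j then 1
         else if i = (j - 1) mod 6 \<or> i = (j + 3) mod 6 then -1
         else if i = (j + 1) mod 6 then omega
         else 0)
      else
        (if i = j \<or> i = (j + 1) mod 6 \<or> i = (j + 3) mod 6 then 1 else 0))"
| "S12_listed (Vn i) (Vo j) = (if odd j \<and> i = (j - 1) mod 6 then - omega else 0)"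
| "S12_listed _ _ = 0"

definition S12_graph :: "on_vertex set \<times> (on_vertex \<Rightarrow> on_vertex \<Rightarrow> complex)" where
  "S12_graph = (on_vertices 6, hermitian_weight S12_listed)"

fun S14_listed :: "on_vertex \<Rightarrow> on_vertex \<Rightarrow> complex" where
  "S14_listed (Vo j) (Vn i) =
     (if i = j \<or> i = (j + 1) mod 7 \<or> i = (j + 3) mod 7 then 1
      else if i = (j - 1) mod 7 then -1
      else 0)"
| "S14_listed _ _ = 0"

definition S14_graph :: "on_vertex set \<times> (on_vertex \<Rightarrow> on_vertex \<Rightarrow> complex)" where
  "S14_graph = (on_vertices 7, hermitian_weight S14_listed)"

fun S16_listed :: "on_vertex \<Rightarrow> on_vertex \<Rightarrow> complex" where
  "S16_listed (Vo j) (Vo i) = (if i = (j + 1) mod 8 then 1 else 0)"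
| "S16_listed (Vn j) (Vn i) = (if i = (j + 3) mod 8 then 1 else 0)"
| "S16_listed (Vo j) (Vn i) =
     (if i = (j + 1) mod 8 then -1 else if i = (j - 1) mod 8 then 1 else 0)"
| "S16_listed _ _ = 0"

definition S16_graph :: "on_vertex set \<times> (on_vertex \<Rightarrow> on_vertex \<Rightarrow> complex)" where
  "S16_graph = (on_vertices 8, hermitian_weight S16_listed)"

end

theory Submission
  imports Defs "Jordan_Normal_Form.Spectral_Radius"
begin

text \<open>
  The matrices \<open>2 - A\<close> and \<open>2 + A\<close> are positive semidefinite, and \<open>A\<close> can be bordered by a
  column \<open>x = (4 - A\<^sup>2) f\<close> as soon as \<open>f\<close> is short with respect to both forms. Maximality thus
  forbids short nonzero vectors in the dual of the lattice with Gram matrix \<open>4 - A\<^sup>2\<close>, which forces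
  every row of \<open>A\<close> to have norm 4; so distinct rows are orthogonal and \<open>A\<^sup>2 = 4\<close>.

  An entry of norm 4 or 3 gives \<open>S\<^sub>2\<close> or \<open>S\<^sub>4\<close>. Otherwise the graph is 4-regular with unit weights,
  and no two neighbourhoods meet in exactly one vertex. If two neighbourhoods coincide, this property
  propagates along the graph, which closes up to a tessellation \<open>T\<close> with some twist \<open>z\<close>. If two
  neighbourhoods meet in three vertices, orthogonality makes the ratios of their entries cube roots of
  unity and leaves \<open>S\<^sub>1\<^sub>0\<close> and \<open>S\<^sub>1\<^sub>2\<close>. If they always meet in 0 or 2 vertices, rows and columns form
  the complement of the Fano plane or the 4-cube, which carry only the weightings \<open>S\<^sub>1\<^sub>4\<close> and \<open>S\<^sub>1\<^sub>6\<close>.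
\<close>

section \<open>Eisenstein integers\<close>

text \<open>Squared row norms are integers at most 4, and norm 3 falls to a dual vector of norm 1;
  the hard case is a row of norm at most 2. There the short vector depends on the neighbourhood. It
  is found in the kernel of A, where squared norm 4 is allowed, or in an eigenspace of A^2 for the
  eigenvalue 1 or 2, where only 3 or 2 is allowed. The cancellations it needs come from rows of norm
  4: such a row is orthogonal to all others even before A^2 = 4 is known, because its basis vector
  is a null vector of the positive semidefinite form 4 - A^2. So one row of norm 4 has to be
  produced first, and the analysis then spreads from it along the connected graph. The arithmetic
  behind all case distinctions is that of vanishing sums of units: two are opposite, three have
  primitive cube roots of unity as ratios, four split into opposite pairs. In the final equivalences
  only diagonal unitary matrices and renumberings occur; the global sign stays 1, and complex
  conjugation is applied only for the twist 1 - omega.\<close>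

lemma omega_facts:
  "cmod omega = 1" "omega \<in> Z_omega" "omega * omega = omega - 1" "cnj omega = 1 - omega"
  "omega \<noteq> 0"
proof -
  have "(cmod omega)\<^sup>2 = (1 / 2)\<^sup>2 + (sqrt 3 / 2)\<^sup>2" by (simp add: omega_def cmod_power2)
  then have "(cmod omega)\<^sup>2 = 1\<^sup>2" by (simp add: power2_eq_square)
  then show "cmod omega = 1" by (metis norm_ge_zero power2_eq_iff_nonneg zero_le_one)
  then show "omega \<noteq> 0" by auto
  have "omega = of_int 0 + of_int 1 * omega" by simp
  then show "omega \<in> Z_omega" unfolding Z_omega_def by blast
  show "omega * omega = omega - 1" "cnj omega = 1 - omega"
    by (simp_all add: omega_def complex_eq_iff)
qed

lemma Z_omega_algebra:
  assumes "x \<in> Z_omega" "y \<in> Z_omega"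
  shows "x + y \<in> Z_omega" "x - y \<in> Z_omega" "x * y \<in> Z_omega" "- x \<in> Z_omega" "cnj x \<in> Z_omega"
proof -
  obtain a b c d :: int where x: "x = of_int a + of_int b * omega" and y: "y = of_int c + of_int d * omega"
    using assms unfolding Z_omega_def by blast
  have "x + y = of_int (a + c) + of_int (b + d) * omega" by (simp add: x y algebra_simps)
  then show "x + y \<in> Z_omega" unfolding Z_omega_def by blast
  have "x - y = of_int (a - c) + of_int (b - d) * omega" by (simp add: x y algebra_simps)
  then show "x - y \<in> Z_omega" unfolding Z_omega_def by blast
  have "- x = of_int (- a) + of_int (- b) * omega" by (simp add: x)
  then show "- x \<in> Z_omega" unfolding Z_omega_def by blast
  have "cnj x = of_int (a + b) + of_int (- b) * omega" by (simp add: x omega_facts(4) algebra_simps)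
  then show "cnj x \<in> Z_omega" unfolding Z_omega_def by blast
  have "x * y = of_int a * of_int c + (of_int a * of_int d + of_int b * of_int c) * omega
      + of_int b * of_int d * (omega * omega)"
    by (simp add: x y algebra_simps)
  also have "\<dots> = of_int (a * c - b * d) + of_int (a * d + b * c + b * d) * omega"
    unfolding omega_facts(3) by (simp add: algebra_simps)
  finally show "x * y \<in> Z_omega" unfolding Z_omega_def by blast
qed

lemma Z_omega_unary: "x \<in> Z_omega \<Longrightarrow> - x \<in> Z_omega" "x \<in> Z_omega \<Longrightarrow> cnj x \<in> Z_omega"
  using Z_omega_algebra(4,5)[of x x] by simp_all

lemma of_int_Z_omega [simp]: "of_int k \<in> Z_omega"
  unfolding Z_omega_def by (rule CollectI, rule exI[of _ k], rule exI[of _ 0]) simp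

lemma Z_omega_numerals [simp]: "0 \<in> Z_omega" "1 \<in> Z_omega" "-1 \<in> Z_omega"
  using of_int_Z_omega[of 0] of_int_Z_omega[of 1] of_int_Z_omega[of "-1"] by auto

lemma Z_omega_sum: "(\<And>i. i \<in> S \<Longrightarrow> f i \<in> Z_omega) \<Longrightarrow> sum f S \<in> Z_omega"
  by (induction S rule: infinite_finite_induct) (auto intro: Z_omega_algebra)

lemma Z_omega_Reals:
  assumes "x \<in> Z_omega" "cnj x = x"
  obtains k :: int where "x = of_int k"
proof -
  obtain a b :: int where x: "x = of_int a + of_int b * omega"
    using assms unfolding Z_omega_def by blast
  have "Im (cnj x) = Im x" using assms(2) by simp
  then have "Im x = 0" by simp
  then have "b = 0" by (simp add: x omega_def)
  then show ?thesis using x that by simp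
qed

lemma cmod_Eisenstein:
  "(cmod (of_int a + of_int b * omega))\<^sup>2 = real_of_int (a\<^sup>2 + a * b + b\<^sup>2)"
proof -
  have "(cmod (of_int a + of_int b * omega))\<^sup>2 = (real_of_int a + of_int b / 2)\<^sup>2 + (of_int b * sqrt 3 / 2)\<^sup>2"
    by (simp add: omega_def cmod_power2)
  also have "\<dots> = real_of_int (a\<^sup>2 + a * b + b\<^sup>2)"
    by (simp add: power2_eq_square field_simps)
  finally show ?thesis .
qed

text \<open>The prime 2 is inert: the norm form is odd unless a and b are both even, and then it is
  divisible by 4. This gap is why a matrix entry can only be zero, a unit, or of norm 3 or
  4.\<close>

lemma Z_omega_norm:
  assumes "x \<in> Z_omega"
  obtains k :: nat where "(cmod x)\<^sup>2 = real k" "k \<noteq> 2"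
proof -
  obtain a b :: int where x: "x = of_int a + of_int b * omega"
    using assms unfolding Z_omega_def by blast
  have eq: "(cmod x)\<^sup>2 = real_of_int (a\<^sup>2 + a * b + b\<^sup>2)" unfolding x by (rule cmod_Eisenstein)
  then have nn: "a\<^sup>2 + a * b + b\<^sup>2 \<ge> 0"
    by (metis of_int_0_le_iff zero_le_power2)
  have "a\<^sup>2 + a * b + b\<^sup>2 \<noteq> 2"
  proof
    assume e: "a\<^sup>2 + a * b + b\<^sup>2 = 2"
    have "even a \<and> even b"
    proof (rule ccontr)
      assume "\<not> (even a \<and> even b)"
      then have "odd (a\<^sup>2 + a * b + b\<^sup>2)" by auto
      then show False using e by simp
    qed
    then obtain c d where "a = 2 * c" "b = 2 * d" by (auto elim!: evenE)
    then have "4 * (c\<^sup>2 + c * d + d\<^sup>2) = 2" using e by (simp add: power2_eq_square algebra_simps)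
    then show False by presburger
  qed
  then show ?thesis
    using that[of "nat (a\<^sup>2 + a * b + b\<^sup>2)"] eq nn by simp
qed

lemma Z_omega_units:
  assumes "x \<in> Z_omega" "cmod x = 1"
  shows "x \<in> {1, omega, omega - 1, - 1, - omega, 1 - omega}"
proof -
  obtain a b :: int where x: "x = of_int a + of_int b * omega"
    using assms unfolding Z_omega_def by blast
  have "real_of_int (a\<^sup>2 + a * b + b\<^sup>2) = 1" using assms cmod_Eisenstein[of a b] by (simp add: x)
  then have eq: "a\<^sup>2 + a * b + b\<^sup>2 = 1" by linarith
  \<comment> \<open>Completing the square in either variable bounds the other one by 1 in absolute
    value.\<close>
  then have "4 * a\<^sup>2 + 4 * (a * b) + 4 * b\<^sup>2 = 4" by simp
  then have "(2 * a + b)\<^sup>2 + 3 * b\<^sup>2 = 4" "(2 * b + a)\<^sup>2 + 3 * a\<^sup>2 = 4"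
    by (simp_all add: power2_eq_square algebra_simps)
  then have "3 * b\<^sup>2 \<le> 4" "3 * a\<^sup>2 \<le> 4"
    by (smt (verit) zero_le_power2)+
  then have "b\<^sup>2 \<le> 1" "a\<^sup>2 \<le> 1" by linarith+
  then have "\<bar>b\<bar> \<le> 1" "\<bar>a\<bar> \<le> 1" by (simp_all add: abs_square_le_1)
  then have "a = -1 \<or> a = 0 \<or> a = 1" "b = -1 \<or> b = 0 \<or> b = 1" by linarith+
  then show ?thesis using eq by (auto simp: x)
qed

text \<open>As 2 is inert, an even norm forces both coordinates to be even; so the elements of norm
  4 are the units times 2.\<close>

lemma Z_omega_half:
  assumes "x \<in> Z_omega" "(cmod x)\<^sup>2 = 4"
  shows "x / 2 \<in> Z_omega"
proof -
  obtain a b :: int where x: "x = of_int a + of_int b * omega"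
    using assms unfolding Z_omega_def by blast
  have "real_of_int (a\<^sup>2 + a * b + b\<^sup>2) = 4" using assms cmod_Eisenstein[of a b] by (simp add: x)
  then have eq: "a\<^sup>2 + a * b + b\<^sup>2 = 4" by linarith
  have "even a \<and> even b"
  proof (rule ccontr)
    assume "\<not> (even a \<and> even b)"
    then have "odd (a\<^sup>2 + a * b + b\<^sup>2)" by auto
    then show False using eq by simp
  qed
  then obtain c d where "a = 2 * c" "b = 2 * d" by (auto elim!: evenE)
  then have "x / 2 = of_int c + of_int d * omega" by (simp add: x)
  then show ?thesis unfolding Z_omega_def by blast
qed

text \<open>The prime 3 ramifies: modulo 3 the norm form is (a - b)^2, so norm 3 forces a = b modulo
  3, which is the condition for divisibility by 1 + omega.\<close>

lemma Z_omega_third: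
  assumes "x \<in> Z_omega" "(cmod x)\<^sup>2 = 3"
  shows "x / (1 + omega) \<in> Z_omega"
proof -
  obtain a b :: int where x: "x = of_int a + of_int b * omega"
    using assms unfolding Z_omega_def by blast
  have "real_of_int (a\<^sup>2 + a * b + b\<^sup>2) = 3" using assms cmod_Eisenstein[of a b] by (simp add: x)
  then have eq: "a\<^sup>2 + a * b + b\<^sup>2 = 3" by linarith
  have "(a - b)\<^sup>2 = 3 * (1 - a * b)" using eq by (simp add: power2_eq_square algebra_simps)
  then have "3 dvd (a - b)\<^sup>2" by simp
  then have "3 dvd a - b" by (rule prime_dvd_power[rotated]) simp
  then obtain k where "a - b = 3 * k" by (elim dvdE)
  then have a: "a = b + 3 * k" by simp
  have ne: "1 + omega \<noteq> 0" by (simp add: omega_def complex_eq_iff)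
  have "(of_int (b + 2 * k) + of_int (- k) * omega) * (1 + omega)
      = of_int (b + 2 * k) + of_int (b + k) * omega + of_int (- k) * (omega * omega)"
    by (simp add: algebra_simps)
  then have "x = (of_int (b + 2 * k) + of_int (- k) * omega) * (1 + omega)"
    unfolding omega_facts(3) by (simp add: x a algebra_simps)
  then have "x / (1 + omega) = of_int (b + 2 * k) + of_int (- k) * omega"
    using ne by (simp add: field_simps)
  then show ?thesis unfolding Z_omega_def by blast
qed

section \<open>Hermitian forms and the spectral bound\<close>

text \<open>Vectors are plain functions of which only the entries below \<open>n\<close> count, so
  no dimension conditions accompany the algebra. Matrices proper occur only at the two ends of the
  proof, in maximality and in equivalence.\<close>

locale herm_form =
  fixes n :: nat and a :: "nat \<Rightarrow> nat \<Rightarrow> complex"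
  assumes herm: "i < n \<Longrightarrow> j < n \<Longrightarrow> a j i = cnj (a i j)"
begin

definition ip :: "(nat \<Rightarrow> complex) \<Rightarrow> (nat \<Rightarrow> complex) \<Rightarrow> complex" where
  "ip u v = (\<Sum>i<n. cnj (u i) * v i)"

definition ap :: "(nat \<Rightarrow> complex) \<Rightarrow> nat \<Rightarrow> complex" where
  "ap z i = (\<Sum>j<n. a i j * z j)"

lemma ip_add: "ip u (\<lambda>i. v i + w i) = ip u v + ip u w" "ip (\<lambda>i. v i + w i) u = ip v u + ip w u"
  "ip u (\<lambda>i. v i - w i) = ip u v - ip u w" "ip (\<lambda>i. v i - w i) u = ip v u - ip w u"
  "ip u (\<lambda>i. c * v i) = c * ip u v" "ip (\<lambda>i. c * v i) u = cnj c * ip v u"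
  by (simp_all add: ip_def sum.distrib sum_subtractf sum_distrib_left algebra_simps)

lemma ap_add: "ap (\<lambda>i. v i + w i) = (\<lambda>i. ap v i + ap w i)" "ap (\<lambda>i. v i - w i) = (\<lambda>i. ap v i - ap w i)"
  "ap (\<lambda>i. c * v i) = (\<lambda>i. c * ap v i)"
  by (simp_all add: ap_def fun_eq_iff sum.distrib sum_subtractf sum_distrib_left algebra_simps)

lemma ip_cnj: "ip u v = cnj (ip v u)"
  by (simp add: ip_def mult.commute)

lemma ip_ap: "ip u (ap v) = ip (ap u) v"
proof -
  have "ip u (ap v) = (\<Sum>i<n. \<Sum>j<n. cnj (u i) * a i j * v j)"
    by (simp add: ip_def ap_def sum_distrib_left mult.assoc)
  also have "\<dots> = (\<Sum>j<n. \<Sum>i<n. cnj (u i) * a i j * v j)" by (rule sum.swap)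
  also have "\<dots> = (\<Sum>j<n. \<Sum>i<n. cnj (u i) * cnj (a j i) * v j)"
    by (intro sum.cong refl) (metis herm complex_cnj_cnj lessThan_iff)
  also have "\<dots> = ip (ap u) v"
    by (simp add: ip_def ap_def sum_distrib_right) (simp add: mult_ac sum_distrib_left)
  finally show ?thesis .
qed

lemma ip_cong: "(\<And>i. i < n \<Longrightarrow> u i = u' i) \<Longrightarrow> (\<And>i. i < n \<Longrightarrow> v i = v' i) \<Longrightarrow> ip u v = ip u' v'"
  by (simp add: ip_def)

lemma ip_self: "ip u u = of_real (\<Sum>i<n. (cmod (u i))\<^sup>2)"
proof -
  have "cnj (u i) * u i = of_real ((cmod (u i))\<^sup>2)" for i
    by (metis complex_norm_square mult.commute)
  then show ?thesis by (simp add: ip_def)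
qed

lemma Re_ip_self: "Re (ip u u) = (\<Sum>i<n. (cmod (u i))\<^sup>2)" "Im (ip u u) = 0"
  by (simp_all add: ip_self)

lemma Re_ip_nonneg: "Re (ip u u) \<ge> 0"
  by (simp add: ip_self sum_nonneg)

lemma ip_zero: "Re (ip u u) = 0 \<Longrightarrow> i < n \<Longrightarrow> u i = 0"
  by (simp add: ip_self sum_nonneg_eq_0_iff)

lemma Im_ip_ap: "Im (ip z (ap z)) = 0"
proof -
  have "cnj (ip z (ap z)) = ip z (ap z)"
    by (metis ip_ap ip_cnj)
  then have "Im (cnj (ip z (ap z))) = Im (ip z (ap z))" by simp
  then show ?thesis by simp
qed

lemma cauchy_schwarz: "(cmod (ip u v))\<^sup>2 \<le> Re (ip u u) * Re (ip v v)"
proof (cases "Re (ip u u) = 0")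
  case True
  then have "ip u v = 0" using ip_zero[OF True] by (simp add: ip_def)
  then show ?thesis using True by simp
next
  case False
  define U where "U = Re (ip u u)"
  have U: "ip u u = of_real U" "U > 0" using False Re_ip_nonneg[of u] Re_ip_self(2)[of u]
    by (auto simp: U_def complex_eq_iff)
  define s where "s = ip u v / of_real U"
  have "0 \<le> Re (ip (\<lambda>i. v i - s * u i) (\<lambda>i. v i - s * u i))" by (rule Re_ip_nonneg)
  also have "ip (\<lambda>i. v i - s * u i) (\<lambda>i. v i - s * u i) =
     ip v v - s * ip v u - cnj s * ip u v + cnj s * s * of_real U"
    by (simp add: ip_add U(1) algebra_simps)
  also have "\<dots> = ip v v - s * ip v u"
    using U(2) by (simp add: s_def ip_cnj[of u v])
  also have "s * ip v u = of_real ((cmod (ip u v))\<^sup>2 / U)"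
    by (simp add: s_def ip_cnj[of v u] complex_norm_square[symmetric] del: of_real_power)
  finally show ?thesis using U(2) by (simp add: U_def[symmetric] field_simps)
qed

text \<open>The norms of the iterates of a Hermitian operator are log-convex, so that one step
  of growth faster than the spectral radius would persist.\<close>

lemma norm_bound_of_iterates:
  assumes r: "r > 0" and C: "\<And>k. Re (ip ((ap ^^ k) z) ((ap ^^ k) z)) \<le> C * r ^ k"
  shows "Re (ip (ap z) (ap z)) \<le> r * Re (ip z z)"
proof (rule ccontr)
  define s where "s k = Re (ip ((ap ^^ k) z) ((ap ^^ k) z))" for k
  assume "\<not> ?thesis"
  then have gt: "s 1 > r * s 0" by (simp add: s_def)
  have s0: "s k \<ge> 0" for k unfolding s_def by (rule Re_ip_nonneg)
  have convex: "(s (Suc k))\<^sup>2 \<le> s k * s (Suc (Suc k))" for k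
  proof -
    have eq: "ip ((ap ^^ Suc k) z) ((ap ^^ Suc k) z) = ip ((ap ^^ k) z) ((ap ^^ Suc (Suc k)) z)"
      by (simp add: ip_ap)
    show ?thesis
      unfolding s_def eq
      by (rule order_trans[OF _ cauchy_schwarz[of "(ap ^^ k) z" "(ap ^^ Suc (Suc k)) z"]])
        (simp only: cmod_power2 zero_le_power2 le_add_same_cancel1)
  qed
  have pos0: "s 0 > 0"
  proof (rule ccontr)
    assume "\<not> s 0 > 0"
    then have "s 0 = 0" using s0[of 0] by simp
    then have "(s 1)\<^sup>2 \<le> 0" using convex[of 0] by simp
    then show False using gt \<open>s 0 = 0\<close> by simp
  qed
  define q where "q = s 1 / s 0"
  have q: "q > r" using gt pos0 by (simp add: q_def field_simps)
  have step: "s k > 0 \<and> s (Suc k) \<ge> q * s k" for k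
  proof (induction k)
    case 0 then show ?case using pos0 by (simp add: q_def)
  next
    case (Suc k)
    then have p: "s (Suc k) > 0" using q r by (smt (verit) mult_pos_pos)
    have "q * s k * s (Suc k) \<le> s (Suc k) * s (Suc k)" using Suc p by (simp add: mult_right_mono)
    also have "\<dots> \<le> s k * s (Suc (Suc k))" using convex[of k] by (simp add: power2_eq_square)
    finally have "s k * (q * s (Suc k)) \<le> s k * s (Suc (Suc k))" by (simp add: mult_ac)
    then show ?case using p Suc by (simp add: mult_le_cancel_left_pos)
  qed
  have grow: "q ^ k * s 0 \<le> s k" for k
  proof (induction k)
    case (Suc k)
    have "q ^ Suc k * s 0 = q * (q ^ k * s 0)" by simp
    also have "\<dots> \<le> q * s k" using Suc q r by (simp add: mult_left_mono)
    finally show ?case using step[of k] by simp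
  qed simp
  have "(q / r) ^ k \<le> C / s 0" for k
  proof -
    have "q ^ k * s 0 \<le> C * r ^ k" using grow[of k] C[of k] by (simp add: s_def)
    then show ?thesis using r pos0 by (simp add: power_divide field_simps)
  qed
  moreover obtain k where "(q / r) ^ k > C / s 0"
    using real_arch_pow[of "q / r" "C / s 0"] q r by auto
  ultimately show False by (metis not_le)
qed

text \<open>No diagonalisation is involved. For e > 0 the matrix A / (2 + e) has spectral radius
  below 1, so its powers are bounded and the iterates of A grow at most like (2 + e)^k. The
  preceding growth lemma then gives the bound with (2 + e)^2 in place of 4, and e tends to
  0.\<close>

lemma norm_bound_of_eigenvalues:
  assumes A: "A \<in> carrier_mat n n" "\<And>i j. i < n \<Longrightarrow> j < n \<Longrightarrow> A $$ (i, j) = a i j"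
    and ev: "\<And>e. eigenvalue A e \<Longrightarrow> cmod e \<le> 2" and "n > 0"
  shows "Re (ip (ap z) (ap z)) \<le> 4 * Re (ip z z)"
proof -
  have iter: "((ap ^^ k) z) i = (\<Sum>j<n. (A ^\<^sub>m k) $$ (i, j) * z j)" if "i < n" for k i
    using that
  proof (induction k arbitrary: i)
    case 0
    then show ?case using A by (simp add: if_distrib[of "\<lambda>x. x * _"] cong: if_cong)
  next
    case (Suc k)
    have cm: "A ^\<^sub>m k \<in> carrier_mat n n" using A by simp
    \<comment> \<open>Matrix powers are defined by multiplication on the right, whereas iterating
      \<open>ap\<close> multiplies on the left.\<close>
    have comm: "A ^\<^sub>m Suc k = A * A ^\<^sub>m k"
    proof (induction k)
      case 0 then show ?case using A by simp
    next
      case (Suc k)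
      have "A ^\<^sub>m Suc (Suc k) = (A * A ^\<^sub>m k) * A" using Suc by simp
      also have "\<dots> = A * (A ^\<^sub>m k * A)" using A by (intro assoc_mult_mat[of _ n n _ n _ n]) auto
      finally show ?case by simp
    qed
    have "((ap ^^ Suc k) z) i = (\<Sum>l<n. a i l * (\<Sum>j<n. (A ^\<^sub>m k) $$ (l, j) * z j))"
      using Suc.IH by (simp add: ap_def[of "(ap ^^ k) z"])
    also have "\<dots> = (\<Sum>l<n. \<Sum>j<n. a i l * (A ^\<^sub>m k) $$ (l, j) * z j)"
      by (simp add: sum_distrib_left mult.assoc)
    also have "\<dots> = (\<Sum>j<n. \<Sum>l<n. a i l * (A ^\<^sub>m k) $$ (l, j) * z j)" by (rule sum.swap)
    also have "\<dots> = (\<Sum>j<n. (A ^\<^sub>m Suc k) $$ (i, j) * z j)"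
    proof (rule sum.cong[OF refl])
      fix j assume "j \<in> {..<n}"
      then have "(A ^\<^sub>m Suc k) $$ (i, j) = (\<Sum>l<n. a i l * (A ^\<^sub>m k) $$ (l, j))"
        unfolding comm using A cm Suc.prems by (auto simp: scalar_prod_def atLeast0LessThan intro!: sum.cong)
      then show "(\<Sum>l<n. a i l * (A ^\<^sub>m k) $$ (l, j) * z j) = (A ^\<^sub>m Suc k) $$ (i, j) * z j"
        by (simp add: sum_distrib_right)
    qed
    finally show ?case .
  qed
  have bound: "Re (ip (ap z) (ap z)) \<le> (2 + e)\<^sup>2 * Re (ip z z)" if e: "e > 0" for e :: real
  proof -
    define B where "B = complex_of_real (1 / (2 + e)) \<cdot>\<^sub>m A"
    have B: "B \<in> carrier_mat n n" using A by (simp add: B_def)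
    have evB: "cmod x < 1" if evx: "eigenvalue B x" for x
    proof -
      have "dim_row B = n" using B by simp
      then obtain v where v: "v \<in> carrier_vec n" "v \<noteq> 0\<^sub>v n" "B *\<^sub>v v = x \<cdot>\<^sub>v v"
        using evx unfolding eigenvalue_def eigenvector_def by auto
      have "A = complex_of_real (2 + e) \<cdot>\<^sub>m B"
        unfolding B_def using e by (intro eq_matI) (auto simp flip: of_real_mult of_real_add)
      then have "A *\<^sub>v v = complex_of_real (2 + e) \<cdot>\<^sub>v (B *\<^sub>v v)"
        using B v(1) by (intro eq_vecI) (auto simp: smult_scalar_prod_distrib scalar_prod_def
            sum_distrib_left mult.assoc)
      then have "A *\<^sub>v v = (complex_of_real (2 + e) * x) \<cdot>\<^sub>v v"
        using v by (auto simp: mult.assoc)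
      then have "eigenvalue A (complex_of_real (2 + e) * x)"
        unfolding eigenvalue_def eigenvector_def using A v by auto
      then have "cmod (complex_of_real (2 + e) * x) \<le> 2" by (rule ev)
      then have "(2 + e) * cmod x \<le> 2" using e by (simp add: norm_mult del: of_real_add)
      moreover have "2 < (2 + e) * 1" using e by simp
      ultimately have "(2 + e) * cmod x < (2 + e) * 1" by linarith
      then show ?thesis using e by (simp add: mult_less_cancel_left_pos)
    qed
    have "spectral_radius B \<in> cmod ` spectrum B" using spectral_radius_mem_max(1)[OF B \<open>n > 0\<close>] .
    then have "spectral_radius B < 1" using evB by (auto simp: spectrum_def)
    then obtain c where c: "\<And>k. norm_bound (B ^\<^sub>m k) c"
      using spectral_radius_jnf_norm_bound_less_1_upper_triangular[OF B] by blast
    have powB: "(A ^\<^sub>m k) $$ (i, j) = complex_of_real ((2 + e) ^ k) * (B ^\<^sub>m k) $$ (i, j)"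
      if "i < n" "j < n" for i j k
    proof -
      have "B ^\<^sub>m k = complex_of_real (1 / (2 + e)) ^ k \<cdot>\<^sub>m (A ^\<^sub>m k)"
      proof (induction k)
        case 0 then show ?case using A B by (intro eq_matI) auto
      next
        case (Suc k)
        have "B ^\<^sub>m Suc k = (complex_of_real (1 / (2 + e)) ^ k \<cdot>\<^sub>m (A ^\<^sub>m k)) * (complex_of_real (1 / (2 +
            e)) \<cdot>\<^sub>m A)"
          using Suc by (simp add: B_def)
        also have "\<dots> = complex_of_real (1 / (2 + e)) ^ k \<cdot>\<^sub>m (complex_of_real (1 / (2 + e)) \<cdot>\<^sub>m (A ^\<^sub>m k * A))"
          using A by (subst mult_smult_assoc_mat[of _ n n _ n], simp, simp)
            (subst mult_smult_distrib[of _ n n _ n], auto)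
        also have "\<dots> = complex_of_real (1 / (2 + e)) ^ Suc k \<cdot>\<^sub>m (A ^\<^sub>m k * A)"
          by (intro eq_matI) auto
        finally show ?case by simp
      qed
      moreover have "complex_of_real ((2 + e) ^ k) * complex_of_real (1 / (2 + e)) ^ k = 1"
      proof -
        have "(2 + e) ^ k * (1 / (2 + e)) ^ k = 1" using e by (simp flip: power_mult_distrib)
        then show ?thesis by (metis of_real_mult of_real_power of_real_1)
      qed
      ultimately show ?thesis using that A by (simp flip: mult.assoc)
    qed
    define K where "K = c * (\<Sum>j<n. cmod (z j))"
    have iterb: "cmod (((ap ^^ k) z) i) \<le> (2 + e) ^ k * K" if i: "i < n" for k i
    proof -
      have "cmod (((ap ^^ k) z) i) \<le> (\<Sum>j<n. cmod ((A ^\<^sub>m k) $$ (i, j) * z j))"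
        using iter[OF i] by (simp add: norm_sum)
      also have "\<dots> \<le> (\<Sum>j<n. ((2 + e) ^ k * c) * cmod (z j))"
      proof (rule sum_mono)
        fix j assume j: "j \<in> {..<n}"
        then have "cmod ((B ^\<^sub>m k) $$ (i, j)) \<le> c" using c[of k] B i unfolding norm_bound_def by auto
        then have "cmod ((A ^\<^sub>m k) $$ (i, j)) \<le> (2 + e) ^ k * c"
          using powB[OF i, of j k] j e by (simp add: norm_mult mult_left_mono norm_power del:
              of_real_add flip: of_real_power)
        then show "cmod ((A ^\<^sub>m k) $$ (i, j) * z j) \<le> ((2 + e) ^ k * c) * cmod (z j)"
          by (simp add: norm_mult mult_right_mono)
      qed
      also have "\<dots> = (2 + e) ^ k * K" by (simp add: K_def sum_distrib_left mult.assoc)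
      finally show ?thesis .
    qed
    show ?thesis
    proof (rule norm_bound_of_iterates)
      show "0 < (2 + e)\<^sup>2" using e by simp
      fix k
      have "Re (ip ((ap ^^ k) z) ((ap ^^ k) z)) \<le> (\<Sum>i<n. ((2 + e) ^ k * K)\<^sup>2)"
        unfolding Re_ip_self using iterb by (intro sum_mono power_mono) auto
      also have "\<dots> = (n * K\<^sup>2) * ((2 + e)\<^sup>2) ^ k"
        by (simp add: power_mult_distrib power_mult[symmetric] mult.commute)
      finally show "Re (ip ((ap ^^ k) z) ((ap ^^ k) z)) \<le> (n * K\<^sup>2) * ((2 + e)\<^sup>2) ^ k" .
    qed
  qed
  have "((\<lambda>e. (2 + e)\<^sup>2 * Re (ip z z)) \<longlongrightarrow> (2 + 0)\<^sup>2 * Re (ip z z)) (at_right (0::real))"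
    by (intro tendsto_intros)
  moreover have "eventually (\<lambda>e. Re (ip (ap z) (ap z)) \<le> (2 + e)\<^sup>2 * Re (ip z z)) (at_right (0::real))"
    using bound by (auto simp: eventually_at_filter)
  ultimately have "Re (ip (ap z) (ap z)) \<le> (2 + 0)\<^sup>2 * Re (ip z z)"
    by (rule tendsto_lowerbound) simp
  then show ?thesis by simp
qed

end

section \<open>Maximality as an extension criterion\<close>

text \<open>The last assumption is maximality with respect to one new row and column. Its second
  premise bounds the quadratic form of the bordered matrix at the vector (z, y); a nonzero
  \<open>x\<close> would keep the larger graph connected. The corner entry is an integer because the
  real elements of Z[omega] are integers.\<close>

locale maximal_form = herm_form +
  assumes n_pos: "n > 0"
    and ints: "i < n \<Longrightarrow> j < n \<Longrightarrow> a i j \<in> Z_omega"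
    and diag: "i < n \<Longrightarrow> a i i = 0"
    and norm_le: "Re (ip (ap z) (ap z)) \<le> 4 * Re (ip z z)"
    and conn: "i < n \<Longrightarrow> j < n \<Longrightarrow> (i, j) \<in> {(u, v). u < n \<and> v < n \<and> u \<noteq> v \<and> a u v \<noteq> 0}\<^sup>*"
    and no_extension: "(\<And>i. i < n \<Longrightarrow> x i \<in> Z_omega) \<Longrightarrow>
      (\<And>z y. \<bar>Re (ip z (ap z)) + 2 * Re (cnj y * ip x z) + of_int c * (cmod y)\<^sup>2\<bar>
         \<le> 2 * (Re (ip z z) + (cmod y)\<^sup>2)) \<Longrightarrow> i < n \<Longrightarrow> x i = 0"

section \<open>Bordered matrices, and the passage between matrices and forms\<close>

lemma index_mat_adjoint:
  fixes A :: "complex mat"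
  shows "i < dim_col A \<Longrightarrow> j < dim_row A \<Longrightarrow> mat_adjoint A $$ (i, j) = cnj (A $$ (j, i))"
  by (simp add: mat_adjoint_def mat_of_rows_index)

lemma dim_mat_adjoint [simp]:
  "dim_row (mat_adjoint A) = dim_col A" "dim_col (mat_adjoint A) = dim_row A"
  by (simp_all add: mat_adjoint_def)

lemma hermitian_mat_index:
  "hermitian_mat A \<Longrightarrow> i < dim_row A \<Longrightarrow> j < dim_row A \<Longrightarrow> A $$ (j, i) = cnj (A $$ (i, j))"
  unfolding hermitian_mat_def by (metis index_mat_adjoint square_mat.simps)

lemma (in herm_form) form_le:
  assumes "\<And>z. Re (ip (ap z) (ap z)) \<le> 4 * Re (ip z z)"
  shows "\<bar>Re (ip z (ap z))\<bar> \<le> 2 * Re (ip z z)"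
proof -
  have "(Re (ip z (ap z)))\<^sup>2 \<le> (cmod (ip z (ap z)))\<^sup>2" by (simp add: cmod_power2)
  also have "\<dots> \<le> Re (ip z z) * Re (ip (ap z) (ap z))" by (rule cauchy_schwarz)
  also have "\<dots> \<le> Re (ip z z) * (4 * Re (ip z z))" using assms Re_ip_nonneg by (intro mult_left_mono)
  also have "\<dots> = (2 * Re (ip z z))\<^sup>2" by (simp add: power2_eq_square)
  finally have "\<bar>Re (ip z (ap z))\<bar> \<le> \<bar>2 * Re (ip z z)\<bar>" by (simp only: abs_le_square_iff)
  then show ?thesis using Re_ip_nonneg[of z] by linarith
qed

definition bordered_mat :: "nat \<Rightarrow> (nat \<Rightarrow> nat \<Rightarrow> complex) \<Rightarrow> (nat \<Rightarrow> complex) \<Rightarrow> complex \<Rightarrow> complex mat" where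
  "bordered_mat n a x c = mat (Suc n) (Suc n) (\<lambda>(i, j).
     if i < n then (if j < n then a i j else x i) else (if j < n then cnj (x j) else c))"

text \<open>An eigenvalue is the Rayleigh quotient of its eigenvector (z, y), hence real, and the
  bound on the form places it in the interval.\<close>

lemma (in herm_form) bordered_cyclotomic:
  assumes ints: "\<And>i j. i < n \<Longrightarrow> j < n \<Longrightarrow> a i j \<in> Z_omega"
    and x: "\<And>i. i < n \<Longrightarrow> x i \<in> Z_omega"
    and bd: "\<And>z y. \<bar>Re (ip z (ap z)) + 2 * Re (cnj y * ip x z) + of_int c * (cmod y)\<^sup>2\<bar>
         \<le> 2 * (Re (ip z z) + (cmod y)\<^sup>2)"
  shows "cyclotomic_mat (bordered_mat n a x (of_int c))"
proof -
  define B where "B = bordered_mat n a x (of_int c)"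
  have dim: "dim_row B = Suc n" "dim_col B = Suc n" by (simp_all add: B_def bordered_mat_def)
  have Bij: "B $$ (i, j) = (if i < n then (if j < n then a i j else x i)
      else (if j < n then cnj (x j) else of_int c))" if "i < Suc n" "j < Suc n" for i j
    using that by (simp add: B_def bordered_mat_def)
  have R: "B \<in> R_mat (dim_row B)"
    unfolding R_mat_def using dim
    by (auto simp: elements_mat_def Bij ints x split: if_splits intro!: Z_omega_unary)
  have H: "hermitian_mat B"
    unfolding hermitian_mat_def
  proof
    show "square_mat B" using dim by simp
    show "mat_adjoint B = B"
    proof (rule eq_matI)
      fix i j assume "i < dim_row B" "j < dim_col B"
      then show "mat_adjoint B $$ (i, j) = B $$ (i, j)"
        using dim by (auto simp: index_mat_adjoint Bij herm[symmetric])
    qed (use dim in auto)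
  qed
  have E: "e \<in> complex_of_real ` {-2..2}" if evx: "eigenvalue B e" for e
  proof -
    obtain v where v: "v \<in> carrier_vec (Suc n)" "v \<noteq> 0\<^sub>v (Suc n)" "B *\<^sub>v v = e \<cdot>\<^sub>v v"
      using evx dim unfolding eigenvalue_def eigenvector_def by auto
    define z where "z = (\<lambda>i. v $ i)"
    define y where "y = v $ n"
    define N where "N = Re (ip z z) + (cmod y)\<^sup>2"
    have Bv: "(B *\<^sub>v v) $ i = (\<Sum>j<n. B $$ (i, j) * z j) + B $$ (i, n) * y" if "i < Suc n" for i
      using that v(1) dim by (simp add: scalar_prod_def z_def y_def atLeast0LessThan)
    have ez: "e * z i = ap z i + x i * y" if "i < n" for i
      using Bv[of i] that v by (simp add: Bij ap_def z_def)
    have ey: "e * y = ip x z + of_int c * y"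
      using Bv[of n] v by (simp add: Bij ip_def y_def)
    have N: "N > 0"
    proof (rule ccontr)
      assume "\<not> N > 0"
      then have "Re (ip z z) = 0" "y = 0"
        unfolding N_def using Re_ip_nonneg[of z] zero_le_power2[of "cmod y"]
        by (linarith, metis add_nonneg_eq_0_iff linorder_not_less norm_eq_zero order_antisym_conv
            add_nonneg_nonneg zero_eq_power2)
      then have "v $ i = 0" if "i < Suc n" for i
        using ip_zero[of z i] that by (cases "i = n") (auto simp: z_def y_def)
      then have "v = 0\<^sub>v (Suc n)" using v(1) by (intro eq_vecI) auto
      then show False using v(2) by simp
    qed
    \<comment> \<open>\<open>q\<close> is the quadratic form of \<open>B\<close> at (z, y), and
      \<open>N\<close> is the squared norm of that vector.\<close>
    define q where "q = Re (ip z (ap z)) + 2 * Re (cnj y * ip x z) + of_int c * (cmod y)\<^sup>2"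
    have yy: "complex_of_real ((cmod y)\<^sup>2) = cnj y * y"
      by (metis complex_norm_square mult.commute)
    have "complex_of_real N = ip z z + cnj y * y"
      unfolding N_def of_real_add yy using Re_ip_self(2)[of z] by (simp add: complex_eq_iff)
    then have "e * of_real N = e * ip z z + cnj y * (e * y)"
      by (simp add: algebra_simps)
    also have "e * ip z z = (\<Sum>i<n. cnj (z i) * (e * z i))"
      by (simp add: ip_def sum_distrib_left mult_ac)
    also have "\<dots> = (\<Sum>i<n. cnj (z i) * (ap z i + x i * y))"
      using ez by (intro sum.cong) auto
    also have "\<dots> = ip z (ap z) + y * ip z x"
      by (simp add: ip_def sum.distrib sum_distrib_left algebra_simps)
    also have "y * ip z x = cnj (cnj y * ip x z)" using ip_cnj[of z x] by simp
    also have "ip z (ap z) + cnj (cnj y * ip x z) + cnj y * (e * y) = of_real q"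
      unfolding ey q_def using Im_ip_ap[of z]
      by (simp add: complex_eq_iff cmod_power2) (simp add: algebra_simps power2_eq_square)
    finally have "e = of_real (q / N)" using N by (simp add: field_simps)
    moreover have "\<bar>q\<bar> \<le> 2 * N" using bd[of z y] by (simp add: q_def N_def)
    then have "q \<le> 2 * N" "- 2 * N \<le> q" by linarith+
    then have "q / N \<in> {-2..2}" using N by (simp add: divide_le_eq le_divide_eq)
    ultimately show ?thesis by blast
  qed
  show ?thesis unfolding cyclotomic_mat_def B_def[symmetric] using R H E by blast
qed

lemma maximal_form_of_maximal:
  assumes max: "maximal_indecomposable_cyclotomic_mat A"
    and dg: "\<forall>i < dim_row A. A $$ (i, i) = 0"
  shows "maximal_form (dim_row A) (\<lambda>i j. A $$ (i, j))"
proof -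
  define n where "n = dim_row A"
  define a where "a = (\<lambda>i j. A $$ (i, j))"
  have cyc: "cyclotomic_mat A" and ind: "indecomposable_mat A" and
    nomax: "\<not> (\<exists>B. cyclotomic_mat B \<and> indecomposable_mat B \<and> proper_principal_submatrix A B)"
    using max unfolding maximal_indecomposable_cyclotomic_mat_def by auto
  have R: "A \<in> R_mat n" and H: "hermitian_mat A" and ev: "\<And>e. eigenvalue A e \<Longrightarrow> e \<in> complex_of_real ` {-2..2}"
    using cyc unfolding cyclotomic_mat_def n_def by auto
  have carr: "A \<in> carrier_mat n n" using R unfolding R_mat_def by auto
  interpret herm_form n a
    by standard (unfold a_def n_def, rule hermitian_mat_index[OF H])
  have npos: "n > 0" using ind unfolding indecomposable_mat_def n_def by auto
  have ints: "a i j \<in> Z_omega" if "i < n" "j < n" for i j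
    using R carr that unfolding R_mat_def a_def elements_mat_def by (auto simp: subset_eq)
  have nl: "Re (ip (ap z) (ap z)) \<le> 4 * Re (ip z z)" for z
  proof (rule norm_bound_of_eigenvalues[OF carr])
    show "A $$ (i, j) = a i j" for i j by (simp add: a_def)
    show "cmod e \<le> 2" if "eigenvalue A e" for e using ev[OF that] by auto
    show "n > 0" by (rule npos)
  qed
  have adj: "adjacent A = {(u, v). u < n \<and> v < n \<and> u \<noteq> v \<and> a u v \<noteq> 0}"
    by (auto simp: adjacent_def n_def a_def)
  have conn: "(i, j) \<in> {(u, v). u < n \<and> v < n \<and> u \<noteq> v \<and> a u v \<noteq> 0}\<^sup>*" if "i < n" "j < n" for i j
    using ind that unfolding indecomposable_mat_def adj n_def[symmetric] by blast
  have noext: "x i = 0" if x: "\<And>i. i < n \<Longrightarrow> x i \<in> Z_omega"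
    and bd: "\<And>z y. \<bar>Re (ip z (ap z)) + 2 * Re (cnj y * ip x z) + of_int c * (cmod y)\<^sup>2\<bar>
         \<le> 2 * (Re (ip z z) + (cmod y)\<^sup>2)" and i: "i < n" for x i c
  proof (rule ccontr)
    assume xi: "x i \<noteq> 0"
    define B where "B = bordered_mat n a x (of_int c)"
    have dim: "dim_row B = Suc n" "dim_col B = Suc n" by (simp_all add: B_def bordered_mat_def)
    have Bij: "B $$ (i, j) = (if i < n then (if j < n then a i j else x i)
        else (if j < n then cnj (x j) else of_int c))" if "i < Suc n" "j < Suc n" for i j
      using that by (simp add: B_def bordered_mat_def)
    have "cyclotomic_mat B" unfolding B_def by (rule bordered_cyclotomic[OF ints x bd])
    \<comment> \<open>Paths can be routed through \<open>i\<close>, which is joined to the new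
      vertex \<open>n\<close> because \<open>x i\<close> is nonzero.\<close>
    moreover have "indecomposable_mat B"
    proof -
      have sub: "adjacent A \<subseteq> adjacent B"
        unfolding adj unfolding adjacent_def using dim Bij by auto
      have in1: "(i, n) \<in> adjacent B" "(n, i) \<in> adjacent B"
        unfolding adjacent_def using dim Bij[of i n] Bij[of n i] i xi by auto
      have to_i: "(u, i) \<in> (adjacent B)\<^sup>* \<and> (i, u) \<in> (adjacent B)\<^sup>*" if "u < Suc n" for u
      proof (cases "u = n")
        case True then show ?thesis using in1 by auto
      next
        case False
        then have "(u, i) \<in> (adjacent A)\<^sup>*" "(i, u) \<in> (adjacent A)\<^sup>*"
          using conn[of u i] conn[of i u] that i unfolding adj by auto
        then show ?thesis using rtrancl_mono[OF sub] by auto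
      qed
      show ?thesis unfolding indecomposable_mat_def dim using to_i by (blast intro: rtrancl_trans)
    qed
    moreover have "proper_principal_submatrix A B"
    proof -
      \<comment> \<open>\<open>submatrix\<close> renumbers the retained indices by counting. On an
        initial segment this changes nothing, so dropping the last row and column gives back
        \<open>A\<close>.\<close>
      have c: "card {l. l < Suc n \<and> l \<in> {..<n}} = n"
        by (rule trans[OF _ card_lessThan]) (rule arg_cong[of _ _ card], auto)
      have c': "card {l \<in> {..<n}. l < i} = i" if "i < n" for i
        using that by (intro trans[OF _ card_lessThan[of i]] arg_cong[of _ _ card]) auto
      have "A = submatrix B {..<n} {..<n}"
      proof (rule eq_matI)
        show "dim_row A = dim_row (submatrix B {..<n} {..<n})"
            "dim_col A = dim_col (submatrix B {..<n} {..<n})"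
          using carr by (simp_all add: dim_submatrix dim c del: lessThan_iff)
        fix i j assume "i < dim_row (submatrix B {..<n} {..<n})" "j < dim_col (submatrix B {..<n} {..<n})"
        then have ij: "i < n" "j < n" by (simp_all add: dim_submatrix dim c del: lessThan_iff)
        have "submatrix B {..<n} {..<n} $$ (card {l \<in> {..<n}. l < i}, card {l \<in> {..<n}. l < j}) = B $$ (i, j)"
          using ij dim by (intro submatrix_index_card) auto
        then show "A $$ (i, j) = submatrix B {..<n} {..<n} $$ (i, j)"
          using ij by (simp only: c') (simp add: Bij a_def)
      qed
      moreover have "{..<n} \<subset> {..<dim_row B}" using dim by auto
      ultimately show ?thesis unfolding proper_principal_submatrix_def by blast
    qed
    ultimately show False using nomax by blast
  qed
  have dg': "a i i = 0" if "i < n" for i using dg that by (simp add: a_def n_def)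
  have "maximal_form n a"
  proof (intro maximal_form.intro maximal_form_axioms.intro herm_form_axioms)
    fix x :: "nat \<Rightarrow> complex" and c :: int and i
    assume "\<And>i. i < n \<Longrightarrow> x i \<in> Z_omega" "i < n"
      "\<And>z y. \<bar>Re (ip z (ap z)) + 2 * Re (cnj y * ip x z) + of_int c * (cmod y)\<^sup>2\<bar>
         \<le> 2 * (Re (ip z z) + (cmod y)\<^sup>2)"
    then show "x i = 0" using noext by blast
  qed (fact npos ints nl conn dg')+
  then show ?thesis by (simp add: n_def a_def)
qed

text \<open>The permutation of vertices is absorbed by the free choice of bijection in
  \<open>adjacency_matrix_of\<close>, so a diagonal \<open>Q\<close> with entries \<open>d\<close>
  (a switching of the graph) is enough, with sign 1.\<close>

lemma equivalent_to_graph_intro: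
  fixes g :: "'v \<Rightarrow> nat"
  assumes R: "A \<in> R_mat n"
    and g: "bij_betw g V {..<n}"
    and w: "\<And>x y. x \<in> V \<Longrightarrow> y \<in> V \<Longrightarrow> w x y \<in> Z_omega"
    and d: "\<And>x. x \<in> V \<Longrightarrow> d x \<in> Z_omega" "\<And>x. x \<in> V \<Longrightarrow> cmod (d x) = 1"
    and s: "\<sigma> \<in> {id, cnj}"
    and eq: "\<And>x y. x \<in> V \<Longrightarrow> y \<in> V \<Longrightarrow> A $$ (g x, g y) = \<sigma> (d x * w x y * cnj (d y))"
  shows "equivalent_to_graph A (V, w)"
proof -
  define f where "f = inv_into V g"
  have f: "bij_betw f {..<n} V" unfolding f_def by (rule bij_betw_inv_into[OF g])
  have card: "card V = n" using bij_betw_same_card[OF g] by simp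
  have fV: "f i \<in> V" "g (f i) = i" if "i < n" for i
    using that f bij_betwE[OF f] bij_betw_inv_into_right[OF g] by (auto simp: f_def)
  define B where "B = mat n n (\<lambda>(i, j). w (f i) (f j))"
  define Q where "Q = mat n n (\<lambda>(i, j). if i = j then d (f i) else 0)"
  have dd: "d x * cnj (d x) = 1" "cnj (d x) * d x = 1" if "x \<in> V" for x
    using d(2)[OF that] complex_norm_square[of "d x"] by (simp_all add: mult.commute)
  have Qadj: "mat_adjoint Q = mat n n (\<lambda>(i, j). if i = j then cnj (d (f i)) else 0)"
    by (rule eq_matI) (auto simp: Q_def index_mat_adjoint)
  have QM: "Q * M = mat n n (\<lambda>(i, j). d (f i) * M $$ (i, j))" if "M \<in> carrier_mat n n" for M
    using that by (intro eq_matI) (auto simp: Q_def scalar_prod_def if_distrib[of "\<lambda>x. x * _"] cong: if_cong)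
  have MQ: "M * mat_adjoint Q = mat n n (\<lambda>(i, j). M $$ (i, j) * cnj (d (f j)))" if "M \<in> carrier_mat n n" for M
    using that unfolding Qadj by (intro eq_matI) (auto simp: scalar_prod_def if_distrib[of "\<lambda>x. _ * x"]
        cong: if_cong)
  have AM: "mat_adjoint Q * M = mat n n (\<lambda>(i, j). cnj (d (f i)) * M $$ (i, j))" if "M \<in> carrier_mat n n" for M
    using that unfolding Qadj by (intro eq_matI) (auto simp: scalar_prod_def if_distrib[of "\<lambda>x. x * _"]
        cong: if_cong)
  have Qc: "Q \<in> carrier_mat n n" "mat_adjoint Q \<in> carrier_mat n n" by (auto simp: Q_def)
  have B: "B \<in> R_mat n" "B \<in> carrier_mat n n"
    unfolding R_mat_def B_def elements_mat_def using w fV by auto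
  have Q: "Q \<in> R_unitary_mat n"
    unfolding R_unitary_mat_def
  proof (intro CollectI conjI)
    show "Q \<in> R_mat n" unfolding R_mat_def Q_def elements_mat_def using d fV by auto
    show "Q * mat_adjoint Q = 1\<^sub>m n"
      unfolding QM[OF Qc(2)] by (rule eq_matI) (auto simp: Qadj dd fV)
    show "mat_adjoint Q * Q = 1\<^sub>m n"
      unfolding AM[OF Qc(1)] by (rule eq_matI) (auto simp: Q_def dd fV)
  qed
  have eqA: "A = 1 \<cdot>\<^sub>m map_mat \<sigma> (Q * B * mat_adjoint Q)"
  proof (rule eq_matI)
    have A: "A \<in> carrier_mat n n" using R unfolding R_mat_def by auto
    then show "dim_row A = dim_row (1 \<cdot>\<^sub>m map_mat \<sigma> (Q * B * mat_adjoint Q))"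
      "dim_col A = dim_col (1 \<cdot>\<^sub>m map_mat \<sigma> (Q * B * mat_adjoint Q))" using Qc by auto
    fix i j assume "i < dim_row (1 \<cdot>\<^sub>m map_mat \<sigma> (Q * B * mat_adjoint Q))"
       "j < dim_col (1 \<cdot>\<^sub>m map_mat \<sigma> (Q * B * mat_adjoint Q))"
    then have ij: "i < n" "j < n" using Qc by auto
    have QB: "Q * B \<in> carrier_mat n n" using Qc B by auto
    have "A $$ (i, j) = \<sigma> (d (f i) * w (f i) (f j) * cnj (d (f j)))"
      using eq[OF fV(1)[OF ij(1)] fV(1)[OF ij(2)]] fV ij by simp
    also have "\<dots> = (1 \<cdot>\<^sub>m map_mat \<sigma> (Q * B * mat_adjoint Q)) $$ (i, j)"
      unfolding MQ[OF QB] unfolding QM[OF B(2)] using ij by (simp add: B_def)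
    finally show "A $$ (i, j) = (1 \<cdot>\<^sub>m map_mat \<sigma> (Q * B * mat_adjoint Q)) $$ (i, j)" .
  qed
  have "R_equivalent A B"
    unfolding R_equivalent_def
    by (intro exI[of _ n] conjI R B(1), rule bexI[where x = Q], rule bexI[where x = 1],
        rule bexI[where x = \<sigma>], rule eqA, rule s, simp, rule Q)
  moreover have "adjacency_matrix_of (V, w) B"
    unfolding adjacency_matrix_of_def using f card by (auto simp: B_def)
  ultimately show ?thesis unfolding equivalent_to_graph_def by blast
qed

section \<open>Short dual vectors and the norms of rows\<close>

lemma (in herm_form) Re_ip_comm: "Re (ip u v) = Re (ip v u)"
  by (subst ip_cnj) simp

context maximal_form
begin

lemma abs_form_le: "\<bar>Re (ip z (ap z))\<bar> \<le> 2 * Re (ip z z)"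
  by (rule form_le[OF norm_le])

text \<open>With \<open>x = (4 - A\<^sup>2) f\<close>, the two forms \<open>2 + A\<close> and \<open>2 - A\<close> applied to
  \<open>z + y (2 - A) f\<close> and \<open>z - y (2 + A) f\<close> show that bordering \<open>A\<close> by \<open>x\<close> keeps both of
  them positive semidefinite.\<close>

lemma no_extension_image:
  assumes x: "x = (\<lambda>i. 4 * f i - ap (ap f) i)"
    and ints: "\<And>i. i < n \<Longrightarrow> x i \<in> Z_omega"
    and c1: "2 * Re (ip f x) - Re (ip f (ap x)) \<le> 2 + of_int c"
    and c2: "2 * Re (ip f x) + Re (ip f (ap x)) \<le> 2 - of_int c"
    and i: "i < n"
  shows "x i = 0"
proof (rule no_extension[OF ints _ i])
  fix z y
  define q where "q = Re (ip z (ap z))"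
  define N where "N = Re (ip z z)"
  define m where "m = Re (cnj y * ip x z)"
  define F where "F = Re (ip f x)"
  define G where "G = Re (ip f (ap x))"
  \<comment> \<open>For either sign this is the positive semidefinite form 2 + s A, evaluated at the
    vector \<open>w\<close> below.\<close>
  have key: "0 \<le> 2 * N + s * q + 2 * s * m + (2 * F - s * G) * (cmod y)\<^sup>2" if s: "s = 1 \<or> s = -1" for s :: real
  proof -
    define t where "t = complex_of_real s"
    have t: "t = 1 \<or> t = -1" using s by (auto simp: t_def)
    \<comment> \<open>Since t^2 = 1, the operator 4 - A^2 factors as (2 t + A) (2 t - A), so
      \<open>x\<close> is the image of \<open>h\<close> under the first factor.\<close>
    define h where "h = (\<lambda>i. 2 * t * f i - ap f i)"
    have x2: "x = (\<lambda>i. 2 * t * h i + ap h i)"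
      using t unfolding h_def ap_add by (elim disjE) (simp_all add: x fun_eq_iff algebra_simps ap_add)
    define w where "w = (\<lambda>i. z i + y * h i)"
    have ww: "ip w w = ip z z + y * ip z h + cnj y * ip h z + cnj y * y * ip h h"
      by (simp add: w_def ip_add algebra_simps)
    have waw: "ip w (ap w) = ip z (ap z) + y * ip z (ap h) + cnj y * ip h (ap z) + cnj y * y * ip h (ap h)"
      by (simp add: w_def ip_add ap_add algebra_simps)
    have hz: "2 * ip h z + t * ip h (ap z) = t * ip x z"
      unfolding x2 using t by (elim disjE) (simp_all add: ip_add ip_ap)
    have zh: "2 * ip z h + t * ip z (ap h) = t * ip z x"
      unfolding x2 using t by (elim disjE) (simp_all add: ip_add)
    have hh: "2 * ip h h + t * ip h (ap h) = t * ip h x"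
      unfolding x2 using t by (elim disjE) (simp_all add: ip_add)
    have "ip h x = 2 * cnj t * ip f x - ip f (ap x)" by (simp add: h_def ip_add ip_ap)
    then have hx: "t * ip h x = 2 * ip f x - t * ip f (ap x)"
      using t by (elim disjE) simp_all
    have "0 \<le> 2 * Re (ip w w) + s * Re (ip w (ap w))"
      using abs_form_le[of w] s by (auto simp: abs_le_iff)
    also have "2 * Re (ip w w) + s * Re (ip w (ap w)) = Re (2 * ip w w + t * ip w (ap w))"
      by (simp add: t_def)
    also have "2 * ip w w + t * ip w (ap w) = (2 * ip z z + t * ip z (ap z))
        + cnj y * (2 * ip h z + t * ip h (ap z)) + y * (2 * ip z h + t * ip z (ap h))
        + cnj y * y * (2 * ip h h + t * ip h (ap h))"
      unfolding ww waw by (simp add: algebra_simps)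
    also have "\<dots> = (2 * ip z z + t * ip z (ap z)) + t * (cnj y * ip x z + y * ip z x)
        + cnj y * y * (2 * ip f x - t * ip f (ap x))"
      unfolding hz zh hh hx by (simp add: algebra_simps)
    also have "cnj y * y = of_real ((cmod y)\<^sup>2)" by (metis complex_norm_square mult.commute)
    also have "y * ip z x = cnj (cnj y * ip x z)" using ip_cnj[of z x] by simp
    finally show ?thesis
      by (simp add: t_def q_def N_def m_def F_def G_def algebra_simps del: of_real_power)
  qed
  have y0: "0 \<le> (cmod y)\<^sup>2" by simp
  have "0 \<le> 2 * N + q + 2 * m + (2 * F - G) * (cmod y)\<^sup>2" using key[of 1] by simp
  moreover have "(2 * F - G) * (cmod y)\<^sup>2 \<le> (2 + of_int c) * (cmod y)\<^sup>2"
    using c1 y0 unfolding F_def G_def by (intro mult_right_mono)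
  moreover have "0 \<le> 2 * N - q - 2 * m + (2 * F + G) * (cmod y)\<^sup>2" using key[of "-1"] by simp
  moreover have "(2 * F + G) * (cmod y)\<^sup>2 \<le> (2 - of_int c) * (cmod y)\<^sup>2"
    using c2 y0 unfolding F_def G_def by (intro mult_right_mono)
  ultimately show "\<bar>Re (ip z (ap z)) + 2 * Re (cnj y * ip x z) + of_int c * (cmod y)\<^sup>2\<bar>
         \<le> 2 * (Re (ip z z) + (cmod y)\<^sup>2)"
    unfolding q_def[symmetric] N_def[symmetric] m_def[symmetric] by (simp add: algebra_simps abs_le_iff)
qed

lemma ap_cong: "(\<And>i. i < n \<Longrightarrow> u i = v i) \<Longrightarrow> ap u = ap v"
  by (simp add: ap_def fun_eq_iff)

text \<open>On an eigenvector of A^2 the operator 4 - A^2 is multiplication by 4 - r, so f = x / (4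
  - r) has image \<open>x\<close>. Then <f, x> = |x|^2 / (4 - r), and the orthogonality of
  \<open>x\<close> and A x removes the odd term, so the corner entry c = 0 satisfies both
  inequalities.\<close>

lemma no_extension_eigen:
  assumes ev: "\<And>i. i < n \<Longrightarrow> ap (ap x) i = of_real r * x i" and r: "r < 4"
    and ints: "\<And>i. i < n \<Longrightarrow> x i \<in> Z_omega"
    and le: "Re (ip x x) \<le> 4 - r" and orth: "ip x (ap x) = 0"
    and i: "i < n"
  shows "x i = 0"
proof -
  define k where "k = complex_of_real (1 / (4 - r))"
  have k: "k * of_real (4 - r) = 1" "cnj k = k"
    using r by (simp_all add: k_def del: of_real_diff flip: of_real_mult)
  define f where "f = (\<lambda>i. k * x i)"
  \<comment> \<open>\<open>X\<close> agrees with \<open>x\<close> only below \<open>n\<close>: the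
    eigenvalue equation says nothing about larger indices.\<close>
  define X where "X = (\<lambda>i. 4 * f i - ap (ap f) i)"
  have Xx: "X i = x i" if "i < n" for i
  proof -
    have "X i = k * (4 * x i - ap (ap x) i)"
      by (simp add: X_def f_def ap_add algebra_simps)
    also have "\<dots> = k * of_real (4 - r) * x i"
      using ev[OF that] by (simp add: algebra_simps)
    also have "\<dots> = x i" unfolding k by simp
    finally show ?thesis .
  qed
  have F: "ip f X = k * ip x x"
    by (subst ip_cong[of f f X x]) (simp_all add: Xx f_def ip_add k)
  have "ip f (ap X) = ip f (ap x)" by (subst ap_cong[of X x]) (simp_all add: Xx)
  also have "\<dots> = 0" by (simp add: f_def ip_add orth)
  finally have G: "ip f (ap X) = 0" .
  have "Re (ip f X) \<le> 1" unfolding F k_def using le r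
      by (simp add: divide_le_eq del: of_real_diff of_real_divide)
  then have "X i = 0"
    by (intro no_extension_image[OF X_def, of 0]) (use Xx ints G i in auto)
  then show ?thesis using Xx i by simp
qed

lemma no_extension_kernel:
  assumes "\<And>i. i < n \<Longrightarrow> ap x i = 0" "\<And>i. i < n \<Longrightarrow> x i \<in> Z_omega"
    and "Re (ip x x) \<le> 4" "i < n"
  shows "x i = 0"
proof (rule no_extension_eigen[of x 0])
  have "ap (ap x) = ap (\<lambda>i. 0)" by (rule ap_cong) (rule assms)
  then show "ap (ap x) i = of_real 0 * x i" for i by (simp add: ap_def)
  show "ip x (ap x) = 0" using assms(1) by (simp add: ip_def)
qed (use assms in auto)

definition basis :: "nat \<Rightarrow> nat \<Rightarrow> complex" where
  "basis v = (\<lambda>i. if i = v then 1 else 0)"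

lemma ip_basis: "v < n \<Longrightarrow> ip (basis v) z = z v" "v < n \<Longrightarrow> ip z (basis v) = cnj (z v)"
  by (simp_all add: ip_def basis_def if_distrib[of cnj] if_distrib[of "\<lambda>x. x * _"]
      if_distrib[of "\<lambda>x. _ * x"] cong: if_cong)

lemma ap_basis: "v < n \<Longrightarrow> ap (basis v) i = a i v"
  by (simp add: ap_def basis_def if_distrib[of "\<lambda>x. _ * x"] cong: if_cong)

text \<open>The squared norm of row \<open>v\<close>. Once all weights are units it is the number of
  neighbours.\<close>

definition deg :: "nat \<Rightarrow> real" where
  "deg v = (\<Sum>u<n. (cmod (a v u))\<^sup>2)"

lemma norm_herm: "u < n \<Longrightarrow> v < n \<Longrightarrow> cmod (a u v) = cmod (a v u)"
  by (metis herm complex_mod_cnj)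

lemma deg_ip: "v < n \<Longrightarrow> Re (ip (ap (basis v)) (ap (basis v))) = deg v"
  unfolding Re_ip_self deg_def by (intro sum.cong) (auto simp: ap_basis norm_herm)

lemma deg_le: "v < n \<Longrightarrow> deg v \<le> 4"
  using norm_le[of "basis v"] deg_ip[of v] ip_basis(1)[of v "basis v"] by (simp add: basis_def)

text \<open>The form 4 - A^2 is positive semidefinite and vanishes at the basis vector of
  \<open>p\<close>, so this vector lies in its kernel. The remaining entries of column
  \<open>p\<close> of A^2 are therefore 0.\<close>

lemma rows_orthogonal:
  assumes p: "p < n" "deg p = 4" and v: "v < n" "v \<noteq> p"
  shows "(\<Sum>j<n. a p j * cnj (a v j)) = 0"
proof -
  define K where "K = (\<lambda>i. 4 * basis p i - ap (ap (basis p)) i)"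
  \<comment> \<open>A step against the gradient \<open>K\<close> from a zero of the form. Because
    the form is at most 4 times the squared norm, step length 1/4 changes it by at most -|K|^2 / 4,
    which nonnegativity forbids unless \<open>K\<close> vanishes.\<close>
  define w where "w = (\<lambda>i. basis p i - of_real (1/4) * K i)"
  define P where "P z = 4 * Re (ip z z) - Re (ip (ap z) (ap z))" for z
  have P: "P z \<ge> 0" for z using norm_le[of z] by (simp add: P_def)
  have Pp: "P (basis p) = 0"
    using p ip_basis(1)[of p "basis p"] by (simp add: P_def deg_ip) (simp add: basis_def)
  have pK: "4 * ip (basis p) K - ip (ap (basis p)) (ap K) = ip K K"
  proof -
    have "ip K K = 4 * ip (basis p) K - ip (ap (ap (basis p))) K" by (simp add: K_def ip_add)
    then show ?thesis by (simp add: ip_ap)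
  qed
  have "P w = P (basis p) - (1/2) * Re (4 * ip (basis p) K - ip (ap (basis p)) (ap K)) + (1/16) * P K"
    unfolding P_def w_def ap_add ip_add
    using Re_ip_comm[of K "basis p"] Re_ip_comm[of "ap K" "ap (basis p)"] by (simp add: algebra_simps)
  also have "\<dots> = - (1/2) * Re (ip K K) + (1/16) * P K" unfolding pK Pp by simp
  also have "P K \<le> 4 * Re (ip K K)" using Re_ip_nonneg[of "ap K"] by (simp add: P_def)
  finally have "0 \<le> - (1/4) * Re (ip K K)" using P[of w] by simp
  then have "Re (ip K K) = 0" using Re_ip_nonneg[of K] by simp
  then have "K v = 0" using ip_zero v by blast
  moreover have "K v = - ap (ap (basis p)) v" using v by (simp add: K_def basis_def)
  moreover have "ap (ap (basis p)) v = (\<Sum>j<n. a v j * a j p)"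
    unfolding ap_def[of "ap (basis p)" v] using p by (simp add: ap_basis)
  ultimately have "(\<Sum>j<n. a v j * a j p) = 0" by simp
  then have "cnj (\<Sum>j<n. a v j * a j p) = 0" by simp
  moreover have "cnj (\<Sum>j<n. a v j * a j p) = (\<Sum>j<n. a p j * cnj (a v j))"
    unfolding cnj_sum using p by (intro sum.cong) (auto simp: herm[of p] mult.commute)
  ultimately show ?thesis by simp
qed

text \<open>If \<open>v\<close> has degree 3, the corresponding generator of the lattice with Gram matrix
  \<open>4 - A\<^sup>2\<close> has norm 1, hence splits off and belongs to the dual lattice.\<close>

lemma deg_neq_3:
  assumes v: "v < n" shows "deg v \<noteq> 3"
proof
  assume d: "deg v = 3"
  define x where "x = (\<lambda>i. 4 * basis v i - ap (ap (basis v)) i)"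
  have apz: "ap z i \<in> Z_omega" if "i < n" "\<And>j. j < n \<Longrightarrow> z j \<in> Z_omega" for z i
    unfolding ap_def using that ints by (intro Z_omega_sum Z_omega_algebra(3)) auto
  have b: "basis v i \<in> Z_omega" for i by (simp add: basis_def)
  have four: "4 \<in> Z_omega" using of_int_Z_omega[of 4] by simp
  have xi: "x i \<in> Z_omega" if "i < n" for i
    unfolding x_def using that b four by (intro Z_omega_algebra(2,3) apz) auto
  have "ip (basis v) (ap (ap (basis v))) = ip (ap (basis v)) (ap (basis v))" by (rule ip_ap)
  then have xv: "x v = 1" using v d deg_ip[of v] Re_ip_self(2)[of "ap (basis v)"]
    by (simp add: x_def ip_basis complex_eq_iff) (simp add: basis_def)
  \<comment> \<open>\<open>g\<close> is real and lies in Z[omega], hence is an integer, and its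
    negative can serve as the corner entry.\<close>
  define g where "g = ip (basis v) (ap x)"
  have gv: "g = ap x v" using v by (simp add: g_def ip_basis)
  have "g = 4 * ip (basis v) (ap (basis v)) - ip (ap (basis v)) (ap (ap (basis v)))"
    by (simp add: g_def x_def ap_add ip_add ip_ap)
  then have "Im g = 0" using Im_ip_ap by simp
  then have "cnj g = g" by (simp add: complex_eq_iff)
  moreover have "g \<in> Z_omega" unfolding gv using v xi by (rule apz)
  ultimately obtain k :: int where k: "g = of_int k" using Z_omega_Reals by metis
  \<comment> \<open>Since \<open>x v\<close> is 1, both inequalities hold with equality when the
    corner entry is - g.\<close>
  have "x v = 0"
    by (rule no_extension_image[OF x_def xi, of "- k"])
      (use v k in \<open>simp_all add: g_def[symmetric] ip_basis xv\<close>)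
  then show False using xv by simp
qed

definition nb :: "nat \<Rightarrow> nat set" where
  "nb u = {v. v < n \<and> a u v \<noteq> 0}"

lemma nbD: "v \<in> nb u \<Longrightarrow> v < n" "v \<in> nb u \<Longrightarrow> a u v \<noteq> 0"
  by (auto simp: nb_def)

lemma nb_finite [simp]: "finite (nb u)"
  by (rule finite_subset[of _ "{..<n}"]) (auto simp: nb_def)

lemma nb_sym: "u < n \<Longrightarrow> v \<in> nb u \<Longrightarrow> u \<in> nb v"
  by (auto simp: nb_def) (metis herm complex_cnj_zero_iff)

lemma nb_irrefl: "u < n \<Longrightarrow> u \<notin> nb u"
  by (auto simp: nb_def diag)

lemma closed_eq_UNIV:
  assumes S: "S \<subseteq> {..<n}" "S \<noteq> {}" "\<And>u. u \<in> S \<Longrightarrow> nb u \<subseteq> S"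
  shows "S = {..<n}"
proof
  obtain u where u: "u \<in> S" using S by blast
  show "{..<n} \<subseteq> S"
  proof
    fix v assume "v \<in> {..<n}"
    then have "(u, v) \<in> {(u, v). u < n \<and> v < n \<and> u \<noteq> v \<and> a u v \<noteq> 0}\<^sup>*"
      using conn u S by auto
    then show "v \<in> S"
    proof (induction rule: rtrancl_induct)
      case base then show ?case using u .
    next
      case (step y z) then show ?case using S(3)[of y] by (auto simp: nb_def)
    qed
  qed
qed (rule S)

lemma deg_nb: "deg v = (\<Sum>u\<in>nb v. (cmod (a v u))\<^sup>2)"
  unfolding deg_def by (rule sum.mono_neutral_right) (auto simp: nb_def)

lemma norm_values:
  assumes "u < n" "v < n"
  shows "(cmod (a u v))\<^sup>2 \<in> {0, 1, 3, 4}"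
proof -
  obtain k :: nat where k: "(cmod (a u v))\<^sup>2 = real k" "k \<noteq> 2" using Z_omega_norm ints assms by metis
  have "(cmod (a u v))\<^sup>2 \<le> deg u"
    unfolding deg_def using assms by (intro member_le_sum) auto
  then have "real k \<le> 4" using deg_le[OF assms(1)] k by linarith
  then have "k \<le> 4" by simp
  then have "k \<in> {0, 1, 3, 4}" using k(2) by auto
  then show ?thesis using k by auto
qed

section \<open>Entries of norm 3 and 4\<close>

text \<open>Row norms are at most 4, so entries of total norm 4 leave no room for another.\<close>

lemma nb_subset:
  assumes "u < n" "F \<subseteq> {..<n}" "(\<Sum>w\<in>F. (cmod (a u w))\<^sup>2) \<ge> 4"
  shows "nb u \<subseteq> F"
proof
  fix w assume w: "w \<in> nb u"
  show "w \<in> F"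
  proof (rule ccontr)
    assume "w \<notin> F"
    have fin: "finite F" using assms(2) finite_subset by blast
    have "(\<Sum>j\<in>insert w F. (cmod (a u j))\<^sup>2) \<le> deg u"
      unfolding deg_def using assms w nbD by (intro sum_mono2) auto
    moreover have "(\<Sum>j\<in>insert w F. (cmod (a u j))\<^sup>2) = (cmod (a u w))\<^sup>2 + (\<Sum>j\<in>F. (cmod (a u j))\<^sup>2)"
      using fin \<open>w \<notin> F\<close> by simp
    moreover have "(cmod (a u w))\<^sup>2 > 0" using nbD(2)[OF w] by simp
    ultimately show False using deg_le[OF assms(1)] assms(3) by linarith
  qed
qed

lemma orth_nb:
  assumes "p < n" "deg p = 4" "v < n" "v \<noteq> p"
  shows "(\<Sum>j\<in>nb p \<inter> nb v. a p j * cnj (a v j)) = 0"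
proof -
  have "(\<Sum>j<n. a p j * cnj (a v j)) = (\<Sum>j\<in>nb p \<inter> nb v. a p j * cnj (a v j))"
    by (rule sum.mono_neutral_right) (auto simp: nb_def)
  then show ?thesis using rows_orthogonal[OF assms] by simp
qed

text \<open>An entry of norm 4 exhausts both of its rows, so by connectivity this edge is the whole
  graph.\<close>

lemma S2_case:
  assumes A: "A \<in> R_mat n" "\<And>i j. i < n \<Longrightarrow> j < n \<Longrightarrow> A $$ (i, j) = a i j"
    and uv: "u < n" "v < n" "(cmod (a u v))\<^sup>2 = 4"
  shows "equivalent_to_graph A S2_graph"
proof -
  have ne: "u \<noteq> v" using uv diag by auto
  have nbu: "nb u \<subseteq> {v}" using uv by (intro nb_subset) auto
  have nbv: "nb v \<subseteq> {u}" using uv norm_herm[of u v] by (intro nb_subset) auto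
  have V: "{u, v} = {..<n}" by (rule closed_eq_UNIV) (use uv nbu nbv in auto)
  define g where "g = (\<lambda>x. if x = VA then u else v)"
  define d where "d = (\<lambda>x. if x = VA then a u v / 2 else 1)"
  have au: "a u v / 2 \<in> Z_omega" using Z_omega_half ints uv by blast
  have "(cmod (a u v))\<^sup>2 = 2\<^sup>2" using uv by simp
  then have c2: "cmod (a u v) = 2" using norm_ge_zero power2_eq_iff_nonneg zero_le_numeral by blast
  show ?thesis unfolding S2_graph_def
  proof (rule equivalent_to_graph_intro[OF A(1), of g _ _ d id])
    show "bij_betw g {VA, VB} {..<n}"
      using ne by (auto simp: V[symmetric] bij_betw_def inj_on_def g_def)
    show "hermitian_weight S2_listed x y \<in> Z_omega" if "x \<in> {VA, VB}" "y \<in> {VA, VB}" for x y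
      using that of_int_Z_omega[of 2] by (auto simp: hermitian_weight_def)
    show "A $$ (g x, g y) = id (d x * hermitian_weight S2_listed x y * cnj (d y))"
      if "x \<in> {VA, VB}" "y \<in> {VA, VB}" for x y
      using that uv ne diag herm[of u v] by (auto simp: hermitian_weight_def g_def d_def A(2))
  qed (use au c2 in \<open>auto simp: d_def\<close>)
qed

lemma deg_nat: "v < n \<Longrightarrow> \<exists>k::nat. deg v = real k"
proof -
  assume v: "v < n"
  have "\<forall>u. \<exists>k::nat. u < n \<longrightarrow> (cmod (a v u))\<^sup>2 = real k" using Z_omega_norm ints v by metis
  then obtain k :: "nat \<Rightarrow> nat" where "\<And>u. u < n \<Longrightarrow> (cmod (a v u))\<^sup>2 = real (k u)" by metis
  then have "deg v = real (\<Sum>u<n. k u)" unfolding deg_def by simp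
  then show ?thesis by blast
qed

lemma deg_eq_4:
  assumes "v < n" "deg v \<ge> 3" shows "deg v = 4"
proof -
  obtain k :: nat where k: "deg v = real k" using deg_nat assms by blast
  then have "k \<noteq> 3" "k \<ge> 3" "k \<le> 4" using deg_neq_3 deg_le assms by force+
  then show ?thesis using k by simp
qed

text \<open>A row of norm at least 3 has norm 4, so besides the entry of norm 3 there is exactly one
  more, and it is a unit.\<close>

lemma norm3_nb:
  assumes uv: "u < n" "v < n" "(cmod (a u v))\<^sup>2 = 3"
  shows "deg u = 4 \<and> (\<exists>p. p < n \<and> p \<noteq> v \<and> p \<noteq> u \<and> cmod (a u p) = 1 \<and> nb u = {v, p})"
proof -
  have "(cmod (a u v))\<^sup>2 \<le> deg u"
    unfolding deg_def using uv by (intro member_le_sum) auto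
  then have d4: "deg u = 4" using deg_eq_4 uv by simp
  have "\<exists>p<n. p \<noteq> v \<and> a u p \<noteq> 0"
  proof (rule ccontr)
    assume "\<not> ?thesis"
    then have "deg u = (\<Sum>w\<in>{v}. (cmod (a u w))\<^sup>2)" unfolding deg_def using uv
      by (intro sum.mono_neutral_right) auto
    then show False using d4 uv by simp
  qed
  then obtain p where p: "p < n" "p \<noteq> v" "a u p \<noteq> 0" by blast
  have "(\<Sum>w\<in>{v, p}. (cmod (a u w))\<^sup>2) \<le> deg u"
    unfolding deg_def using uv p by (intro sum_mono2) auto
  then have "(cmod (a u p))\<^sup>2 \<le> 1" using p uv d4 by simp
  then have p1: "(cmod (a u p))\<^sup>2 = 1" using norm_values[of u p] p uv by auto
  then have "nb u \<subseteq> {v, p}" using uv p by (intro nb_subset) auto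
  then have "nb u = {v, p}" using uv p by (auto simp: nb_def)
  moreover have "p \<noteq> u" using p diag by auto
  moreover have "cmod (a u p) = 1" using p1 by (simp add: abs_square_eq_1)
  ultimately show ?thesis using d4 p by blast
qed

text \<open>The ends \<open>u\<close>, \<open>v\<close> of an edge of norm 3 have one further
  neighbour each, \<open>p\<close> and \<open>q\<close>. Orthogonality of rows \<open>u\<close> and
  \<open>v\<close> keeps these apart, and orthogonality of rows \<open>v\<close> and
  \<open>p\<close> forces the entry at p, q to have norm 3 too. All four rows are then full, and the
  graph is a 4-cycle.\<close>

lemma S4_case:
  assumes A: "A \<in> R_mat n" "\<And>i j. i < n \<Longrightarrow> j < n \<Longrightarrow> A $$ (i, j) = a i j"
    and uv: "u < n" "v < n" "(cmod (a u v))\<^sup>2 = 3"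
  shows "equivalent_to_graph A S4_graph"
proof -
  obtain p where p: "deg u = 4" "p < n" "p \<noteq> v" "p \<noteq> u" "cmod (a u p) = 1" "nb u = {v, p}"
    using norm3_nb[OF uv] by blast
  have vu: "(cmod (a v u))\<^sup>2 = 3" using uv norm_herm by simp
  obtain q where q: "deg v = 4" "q < n" "q \<noteq> u" "q \<noteq> v" "cmod (a v q) = 1" "nb v = {u, q}"
    using norm3_nb[OF uv(2) uv(1) vu] by blast
  have ne: "u \<noteq> v" using uv diag by auto
  have pq: "p \<noteq> q"
  proof
    assume "p = q"
    then have "nb u \<inter> nb v = {p}" using p q ne by auto
    then have "a u p * cnj (a v p) = 0" using orth_nb[of u v] uv p ne by simp
    then show False using p q \<open>p = q\<close> by auto
  qed
  have "(\<Sum>j\<in>nb v. a v j * cnj (a p j)) = (\<Sum>j\<in>nb v \<inter> nb p. a v j * cnj (a p j))"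
    using p by (intro sum.mono_neutral_right) (auto simp: nb_def)
  then have orth: "a v u * cnj (a p u) + a v q * cnj (a p q) = 0"
    using orth_nb[of v p] uv p q by simp
  have cm: "cmod (a p u) = 1" using norm_herm p uv by simp
  have "a v u * cnj (a p u) = - (a v q * cnj (a p q))" using orth by (simp add: eq_neg_iff_add_eq_0)
  then have "cmod (a v u * cnj (a p u)) = cmod (a v q * cnj (a p q))" by simp
  then have "cmod (a v u) = cmod (a p q)" using cm q by (simp add: norm_mult)
  then have pq3: "(cmod (a p q))\<^sup>2 = 3" using vu by simp
  have nbp: "nb p \<subseteq> {u, q}" using p q pq3 cm uv by (intro nb_subset) auto
  have nbq: "nb q \<subseteq> {v, p}" using p q pq3 norm_herm[of p q] norm_herm[of v q] uv by (intro nb_subset) auto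
  have V: "{u, v, p, q} = {..<n}" by (rule closed_eq_UNIV) (use uv p q nbp nbq in auto)
  define t where "t = 1 + omega"
  have t0: "t \<noteq> 0" by (simp add: omega_def t_def complex_eq_iff)
  \<comment> \<open>With scaling 1 at \<open>VA\<close>, this is the scaling at \<open>VC\<close>
    that gives the edge from \<open>u\<close> to \<open>v\<close> its listed weight - t.\<close>
  define dC where "dC = - cnj (a u v / t)"
  define g where "g = (\<lambda>x. case x of VA \<Rightarrow> u | VB \<Rightarrow> p | VC \<Rightarrow> v | VD \<Rightarrow> q)"
  define d where "d = (\<lambda>x. case x of VA \<Rightarrow> 1 | VB \<Rightarrow> cnj (a u p) | VC \<Rightarrow> dC | VD \<Rightarrow> cnj (a v q) * dC)"
  have "t = Complex (3 / 2) (sqrt 3 / 2)" by (simp add: t_def omega_def complex_eq_iff)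
  then have t3: "(cmod t)\<^sup>2 = 3" unfolding cmod_power2 by (simp add: power2_eq_square)
  have dC1: "cmod dC = 1"
  proof -
    have "(cmod (a u v / t))\<^sup>2 = 1" using uv t3 by (simp add: norm_divide power_divide)
    then have "cmod (a u v / t) = 1" by (simp only: abs_square_eq_1 abs_norm_cancel)
    then show ?thesis by (simp only: dC_def norm_minus_cancel complex_mod_cnj)
  qed
  have dCZ: "dC \<in> Z_omega" unfolding dC_def t_def using Z_omega_third ints uv by (intro Z_omega_unary) blast
  have unit: "z * cnj z = 1" if "cmod z = 1" for z using complex_norm_square[of z] that by simp
  have e1: "a u v = - (t * cnj dC)" using t0 by (simp add: dC_def)
  have e2: "a p q = cnj (a u p) * t * (a v q * cnj dC)"
  proof -
    have "cnj (a v u * cnj (a p u) + a v q * cnj (a p q)) = 0" using orth by simp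
    then have "cnj (a v q) * a p q = - (a u v * a p u)"
      using herm[of v u] uv by (simp add: eq_neg_iff_add_eq_0 add.commute)
    then have "a v q * cnj (a v q) * a p q = - a v q * a u v * a p u" by (simp add: mult.assoc)
    then have "a p q = - a v q * a u v * a p u" using unit[of "a v q"] q by simp
    then show ?thesis using herm[of u p] uv p unfolding e1 by (simp add: mult_ac)
  qed
  have z: "a u q = 0" "a q u = 0" "a v p = 0" "a p v = 0"
    using p q pq ne nbp nbq uv by (auto simp: nb_def)
  show ?thesis unfolding S4_graph_def
  proof (rule equivalent_to_graph_intro[OF A(1), of g _ _ d id])
    show "bij_betw g {VA, VB, VC, VD} {..<n}"
      using ne p q pq by (auto simp: V[symmetric] bij_betw_def inj_on_def g_def)
    show "d x \<in> Z_omega" "cmod (d x) = 1" for x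
      using dCZ dC1 ints uv p q by (cases x; auto simp: d_def norm_mult intro!:
          Z_omega_unary Z_omega_algebra(3))+
    have tne: "- 1 - omega \<noteq> 0" "1 + omega \<noteq> 0" by (simp_all add: omega_def complex_eq_iff)
    have lst: "hermitian_weight S4_listed VA VB = 1" "hermitian_weight S4_listed VC VD = 1"
      "hermitian_weight S4_listed VA VC = - t" "hermitian_weight S4_listed VB VD = t"
      "hermitian_weight S4_listed VB VA = 1" "hermitian_weight S4_listed VD VC = 1"
      "hermitian_weight S4_listed VC VA = - cnj t" "hermitian_weight S4_listed VD VB = cnj t"
      "hermitian_weight S4_listed VA VD = 0" "hermitian_weight S4_listed VD VA = 0"
      "hermitian_weight S4_listed VB VC = 0" "hermitian_weight S4_listed VC VB = 0"
      "hermitian_weight S4_listed x x = 0" for x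
      by (simp_all add: hermitian_weight_def t_def tne) (cases x; simp)
    have "t \<in> Z_omega" using omega_facts(2) by (auto simp: t_def intro!: Z_omega_algebra(1))
    then have Z: "t \<in> Z_omega" "- t \<in> Z_omega" "cnj t \<in> Z_omega" "- cnj t \<in> Z_omega"
      by (simp_all add: Z_omega_unary)
    show "hermitian_weight S4_listed x y \<in> Z_omega" for x y
      using Z by (cases x; cases y) (simp_all add: lst)
    have c: "dC * cnj dC = 1" "cnj dC * dC = 1" using unit[OF dC1] by (simp_all add: mult.commute)
    have hs: "a p u = cnj (a u p)" "a v u = cnj (a u v)" "a q v = cnj (a v q)" "a q p = cnj (a p q)"
      using herm uv p q by blast+
    show "A $$ (g x, g y) = id (d x * hermitian_weight S4_listed x y * cnj (d y))" for x y
      using uv p q by (cases x; cases y)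
       (simp_all add: g_def d_def A(2) lst z diag hs e1 e2 c mult_ac)
  qed simp
qed

end

section \<open>Unit weights: kernel vectors and the existence of a row of norm 4\<close>

locale unit_form = maximal_form +
  assumes unit: "u < n \<Longrightarrow> v < n \<Longrightarrow> a u v \<noteq> 0 \<Longrightarrow> cmod (a u v) = 1"
begin

lemma deg_card: "v < n \<Longrightarrow> deg v = card (nb v)"
  unfolding deg_nb by (simp add: nb_def unit)

lemma card_nb: "v < n \<Longrightarrow> card (nb v) \<le> 2 \<or> card (nb v) = 4"
  using deg_le[of v] deg_neq_3[of v] deg_card[of v] by auto

lemma unit_nb: "u < n \<Longrightarrow> v \<in> nb u \<Longrightarrow> a u v * cnj (a u v) = 1" "u < n \<Longrightarrow> v \<in> nb u \<Longrightarrow> cnj (a u v) * a u v = 1"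
  "u < n \<Longrightarrow> v \<in> nb u \<Longrightarrow> cmod (a u v) = 1" "u < n \<Longrightarrow> v \<in> nb u \<Longrightarrow> a u v \<in> Z_omega"
  using complex_norm_square[of "a u v"] unit[of u v] ints[of u v] by (auto simp: nb_def mult.commute)

lemma orth:
  assumes "p < n" "card (nb p) = 4" "v < n" "v \<noteq> p"
  shows "(\<Sum>j\<in>nb p \<inter> nb v. a p j * cnj (a v j)) = 0"
  using orth_nb[of p v] assms by (simp add: deg_card)

lemma overlap_neq_singleton:
  assumes "p < n" "card (nb p) = 4" "v < n" "v \<noteq> p"
  shows "nb p \<inter> nb v \<noteq> {x}"
proof
  assume e: "nb p \<inter> nb v = {x}"
  then have "a p x * cnj (a v x) = 0" using orth[OF assms] by simp
  moreover have "x \<in> nb p" "x \<in> nb v" using e by auto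
  ultimately show False using nbD by auto
qed

text \<open>Combinatorial form of \<open>no_extension_kernel\<close>: a vector with unit entries on
  \<open>F\<close> has squared norm \<open>card F\<close>, and its image under A can be nonzero only
  at neighbours of \<open>F\<close>.\<close>

lemma no_kernel_extension:
  assumes F: "F \<subseteq> {..<n}" "F \<noteq> {}" "card F \<le> 4"
    and x: "\<And>j. j \<in> F \<Longrightarrow> x j \<in> Z_omega" "\<And>j. j \<in> F \<Longrightarrow> cmod (x j) = 1"
    and ker: "\<And>i j. j \<in> F \<Longrightarrow> i \<in> nb j \<Longrightarrow> (\<Sum>j\<in>F \<inter> nb i. a i j * x j) = 0"
  shows False
proof -
  define X where "X = (\<lambda>i. if i \<in> F then x i else 0)"
  have ap: "ap X i = (\<Sum>j\<in>F \<inter> nb i. a i j * x j)" if "i < n" for i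
  proof -
    have "ap X i = (\<Sum>j\<in>F \<inter> nb i. a i j * X j)"
      unfolding ap_def using F by (intro sum.mono_neutral_right) (auto simp: nb_def X_def)
    then show ?thesis by (simp add: X_def)
  qed
  have apX: "ap X i = 0" if i: "i < n" for i
  proof (cases "F \<inter> nb i = {}")
    case True then show ?thesis using ap[OF i] by simp
  next
    case False
    then obtain j where j: "j \<in> F" "j \<in> nb i" by blast
    then have "i \<in> nb j" using nb_sym i by blast
    then show ?thesis using ap[OF i] ker[OF j(1)] by simp
  qed
  have "Re (ip X X) = (\<Sum>i\<in>F. (cmod (X i))\<^sup>2)"
    unfolding Re_ip_self using F(1) by (intro sum.mono_neutral_right) (auto simp: X_def)
  also have "\<dots> = (\<Sum>i\<in>F. 1)" using x(2) by (intro sum.cong) (auto simp: X_def)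
  finally have le: "Re (ip X X) \<le> 4" using F(3) by simp
  have XZ: "X i \<in> Z_omega" for i using x(1) by (simp add: X_def)
  obtain j where j: "j \<in> F" "j < n" using F(1,2) by blast
  have "X j = 0" by (rule no_extension_kernel[OF apX XZ le j(2)])
  then show False using x(2)[OF j(1)] j(1) by (simp add: X_def)
qed

text \<open>The inequality 2 |z i| |z j| <= |z i|^2 + |z j|^2 on each edge within \<open>T\<close>
  charges |z i|^2 once for every neighbour of \<open>i\<close> in \<open>T\<close>.\<close>

lemma form_le_card:
  assumes z: "\<And>i. i \<notin> T \<Longrightarrow> z i = 0"
  shows "\<bar>Re (ip z (ap z))\<bar> \<le> (\<Sum>i<n. card (nb i \<inter> T) * (cmod (z i))\<^sup>2)"
proof -
  define W where "W i j = (if j \<in> nb i \<and> i \<in> T \<and> j \<in> T then 1 else 0 :: real)" for i j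
  have Wsym: "W i j = W j i" if "i < n" "j < n" for i j using nb_sym that by (auto simp: W_def)
  have "\<bar>Re (ip z (ap z))\<bar> \<le> cmod (ip z (ap z))" by (rule abs_Re_le_cmod)
  also have "\<dots> \<le> (\<Sum>i<n. cmod (cnj (z i) * ap z i))" unfolding ip_def by (rule norm_sum)
  also have "\<dots> \<le> (\<Sum>i<n. \<Sum>j<n. W i j * ((cmod (z i))\<^sup>2 / 2 + (cmod (z j))\<^sup>2 / 2))"
  proof (rule sum_mono)
    fix i assume i: "i \<in> {..<n}"
    have "cmod (cnj (z i) * ap z i) \<le> (\<Sum>j<n. cmod (cnj (z i) * (a i j * z j)))"
      unfolding ap_def sum_distrib_left by (rule norm_sum)
    also have "\<dots> \<le> (\<Sum>j<n. W i j * ((cmod (z i))\<^sup>2 / 2 + (cmod (z j))\<^sup>2 / 2))"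
    proof (rule sum_mono)
      fix j assume j: "j \<in> {..<n}"
      have am: "cmod (z i) * cmod (z j) \<le> (cmod (z i))\<^sup>2 / 2 + (cmod (z j))\<^sup>2 / 2"
        using sum_squares_bound[of "cmod (z i)" "cmod (z j)"] by simp
      show "cmod (cnj (z i) * (a i j * z j)) \<le> W i j * ((cmod (z i))\<^sup>2 / 2 + (cmod (z j))\<^sup>2 / 2)"
      proof (cases "j \<in> nb i \<and> i \<in> T \<and> j \<in> T")
        case True then show ?thesis using am i j unit_nb(3)[of i j] by (simp add: W_def norm_mult)
      next
        case False then have "a i j = 0 \<or> z i = 0 \<or> z j = 0" using z j by (auto simp: nb_def)
        then show ?thesis using False by (auto simp: W_def)
      qed
    qed
    finally show "cmod (cnj (z i) * ap z i) \<le> (\<Sum>j<n. W i j * ((cmod (z i))\<^sup>2 / 2 + (cmod (z j))\<^sup>2 / 2))" .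
  qed
  also have "\<dots> = (\<Sum>i<n. \<Sum>j<n. W i j * ((cmod (z i))\<^sup>2 / 2)) + (\<Sum>i<n. \<Sum>j<n. W i j * ((cmod (z j))\<^sup>2 / 2))"
    by (simp add: sum.distrib distrib_left)
  also have "(\<Sum>i<n. \<Sum>j<n. W i j * ((cmod (z j))\<^sup>2 / 2)) = (\<Sum>j<n. \<Sum>i<n. W i j * ((cmod (z j))\<^sup>2 / 2))"
    by (rule sum.swap)
  also have "\<dots> = (\<Sum>j<n. \<Sum>i<n. W j i * ((cmod (z j))\<^sup>2 / 2))"
    using Wsym by (intro sum.cong refl) auto
  also have "(\<Sum>i<n. \<Sum>j<n. W i j * ((cmod (z i))\<^sup>2 / 2)) + \<dots> = (\<Sum>i<n. (\<Sum>j<n. W i j) * (cmod (z i))\<^sup>2)"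
    by (simp add: sum.distrib[symmetric] sum_distrib_right)
  also have "\<dots> \<le> (\<Sum>i<n. card (nb i \<inter> T) * (cmod (z i))\<^sup>2)"
  proof (rule sum_mono)
    fix i assume "i \<in> {..<n}"
    have "(\<Sum>j<n. W i j) \<le> (\<Sum>j<n. if j \<in> nb i \<inter> T then 1 else 0)"
      by (rule sum_mono) (auto simp: W_def)
    also have "\<dots> = (\<Sum>j\<in>nb i \<inter> T. 1)"
      by (rule sum.mono_neutral_cong_right) (auto simp: nb_def)
    finally have "(\<Sum>j<n. W i j) \<le> card (nb i \<inter> T)" by simp
    then show "(\<Sum>j<n. W i j) * (cmod (z i))\<^sup>2 \<le> card (nb i \<inter> T) * (cmod (z i))\<^sup>2"
      by (intro mult_right_mono) auto
  qed
  finally show ?thesis .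
qed

lemma Re_mult_le: "2 * \<bar>Re (cnj y * w)\<bar> \<le> (cmod y)\<^sup>2 + (cmod w)\<^sup>2"
proof -
  have "\<bar>Re (cnj y * w)\<bar> \<le> cmod y * cmod w" by (metis abs_Re_le_cmod norm_mult complex_mod_cnj)
  then show ?thesis using sum_squares_bound[of "cmod y" "cmod w"] by linarith
qed

text \<open>A graph of maximal degree 2 extends: attach a leaf to the end of a path, or in a cycle
  duplicate a vertex, changing the sign of one of its two edges.\<close>

lemma exists_saturated: "\<exists>v<n. card (nb v) = 4"
proof (rule ccontr)
  assume "\<not> ?thesis"
  then have le2: "card (nb v) \<le> 2" if "v < n" for v using card_nb that by blast
  show False
  proof (cases "\<exists>v<n. card (nb v) \<le> 1")
    case True
    then obtain v where v: "v < n" "card (nb v) \<le> 1" by blast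
    \<comment> \<open>The column \<open>basis v\<close> hangs a leaf on \<open>v\<close>. As
      \<open>v\<close> has at most one neighbour, \<open>form_le_card\<close> leaves a spare |z
      v|^2, which together with |y|^2 pays for the new edge.\<close>
    have "basis v v = 0"
    proof (rule no_extension[of "basis v" 0])
      show "basis v i \<in> Z_omega" for i by (simp add: basis_def)
      fix z y
      have "\<bar>Re (ip z (ap z))\<bar> \<le> (\<Sum>i<n. card (nb i \<inter> UNIV) * (cmod (z i))\<^sup>2)"
        by (rule form_le_card) simp
      also have "\<dots> \<le> (\<Sum>i<n. 2 * (cmod (z i))\<^sup>2 - (if i = v then (cmod (z v))\<^sup>2 else 0))"
      proof (rule sum_mono)
        fix i assume "i \<in> {..<n}"
        then have "real (card (nb i)) \<le> 2 - (if i = v then 1 else 0)" using le2 v by auto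
        then have "real (card (nb i)) * (cmod (z i))\<^sup>2 \<le> (2 - (if i = v then 1 else 0)) * (cmod (z i))\<^sup>2"
          by (intro mult_right_mono) auto
        then show "card (nb i \<inter> UNIV) * (cmod (z i))\<^sup>2 \<le> 2 * (cmod (z i))\<^sup>2 - (if i =
            v then (cmod (z v))\<^sup>2 else 0)"
          by (auto simp: algebra_simps)
      qed
      also have "\<dots> = 2 * Re (ip z z) - (cmod (z v))\<^sup>2"
        using v by (simp add: sum_subtractf Re_ip_self sum_distrib_left)
      finally have "\<bar>Re (ip z (ap z))\<bar> \<le> 2 * Re (ip z z) - (cmod (z v))\<^sup>2" .
      moreover have "ip (basis v) z = z v" using v by (simp add: ip_basis)
      ultimately show "\<bar>Re (ip z (ap z)) + 2 * Re (cnj y * ip (basis v) z) + of_int 0 * (cmod y)\<^sup>2\<bar>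
         \<le> 2 * (Re (ip z z) + (cmod y)\<^sup>2)"
        using Re_mult_le[of y "z v"] by (simp only: of_int_0 mult_zero_left) (smt (verit) zero_le_power2)
    qed (rule v)
    then show False by (simp add: basis_def)
  next
    case False
    then have c2: "card (nb v) = 2" if "v < n" for v using le2[OF that] that by force
    define v where "v = (0::nat)"
    have v: "v < n" using n_pos by (simp add: v_def)
    obtain p q where pq: "nb v = {p, q}" "p \<noteq> q" using c2[OF v] by (auto simp: card_2_iff)
    then have lt: "p < n" "q < n" "p \<in> nb v" "q \<in> nb v" using nbD by auto
    have vn: "v \<noteq> p" "v \<noteq> q" using nb_irrefl[OF v] lt by auto
    have vin: "v \<in> nb p" "v \<in> nb q" using nb_sym v lt by auto
    \<comment> \<open>The new vertex is a copy of \<open>v\<close>: its weights are those of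
      \<open>v\<close>, with the sign of the edge to \<open>q\<close> reversed.\<close>
    define x where "x = (\<lambda>i. if i = p then cnj (a v p) else if i = q then - cnj (a v q) else 0)"
    have "x p = 0"
    proof (rule no_extension[of x 0])
      show "x i \<in> Z_omega" for i using ints v lt by (auto simp: x_def intro!: Z_omega_unary)
      fix z :: "nat \<Rightarrow> complex" and y
      \<comment> \<open>Setting the entry at \<open>v\<close> to 0 separates the edges at
        \<open>v\<close>, which are estimated together with those of its copy.\<close>
      define z' where "z' = (\<lambda>i. if i = v then 0 else z i)"
      define A1 where "A1 = a v p * z p"
      define A2 where "A2 = a v q * z q"
      have cm: "cmod A1 = cmod (z p)" "cmod A2 = cmod (z q)"
        using unit_nb(3)[OF v] lt by (simp_all add: A1_def A2_def norm_mult)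
      have zz: "z = (\<lambda>i. z' i + z v * basis v i)" by (auto simp: z'_def basis_def)
      have apv: "ap z' v = A1 + A2"
      proof -
        have "ap z' v = (\<Sum>j\<in>{p, q}. a v j * z' j)"
          unfolding ap_def using lt pq v by (intro sum.mono_neutral_right) (auto simp: nb_def)
        then show ?thesis using pq vn by (simp add: A1_def A2_def z'_def)
      qed
      have "ip z (ap z) = ip z' (ap z') + z v * ip (ap z') (basis v) + cnj (z v) * ip (basis v) (ap z')
          + cnj (z v) * z v * ip (basis v) (ap (basis v))"
        by (subst (1 2) zz) (simp add: ip_add ap_add ip_ap algebra_simps)
      also have "ip (basis v) (ap (basis v)) = 0" using v diag by (simp add: ip_basis ap_basis)
      also have "ip (ap z') (basis v) = cnj (A1 + A2)" using v apv by (simp add: ip_basis)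
      also have "ip (basis v) (ap z') = A1 + A2" using v apv by (simp add: ip_basis)
      finally have q1: "Re (ip z (ap z)) = Re (ip z' (ap z')) + 2 * Re (cnj (z v) * (A1 + A2))"
        by (simp add: algebra_simps)
      have ipx: "ip x z = A1 - A2"
      proof -
        have "ip x z = (\<Sum>j\<in>{p, q}. cnj (x j) * z j)"
          unfolding ip_def using lt by (intro sum.mono_neutral_right) (auto simp: x_def)
        then show ?thesis using pq by (simp add: x_def A1_def A2_def)
      qed
      have "\<bar>Re (ip z' (ap z'))\<bar> \<le> (\<Sum>i<n. card (nb i \<inter> (- {v})) * (cmod (z' i))\<^sup>2)"
        by (rule form_le_card) (simp add: z'_def)
      also have "\<dots> \<le> (\<Sum>i<n. 2 * (cmod (z i))\<^sup>2 - (if i = v then 2 * (cmod (z v))\<^sup>2 else 0)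
         - (if i = p then (cmod (z p))\<^sup>2 else 0) - (if i = q then (cmod (z q))\<^sup>2 else 0))"
      proof (rule sum_mono)
        fix i assume i: "i \<in> {..<n}"
        show "card (nb i \<inter> (- {v})) * (cmod (z' i))\<^sup>2 \<le> 2 * (cmod (z i))\<^sup>2 - (if i =
            v then 2 * (cmod (z v))\<^sup>2 else 0)
         - (if i = p then (cmod (z p))\<^sup>2 else 0) - (if i = q then (cmod (z q))\<^sup>2 else 0)"
        proof (cases "i = v")
          case True then show ?thesis using vn by (simp add: z'_def)
        next
          case False
          have "card (nb i \<inter> (- {v})) \<le> 2 - (if i = p \<or> i = q then 1 else 0)"
          proof -
            have e: "nb i \<inter> (- {v}) = nb i - {v}" by auto
            show ?thesis unfolding e using c2[of i] i vin by (auto simp: card_Diff_singleton_if)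
          qed
          then have "real (card (nb i \<inter> (- {v}))) \<le> 2 - (if i = p \<or> i = q then 1 else 0)"
            by (auto split: if_splits)
          then have "card (nb i \<inter> (- {v})) * (cmod (z i))\<^sup>2 \<le> (2 - (if i = p \<or> i =
              q then 1 else 0)) * (cmod (z i))\<^sup>2"
            by (intro mult_right_mono) auto
          then show ?thesis using False pq(2) by (auto simp: z'_def algebra_simps split: if_splits)
        qed
      qed
      also have "\<dots> = 2 * Re (ip z z) - 2 * (cmod (z v))\<^sup>2 - (cmod (z p))\<^sup>2 - (cmod (z q))\<^sup>2"
        using v lt by (simp add: sum_subtractf Re_ip_self sum_distrib_left)
      finally have b:
          "\<bar>Re (ip z' (ap z'))\<bar> \<le> 2 * Re (ip z z) - 2 * (cmod (z v))\<^sup>2 - (cmod (z p))\<^sup>2 - (cmod (z q))\<^sup>2" .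
      \<comment> \<open>The vertex \<open>v\<close> sees A1 + A2 and its copy sees A1 - A2. After
        regrouping, A1 is paired with z v + y and A2 with z v - y, whose squared norms add up to 2
        |z v|^2 + 2 |y|^2 by the parallelogram law.\<close>
      define T1 T2 U W where "T1 = Re (cnj (z v + y) * A1)" and "T2 = Re (cnj (z v - y) * A2)"
        and "U = Re (cnj (z v) * (A1 + A2))" and "W = Re (cnj y * ip x z)"
      have "2 * U + 2 * W = 2 * T1 + 2 * T2"
        unfolding T1_def T2_def U_def W_def ipx by (simp add: algebra_simps)
      moreover have "(cmod (z v + y))\<^sup>2 + (cmod (z v - y))\<^sup>2 = 2 * (cmod (z v))\<^sup>2 + 2 * (cmod y)\<^sup>2"
        unfolding cmod_power2 by (simp add: power2_eq_square algebra_simps)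
      moreover have "2 * \<bar>T1\<bar> \<le> (cmod (z v + y))\<^sup>2 + (cmod (z p))\<^sup>2"
        "2 * \<bar>T2\<bar> \<le> (cmod (z v - y))\<^sup>2 + (cmod (z q))\<^sup>2"
        unfolding T1_def T2_def cm[symmetric] by (rule Re_mult_le)+
      moreover have "Re (ip z (ap z)) = Re (ip z' (ap z')) + 2 * U" unfolding q1 U_def ..
      ultimately have "\<bar>Re (ip z (ap z)) + 2 * W\<bar> \<le> 2 * Re (ip z z) + 2 * (cmod y)\<^sup>2"
        using b by linarith
      then show "\<bar>Re (ip z (ap z)) + 2 * Re (cnj y * ip x z) + of_int 0 * (cmod y)\<^sup>2\<bar>
         \<le> 2 * (Re (ip z z) + (cmod y)\<^sup>2)"
        unfolding W_def by (simp only: of_int_0 mult_zero_left add_0_right distrib_left)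
    qed (rule lt)
    then show False using lt nbD by (simp add: x_def)
  qed
qed

end

section \<open>Every vertex has degree 4\<close>

lemma unit_cnj: "cmod z = 1 \<Longrightarrow> z * cnj z = 1"
  using complex_norm_square[of z] by simp

text \<open>Conjugation inverts numbers of modulus 1, so |x + y| = 1 reads (x + y) (1/x + 1/y) = 1.
  The first equation says that y / x is a primitive cube root of unity.\<close>

lemma unit_sum3:
  assumes "cmod x = 1" "cmod y = 1" "cmod z = 1" "x + y + z = 0"
  shows "x\<^sup>2 + x * y + y\<^sup>2 = 0" "x\<^sup>2 + y\<^sup>2 + z\<^sup>2 = 0"
proof -
  have z: "z = - (x + y)" using assms(4) by Groebner_Basis.algebra
  have c: "x * cnj x = 1" "y * cnj y = 1" "z * cnj z = 1" using assms unit_cnj by auto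
  have cz: "cnj z = - (cnj x + cnj y)" using z by simp
  have e: "(x + y) * (cnj x + cnj y) = 1" using c(3) unfolding cz z by (simp add: algebra_simps)
  have "x\<^sup>2 + x * y + y\<^sup>2 = x * y * ((x + y) * (cnj x + cnj y) - 1)
     - x * y * (x * cnj x - 1) - x * y * (y * cnj y - 1) - x\<^sup>2 * (y * cnj y - 1) - y\<^sup>2 * (x * cnj x - 1)"
    by (simp add: algebra_simps power2_eq_square)
  then show *: "x\<^sup>2 + x * y + y\<^sup>2 = 0" unfolding e c by simp
  show "x\<^sup>2 + y\<^sup>2 + z\<^sup>2 = 0" using * unfolding z by Groebner_Basis.algebra
qed

text \<open>Four unit vectors with sum 0 are the sides of a rhombus. In symmetric functions of x, y,
  z, the condition |x + y + z| = 1 becomes e1 e2 = e3, and e1 e2 - e3 is the product (x + y) (x + z)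
  (y + z).\<close>

lemma unit_sum4:
  assumes "cmod x = 1" "cmod y = 1" "cmod z = 1" "cmod w = 1" "x + y + z + w = 0"
  shows "x + y = 0 \<or> x + z = 0 \<or> x + w = 0"
proof -
  have w: "w = - (x + y + z)" using assms(5) by Groebner_Basis.algebra
  have c: "x * cnj x = 1" "y * cnj y = 1" "z * cnj z = 1" "w * cnj w = 1" using assms unit_cnj by auto
  have cw: "cnj w = - (cnj x + cnj y + cnj z)" using w by simp
  have e: "(x + y + z) * (cnj x + cnj y + cnj z) = 1" using c(4) unfolding cw w by (simp add: algebra_simps)
  have "(x + y) * (x + z) * (y + z) = 0"
  proof -
    have "x * y * z * ((x + y + z) * (cnj x + cnj y + cnj z))
      = (x + y + z) * ((x * cnj x) * (y * z) + (y * cnj y) * (x * z) + (z * cnj z) * (x * y))"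
      by (simp add: algebra_simps)
    then have "x * y * z = (x + y + z) * (y * z + x * z + x * y)" unfolding e c by simp
    then show ?thesis by Groebner_Basis.algebra
  qed
  then have "x + y = 0 \<or> x + z = 0 \<or> y + z = 0" by simp
  moreover have "x + w = 0" if "y + z = 0" using that assms(5) by Groebner_Basis.algebra
  ultimately show ?thesis by blast
qed

lemma card4_one:
  assumes "card A = 4" "x \<in> A"
  obtains y z w where "A = {x, y, z, w}" "x \<noteq> y" "x \<noteq> z" "x \<noteq> w" "y \<noteq> z" "y \<noteq> w" "z \<noteq> w"
proof -
  have "finite A" using assms by (metis card.infinite zero_neq_numeral)
  then have "card (A - {x}) = 3" using assms by simp
  then obtain y z w where "A - {x} = {y, z, w}" "y \<noteq> z" "y \<noteq> w" "z \<noteq> w" by (auto simp: card_3_iff)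
  moreover have "A = insert x (A - {x})" "x \<notin> A - {x}" using assms by auto
  ultimately show ?thesis using that[of y z w] by auto
qed

lemma card4_two:
  assumes "card A = 4" "x \<in> A" "y \<in> A" "x \<noteq> y"
  obtains z w where "A = {x, y, z, w}" "x \<noteq> z" "x \<noteq> w" "y \<noteq> z" "y \<noteq> w" "z \<noteq> w"
proof -
  have "finite A" using assms by (metis card.infinite zero_neq_numeral)
  then have "card (A - {x, y}) = 2" using assms by simp
  then obtain z w where zw: "A - {x, y} = {z, w}" "z \<noteq> w" by (auto simp: card_2_iff)
  moreover have "A = {x, y} \<union> (A - {x, y})" using assms by auto
  moreover have "x \<notin> A - {x, y}" "y \<notin> A - {x, y}" by auto
  ultimately show ?thesis using that[of z w] by auto
qed

lemma card4_three:
  assumes "card A = 4" "x \<in> A" "y \<in> A" "z \<in> A" "x \<noteq> y" "x \<noteq> z" "y \<noteq> z"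
  obtains w where "A = {x, y, z, w}" "x \<noteq> w" "y \<noteq> w" "z \<noteq> w"
proof -
  have "finite A" using assms by (metis card.infinite zero_neq_numeral)
  then have "card (A - {x, y, z}) = 1" using assms by simp
  then obtain w where w: "A - {x, y, z} = {w}" by (auto simp: card_1_singleton_iff)
  moreover have "A = {x, y, z} \<union> (A - {x, y, z})" using assms by auto
  moreover have "x \<notin> A - {x, y, z}" "y \<notin> A - {x, y, z}" "z \<notin> A - {x, y, z}" by auto
  ultimately show ?thesis using that[of w] by auto
qed

lemma card4_four:
  assumes "card A = 4" "x \<in> A" "y \<in> A" "z \<in> A" "w \<in> A" "x \<noteq> y" "x \<noteq> z" "y \<noteq> z" "x \<noteq> w" "y \<noteq> w" "z \<noteq> w"
  shows "A = {x, y, z, w}"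
proof -
  have "finite A" using assms by (metis card.infinite zero_neq_numeral)
  then show ?thesis using assms by (intro card_seteq[symmetric]) auto
qed

lemma card2_two:
  assumes "finite A" "card A \<le> 2" "x \<in> A" "y \<in> A" "x \<noteq> y"
  shows "A = {x, y}"
  using assms by (intro card_seteq[symmetric]) auto

section \<open>Unsaturated vertices and leaves\<close>

context unit_form
begin

abbreviation sat :: "nat \<Rightarrow> bool" where
  "sat p \<equiv> card (nb p) = 4"

lemma unsat_le: "v < n \<Longrightarrow> \<not> sat v \<Longrightarrow> card (nb v) \<le> 2"
  using card_nb by blast

lemma overlap:
  assumes "sat p" "x \<in> nb p" "x \<in> nb v" "v \<noteq> p" "p < n" "v < n"
  obtains y where "y \<noteq> x" "y \<in> nb p" "y \<in> nb v"
  using overlap_neq_singleton[of p v x] assms by blast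

lemma orth2:
  assumes "p < n" "sat p" "v < n" "v \<noteq> p" "nb p \<inter> nb v = {x, y}" "x \<noteq> y"
  shows "a p x * cnj (a v x) + a p y * cnj (a v y) = 0"
  using orth[OF assms(1-4)] assms by simp

lemma orth3:
  assumes "p < n" "sat p" "v < n" "v \<noteq> p" "nb p \<inter> nb v = {x, y, z}" "x \<noteq> y" "x \<noteq> z" "y \<noteq> z"
  shows "a p x * cnj (a v x) + a p y * cnj (a v y) + a p z * cnj (a v z) = 0"
  using orth[OF assms(1-4)] assms by (simp add: add.assoc)

lemma orth4:
  assumes "p < n" "sat p" "v < n" "v \<noteq> p" "nb p \<inter> nb v = {x, y, z, w}"
    "x \<noteq> y" "x \<noteq> z" "y \<noteq> z" "x \<noteq> w" "y \<noteq> w" "z \<noteq> w"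
  shows "a p x * cnj (a v x) + a p y * cnj (a v y) + a p z * cnj (a v z) + a p w * cnj (a v w) = 0"
  using orth[OF assms(1-4)] assms by (simp add: add.assoc)

lemma ap_ap_basis:
  assumes "u < n" "i < n"
  shows "ap (ap (basis u)) i = (\<Sum>j\<in>nb u. a i j * a j u)"
proof -
  have "ap (ap (basis u)) i = (\<Sum>j<n. a i j * a j u)"
    unfolding ap_def[of "ap (basis u)"] using assms by (simp add: ap_basis)
  also have "\<dots> = (\<Sum>j\<in>nb u. a i j * a j u)"
    using assms nb_sym by (intro sum.mono_neutral_right) (auto simp: nb_def herm[of u])
  finally show ?thesis .
qed

text \<open>The basis vector of \<open>u1\<close> is an eigenvector of A^2 with eigenvalue 2:
  \<open>u1\<close> has two neighbours, both of degree 2, and the two paths from \<open>u1\<close>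
  to the saturated vertex \<open>p\<close> cancel. Its norm 1 is below 4 - 2.\<close>

lemma unsat_edge_cycle:
  assumes u: "u < n" and un: "nb u = {p, u1}" and u1: "u1 < n" "nb u1 = {u, u'}"
    and u': "u' < n" "nb u' = {p, u1}" and ne: "u \<noteq> u'" "p \<noteq> u1" and p: "p < n" "sat p" "u \<in> nb p" "u' \<in> nb p"
  shows False
proof -
  have o: "a p u * cnj (a u1 u) + a p u' * cnj (a u1 u') = 0"
    by (rule orth2) (use p u1 ne in auto)
  have h: "a u u1 = cnj (a u1 u)" "a u' u1 = cnj (a u1 u')" using herm u u1 u' by blast+
  have "basis u1 u1 = 0"
  proof (rule no_extension_eigen[of "basis u1" 2])
    fix i assume i: "i < n"
    have s: "ap (ap (basis u1)) i = a i u * a u u1 + a i u' * a u' u1"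
      using ap_ap_basis[OF u1(1) i] u1 ne by simp
    show "ap (ap (basis u1)) i = complex_of_real 2 * basis u1 i"
    proof (cases "i = u1")
      case True
      then show ?thesis using s unit_nb[OF u1(1), of u] unit_nb[OF u1(1), of u'] u1 by (simp add: basis_def h)
    next
      case False
      show ?thesis
      proof (cases "i = p")
        case True then show ?thesis using s o False by (simp add: basis_def h)
      next
        case False
        then have "i \<notin> nb u" "i \<notin> nb u'" using un u' \<open>i \<noteq> u1\<close> by auto
        then have "u \<notin> nb i" "u' \<notin> nb i" using nb_sym i by blast+
        then have "a i u = 0" "a i u' = 0" using u u' by (auto simp: nb_def)
        then show ?thesis using s \<open>i \<noteq> u1\<close> by (simp add: basis_def)
      qed
    qed
  next
    show "basis u1 i \<in> Z_omega" for i by (simp add: basis_def)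
    show "Re (ip (basis u1) (basis u1)) \<le> 4 - 2" using u1 by (simp add: ip_basis) (simp add: basis_def)
    show "ip (basis u1) (ap (basis u1)) = 0" using u1 diag by (simp add: ip_basis ap_basis)
  qed (use u1 in auto)
  then show False by (simp add: basis_def)
qed

text \<open>Two 4-cycles share the edge between \<open>p\<close> and \<open>u'\<close>. The
  difference of the normalised basis vectors of \<open>u\<close> and \<open>y'\<close> is an
  eigenvector of A^2 with eigenvalue 1: it cancels at \<open>p\<close>, and what arrives at
  \<open>u'\<close> along the two cycles cancels because row \<open>p\<close> is orthogonal to rows
  \<open>u1\<close> and \<open>y\<close>. Its squared norm 2 is below 4 - 1.\<close>

lemma unsat_edge_book:
  assumes u: "u < n" and un: "nb u = {p, u1}" and u1: "u1 < n" "nb u1 = {u, u'}"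
    and u': "u' < n" "u' \<in> nb p" "u1 \<in> nb u'" and y': "y' < n" "nb y' = {p, y}" "y' \<in> nb p"
    and y: "y < n" "nb y = {y', u'}" "y \<in> nb u'"
    and p: "p < n" "sat p" "u \<in> nb p"
    and ne: "u \<noteq> u'" "p \<noteq> u1" "y' \<noteq> u" "y' \<noteq> u'" "y \<noteq> u1" "y \<noteq> p"
  shows False
proof -
  have o1: "a p u * cnj (a u1 u) + a p u' * cnj (a u1 u') = 0"
    by (rule orth2) (use p u1 u' ne in auto)
  have o2: "a p y' * cnj (a y y') + a p u' * cnj (a y u') = 0"
    by (rule orth2) (use p y y' u' ne in auto)
  have h: "a u u1 = cnj (a u1 u)" "a u' u1 = cnj (a u1 u')" "a y' y = cnj (a y y')" "a u' y = cnj (a y u')"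
    using herm u u1 u' y y' by blast+
  have U: "a p u * cnj (a p u) = 1" "a p y' * cnj (a p y') = 1" "a u1 u * cnj (a u1 u) = 1"
    "a y y' * cnj (a y y') = 1" "a p u' * cnj (a p u') = 1"
    using unit_nb(1)[of p] unit_nb(1)[of u1] unit_nb(1)[of y] p u1 y y' u' by auto
  define x where "x = (\<lambda>i. cnj (a p u) * basis u i - cnj (a p y') * basis y' i)"
  have "x u = 0"
  proof (rule no_extension_eigen[of x 1])
    fix i assume i: "i < n"
    have "ap (ap x) i = cnj (a p u) * ap (ap (basis u)) i - cnj (a p y') * ap (ap (basis y')) i"
      by (simp add: x_def ap_add)
    also have "\<dots> = cnj (a p u) * (a i p * a p u + a i u1 * a u1 u) - cnj (a p y') * (a i p * a p y' + a i
        y * a y y')"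
      using ap_ap_basis[OF u(1) i] ap_ap_basis[OF y'(1) i] un y' ne by simp
    also have "\<dots> = cnj (a p u) * (a i u1 * a u1 u) - cnj (a p y') * (a i y * a y y')"
      using U by Groebner_Basis.algebra
    finally have s: "ap (ap x) i = cnj (a p u) * (a i u1 * a u1 u) - cnj (a p y') * (a i y * a y y')" .
    show "ap (ap x) i = complex_of_real 1 * x i"
    proof -
      consider "i = u" | "i = y'" | "i = u'" | "i \<notin> {u, y', u'}" by blast
      then show ?thesis
      proof cases
        case 1
        have "y \<notin> nb u" using un ne by auto
        then have "a u y = 0" using y by (simp add: nb_def)
        then show ?thesis using s U(3) ne unfolding 1 by (simp add: x_def basis_def h mult.commute)
      next
        case 2
        have "u1 \<notin> nb y'" using y' ne by auto
        then have "a y' u1 = 0" using u1 by (simp add: nb_def)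
        then show ?thesis using s U(4) ne unfolding 2 by (simp add: x_def basis_def h mult.commute)
      next
        case 3
        have "cnj (a p u) * (cnj (a u1 u') * a u1 u) = cnj (a p y') * (cnj (a y u') * a y y')"
          using o1 o2 U by Groebner_Basis.algebra
        then show ?thesis using s ne unfolding 3 by (simp add: x_def basis_def h)
      next
        case 4
        then have "i \<notin> nb u1" "i \<notin> nb y" using u1 y by auto
        then have "u1 \<notin> nb i" "y \<notin> nb i" using nb_sym i by blast+
        then have "a i u1 = 0" "a i y = 0" using u1 y by (auto simp: nb_def)
        then show ?thesis using s 4 by (simp add: x_def basis_def)
      qed
    qed
  next
    show "x i \<in> Z_omega" for i using unit_nb(4)[OF p(1)] p y'
      by (auto simp: x_def basis_def intro!: Z_omega_unary)
    have xx: "ip x z = a p u * z u - a p y' * z y'" for z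
      using u y' by (simp add: x_def ip_add ip_basis)
    have xu: "x u = cnj (a p u)" "x y' = - cnj (a p y')" using ne by (simp_all add: x_def basis_def)
    have "ip x x = 2" unfolding xx xu using U(1,2) by simp
    then show "Re (ip x x) \<le> 4 - 1" by simp
    have "p \<notin> nb u1" using u1(2) p(3) u'(2) nb_irrefl[OF p(1)] by auto
    then have "y' \<noteq> u1" using y'(2) by auto
    then have "y' \<notin> nb u" using un y'(3) nb_irrefl[OF p(1)] by auto
    then have "a u y' = 0" using y' by (simp add: nb_def)
    then have "a y' u = 0" using herm[of u y'] u y' by simp
    then show "ip x (ap x) = 0"
      using \<open>a u y' = 0\<close> diag u y' by (simp add: xx) (simp add: x_def ap_add ap_basis)
  qed (use u in auto)
  moreover have "x u = cnj (a p u)" using ne by (simp add: x_def basis_def)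
  ultimately show False using U(1) by simp
qed

text \<open>Two adjacent unsaturated vertices, one of them next to a saturated vertex, force three
  4-cycles with a common edge.\<close>

lemma unsat_nb_sat:
  assumes u: "u < n" "\<not> sat u" and p: "p < n" "sat p" "u \<in> nb p" and u1: "u1 \<in> nb u" "u1 \<noteq> p"
  shows "sat u1"
proof (rule ccontr)
  assume ns: "\<not> sat u1"
  have u1n: "u1 < n" using u1 nbD by blast
  have pu: "p \<in> nb u" using nb_sym p by blast
  have nbu: "nb u = {p, u1}" using card2_two[OF _ unsat_le[OF u] pu u1(1)] u1 by auto
  have uu1: "u \<in> nb u1" using nb_sym u u1 by blast
  obtain u' where u': "u' \<noteq> u" "u' \<in> nb p" "u' \<in> nb u1"
    using overlap[OF p(2) p(3) uu1] u1 p u1n by auto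
  have nbu1: "nb u1 = {u, u'}" using card2_two[OF _ unsat_le[OF u1n ns] uu1 u'(3)] u' by auto
  have u'n: "u' < n" using u' nbD by blast
  have inu': "p \<in> nb u'" "u1 \<in> nb u'" using nb_sym u' p u1n by blast+
  show False
  \<comment> \<open>If \<open>u'\<close> is unsaturated, the 4-cycle p, u, u1, u' has no edges
    leaving it except at \<open>p\<close>. Otherwise another neighbour \<open>y'\<close> of
    \<open>p\<close> starts a second 4-cycle through the edge between \<open>p\<close> and
    \<open>u'\<close>.\<close>
  proof (cases "sat u'")
    case False
    have "nb u' = {p, u1}" using card2_two[OF _ unsat_le[OF u'n False] inu'] u1 by auto
    then show False using unsat_edge_cycle[OF u(1) nbu u1n nbu1 u'n] p u' u1 by auto
  next
    case True
    obtain y' z' where nbp: "nb p = {u, u', y', z'}" "u \<noteq> y'" "u' \<noteq> y'"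
      using card4_two[OF p(2) p(3) u'(2)] u'(1) by metis
    have y'n: "y' < n" using nbp nbD[of y' p] by auto
    have y'p: "y' \<in> nb p" "p \<in> nb y'" using nbp nb_sym[of p y'] p by auto
    have ysat: "\<not> sat y'"
    proof
      assume "sat y'"
      then obtain w where "w \<noteq> p" "w \<in> nb y'" "w \<in> nb u"
        using overlap[of y' p u] y'p pu nbp u y'n by metis
      then have "u1 \<in> nb y'" using nbu by auto
      then have "y' \<in> nb u1" using nb_sym y'n by blast
      then show False using nbu1 nbp by auto
    qed
    obtain y where y: "y \<noteq> p" "y \<in> nb u'" "y \<in> nb y'"
      using overlap[OF True inu'(1) y'p(2)] nbp u'n y'n by metis
    have nby': "nb y' = {p, y}" using card2_two[OF _ unsat_le[OF y'n ysat] y'p(2) y(3)] y by auto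
    have yn: "y < n" using y nbD by blast
    have iny: "y' \<in> nb y" "u' \<in> nb y" using nb_sym y y'n u'n by blast+
    have yu1: "y \<noteq> u1" using iny nbu1 nbp by auto
    have "\<not> sat y"
    proof
      assume "sat y"
      moreover have "y \<noteq> u1" by (rule yu1)
      ultimately obtain w where "w \<noteq> u'" "w \<in> nb y" "w \<in> nb u1"
        using overlap[of y u' u1] iny u' yn u1n by metis
      then have "u \<in> nb y" using nbu1 by auto
      then have "y \<in> nb u" using nb_sym yn by blast
      then show False using nbu yu1 y by auto
    qed
    then have nby: "nb y = {y', u'}" using card2_two[OF _ unsat_le[OF yn] iny] nbp by auto
    show False
      by (rule unsat_edge_book[OF u(1) nbu u1n nbu1 u'n u'(2) inu'(2) y'n nby' y'p(1) yn nby y(2) p])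
        (use u' u1 nbp yu1 y in auto)
  qed
qed

text \<open>By \<open>unsat_nb_sat\<close>, the vertices that are saturated or have a saturated
  neighbour are closed under adjacency, so connectivity makes them everything.\<close>

lemma unsat_nb:
  assumes u: "u < n" "\<not> sat u"
  shows "nb u \<noteq> {}" "v \<in> nb u \<Longrightarrow> sat v"
proof -
  define T where "T = {v. v < n \<and> (sat v \<or> (\<exists>p\<in>nb v. sat p))}"
  obtain s where s: "s < n" "sat s" using exists_saturated by blast
  have "T = {..<n}"
  proof (rule closed_eq_UNIV)
    show "T \<subseteq> {..<n}" "T \<noteq> {}" using s by (auto simp: T_def)
    fix x assume x: "x \<in> T"
    show "nb x \<subseteq> T"
    proof
      fix y assume y: "y \<in> nb x"
      have "x < n" using x by (simp add: T_def)
      then have xy: "x \<in> nb y" "y < n" "x < n" using nb_sym[OF _ y] nbD(1)[OF y] by simp_all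
      show "y \<in> T"
      proof (cases "sat x")
        case True then show ?thesis using xy by (auto simp: T_def)
      next
        case False
        then obtain p where p: "p \<in> nb x" "sat p" using x by (auto simp: T_def)
        have "p < n" "x \<in> nb p" using nbD(1)[OF p(1)] nb_sym[OF xy(3) p(1)] by simp_all
        then have "sat y" using unsat_nb_sat[of x p y] False p y xy by (cases "y = p") auto
        then show ?thesis using xy by (auto simp: T_def)
      qed
    qed
  qed
  then obtain p where p: "p \<in> nb u" "sat p" using u by (auto simp: T_def)
  then show "nb u \<noteq> {}" by blast
  have "p < n" "u \<in> nb p" using nbD(1)[OF p(1)] nb_sym[OF u(1) p(1)] by simp_all
  then show "sat v" if "v \<in> nb u"
    using unsat_nb_sat[of u p v] p that u by (cases "v = p") auto
qed

lemma nbs: "x \<in> nb u \<Longrightarrow> u < n \<Longrightarrow> x < n \<and> u \<in> nb x \<and> x \<noteq> u"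
  using nbD(1)[of x u] nb_sym[of u x] nb_irrefl[of u] by blast

text \<open>The difference of the two leaves, normalised by their weights at \<open>p\<close>, is a
  kernel vector of squared norm 2.\<close>

lemma no_two_leaves:
  assumes p: "p < n" "u \<in> nb p" "v \<in> nb p" "u \<noteq> v" and nb: "nb u = {p}" "nb v = {p}"
  shows False
proof -
  note U = unit_nb[OF p(1)]
  have lt: "u < n" "v < n" using nbD(1) p by blast+
  define x where "x = (\<lambda>i. if i = u then cnj (a p u) else - cnj (a p v))"
  show False
  proof (rule no_kernel_extension[of "{u, v}" x])
    show "{u, v} \<subseteq> {..<n}" "{u, v} \<noteq> {}" "card {u, v} \<le> 4" using lt p by auto
    show "x j \<in> Z_omega" "cmod (x j) = 1" if "j \<in> {u, v}" for j
      using that U(3,4) p by (auto simp: x_def intro!: Z_omega_unary)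
    fix i j assume "j \<in> {u, v}" "i \<in> nb j"
    then have "i = p" using nb by auto
    moreover have "{u, v} \<inter> nb p = {u, v}" using p by auto
    ultimately show "(\<Sum>j\<in>{u, v} \<inter> nb i. a i j * x j) = 0"
      using p U(1)[of u] U(1)[of v] by (simp add: x_def)
  qed
qed

text \<open>A saturated neighbour of \<open>p\<close> would share only \<open>p\<close> with the
  leaf, so all neighbours of \<open>p\<close> are unsaturated. Three of them turn out to have the
  same second neighbour \<open>q\<close>, and they carry a kernel vector of squared norm 3.\<close>

lemma no_leaf:
  assumes u: "u < n" "nb u = {p}" and sp: "sat p" "p < n"
  shows False
proof -
  have up: "u \<in> nb p" using nbs[of p u] u by auto
  have unsat: "\<not> sat v" if "v \<in> nb p" for v
  proof
    assume "sat v"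
    moreover have "p \<in> nb v" "v < n" using nbs[of v p] that sp by auto
    moreover have "v \<noteq> u" using \<open>sat v\<close> u by auto
    ultimately obtain y where "y \<noteq> p" "y \<in> nb v" "y \<in> nb u" using overlap[of v p u] u by auto
    then show False using u by auto
  qed
  have two: "\<exists>q. nb v = {p, q} \<and> q \<noteq> p \<and> q < n" if v: "v \<in> nb p" "v \<noteq> u" for v
  proof -
    have vp: "p \<in> nb v" "v < n" using nbs[OF v(1) sp(2)] by auto
    have "nb v \<noteq> {p}" using no_two_leaves[OF sp(2) up v(1)] v u by auto
    then obtain q where q: "q \<in> nb v" "q \<noteq> p" using vp by blast
    have "nb v = {p, q}" using card2_two[OF _ unsat_le[OF vp(2) unsat[OF v(1)]] vp(1) q(1)] q by auto
    then show ?thesis using q nbD by blast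
  qed
  obtain v2 v3 v4 where nbp: "nb p = {u, v2, v3, v4}" "u \<noteq> v2" "u \<noteq> v3" "u \<noteq> v4" "v2 \<noteq> v3" "v2 \<noteq> v4" "v3 \<noteq> v4"
    using card4_one[OF sp(1) up] by metis
  obtain q where q: "nb v2 = {p, q}" "q \<noteq> p" "q < n" using two[of v2] nbp by auto
  \<comment> \<open>Each of the three has a partner with the same second neighbour. Three vertices
    do not split into pairs, so all three agree.\<close>
  have same: "nb v = {p, q}" if v: "v \<in> nb p" "v \<noteq> u" for v
  proof -
    have key: "\<exists>w \<in> nb p - {u, x}. nb w = nb x" if x: "x \<in> nb p" "x \<noteq> u" for x
    proof -
      obtain r where r: "nb x = {p, r}" "r \<noteq> p" "r < n" using two[OF x] by blast
      have "x \<in> nb r" using nbs[of r x] nbD(1)[OF x(1)] r by auto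
      then obtain w where w: "w \<noteq> x" "w \<in> nb p" "w \<in> nb r" using overlap[OF sp(1) x(1), of r] r sp by auto
      have "r \<in> nb w" using nbs[OF w(3) r(3)] by blast
      have "w \<noteq> u" using \<open>r \<in> nb w\<close> u r by auto
      obtain r' where "nb w = {p, r'}" using two[OF w(2) \<open>w \<noteq> u\<close>] by blast
      then have "nb w = nb x" using \<open>r \<in> nb w\<close> r by auto
      then show ?thesis using w \<open>w \<noteq> u\<close> by blast
    qed
    have "v = v2 \<or> v = v3 \<or> v = v4" using v nbp by auto
    moreover have "nb v3 = nb v2 \<or> nb v4 = nb v2" using key[of v2] nbp by auto
    moreover have "nb v2 = nb v3 \<or> nb v4 = nb v3" using key[of v3] nbp by auto
    moreover have "nb v2 = nb v4 \<or> nb v3 = nb v4" using key[of v4] nbp by auto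
    ultimately show ?thesis using q(1) by metis
  qed
  have nbv: "nb v2 = {p, q}" "nb v3 = {p, q}" "nb v4 = {p, q}" using same nbp by auto
  have lt: "v2 < n" "v3 < n" "v4 < n" using nbp nbD(1)[of _ p] by auto
  have vq: "v2 \<in> nb q" "v3 \<in> nb q" "v4 \<in> nb q" using nbs[of q] nbv lt by auto
  have "u \<notin> nb q" using nbs[of u q] u q by auto
  then have int: "nb p \<inter> nb q = {v2, v3, v4}" using nbp vq by auto
  have o: "a p v2 * cnj (a q v2) + a p v3 * cnj (a q v3) + a p v4 * cnj (a q v4) = 0"
    by (rule orth3[OF sp(2,1) q(3,2) int]) (use nbp in auto)
  note U = unit_nb[OF sp(2)] unit_nb[OF q(3)]
  have U3: "cmod (a p v) = 1" "cmod (a q v) = 1" "a p v \<in> Z_omega" "a q v \<in> Z_omega" "a p v * cnj (a p v) = 1"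
    if "v \<in> {v2, v3, v4}" for v
    using that U nbp vq by auto
  have sq: "(a p v2 * cnj (a q v2))\<^sup>2 + (a p v3 * cnj (a q v3))\<^sup>2 + (a p v4 * cnj (a q v4))\<^sup>2 = 0"
    by (rule unit_sum3(2)[OF _ _ _ o]) (simp_all add: norm_mult U3)
  \<comment> \<open>Put e j = a p j * cnj (a q j). Row \<open>p\<close> then yields the conjugate of
    the sum of the e j, and row \<open>q\<close> the conjugate of the sum of their squares. Both
    sums vanish because the ratios of the e j are cube roots of unity.\<close>
  define x where "x = (\<lambda>i. cnj (a p i) * cnj (a p i) * a q i)"
  show False
  proof (rule no_kernel_extension[of "{v2, v3, v4}" x])
    show "{v2, v3, v4} \<subseteq> {..<n}" "{v2, v3, v4} \<noteq> {}" "card {v2, v3, v4} \<le> 4"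
      using lt by (auto simp: card_insert_if)
    show "x j \<in> Z_omega" "cmod (x j) = 1" if "j \<in> {v2, v3, v4}" for j
      using U3[OF that] by (auto simp: x_def norm_mult intro!: Z_omega_unary Z_omega_algebra(3))
    fix i j assume "j \<in> {v2, v3, v4}" "i \<in> nb j"
    then have i: "i = p \<or> i = q" using nbv by auto
    have F: "{v2, v3, v4} \<inter> nb p = {v2, v3, v4}" "{v2, v3, v4} \<inter> nb q = {v2, v3, v4}" using nbp vq by auto
    have pp: "a p v * x v = cnj (a p v * cnj (a q v))" if "v \<in> {v2, v3, v4}" for v
      using U3(5)[OF that] by (simp add: x_def)
    have qq: "a q v * x v = cnj ((a p v * cnj (a q v))\<^sup>2)" for v
      by (simp add: x_def power2_eq_square)
    show "(\<Sum>j\<in>{v2, v3, v4} \<inter> nb i. a i j * x j) = 0"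
      using i
    proof
      assume i: "i = p"
      have "(\<Sum>j\<in>{v2, v3, v4}. a p j * x j) = cnj (a p v2 * cnj (a q v2) + a p v3 * cnj (a q v3) + a p v4
          * cnj (a q v4))"
        using nbp pp by (simp add: add.assoc)
      then show ?thesis unfolding i F o by simp
    next
      assume i: "i = q"
      have "(\<Sum>j\<in>{v2, v3, v4}. a q j * x j) = cnj ((a p v2 * cnj (a q v2))\<^sup>2 + (a p v3 * cnj (a q v3))\<^sup>2 +
          (a p v4 * cnj (a q v4))\<^sup>2)"
        using nbp qq by (simp add: add.assoc)
      then show ?thesis unfolding i F sq by simp
    qed
  qed
qed

section \<open>Unsaturated vertices of degree 2\<close>

lemma unsat_two:
  assumes u: "u < n" "\<not> sat u" "p \<in> nb u"
  obtains q where "nb u = {p, q}" "q \<noteq> p" "q < n" "sat q" "p < n" "sat p" "u \<in> nb p" "u \<in> nb q"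
proof -
  have p: "p < n" "u \<in> nb p" "sat p" using nbs[OF u(3,1)] unsat_nb(2)[OF u] by auto
  have "nb u \<noteq> {p}" using no_leaf[OF u(1)] p by auto
  then obtain q where q: "q \<in> nb u" "q \<noteq> p" using u by blast
  have "nb u = {p, q}" using card2_two[OF _ unsat_le[OF u(1,2)] u(3) q(1)] q by auto
  then show ?thesis using that[of q] q p nbs[OF q(1) u(1)] unsat_nb(2)[OF u(1,2) q(1)] by auto
qed

text \<open>The saturated vertex \<open>s\<close> meets \<open>u\<close> in \<open>p\<close>, hence
  in a second vertex, which can only be \<open>q\<close>.\<close>

lemma sat_common:
  assumes "u < n" "nb u = {p, q}" "\<not> sat u" "p < n" "s \<in> nb p" "sat s"
  shows "s \<in> nb q"
proof -
  have s: "p \<in> nb s" "s < n" using nbs[of s p] assms by auto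
  have "s \<noteq> u" using assms by auto
  then obtain y where y: "y \<noteq> p" "y \<in> nb s" "y \<in> nb u" using overlap[of s p u] s assms by auto
  then have "q \<in> nb s" using assms by auto
  then show ?thesis using nbs[of q s] s by auto
qed

text \<open>Normalised by the weights at \<open>p\<close>, the signs +, +, -, - on the four
  neighbours of \<open>p\<close> cancel in row \<open>p\<close>; only the other rows remain to be
  checked. The squared norm is exactly the permitted 4.\<close>

lemma kernel_pair_split:
  assumes p: "p < n" "nb p = {u, y, z, w}"
    and ne: "u \<noteq> y" "u \<noteq> z" "u \<noteq> w" "y \<noteq> z" "y \<noteq> w" "z \<noteq> w"
    and oth: "\<And>i j. j \<in> nb p \<Longrightarrow> i \<in> nb j \<Longrightarrow> i \<noteq> p \<Longrightarrow>
      (\<Sum>j\<in>nb p \<inter> nb i. a i j * (if j = u \<or> j = y then cnj (a p j) else - cnj (a p j))) = 0"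
  shows False
proof (rule no_kernel_extension[of "nb p" "\<lambda>j. if j = u \<or> j = y then cnj (a p j) else - cnj (a p j)"])
  show "nb p \<subseteq> {..<n}" "nb p \<noteq> {}" "card (nb p) \<le> 4" using ne p nbD(1)[of _ p] by auto
  show "(if j = u \<or> j = y then cnj (a p j) else - cnj (a p j)) \<in> Z_omega"
    "cmod (if j = u \<or> j = y then cnj (a p j) else - cnj (a p j)) = 1" if "j \<in> nb p" for j
    using unit_nb(3,4)[OF p(1) that] by (auto intro!: Z_omega_unary)
  fix i j assume ij: "j \<in> nb p" "i \<in> nb j"
  show "(\<Sum>j\<in>nb p \<inter> nb i. a i j * (if j = u \<or> j = y then cnj (a p j) else - cnj (a p j))) = 0"
  proof (cases "i = p")
    case True
    then show ?thesis using unit_nb(1)[OF p(1)] p(2) ne by simp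
  next
    case False
    then show ?thesis using oth ij by blast
  qed
qed

text \<open>Every neighbour of \<open>p\<close> shares its second neighbour with another one, so the
  four form two pairs or all agree. In the first case each pair cancels in the row of its own second
  neighbour; in the second the four products of rows \<open>p\<close> and \<open>q\<close> sum to 0
  and split into cancelling pairs.\<close>

lemma no_unsat_star:
  assumes u: "u < n" "\<not> sat u" and nbu: "nb u = {p, q}" and p: "p < n" "sat p" "u \<in> nb p"
    and q: "q < n" "sat q" "q \<noteq> p"
    and all: "\<And>v. v \<in> nb p \<Longrightarrow> \<not> sat v"
  shows False
proof -
  have uq: "u \<in> nb q" using nbs[of q u] nbu u by auto
  have sec: "\<exists>r. nb v = {p, r} \<and> r \<noteq> p \<and> r < n \<and> v \<in> nb r" if v: "v \<in> nb p" for v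
  proof -
    have vn: "v < n" "p \<in> nb v" using nbs[OF v p(1)] by auto
    show ?thesis using unsat_two[OF vn(1) all[OF v] vn(2)] by metis
  qed
  have partner: "\<exists>w\<in>nb p - {x}. nb w = {p, r}" if x: "x \<in> nb p" "nb x = {p, r}" "r \<noteq> p" for x r
  proof -
    have xr: "r < n" "x \<in> nb r" using nbs[of r x] nbs[OF x(1) p(1)] x by auto
    obtain w where w: "w \<noteq> x" "w \<in> nb p" "w \<in> nb r" using overlap[OF p(2) x(1) xr(2)] x p xr by auto
    have "r \<in> nb w" using nbs[OF w(3) xr(1)] by auto
    then show ?thesis using sec[OF w(2)] w x by auto
  qed
  obtain y where y: "y \<in> nb p" "y \<noteq> u" "nb y = {p, q}" using partner[OF p(3) nbu q(3)] by blast
  obtain z w where nbp: "nb p = {u, y, z, w}" and ne: "u \<noteq> z" "u \<noteq> w" "y \<noteq> z" "y \<noteq> w" "z \<noteq> w"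
    using card4_two[OF p(2,3) y(1)] y(2) by metis
  have zw: "z \<in> nb p" "w \<in> nb p" using nbp by auto
  obtain r where r: "nb z = {p, r}" "r \<noteq> p" "r < n" "z \<in> nb r" using sec[OF zw(1)] by blast
  obtain r' where r': "nb w = {p, r'}" "r' \<noteq> p" "r' < n" "w \<in> nb r'" using sec[OF zw(2)] by blast
  have rr: "r' = r"
  proof (cases "r = q")
    case True
    then obtain x where "x \<in> nb p - {w}" "nb x = {p, r'}" using partner[OF zw(2) r'(1,2)] by blast
    then show ?thesis using True nbp nbu y r r' q by (auto simp: doubleton_eq_iff)
  next
    case False
    obtain x where "x \<in> nb p - {z}" "nb x = {p, r}" using partner[OF zw(1) r(1,2)] by blast
    then have "nb w = {p, r}" using nbp nbu y False r q by (auto simp: doubleton_eq_iff)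
    then show ?thesis using r' r by (auto simp: doubleton_eq_iff)
  qed
  have yq: "y \<in> nb q" using nbs[of q y] nbD(1)[OF y(1)] y(3) by auto
  show False
  proof (cases "r = q")
    case False
    have int: "nb p \<inter> nb q = {u, y}"
      using nbp uq yq r r' rr False q nbs[of z q] nbs[of w q] by auto
    have int': "nb p \<inter> nb r = {z, w}"
      using nbp nbu y r r' rr False q nbs[of u r] nbs[of y r] by auto
    have o1: "a p u * cnj (a q u) + a p y * cnj (a q y) = 0"
      using orth2[OF p(1,2) q(1,3) int] y by auto
    have o2: "a p z * cnj (a r z) + a p w * cnj (a r w) = 0"
      using orth2[OF p(1,2) r(3,2) int'] ne by auto
    show False
    proof (rule kernel_pair_split[OF p(1) nbp])
      fix i j assume "j \<in> nb p" "i \<in> nb j" "i \<noteq> p"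
      then have "i = q \<or> i = r" using nbp nbu y r r' rr by auto
      then show "(\<Sum>j\<in>nb p \<inter> nb i. a i j * (if j = u \<or> j = y then cnj (a p j) else - cnj (a p j))) = 0"
      proof
        assume i: "i = q"
        have "cnj (a p u * cnj (a q u) + a p y * cnj (a q y)) = 0" unfolding o1 by simp
        then show ?thesis unfolding i int using y(2) by (simp add: mult.commute)
      next
        assume i: "i = r"
        have "cnj (a p z * cnj (a r z) + a p w * cnj (a r w)) = 0" unfolding o2 by simp
        moreover have "- (a r z * cnj (a p z)) - a r w * cnj (a p w) = - cnj (a p z * cnj (a r z) + a p w
            * cnj (a r w))"
          by (simp add: mult.commute)
        ultimately show ?thesis unfolding i int' using ne by simp
      qed
    qed (use ne y in auto)
  next
    case True
    have zq: "z \<in> nb q" "w \<in> nb q" using r r' rr True by auto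
    have int: "nb p \<inter> nb q = {u, y, z, w}" using nbp uq yq zq by auto
    have nbq: "nb q = {u, y, z, w}" using card4_four[OF q(2) uq yq zq] ne y by auto
    have o: "a p u * cnj (a q u) + a p y * cnj (a q y) + a p z * cnj (a q z) + a p w * cnj (a q w) = 0"
      using orth4[OF p(1,2) q(1,3) int] ne y by auto
    note U = unit_nb(3)[OF p(1)] unit_nb(3)[OF q(1)]
    have c: "cmod (a p u * cnj (a q u)) = 1" "cmod (a p y * cnj (a q y)) = 1"
      "cmod (a p z * cnj (a q z)) = 1" "cmod (a p w * cnj (a q w)) = 1"
      using U nbp nbq by (auto simp: norm_mult)
    \<comment> \<open>Which neighbour is paired with \<open>u\<close> depends on the outcome of
      \<open>unit_sum4\<close>, so the pairing is kept variable.\<close>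
    have main: False if nbp': "nb p = {u, y', z', w'}"
        and ne': "u \<noteq> y'" "u \<noteq> z'" "u \<noteq> w'" "y' \<noteq> z'" "y' \<noteq> w'" "z' \<noteq> w'"
      and e: "a p u * cnj (a q u) + a p y' * cnj (a q y') = 0"
        "a p z' * cnj (a q z') + a p w' * cnj (a q w') = 0" for y' z' w'
    proof (rule kernel_pair_split[OF p(1) nbp' ne'])
      fix i j assume "j \<in> nb p" "i \<in> nb j" "i \<noteq> p"
      then have i: "i = q" using nbp nbu y r r' rr True by auto
      have int: "nb p \<inter> nb q = {u, y', z', w'}" using nbq nbp nbp' by auto
      have "cnj (a p u * cnj (a q u) + a p y' * cnj (a q y')) = 0"
        "cnj (a p z' * cnj (a q z') + a p w' * cnj (a q w')) = 0" unfolding e by simp_all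
      then have "a q u * cnj (a p u) + a q y' * cnj (a p y') = 0"
        "a q z' * cnj (a p z') + a q w' * cnj (a p w') = 0" by (simp_all add: mult.commute)
      then have "a q u * cnj (a p u) + (a q y' * cnj (a p y') + (- (a q z' * cnj (a p z')) + - (a q w' *
          cnj (a p w')))) = 0"
        by Groebner_Basis.algebra
      then show "(\<Sum>j\<in>nb p \<inter> nb i. a i j * (if j = u \<or> j = y' then cnj (a p j) else - cnj (a p j))) = 0"
        unfolding i int using ne' by simp
    qed
    consider "a p u * cnj (a q u) + a p y * cnj (a q y) = 0" | "a p u * cnj (a q u) + a p z * cnj (a q z) = 0"
      | "a p u * cnj (a q u) + a p w * cnj (a q w) = 0"
      using unit_sum4[OF c o] by blast
    then show False
    proof cases
      case 1
      moreover have "a p z * cnj (a q z) + a p w * cnj (a q w) = 0" using o 1 by Groebner_Basis.algebra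
      ultimately show False using main[of y z w] nbp ne y by auto
    next
      case 2
      moreover have "a p y * cnj (a q y) + a p w * cnj (a q w) = 0" using o 2 by Groebner_Basis.algebra
      moreover have "nb p = {u, z, y, w}" using nbp by auto
      ultimately show False using main[of z y w] ne y by auto
    next
      case 3
      moreover have "a p y * cnj (a q y) + a p z * cnj (a q z) = 0" using o 3 by Groebner_Basis.algebra
      moreover have "nb p = {u, w, y, z}" using nbp by auto
      ultimately show False using main[of w y z] ne y by auto
    qed
  qed
qed

lemma nb_iff: "u < n \<Longrightarrow> v < n \<Longrightarrow> u \<in> nb v \<longleftrightarrow> v \<in> nb u"
  using nbs by blast

text \<open>The vertices \<open>u\<close>, \<open>y1\<close>, \<open>y2\<close> of degree 2 act as
  edges of a triangle on \<open>p\<close>, \<open>q\<close>, \<open>v\<close>. A kernel vector on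
  them can always be made to cancel at \<open>p\<close> and \<open>q\<close>. It also cancels at
  \<open>v\<close>, because any two of the three rows are orthogonal and share just \<open>s\<close>
  and one of these vertices.\<close>

lemma no_unsat_one:
  assumes u: "u < n" "\<not> sat u" and nbu: "nb u = {p, q}" and p: "p < n" "sat p" "u \<in> nb p"
    and q: "q < n" "sat q" "u \<in> nb q" "q \<noteq> p"
    and s: "s \<in> nb p" "sat s" and oth: "\<And>v. v \<in> nb p \<Longrightarrow> v \<noteq> s \<Longrightarrow> \<not> sat v"
  shows False
proof -
  have sn: "s < n" "p \<in> nb s" "s \<noteq> p" using nbs[OF s(1) p(1)] by auto
  have sq: "s \<in> nb q" using sat_common[OF u(1) nbu u(2) p(1) s] .
  have qs: "q \<in> nb s" "s \<noteq> q" using nbs[OF sq q(1)] by auto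
  have nbu': "nb u = {q, p}" using nbu by auto
  have othq: "\<not> sat v" if "v \<in> nb q" "v \<noteq> s" for v
    using sat_common[OF u(1) nbu' u(2) q(1) that(1)] oth that by blast
  have us: "u \<noteq> s" using u s by auto
  have link: "\<exists>y. y \<in> nb p' \<and> y \<noteq> s \<and> nb y = {p', v} \<and> y < n"
    if p': "p' < n" "sat p'" "s \<in> nb p'" "\<And>v. v \<in> nb p' \<Longrightarrow> v \<noteq> s \<Longrightarrow> \<not> sat v"
      and v: "v \<in> nb s" "v \<noteq> p'" for p' v
  proof -
    have vn: "v < n" "s \<in> nb v" using nbs[OF v(1) sn(1)] by auto
    obtain y where y: "y \<noteq> s" "y \<in> nb p'" "y \<in> nb v"
      using overlap[OF p'(2,3) vn(2) v(2) p'(1) vn(1)] by blast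
    have yn: "y < n" "p' \<in> nb y" "v \<in> nb y" using nbs[OF y(2) p'(1)] nbs[OF y(3) vn(1)] by auto
    have "nb y = {p', v}" using card2_two[OF _ unsat_le[OF yn(1) p'(4)[OF y(2,1)]] yn(2,3)] v(2) by auto
    then show ?thesis using y yn by blast
  qed
  obtain v v' where nbs': "nb s = {p, q, v, v'}" and nv: "p \<noteq> v" "p \<noteq> v'" "q \<noteq> v" "q \<noteq> v'" "v \<noteq> v'"
    using card4_two[OF s(2) sn(2) qs(1)] q(4) by metis
  have vs: "v \<in> nb s" "v' \<in> nb s" using nbs' by auto
  have vn: "v < n" "s \<in> nb v" using nbs[OF vs(1) sn(1)] by auto
  obtain y1 where y1: "y1 \<in> nb p" "y1 \<noteq> s" "nb y1 = {p, v}" "y1 < n"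
    using link[OF p(1,2) s(1) oth vs(1)] nv by metis
  obtain y1' where y1': "y1' \<in> nb p" "y1' \<noteq> s" "nb y1' = {p, v'}" "y1' < n"
    using link[OF p(1,2) s(1) oth vs(2)] nv by metis
  obtain y2 where y2: "y2 \<in> nb q" "y2 \<noteq> s" "nb y2 = {q, v}" "y2 < n"
    using link[OF q(1,2) sq othq vs(1)] nv by metis
  obtain y2' where y2': "y2' \<in> nb q" "y2' \<noteq> s" "nb y2' = {q, v'}" "y2' < n"
    using link[OF q(1,2) sq othq vs(2)] nv by metis
  have d: "u \<noteq> y1" "u \<noteq> y1'" "u \<noteq> y2" "u \<noteq> y2'" "y1 \<noteq> y1'" "y2 \<noteq> y2'" "y1 \<noteq> y2"
    using nbu y1(3) y1'(3) y2(3) y2'(3) nv q(4) by (auto simp: doubleton_eq_iff)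
  have nbp: "nb p = {s, u, y1, y1'}"
    by (rule card4_four[OF p(2) s(1) p(3) y1(1) y1'(1)]) (use d us y1 y1' in auto)
  have nbq: "nb q = {s, u, y2, y2'}"
    by (rule card4_four[OF q(2) sq q(3) y2(1) y2'(1)]) (use d us y2 y2' in auto)
  have mem: "u \<notin> nb v" "y1 \<in> nb v" "y1' \<notin> nb v" "y2 \<in> nb v" "y2' \<notin> nb v"
    "y1 \<notin> nb q" "y1' \<notin> nb q" "y2 \<notin> nb p" "y2' \<notin> nb p"
    unfolding nb_iff[OF u(1) vn(1)] nb_iff[OF y1(4) vn(1)] nb_iff[OF y1'(4) vn(1)]
      nb_iff[OF y2(4) vn(1)] nb_iff[OF y2'(4) vn(1)] nb_iff[OF y1(4) q(1)] nb_iff[OF y1'(4) q(1)]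
      nb_iff[OF y2(4) p(1)] nb_iff[OF y2'(4) p(1)] nbu y1(3) y1'(3) y2(3) y2'(3) using nv q(4) by auto
  have i1: "nb p \<inter> nb q = {s, u}" using nbp sq q(3) mem by auto
  have i2: "nb p \<inter> nb v = {s, y1}" using nbp vn mem by auto
  have i3: "nb q \<inter> nb v = {s, y2}" using nbq vn mem by auto
  have e1: "a p s * cnj (a q s) + a p u * cnj (a q u) = 0"
      by (rule orth2[OF p(1,2) q(1,4) i1]) (use us in auto)
  have e2: "a p s * cnj (a v s) + a p y1 * cnj (a v y1) = 0"
      by (rule orth2[OF p(1,2) vn(1) _ i2]) (use nv y1 in auto)
  have e3: "a q s * cnj (a v s) + a q y2 * cnj (a v y2) = 0"
      by (rule orth2[OF q(1,2) vn(1) _ i3]) (use nv y2 in auto)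
  have c: "cnj (a p s) * a q s + cnj (a p u) * a q u = 0" "cnj (a p s) * a v s + cnj (a p y1) * a v y1 = 0"
    "cnj (a q s) * a v s + cnj (a q y2) * a v y2 = 0"
    using arg_cong[OF e1, of cnj] arg_cong[OF e2, of cnj] arg_cong[OF e3, of cnj] by simp_all
  note Up = unit_nb[OF p(1)] and Uq = unit_nb[OF q(1)]
  have U: "a p u * cnj (a p u) = 1" "a p y1 * cnj (a p y1) = 1" "a q y2 * cnj (a q y2) = 1"
      "a q s * cnj (a q s) = 1"
    using Up(1)[OF p(3)] Up(1)[OF y1(1)] Uq(1)[OF y2(1)] Uq(1)[OF sq] by auto
  define x where "x = (\<lambda>i. if i = u then cnj (a p u) else if i = y1 then - cnj (a p y1)
     else - (cnj (a q y2) * a q u * cnj (a p u)))"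
  show False
  proof (rule no_kernel_extension[of "{u, y1, y2}" x])
    show "{u, y1, y2} \<subseteq> {..<n}" "{u, y1, y2} \<noteq> {}" "card {u, y1, y2} \<le> 4"
      using u y1 y2 d by auto
    show "x j \<in> Z_omega" for j
      using Up(4)[OF p(3)] Up(4)[OF y1(1)] Uq(4)[OF y2(1)] Uq(4)[OF q(3)]
      by (auto simp: x_def intro!: Z_omega_unary Z_omega_algebra(3))
    show "cmod (x j) = 1" for j
      using Up(3)[OF p(3)] Up(3)[OF y1(1)] Uq(3)[OF y2(1)] Uq(3)[OF q(3)]
      by (simp add: x_def norm_mult)
    fix i j assume "j \<in> {u, y1, y2}" "i \<in> nb j"
    then have "i = p \<or> i = q \<or> i = v" using nbu y1 y2 by auto
    moreover have F: "{u, y1, y2} \<inter> nb p = {u, y1}" "{u, y1, y2} \<inter> nb q = {u, y2}"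
        "{u, y1, y2} \<inter> nb v = {y1, y2}"
      using p(3) q(3) y1(1) y2(1) mem by auto
    moreover have "a p u * x u + a p y1 * x y1 = 0" using U d by (simp add: x_def)
    moreover have "a q u * x u + a q y2 * x y2 = 0" using U(3) d by (simp add: x_def mult.assoc[symmetric])
    moreover have "a v y1 * x y1 + a v y2 * x y2 = 0"
    proof -
      have "a v y1 * - cnj (a p y1) + a v y2 * - (cnj (a q y2) * a q u * cnj (a p u)) = 0"
        using c U by Groebner_Basis.algebra
      then show ?thesis using d by (simp add: x_def)
    qed
    ultimately show "(\<Sum>j\<in>{u, y1, y2} \<inter> nb i. a i j * x j) = 0" using d by auto
  qed
qed

text \<open>Here \<open>p\<close> and \<open>q\<close> have the same neighbours, and the four ratios
  \<open>r\<close> of their rows cancel in pairs. Overlaps with further vertices make the ratios at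
  \<open>s1\<close>, \<open>s2\<close>, \<open>s3\<close> equal, so two equal nonzero units would
  have to be opposite.\<close>

lemma no_unsat_three:
  assumes u: "u < n" "\<not> sat u" and nbu: "nb u = {p, q}" and p: "p < n" "sat p" "u \<in> nb p"
    and q: "q < n" "sat q" "u \<in> nb q" "q \<noteq> p"
    and nbp: "nb p = {u, s1, s2, s3}" and ne: "u \<noteq> s1" "u \<noteq> s2" "u \<noteq> s3" "s1 \<noteq> s2" "s1 \<noteq> s3" "s2 \<noteq> s3"
    and s: "sat s1" "sat s2" "sat s3"
  shows False
proof -
  have inp: "s1 \<in> nb p" "s2 \<in> nb p" "s3 \<in> nb p" using nbp by auto
  have inq: "s1 \<in> nb q" "s2 \<in> nb q" "s3 \<in> nb q"
    using sat_common[OF u(1) nbu u(2) p(1) inp(1) s(1)] sat_common[OF u(1) nbu u(2) p(1) inp(2) s(2)]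
      sat_common[OF u(1) nbu u(2) p(1) inp(3) s(3)] by auto
  have nbq: "nb q = {u, s1, s2, s3}" by (rule card4_four[OF q(2,3) inq]) (use ne in auto)
  define r where "r j = a q j * cnj (a p j)" for j
  have int: "nb q \<inter> nb p = {u, s1, s2, s3}" using nbp nbq by auto
  have o: "r u + r s1 + r s2 + r s3 = 0"
    unfolding r_def by (rule orth4[OF q(1,2) p(1) q(4)[symmetric] int]) (use ne in auto)
  note Up = unit_nb[OF p(1)] and Uq = unit_nb[OF q(1)]
  have rj: "cmod (r j) = 1" "a q j = r j * a p j" "r j * cnj (r j) = 1" if "j \<in> nb p" for j
  proof -
    have "j \<in> nb q" using that nbp nbq by auto
    then show "cmod (r j) = 1" using Up(3)[OF that] Uq(3) by (simp add: r_def norm_mult)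
    then show "r j * cnj (r j) = 1" by (rule unit_cnj)
    show "a q j = r j * a p j" using Up(2)[OF that] by (simp add: r_def mult.assoc)
  qed
  have rne: "r j \<noteq> 0" if "j \<in> nb p" for j using rj(1)[OF that] by auto
  \<comment> \<open>A vertex adjacent to all of \<open>s1\<close>, \<open>s2\<close>,
    \<open>s3\<close> would give two vanishing sums of three units, with terms y j and r j * y j.
    Two of the r j are opposite, so the two cube-root relations for these indices differ in the sign
    of the mixed term and contradict each other.\<close>
  have no3: "{s1, s2, s3} \<subseteq> nb v \<Longrightarrow> False" if v: "v < n" "v \<noteq> p" "v \<noteq> q" for v
  proof -
    assume sub: "{s1, s2, s3} \<subseteq> nb v"
    have "u \<notin> nb v" using nb_iff[OF u(1) v(1)] nbu v by auto
    then have i: "nb p \<inter> nb v = {s1, s2, s3}" "nb q \<inter> nb v = {s1, s2, s3}" using sub nbp nbq by auto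
    define y where "y j = a p j * cnj (a v j)" for j
    have y1: "cmod (y j) = 1" if "j \<in> {s1, s2, s3}" for j
      using that sub Up(3)[of j] unit_nb(3)[OF v(1), of j] inp by (auto simp: y_def norm_mult)
    have o1: "y s1 + y s2 + y s3 = 0"
      unfolding y_def by (rule orth3[OF p(1,2) v(1,2) i(1)]) (use ne in auto)
    have "a q s1 * cnj (a v s1) + a q s2 * cnj (a v s2) + a q s3 * cnj (a v s3) = 0"
      by (rule orth3[OF q(1,2) v(1,3) i(2)]) (use ne in auto)
    then have o2: "r s1 * y s1 + r s2 * y s2 + r s3 * y s3 = 0"
      using rj(2) inp by (simp add: y_def mult.assoc)
    have contra: False if abc: "y A + y B + y C = 0" "r A * y A + r B * y B + r C * y C = 0" "r B + r C = 0"
      and ABC: "A \<in> {s1, s2, s3}" "B \<in> {s1, s2, s3}" "C \<in> {s1, s2, s3}" for A B C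
    proof -
      have inn: "A \<in> nb p" "B \<in> nb p" "C \<in> nb p" using ABC inp by auto
      have "(y B)\<^sup>2 + y B * y C + (y C)\<^sup>2 = 0"
      proof (rule unit_sum3(1)[of _ _ "y A"])
        show "y B + y C + y A = 0" using abc(1) by Groebner_Basis.algebra
      qed (use y1 ABC in blast)+
      moreover have "(r B * y B)\<^sup>2 + (r B * y B) * (r C * y C) + (r C * y C)\<^sup>2 = 0"
      proof (rule unit_sum3(1)[of _ _ "r A * y A"])
        show "r B * y B + r C * y C + r A * y A = 0" using abc(2) by Groebner_Basis.algebra
      qed (use y1[OF ABC(1)] y1[OF ABC(2)] y1[OF ABC(3)] rj(1)[OF inn(1)] rj(1)[OF inn(2)] rj(1)[OF inn(3)]
          in \<open>simp_all add: norm_mult\<close>)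
      ultimately have "2 * (r B * r B * y B * y C) = 0" using abc(3) by Groebner_Basis.algebra
      moreover have "y B \<noteq> 0" "y C \<noteq> 0" using y1[OF ABC(2)] y1[OF ABC(3)] by auto
      ultimately show False using rne inn by auto
    qed
    consider "r u + r s1 = 0" | "r u + r s2 = 0" | "r u + r s3 = 0"
      using unit_sum4[OF rj(1)[OF p(3)] rj(1)[OF inp(1)] rj(1)[OF inp(2)] rj(1)[OF inp(3)] o] by blast
    then show False
    proof cases
      case 1
      have "r s2 + r s3 = 0" using 1 o by Groebner_Basis.algebra
      then show False using contra[of s1 s2 s3] o1 o2 by simp
    next
      case 2
      have "r s1 + r s3 = 0" using 2 o by Groebner_Basis.algebra
      moreover have "y s2 + y s1 + y s3 = 0" using o1 by Groebner_Basis.algebra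
      moreover have "r s2 * y s2 + r s1 * y s1 + r s3 * y s3 = 0" using o2 by Groebner_Basis.algebra
      ultimately show False using contra[of s2 s1 s3] by simp
    next
      case 3
      have "r s1 + r s2 = 0" using 3 o by Groebner_Basis.algebra
      moreover have "y s3 + y s1 + y s2 = 0" using o1 by Groebner_Basis.algebra
      moreover have "r s3 * y s3 + r s1 * y s1 + r s2 * y s2 = 0" using o2 by Groebner_Basis.algebra
      ultimately show False using contra[of s3 s1 s2] by simp
    qed
  qed
  \<comment> \<open>A further neighbour \<open>v\<close> of \<open>si\<close> meets \<open>p\<close>
    and \<open>q\<close> in the same two vertices; comparing the two orthogonality relations equates
    the ratios there. As each of three ratios equals another one, all are equal.\<close>
  have eq2: "\<exists>j\<in>{s1, s2, s3} - {si}. r j = r si" if si: "si \<in> {s1, s2, s3}" for si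
  proof -
    have sip: "si \<in> nb p" "si \<in> nb q" "sat si" using si inp inq s by auto
    have sn: "si < n" "p \<in> nb si" using nbs[OF sip(1) p(1)] by auto
    have qsi: "q \<in> nb si" using nbs[OF sip(2) q(1)] by auto
    obtain v w where "nb si = {p, q, v, w}" "p \<noteq> v" "q \<noteq> v"
      using card4_two[OF sip(3) sn(2) qsi] q(4) by metis
    then have v: "v \<in> nb si" "v \<noteq> p" "v \<noteq> q" by auto
    have vn: "v < n" "si \<in> nb v" using nbs[OF v(1) sn(1)] by auto
    have uv: "u \<notin> nb v" using nb_iff[OF u(1) vn(1)] nbu v by auto
    obtain j where j: "j \<noteq> si" "j \<in> nb p" "j \<in> nb v" using overlap[OF p(2) sip(1) vn(2) v(2) p(1) vn(1)]
        by blast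
    have js: "j \<in> {s1, s2, s3}" using j uv nbp by auto
    have i: "nb p \<inter> nb v = {si, j}"
    proof -
      have "\<not> {s1, s2, s3} \<subseteq> nb v" using no3[OF vn(1) v(2,3)] by blast
      then show ?thesis using nbp uv j js vn si by auto
    qed
    then have i': "nb q \<inter> nb v = {si, j}" using nbp nbq by auto
    have "a p si * cnj (a v si) + a p j * cnj (a v j) = 0"
        by (rule orth2[OF p(1,2) vn(1) v(2) i]) (use j in auto)
    moreover have "a q si * cnj (a v si) + a q j * cnj (a v j) = 0"
        by (rule orth2[OF q(1,2) vn(1) v(3) i']) (use j in auto)
    ultimately have "r si * (a p si * cnj (a v si)) = r j * (a p si * cnj (a v si))"
      using rj(2)[OF sip(1)] rj(2)[OF j(2)] by Groebner_Basis.algebra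
    moreover have "a p si * cnj (a v si) \<noteq> 0" using nbD(2)[OF sip(1)] nbD(2)[OF vn(2)] by simp
    ultimately have "r j = r si" by simp
    then show ?thesis using j js by blast
  qed
  have A: "r s2 = r s1 \<or> r s3 = r s1" "r s1 = r s2 \<or> r s3 = r s2" "r s1 = r s3 \<or> r s2 = r s3"
    using eq2[of s1] eq2[of s2] eq2[of s3] ne by auto
  then have eq: "r s1 = r s2" "r s2 = r s3" by metis+
  have "r u + r s1 = 0 \<or> r u + r s2 = 0 \<or> r u + r s3 = 0"
    using unit_sum4[OF rj(1)[OF p(3)] rj(1)[OF inp(1)] rj(1)[OF inp(2)] rj(1)[OF inp(3)] o] .
  then have "r u + r s1 = 0" using eq by auto
  then have "2 * r s1 = 0" using o eq by Groebner_Basis.algebra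
  then show False using rne[OF inp(1)] by simp
qed

text \<open>For twins \<open>s1\<close>, \<open>s2\<close>, orthogonality of columns
  \<open>x\<close> and \<open>y\<close> becomes a relation between the row ratios there: they are
  opposite if the twins are the only common neighbours, and differ by a primitive cube root of unity
  if there is one more.\<close>

lemma twin_ratio:
  assumes s: "s1 < n" "s2 < n" "s1 \<noteq> s2" "nb s1 = nb s2"
    and x: "x \<in> nb s1" "sat x" and y: "y \<in> nb s1" "y \<noteq> x"
  defines "\<rho> \<equiv> \<lambda>z. a s1 z * cnj (a s2 z)"
  shows "nb x \<inter> nb y = {s1, s2} \<Longrightarrow> \<rho> x + \<rho> y = 0"
    and "nb x \<inter> nb y = {s1, s2, t} \<Longrightarrow> t \<noteq> s1 \<Longrightarrow> t \<noteq> s2 \<Longrightarrow> (\<rho> x)\<^sup>2 + \<rho> x * \<rho> y + (\<rho> y)\<^sup>2 = 0"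
proof -
  have lt: "x < n" "y < n" using nbD(1) x y by blast+
  have h: "a x s1 = cnj (a s1 x)" "a x s2 = cnj (a s2 x)" "a y s1 = cnj (a s1 y)" "a y s2 = cnj (a s2 y)"
    using herm lt s by blast+
  have x2: "x \<in> nb s2" "y \<in> nb s2" using x y s by auto
  have U: "a s1 x * cnj (a s1 x) = 1" "a s2 y * cnj (a s2 y) = 1"
    using unit_nb(1)[OF s(1) x(1)] unit_nb(1)[OF s(2) x2(2)] by auto
  define c where "c = a s1 x * cnj (a s2 y)"
  have c1: "cmod c = 1" using unit_nb(3)[OF s(1) x(1)] unit_nb(3)[OF s(2) x2(2)]
      by (simp add: c_def norm_mult)
  have r1: "cmod (\<rho> z) = 1" if "z \<in> nb s1" for z
    using that s unit_nb(3)[OF s(1)] unit_nb(3)[OF s(2)] by (simp add: \<rho>_def norm_mult)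
  show "\<rho> x + \<rho> y = 0" if "nb x \<inter> nb y = {s1, s2}"
  proof -
    have "a x s1 * cnj (a y s1) + a x s2 * cnj (a y s2) = 0"
      by (rule orth2[OF lt(1) x(2) lt(2) y(2) that s(3)])
    then have "cnj (a s1 x) * a s1 y + cnj (a s2 x) * a s2 y = 0" by (simp add: h)
    then show ?thesis unfolding \<rho>_def using U by Groebner_Basis.algebra
  qed
  show "(\<rho> x)\<^sup>2 + \<rho> x * \<rho> y + (\<rho> y)\<^sup>2 = 0" if i: "nb x \<inter> nb y = {s1, s2, t}" and t: "t \<noteq> s1" "t \<noteq> s2"
  proof -
    have "a x s1 * cnj (a y s1) + a x s2 * cnj (a y s2) + a x t * cnj (a y t) = 0"
      by (rule orth3[OF lt(1) x(2) lt(2) y(2) i]) (use s t in auto)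
    then have "cnj (a s1 x) * a s1 y + cnj (a s2 x) * a s2 y + a x t * cnj (a y t) = 0" by (simp add: h)
    then have "\<rho> x + \<rho> y + a x t * cnj (a y t) * c = 0" unfolding \<rho>_def c_def using U
        by Groebner_Basis.algebra
    moreover have "cmod (a x t * cnj (a y t) * c) = 1"
    proof -
      have "t \<in> nb x" "t \<in> nb y" using i by auto
      then show ?thesis using unit_nb(3)[OF lt(1)] unit_nb(3)[OF lt(2)] c1 by (simp add: norm_mult)
    qed
    ultimately show ?thesis using unit_sum3(1) r1 x y by blast
  qed
qed

text \<open>The saturated vertices \<open>s1\<close>, \<open>s2\<close> are twins, and
  \<open>twin_ratio\<close> is applied to their four neighbours. If \<open>u2\<close> is adjacent to
  \<open>q\<close>, the ratios yield a kernel vector on \<open>u\<close> and \<open>u2\<close>.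
  Otherwise \<open>p\<close> and \<open>q\<close> have ratios differing by a primitive cube root of
  unity, some \<open>w\<close> has the ratio opposite to \<open>p\<close>, and neither possible
  overlap of \<open>q\<close> with \<open>w\<close> is compatible with this.\<close>

lemma no_unsat_pair:
  assumes u: "u < n" "\<not> sat u" and nbu: "nb u = {p, q}" and p: "p < n" "sat p" "u \<in> nb p"
    and q: "q < n" "sat q" "u \<in> nb q" "q \<noteq> p"
    and nbp: "nb p = {u, u2, s1, s2}" and ne: "u \<noteq> u2" "u \<noteq> s1" "u \<noteq> s2" "u2 \<noteq> s1" "u2 \<noteq> s2" "s1 \<noteq> s2"
    and s: "sat s1" "sat s2" and u2: "\<not> sat u2"
  shows False
proof -
  have inp: "s1 \<in> nb p" "s2 \<in> nb p" "u2 \<in> nb p" using nbp by auto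
  have inq: "s1 \<in> nb q" "s2 \<in> nb q"
    using sat_common[OF u(1) nbu u(2) p(1) inp(1) s(1)] sat_common[OF u(1) nbu u(2) p(1) inp(2) s(2)] by auto
  have u2n: "u2 < n" "p \<in> nb u2" using nbs[OF inp(3) p(1)] by auto
  have sn: "s1 < n" "p \<in> nb s1" "s2 < n" "p \<in> nb s2" using nbs[OF inp(1) p(1)] nbs[OF inp(2) p(1)] by auto
  have qs: "q \<in> nb s1" "q \<in> nb s2" using nbs[OF inq(1) q(1)] nbs[OF inq(2) q(1)] by auto
  \<comment> \<open>A further neighbour \<open>v\<close> of one twin shares a second vertex with
    \<open>p\<close>. This is the other twin, or else \<open>u2\<close>, which then has neighbours
    \<open>p\<close> and \<open>v\<close>, so that \<open>sat_common\<close> applies.\<close>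
  have sub: "v \<in> nb s'" if vs: "v \<in> nb s" and ss: "s = s1 \<and> s' = s2 \<or> s = s2 \<and> s' = s1" for v s s'
  proof (cases "v = p \<or> v = q")
    case True then show ?thesis using ss sn qs by auto
  next
    case False
    have sp: "s \<in> nb p" "s < n" "s' \<in> nb p" "sat s'" using ss inp sn s by auto
    have vn: "v < n" "s \<in> nb v" using nbs[OF vs sp(2)] by auto
    have vp: "v \<noteq> p" using False by simp
    obtain y where y: "y \<noteq> s" "y \<in> nb p" "y \<in> nb v" using overlap[OF p(2) sp(1) vn(2) vp p(1) vn(1)] by blast
    have "y \<noteq> u" using nb_iff[OF u(1) vn(1)] nbu False y by auto
    then have "y = s' \<or> y = u2" using y nbp ss by auto
    then have "s' \<in> nb v"
    proof
      assume "y = u2"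
      then have "v \<in> nb u2" using y nb_iff[OF u2n(1) vn(1)] by auto
      then have "nb u2 = {p, v}" using card2_two[OF _ unsat_le[OF u2n(1) u2] u2n(2)] vp by auto
      then show ?thesis using sat_common[OF u2n(1) _ u2 p(1) sp(3,4)] by auto
    qed (use y in auto)
    then show ?thesis using nbs[of s' v] vn by auto
  qed
  have nbs12: "nb s1 = nb s2" using sub by blast
  obtain v v' where nbs1: "nb s1 = {p, q, v, v'}" and nv: "p \<noteq> v" "p \<noteq> v'" "q \<noteq> v" "q \<noteq> v'" "v \<noteq> v'"
    using card4_two[OF s(1) sn(2) qs(1)] q(4) by metis
  define \<rho> where "\<rho> = (\<lambda>z. a s1 z * cnj (a s2 z))"
  have tw: "\<rho> x + \<rho> y = 0" if "x \<in> nb s1" "sat x" "y \<in> nb s1" "y \<noteq> x" "nb x \<inter> nb y = {s1, s2}" for x y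
    unfolding \<rho>_def by (rule twin_ratio(1)[OF sn(1,3) ne(6) nbs12 that])
  have tw3: "(\<rho> x)\<^sup>2 + \<rho> x * \<rho> y + (\<rho> y)\<^sup>2 = 0"
    if "x \<in> nb s1" "sat x" "y \<in> nb s1" "y \<noteq> x" "nb x \<inter> nb y = {s1, s2, t}" "t \<noteq> s1" "t \<noteq> s2" for x y t
    unfolding \<rho>_def by (rule twin_ratio(2)[OF sn(1,3) ne(6) nbs12 that])
  have "nb s1 \<inter> nb s2 = {p, q, v, v'}" using nbs12 nbs1 by auto
  then have o: "\<rho> p + \<rho> q + \<rho> v + \<rho> v' = 0"
    unfolding \<rho>_def by (intro orth4[OF sn(1) s(1) sn(3)]) (use ne nv q in auto)
  have r1: "cmod (\<rho> z) = 1" if "z \<in> nb s1" for z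
    using that nbs12 unit_nb(3)[OF sn(1)] unit_nb(3)[OF sn(3)] by (simp add: \<rho>_def norm_mult)
  have inv: "v \<in> nb s1" "v' \<in> nb s1" using nbs1 by auto
  have u2iff: "u2 \<in> nb x \<longleftrightarrow> x \<in> nb u2" if "x < n" for x using nb_iff[OF u2n(1) that] .
  have link: "u \<notin> nb x \<and> s1 \<in> nb x \<and> s2 \<in> nb x \<and> x < n" if x: "x \<in> nb s1" "x \<noteq> p" "x \<noteq> q" for x
  proof -
    have xn: "x < n" "s1 \<in> nb x" using nbs[OF x(1) sn(1)] by auto
    moreover have "s2 \<in> nb x" using nbs[of x s2] x nbs12 sn by auto
    moreover have "u \<notin> nb x" using nb_iff[OF u(1) xn(1)] nbu x by auto
    ultimately show ?thesis by simp
  qed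
  note Up = unit_nb[OF p(1)] and Uq = unit_nb[OF q(1)]
  show False
  proof (cases "u2 \<in> nb q")
    case True
    have "q \<in> nb u2" using nb_iff[OF u2n(1) q(1)] True by simp
    then have nbu2: "nb u2 = {p, q}" using card2_two[OF _ unsat_le[OF u2n(1) u2] u2n(2)] q(4) by auto
    have opp: "\<rho> p + \<rho> x = 0" if x: "x \<in> nb s1" "x \<noteq> p" "x \<noteq> q" for x
    proof -
      have "u2 \<notin> nb x" using u2iff[of x] link[OF x] nbu2 x by auto
      then have "nb p \<inter> nb x = {s1, s2}" using nbp link[OF x] by auto
      then show ?thesis by (rule tw[OF sn(2) p(2) x(1,2)])
    qed
    have "\<rho> p + \<rho> v = 0" "\<rho> p + \<rho> v' = 0" using opp inv nv by metis+
    then have rpq: "\<rho> q = \<rho> p" using o by Groebner_Basis.algebra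
    have nbq: "nb q = {u, u2, s1, s2}" by (rule card4_four[OF q(2,3) True inq]) (use ne in auto)
    have int: "nb p \<inter> nb q = {u, u2, s1, s2}" using nbp nbq by auto
    define e where "e j = a p j * cnj (a q j)" for j
    have e0: "e u + e u2 + e s1 + e s2 = 0"
      unfolding e_def by (rule orth4[OF p(1,2) q(1,4) int]) (use ne in auto)
    have e1: "cmod (e j) = 1" if "j \<in> nb p" for j
      using that nbp nbq Up(3)[of j] Uq(3)[of j] by (auto simp: e_def norm_mult)
    have h: "a p s1 = cnj (a s1 p)" "a p s2 = cnj (a s2 p)" "a q s1 = cnj (a s1 q)" "a q s2 = cnj (a s2 q)"
      using herm p q sn by blast+
    have es: "e s1 = e s2"
    proof -
      have U: "a s1 p * cnj (a s1 p) = 1" "a s2 q * cnj (a s2 q) = 1"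
        using unit_nb(1)[OF sn(1) sn(2)] unit_nb(1)[OF sn(3) qs(2)] by auto
      have "a s1 q * cnj (a s2 q) = a s1 p * cnj (a s2 p)" using rpq by (simp add: \<rho>_def)
      then have "cnj (a s1 p) * a s1 q = cnj (a s2 p) * a s2 q" using U by Groebner_Basis.algebra
      then show ?thesis by (simp add: e_def h)
    qed
    have "e s1 + e s2 = 0 \<or> e s1 + e u = 0 \<or> e s1 + e u2 = 0"
      by (rule unit_sum4) (use e1 inp p(3) e0 in \<open>auto simp: add_ac\<close>)
    moreover have "e s1 \<noteq> 0" using e1[OF inp(1)] by auto
    ultimately have "e s1 + e u = 0 \<or> e s1 + e u2 = 0" using es by auto
    then have "e u = e u2"
    proof
      assume "e s1 + e u = 0"
      then show ?thesis using e0 es by Groebner_Basis.algebra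
    next
      assume "e s1 + e u2 = 0"
      then show ?thesis using e0 es by Groebner_Basis.algebra
    qed
    then have eu: "a q u * cnj (a p u) = a q u2 * cnj (a p u2)"
      unfolding e_def by (metis complex_cnj_cnj complex_cnj_mult mult.commute)
    define x where "x = (\<lambda>i. if i = u then cnj (a p u) else - cnj (a p u2))"
    show False
    proof (rule no_kernel_extension[of "{u, u2}" x])
      show "{u, u2} \<subseteq> {..<n}" "{u, u2} \<noteq> {}" "card {u, u2} \<le> 4" using u u2n ne by auto
      show "x j \<in> Z_omega" "cmod (x j) = 1" for j
        using Up(3,4)[OF p(3)] Up(3,4)[OF inp(3)] by (auto simp: x_def intro!: Z_omega_unary)
      fix i j assume "j \<in> {u, u2}" "i \<in> nb j"
      then have i: "i = p \<or> i = q" using nbu nbu2 by auto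
      have F: "{u, u2} \<inter> nb p = {u, u2}" "{u, u2} \<inter> nb q = {u, u2}" using nbp nbq by auto
      have "a p u * x u + a p u2 * x u2 = 0" using Up(1)[OF p(3)] Up(1)[OF inp(3)] ne by (simp add: x_def)
      moreover have "a q u * x u + a q u2 * x u2 = 0" using eu ne by (simp add: x_def)
      ultimately show "(\<Sum>j\<in>{u, u2} \<inter> nb i. a i j * x j) = 0" using i F ne by auto
    qed
  next
    case False
    have int: "nb p \<inter> nb q = {s1, s2, u}" using nbp inq q(3) False by auto
    have zpq: "(\<rho> p)\<^sup>2 + \<rho> p * \<rho> q + (\<rho> q)\<^sup>2 = 0"
      by (rule tw3[OF sn(2) p(2) qs(1) q(4) int]) (use ne in auto)
    have p0: "\<rho> p \<noteq> 0" "\<rho> q \<noteq> 0" using r1[OF sn(2)] r1[OF qs(1)] by auto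
    have npq: "\<rho> p + \<rho> q \<noteq> 0"
    proof
      assume "\<rho> p + \<rho> q = 0"
      then have "\<rho> p * \<rho> p = 0" using zpq by Groebner_Basis.algebra
      then show False using p0 by simp
    qed
    have "\<rho> p + \<rho> v = 0 \<or> \<rho> p + \<rho> v' = 0"
      using unit_sum4[OF r1[OF sn(2)] r1[OF qs(1)] r1[OF inv(1)] r1[OF inv(2)] o] npq by blast
    then obtain w where w: "\<rho> p + \<rho> w = 0" "w \<in> nb s1" "w \<noteq> p" "w \<noteq> q" using inv nv by metis
    obtain u3 where nbq: "nb q = {u, s1, s2, u3}" and u3: "u \<noteq> u3" "s1 \<noteq> u3" "s2 \<noteq> u3"
      using card4_three[OF q(2,3) inq ne(2,3,6)] by metis
    show False
    proof (cases "u3 \<in> nb w")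
      case True
      have "nb q \<inter> nb w = {s1, s2, u3}" using nbq link[OF w(2-4)] True by auto
      then have "(\<rho> q)\<^sup>2 + \<rho> q * \<rho> w + (\<rho> w)\<^sup>2 = 0"
        by (rule tw3[OF qs(1) q(2) w(2,4)]) (use u3 in auto)
      then have "2 * (\<rho> p * \<rho> q) = 0" using zpq w(1) by Groebner_Basis.algebra
      then show False using p0 by simp
    next
      case False
      have "nb q \<inter> nb w = {s1, s2}" using nbq link[OF w(2-4)] False by auto
      then have "\<rho> q + \<rho> w = 0" by (rule tw[OF qs(1) q(2) w(2,4)])
      then have "3 * (\<rho> p * \<rho> p) = 0" using zpq w(1) by Groebner_Basis.algebra
      then show False using p0 by simp
    qed
  qed
qed

text \<open>The cases are ordered by how many of the other three neighbours of \<open>p\<close> are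
  saturated, where \<open>p\<close> is a neighbour of the supposed unsaturated vertex.\<close>

theorem all_saturated:
  assumes "v < n" shows "sat v"
proof (rule ccontr)
  assume ns: "\<not> sat v"
  obtain p where pv: "p \<in> nb v" using unsat_nb(1)[OF assms ns] by blast
  obtain q where nbv: "nb v = {p, q}" and q: "q \<noteq> p" "q < n" "sat q" and p: "p < n" "sat p"
    and inn: "v \<in> nb p" "v \<in> nb q"
    using unsat_two[OF assms ns pv] by metis
  obtain x y z where nbp: "nb p = {v, x, y, z}" and ne: "v \<noteq> x" "v \<noteq> y" "v \<noteq> z" "x \<noteq> y" "x \<noteq> z" "y \<noteq> z"
    using card4_one[OF p(2) inn(1)] by metis
  note hyps = assms ns nbv p inn(1) q(2,3) inn(2) q(1)
  have one: False if "s \<in> nb p" "sat s" "\<And>w. w \<in> nb p \<Longrightarrow> w \<noteq> s \<Longrightarrow> \<not> sat w" for s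
    using no_unsat_one[OF hyps that] by blast
  have two: False if "nb p = {v, u2, s1, s2}" "v \<noteq> u2" "v \<noteq> s1" "v \<noteq> s2" "u2 \<noteq> s1" "u2 \<noteq> s2" "s1 \<noteq> s2"
    "sat s1" "sat s2" "\<not> sat u2" for u2 s1 s2
    using no_unsat_pair[OF hyps that] .
  have perm: "nb p = {v, y, x, z}" "nb p = {v, z, x, y}" using nbp by auto
  show False
  proof (cases "sat x"; cases "sat y"; cases "sat z")
    assume "sat x" "sat y" "sat z"
    then show False using no_unsat_three[OF hyps nbp ne] by blast
  next
    assume "sat x" "sat y" "\<not> sat z"
    then show False using two[OF perm(2)] ne by auto
  next
    assume "sat x" "\<not> sat y" "sat z"
    then show False using two[OF perm(1)] ne by auto
  next
    assume "\<not> sat x" "sat y" "sat z"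
    then show False using two[OF nbp] ne by auto
  next
    assume "sat x" "\<not> sat y" "\<not> sat z"
    then show False using one[of x] nbp ns by auto
  next
    assume "\<not> sat x" "sat y" "\<not> sat z"
    then show False using one[of y] nbp ns by auto
  next
    assume "\<not> sat x" "\<not> sat y" "sat z"
    then show False using one[of z] nbp ns by auto
  next
    assume "\<not> sat x" "\<not> sat y" "\<not> sat z"
    then have "\<And>w. w \<in> nb p \<Longrightarrow> \<not> sat w" using nbp ns by auto
    then show False using no_unsat_star[OF assms ns nbv p inn(1) q(2,3,1)] by blast
  qed
qed

end

section \<open>Vertices with equal neighbourhoods\<close>

lemma hermitian_weight_eq:
  assumes l: "l x y \<noteq> 0 \<Longrightarrow> l y x = 0"
    and xy: "l x y \<noteq> 0 \<Longrightarrow> b x y = d x * l x y * cnj (d y)" "l y x \<noteq> 0 \<Longrightarrow> b y x = d y * l y x * cnj (d x)"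
    and z: "l x y = 0 \<Longrightarrow> l y x = 0 \<Longrightarrow> b x y = 0" and h: "b x y = cnj (b y x)"
  shows "b x y = d x * hermitian_weight l x y * cnj (d y)"
  using assms by (cases "l x y = 0"; cases "l y x = 0") (auto simp: hermitian_weight_def)

context unit_form
begin

lemma degree: "u < n \<Longrightarrow> card (nb u) = 4"
  by (rule all_saturated)

lemma cover:
  assumes "x \<in> nb u" "x \<in> nb v" "u \<noteq> v" "u < n" "v < n"
  obtains y where "y \<noteq> x" "y \<in> nb u" "y \<in> nb v"
  using overlap[OF degree[OF assms(4)] assms(1,2)] assms by auto

text \<open>Only the listed edges have to be compared: they already supply four neighbours at every
  vertex, so the remaining entries of \<open>a\<close> vanish by 4-regularity.\<close>

lemma graph_equiv:
  assumes A: "A \<in> R_mat n" "\<And>i j. i < n \<Longrightarrow> j < n \<Longrightarrow> A $$ (i, j) = a i j"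
    and V: "finite V" and g: "bij_betw g V {..<n}"
    and l: "\<And>x y. x \<in> V \<Longrightarrow> y \<in> V \<Longrightarrow> l x y \<noteq> 0 \<Longrightarrow> l y x = 0"
      "\<And>x. x \<in> V \<Longrightarrow> card {y \<in> V. l x y \<noteq> 0 \<or> l y x \<noteq> 0} = 4"
      "\<And>x y. x \<in> V \<Longrightarrow> y \<in> V \<Longrightarrow> l x y \<in> Z_omega"
    and d: "\<And>x. x \<in> V \<Longrightarrow> d x \<in> Z_omega" "\<And>x. x \<in> V \<Longrightarrow> cmod (d x) = 1"
    and E: "\<And>x y. x \<in> V \<Longrightarrow> y \<in> V \<Longrightarrow> l x y \<noteq> 0 \<Longrightarrow> a (g x) (g y) = d x * l x y * cnj (d y)"
  shows "x \<in> V \<Longrightarrow> y \<in> V \<Longrightarrow> a (g x) (g y) = d x * hermitian_weight l x y * cnj (d y)"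
    and "equivalent_to_graph A (V, hermitian_weight l)"
proof -
  have gn: "g x < n" if "x \<in> V" for x using bij_betwE[OF g] that by auto
  have inj: "inj_on g V" using g by (rule bij_betw_imp_inj_on)
  have d0: "d x \<noteq> 0" if "x \<in> V" for x using d(2)[OF that] by auto
  have *: "a (g x) (g y) = d x * hermitian_weight l x y * cnj (d y)" if x: "x \<in> V" and y: "y \<in> V" for x y
  proof (rule hermitian_weight_eq[of l x y "\<lambda>x y. a (g x) (g y)" d])
    show "a (g x) (g y) = cnj (a (g y) (g x))" using herm gn x y by blast
    assume xy: "l x y = 0" "l y x = 0"
    define S where "S = {y \<in> V. l x y \<noteq> 0 \<or> l y x \<noteq> 0}"
    have "g ` S \<subseteq> nb (g x)"
    proof
      fix i assume "i \<in> g ` S"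
      then obtain s where s: "i = g s" "s \<in> V" "l x s \<noteq> 0 \<or> l s x \<noteq> 0" by (auto simp: S_def)
      from s(3) have "a (g x) (g s) \<noteq> 0"
      proof
        assume "l x s \<noteq> 0" then show ?thesis using E[OF x s(2)] d0[OF x] d0[OF s(2)] by simp
      next
        assume "l s x \<noteq> 0"
        then have "a (g s) (g x) \<noteq> 0" using E[OF s(2) x] d0[OF x] d0[OF s(2)] by simp
        then show ?thesis using herm[OF gn[OF x] gn[OF s(2)]] by auto
      qed
      then show "i \<in> nb (g x)" using s gn by (simp add: nb_def)
    qed
    moreover have "card (g ` S) = 4"
      using card_image[OF inj_on_subset[OF inj]] l(2)[OF x] by (simp add: S_def)
    ultimately have "g ` S = nb (g x)" using degree[OF gn[OF x]] by (intro card_seteq) auto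
    moreover have "g y \<notin> g ` S" using xy inj y by (auto simp: S_def inj_on_def)
    ultimately show "a (g x) (g y) = 0" using gn[OF y] by (simp add: nb_def)
  qed (use l(1)[OF x y] E[OF x y] E[OF y x] in blast)+
  then show "x \<in> V \<Longrightarrow> y \<in> V \<Longrightarrow> a (g x) (g y) = d x * hermitian_weight l x y * cnj (d y)" .
  show "equivalent_to_graph A (V, hermitian_weight l)"
  proof (rule equivalent_to_graph_intro[OF A(1) g, of _ d id])
    show "A $$ (g x, g y) = id (d x * hermitian_weight l x y * cnj (d y))" if "x \<in> V" "y \<in> V" for x y
      using *[OF that] A(2) gn that by simp
    show "hermitian_weight l x y \<in> Z_omega" if "x \<in> V" "y \<in> V" for x y
      using l(3) that by (auto simp: hermitian_weight_def intro!: Z_omega_unary)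
  qed (use d in auto)
qed

text \<open>One level of a tessellation: twins \<open>t\<close>, \<open>b\<close> whose rows are
  proportional on the previous level \<open>P\<close> and on the next level \<open>Q\<close>, with
  opposite factors.\<close>

definition good :: "nat \<Rightarrow> nat \<Rightarrow> nat set \<Rightarrow> nat set \<Rightarrow> bool" where
  "good t b P Q \<longleftrightarrow> t < n \<and> b < n \<and> t \<noteq> b \<and> nb t = P \<union> Q \<and> nb b = P \<union> Q \<and> card P = 2 \<and> card Q = 2 \<and>
     P \<inter> Q = {} \<and> (\<exists>r. (\<forall>x\<in>P. a b x = r * a t x) \<and> (\<forall>x\<in>Q. a b x = - (r * a t x)))"

text \<open>The equality case of the triangle inequality, obtained from \<open>unit_sum4\<close> by
  splitting 2 k into k + k.\<close>

lemma unit_sum_double: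
  assumes "cmod x = 1" "cmod y = 1" "cmod k = 1" "2 * k + x + y = 0"
  shows "x = - k" "y = - k"
proof -
  have "k + k = 0 \<or> k + x = 0 \<or> k + y = 0"
  proof (rule unit_sum4)
    show "k + k + x + y = 0" using assms(4) by Groebner_Basis.algebra
  qed (use assms in auto)
  moreover have "k + k \<noteq> 0" using assms(3) by auto
  ultimately have "k + x = 0 \<or> k + y = 0" by simp
  then have "k + x = 0 \<and> k + y = 0"
  proof (elim disjE)
    assume "k + x = 0" then show ?thesis using assms(4) by (intro conjI) Groebner_Basis.algebra+
  next
    assume "k + y = 0" then show ?thesis using assms(4) by (intro conjI) Groebner_Basis.algebra+
  qed
  then show "x = - k" "y = - k" by (simp_all add: eq_neg_iff_add_eq_0 add.commute)
qed

text \<open>In the product of rows \<open>t'\<close> and \<open>b'\<close> the columns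
  \<open>t\<close> and \<open>b\<close> contribute the same unit \<open>k\<close>. To cancel 2 k,
  two further common neighbours must contribute - k each. Hence \<open>t'\<close> and
  \<open>b'\<close> are twins as well, with opposite factors on the two levels around them.\<close>

lemma good_step:
  assumes g: "good t b P {t', b'}" and ne: "t' \<noteq> b'"
  shows "\<exists>t'' b''. t'' \<noteq> b'' \<and> good t' b' {t, b} {t'', b''}"
proof -
  obtain r where tb: "t < n" "b < n" "t \<noteq> b" and nbt: "nb t = P \<union> {t', b'}" "nb b = P \<union> {t', b'}"
    and r: "a b t' = - (r * a t t')" "a b b' = - (r * a t b')"
    using g unfolding good_def by auto
  have inn: "t' \<in> nb t" "b' \<in> nb t" "t' \<in> nb b" "b' \<in> nb b" using nbt by auto
  have t': "t' < n" "t \<in> nb t'" "b \<in> nb t'" using nbs[OF inn(1) tb(1)] nbs[OF inn(3) tb(2)] by auto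
  have b': "b' < n" "t \<in> nb b'" "b \<in> nb b'" using nbs[OF inn(2) tb(1)] nbs[OF inn(4) tb(2)] by auto
  note U = unit_nb(1)[OF tb(1) inn(1)] unit_nb(1)[OF tb(1) inn(2)] unit_nb(1)[OF tb(2) inn(3)]
  have h: "a t' t = cnj (a t t')" "a t' b = cnj (a b t')" "a b' t = cnj (a t b')" "a b' b = cnj (a b b')"
    using herm tb t'(1) b'(1) by blast+
  have rr: "r * cnj r = 1"
  proof -
    have "a b t' * cnj (a b t') = r * cnj r * (a t t' * cnj (a t t'))" by (simp add: r)
    then show ?thesis using U by simp
  qed
  define k where "k = cnj (a t t') * a t b'"
  have k1: "cmod k = 1"
    using unit_nb(3)[OF tb(1) inn(1)] unit_nb(3)[OF tb(1) inn(2)] by (simp add: k_def norm_mult)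
  have contrib: "a t' t * cnj (a b' t) = k" "a t' b * cnj (a b' b) = k"
    using rr unfolding h r k_def by (simp, simp) (Groebner_Basis.algebra)
  obtain y z where nbt': "nb t' = {t, b, y, z}" and yz: "t \<noteq> y" "t \<noteq> z" "b \<noteq> y" "b \<noteq> z" "y \<noteq> z"
    using card4_two[OF degree[OF t'(1)] t'(2,3) tb(3)] by metis
  have unitk: "cmod (a t' x * cnj (a b' x)) = 1" if "x \<in> nb t'" "x \<in> nb b'" for x
    using unit_nb(3)[OF t'(1) that(1)] unit_nb(3)[OF b'(1) that(2)] by (simp add: norm_mult)
  have "y \<in> nb b' \<and> z \<in> nb b'"
  proof (rule ccontr)
    assume no: "\<not> (y \<in> nb b' \<and> z \<in> nb b')"
    have one: False if i: "nb t' \<inter> nb b' = {t, b, x}" and x: "x \<noteq> t" "x \<noteq> b" for x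
    proof -
      have "a t' t * cnj (a b' t) + a t' b * cnj (a b' b) + a t' x * cnj (a b' x) = 0"
        by (rule orth3[OF t'(1) degree[OF t'(1)] b'(1) _ i]) (use ne x tb in auto)
      then have "2 * k = - (a t' x * cnj (a b' x))" unfolding contrib by (simp add: eq_neg_iff_add_eq_0)
      then have "cmod (2 * k) = cmod (a t' x * cnj (a b' x))" by simp
      then show False using unitk[of x] i k1 by (auto simp: norm_mult)
    qed
    consider "y \<in> nb b'" "z \<notin> nb b'" | "y \<notin> nb b'" "z \<in> nb b'" | "y \<notin> nb b'" "z \<notin> nb b'" using no by blast
    then show False
    proof cases
      case 1
      then have "nb t' \<inter> nb b' = {t, b, y}" using nbt' b' by auto
      then show False using one[of y] yz by auto
    next
      case 2
      then have "nb t' \<inter> nb b' = {t, b, z}" using nbt' b' by auto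
      then show False using one[of z] yz by auto
    next
      case 3
      then have i: "nb t' \<inter> nb b' = {t, b}" using nbt' b' by auto
      have "a t' t * cnj (a b' t) + a t' b * cnj (a b' b) = 0"
        by (rule orth2[OF t'(1) degree[OF t'(1)] b'(1) _ i]) (use ne tb in auto)
      then show False unfolding contrib using k1 by auto
    qed
  qed
  then have yzb: "y \<in> nb b'" "z \<in> nb b'" by auto
  have nbb': "nb b' = {t, b, y, z}"
    by (rule card4_four[OF degree[OF b'(1)] b'(2,3) yzb]) (use tb yz in auto)
  have i: "nb t' \<inter> nb b' = {t, b, y, z}" using nbt' nbb' by auto
  have "a t' t * cnj (a b' t) + a t' b * cnj (a b' b) + a t' y * cnj (a b' y) + a t' z * cnj (a b' z) = 0"
    by (rule orth4[OF t'(1) degree[OF t'(1)] b'(1) _ i]) (use ne tb yz in auto)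
  then have s: "2 * k + a t' y * cnj (a b' y) + a t' z * cnj (a b' z) = 0" unfolding contrib by simp
  have yk: "a t' y * cnj (a b' y) = - k" "a t' z * cnj (a b' z) = - k"
    using unit_sum_double[OF unitk unitk k1 s] nbt' yzb by auto
  have inv: "a b' x = cnj (a t' x * cnj (a b' x)) * a t' x" if "x \<in> nb t'" for x
    using unit_nb(2)[OF t'(1) that] by (simp add: mult_ac)
  have "good t' b' {t, b} {y, z}"
    unfolding good_def
  proof (intro conjI exI[of _ "cnj k"] ballI)
    fix x assume "x \<in> {t, b}"
    then show "a b' x = cnj k * a t' x" using inv[of x] contrib t' by (metis insert_iff singletonD)
  next
    fix x assume "x \<in> {y, z}"
    then have x: "a t' x * cnj (a b' x) = - k" "x \<in> nb t'" using yk nbt' by auto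
    show "a b' x = - (cnj k * a t' x)" using inv[OF x(2)] unfolding x(1) by simp
  qed (use t' b' ne nbt' nbb' tb yz in auto)
  then show ?thesis using yz by blast
qed

text \<open>The ratios \<open>r\<close> on the four common neighbours cancel in pairs. If they take
  only two values, the given twins already form a level. Otherwise the four columns have the same
  neighbourhood, and one of \<open>u\<close>, \<open>v\<close> forms a level together with another
  vertex of it.\<close>

lemma good_of_twins:
  assumes uv: "u < n" "v < n" "u \<noteq> v" "nb u = nb v"
  shows "\<exists>t b x y z w. good t b {x, y} {z, w} \<and> x \<noteq> y \<and> z \<noteq> w"
proof -
  define r where "r j = a v j * cnj (a u j)" for j
  have rj: "cmod (r j) = 1" "a v j = r j * a u j" "r j * cnj (r j) = 1" if "j \<in> nb u" for j
  proof -
    have "j \<in> nb v" using that uv by simp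
    then show "cmod (r j) = 1" using unit_nb(3)[OF uv(1) that] unit_nb(3)[OF uv(2)]
        by (simp add: r_def norm_mult)
    then show "r j * cnj (r j) = 1" by (rule unit_cnj)
    show "a v j = r j * a u j" using unit_nb(2)[OF uv(1) that] by (simp add: r_def mult.assoc)
  qed
  have "\<exists>x x' y y'. nb u = {x, x', y, y'} \<and> distinct [x, x', y, y'] \<and> r x + r x' = 0 \<and> r y + r y' = 0"
  proof -
    obtain x where "x \<in> nb u" using degree[OF uv(1)] by fastforce
    then obtain y z w where nbu: "nb u = {x, y, z, w}" and ne: "x \<noteq> y" "x \<noteq> z" "x \<noteq> w" "y \<noteq> z" "y \<noteq> w" "z \<noteq> w"
      using card4_one[OF degree[OF uv(1)]] by metis
    have i: "nb v \<inter> nb u = {x, y, z, w}" using nbu uv by auto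
    have o: "r x + r y + r z + r w = 0"
      unfolding r_def by (rule orth4[OF uv(2) degree[OF uv(2)] uv(1,3) i]) (use ne in auto)
    have "r x + r y = 0 \<or> r x + r z = 0 \<or> r x + r w = 0"
      by (rule unit_sum4[OF _ _ _ _ o]; rule rj(1)) (simp_all add: nbu)
    then show ?thesis
    proof (elim disjE)
      assume e: "r x + r y = 0"
      then have "r z + r w = 0" using o by Groebner_Basis.algebra
      then show ?thesis using e nbu ne
          by - (rule exI[of _ x], rule exI[of _ y], rule exI[of _ z], rule exI[of _ w], auto)
    next
      assume e: "r x + r z = 0"
      then have "r y + r w = 0" using o by Groebner_Basis.algebra
      then show ?thesis using e nbu ne
          by - (rule exI[of _ x], rule exI[of _ z], rule exI[of _ y], rule exI[of _ w], auto)
    next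
      assume e: "r x + r w = 0"
      then have "r y + r z = 0" using o by Groebner_Basis.algebra
      then show ?thesis using e nbu ne
          by - (rule exI[of _ x], rule exI[of _ w], rule exI[of _ y], rule exI[of _ z], auto)
    qed
  qed
  then obtain x x' y y' where nbu: "nb u = {x, x', y, y'}"
      and ne: "x \<noteq> x'" "x \<noteq> y" "x \<noteq> y'" "x' \<noteq> y" "x' \<noteq> y'" "y \<noteq> y'"
    and rx: "r x + r x' = 0" and ry: "r y + r y' = 0" by auto
  have inn: "x \<in> nb u" "x' \<in> nb u" "y \<in> nb u" "y' \<in> nb u" using nbu by auto
  have rx': "r x' = - r x" "r y' = - r y" using rx ry by (simp_all add: eq_neg_iff_add_eq_0 add.commute)
  have lt: "x < n" "x' < n" "y < n" "y' < n" using inn nbD(1) by blast+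
  have in2: "u \<in> nb j" "v \<in> nb j" "j < n" if "j \<in> nb u" for j
      using nbs[OF that uv(1)] nbs[of j v] that uv by auto
  consider "r x = r y" | "r x = - r y" | "r x \<noteq> r y" "r x \<noteq> - r y" by blast
  then show ?thesis
  proof cases
    case 1
    have "good u v {x, y} {x', y'}"
      unfolding good_def using uv nbu ne rj(2)[OF inn(1)] rj(2)[OF inn(2)] rj(2)[OF inn(3)] rj(2)[OF
          inn(4)] rx' 1
      by (intro conjI exI[of _ "r x"]) auto
    then show ?thesis using ne by blast
  next
    case 2
    have "good u v {x, y'} {x', y}"
      unfolding good_def using uv nbu ne rj(2)[OF inn(1)] rj(2)[OF inn(2)] rj(2)[OF inn(3)] rj(2)[OF
          inn(4)] rx' 2
      by (intro conjI exI[of _ "r x"]) auto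
    then show ?thesis using ne by blast
  next
    case 3
    \<comment> \<open>Columns \<open>i\<close>, \<open>j\<close> overlap in more than \<open>{u, v}\<close> unless \<open>r i = - r j\<close>, and in exactly
      three rows only if \<open>r i / r j\<close> is a primitive cube root of unity.\<close>
    have cc: "a i v * cnj (a j v) = cnj (r i) * r j * (a i u * cnj (a j u))" if "i \<in> nb u" "j \<in> nb u" for i j
    proof -
      have "a i v = cnj (a v i)" "a j v = cnj (a v j)" "a i u = cnj (a u i)" "a j u = cnj (a u j)"
        using herm[OF uv(1)] herm[OF uv(2)] in2(3) that by blast+
      then show ?thesis using rj(2)[OF that(1)] rj(2)[OF that(2)] by (simp add: mult_ac)
    qed
    have c1: "cmod (a i u * cnj (a j u)) = 1" if "i \<in> nb u" "j \<in> nb u" for i j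
      using unit_nb(3)[OF in2(3)[OF that(1)] in2(1)[OF that(1)]] unit_nb(3)[OF in2(3)[OF that(2)]
          in2(1)[OF that(2)]]
      by (simp add: norm_mult)
    have ge3: "nb i \<inter> nb j \<noteq> {u, v}" if ij: "i \<in> nb u" "j \<in> nb u" "i \<noteq> j" "r i \<noteq> - r j" for i j
    proof
      assume i: "nb i \<inter> nb j = {u, v}"
      have "a i u * cnj (a j u) + a i v * cnj (a j v) = 0"
        by (rule orth2[OF in2(3)[OF ij(1)] degree[OF in2(3)[OF ij(1)]] in2(3)[OF ij(2)] _ i uv(3)]) (use
            ij in auto)
      then have "(1 + cnj (r i) * r j) * (a i u * cnj (a j u)) = 0" unfolding cc[OF ij(1,2)]
          by (simp add: algebra_simps)
      moreover have "a i u * cnj (a j u) \<noteq> 0" using c1[OF ij(1,2)] by auto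
      ultimately have "1 + cnj (r i) * r j = 0" by simp
      then have "r i + r j = 0" using rj(3)[OF ij(1)] by Groebner_Basis.algebra
      then show False using ij(4) by (simp add: eq_neg_iff_add_eq_0)
    qed
    have eq3: "(r i)\<^sup>2 + r i * r j + (r j)\<^sup>2 = 0"
      if ij: "i \<in> nb u" "j \<in> nb u" "i \<noteq> j" and i: "nb i \<inter> nb j = {u, v, w}" "w \<noteq> u" "w \<noteq> v" for i j w
    proof -
      have o: "a i u * cnj (a j u) + a i v * cnj (a j v) + a i w * cnj (a j w) = 0"
        by (rule orth3[OF in2(3)[OF ij(1)] degree[OF in2(3)[OF ij(1)]] in2(3)[OF ij(2)] _ i(1) uv(3)])
            (use ij i in auto)
      have "w \<in> nb i" "w \<in> nb j" using i by auto
      then have w1: "cmod (a i w * cnj (a j w)) = 1"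
        using unit_nb(3)[OF in2(3)[OF ij(1)]] unit_nb(3)[OF in2(3)[OF ij(2)]] by (simp add: norm_mult)
      have v1: "cmod (a i v * cnj (a j v)) = 1" unfolding cc[OF ij(1,2)]
        using c1[OF ij(1,2)] rj(1)[OF ij(1)] rj(1)[OF ij(2)] by (simp add: norm_mult)
      define k where "k = a i u * cnj (a j u)"
      have "k\<^sup>2 + k * (a i v * cnj (a j v)) + (a i v * cnj (a j v))\<^sup>2 = 0"
        using unit_sum3(1)[OF c1[OF ij(1,2)] v1 w1 o] by (simp add: k_def)
      then have "k\<^sup>2 * (1 + cnj (r i) * r j + (cnj (r i) * r j)\<^sup>2) = 0"
        unfolding cc[OF ij(1,2)] k_def[symmetric] by (simp add: algebra_simps power2_eq_square)
      moreover have "k \<noteq> 0" using c1[OF ij(1,2)] by (auto simp: k_def)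
      ultimately have "1 + cnj (r i) * r j + (cnj (r i) * r j)\<^sup>2 = 0" by simp
      then show ?thesis using rj(3)[OF ij(1)] by Groebner_Basis.algebra
    qed
    have r0: "r i \<noteq> 0" if "i \<in> nb u" for i using rj(1)[OF that] by auto
    have sub4: "nb i = nb j"
      if ij: "i \<in> nb u" "j \<in> nb u" "i \<noteq> j" "r i \<noteq> - r j" and nc: "(r i)\<^sup>2 + r i * r j + (r j)\<^sup>2 \<noteq> 0" for i j
    proof -
      obtain p q where nbi: "nb i = {u, v, p, q}" and pq: "u \<noteq> p" "v \<noteq> p" "u \<noteq> q" "v \<noteq> q" "p \<noteq> q"
        using card4_two[OF degree[OF in2(3)[OF ij(1)]] in2(1,2)[OF ij(1)] uv(3)] by metis
      note uvj = in2(1,2)[OF ij(2)]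
      have "p \<in> nb j \<and> q \<in> nb j"
      proof (rule ccontr)
        assume "\<not> (p \<in> nb j \<and> q \<in> nb j)"
        then consider "p \<in> nb j" "q \<notin> nb j" | "p \<notin> nb j" "q \<in> nb j" | "p \<notin> nb j" "q \<notin> nb j" by blast
        then show False
        proof cases
          case 1 then have "nb i \<inter> nb j = {u, v, p}" using nbi uvj by auto
          then show False using eq3[OF ij(1-3)] nc pq by metis
        next
          case 2 then have "nb i \<inter> nb j = {u, v, q}" using nbi uvj by auto
          then show False using eq3[OF ij(1-3)] nc pq by metis
        next
          case 3 then have "nb i \<inter> nb j = {u, v}" using nbi uvj by auto
          then show False using ge3[OF ij] by blast
        qed
      qed
      then have "nb j = {u, v, p, q}"
        by (intro card4_four[OF degree[OF in2(3)[OF ij(2)]] uvj]) (use uv pq in auto)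
      then show ?thesis using nbi by simp
    qed
    \<comment> \<open>The columns \<open>x\<close> and \<open>x'\<close> have opposite ratios, so
      their contributions at \<open>u\<close> and \<open>v\<close> cancel. A single further common
      neighbour is then impossible, and having none is excluded by \<open>ge3\<close>, since
      \<open>x'\<close> has the same neighbours as \<open>z'\<close>. So all four columns have the
      neighbourhood {u, v, p, q}.\<close>
    have main: ?thesis if Y: "nb x = nb z" "nb x' = nb z'" "z = y \<and> z' = y' \<or> z = y' \<and> z' = y" for z z'
    proof -
      have zz: "z \<in> nb u" "z' \<in> nb u" "x \<noteq> z" "x \<noteq> z'" "x' \<noteq> z" "x' \<noteq> z'" "z \<noteq> z'"
        "r z' = - r z" "r x \<noteq> r z" "r x \<noteq> - r z" "nb u = {x, x', z, z'}"
        using Y(3) inn ne rx' 3 nbu by auto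
      obtain p q where nbx: "nb x = {u, v, p, q}" and pq: "u \<noteq> p" "v \<noteq> p" "u \<noteq> q" "v \<noteq> q" "p \<noteq> q"
        using card4_two[OF degree[OF lt(1)] in2(1,2)[OF inn(1)] uv(3)] by metis
      have "r x \<noteq> - r z'" using zz by simp
      then have "nb x \<inter> nb x' \<noteq> {u, v}" using ge3[OF inn(1) zz(2,4)] Y(2) by simp
      then obtain s where s: "s \<in> nb x" "s \<in> nb x'" "s \<noteq> u" "s \<noteq> v"
        using in2[OF inn(1)] in2[OF inn(2)] by blast
      have k0: "a x u * cnj (a x' u) + a x v * cnj (a x' v) = 0"
        unfolding cc[OF inn(1,2)] rx' using rj(3)[OF inn(1)] by (simp add: mult.commute)
      have "nb x = nb x'"
      proof (rule ccontr)
        assume ns: "nb x \<noteq> nb x'"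
        obtain s' where nbx': "nb x = {u, v, s, s'}" and s': "u \<noteq> s'" "v \<noteq> s'" "s \<noteq> s'"
          using card4_three[OF degree[OF lt(1)] in2(1,2)[OF inn(1)] s(1) uv(3) s(3,4)[symmetric]] by metis
        have "s' \<notin> nb x'"
        proof
          assume "s' \<in> nb x'"
          then have "nb x' = {u, v, s, s'}"
            by (intro card4_four[OF degree[OF lt(2)] in2(1,2)[OF inn(2)] s(2)]) (use uv s s' in auto)
          then show False using ns nbx' by simp
        qed
        then have "nb x \<inter> nb x' = {u, v, s}" using nbx' s in2(1,2)[OF inn(2)] by auto
        then have "a x u * cnj (a x' u) + a x v * cnj (a x' v) + a x s * cnj (a x' s) = 0"
          by (intro orth3[OF lt(1) degree[OF lt(1)] lt(2)]) (use ne uv s in auto)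
        then have "a x s * cnj (a x' s) = 0" unfolding k0 by simp
        then show False using nbD(2) s by auto
      qed
      then have all: "nb j = {u, v, p, q}" if "j \<in> nb u" for j using that zz(11) Y nbx by auto
      have p: "p < n" "x \<in> nb p" "x' \<in> nb p" "z \<in> nb p" "z' \<in> nb p"
        using nbs[of p] all[OF inn(1)] all[OF inn(2)] all[OF zz(1)] all[OF zz(2)] lt in2(3)[OF zz(1)]
            in2(3)[OF zz(2)] by auto
      have nbp: "nb p = {x, x', z, z'}"
        by (rule card4_four[OF degree[OF p(1)] p(2-5)]) (use zz ne in auto)
      \<comment> \<open>Row \<open>p\<close> is compared with rows \<open>u\<close> and
        \<open>v\<close> on the same four columns. Depending on how the ratios cancel,
        \<open>p\<close> forms a level with \<open>v\<close> or with \<open>u\<close>.\<close>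
      define R where "R j = a p j * cnj (a u j)" for j
      have Rj: "cmod (R j) = 1" "a p j = R j * a u j" if "j \<in> nb u" for j
      proof -
        have "j \<in> nb p" using that zz(11) nbp by simp
        then show "cmod (R j) = 1" using unit_nb(3)[OF uv(1) that] unit_nb(3)[OF p(1)]
            by (simp add: R_def norm_mult)
        show "a p j = R j * a u j" using unit_nb(2)[OF uv(1) that] by (simp add: R_def mult.assoc)
      qed
      have iu: "nb p \<inter> nb u = {x, x', z, z'}" and iv: "nb p \<inter> nb v = {x, x', z, z'}" using nbp zz(11) uv
          by auto
      have ou: "R x + R x' + R z + R z' = 0"
        unfolding R_def by (rule orth4[OF p(1) degree[OF p(1)] uv(1) pq(1) iu]) (use zz ne in auto)
      have "a p x * cnj (a v x) + a p x' * cnj (a v x') + a p z * cnj (a v z) + a p z' * cnj (a v z') = 0"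
        by (rule orth4[OF p(1) degree[OF p(1)] uv(2) pq(2) iv]) (use zz ne in auto)
      moreover have "a p j * cnj (a v j) = R j * cnj (r j)" if "j \<in> nb u" for j
        using rj(2)[OF that] unit_nb(1)[OF uv(1) that] by (simp add: R_def mult_ac)
      ultimately have ov: "R x * cnj (r x) - R x' * cnj (r x) + R z * cnj (r z) - R z' * cnj (r z) = 0"
        using zz inn rx' by simp
      have rcz: "cnj (r x) - cnj (r z) \<noteq> 0" "cnj (r x) + cnj (r z) \<noteq> 0"
        using zz(9,10) by (auto simp flip: complex_cnj_diff complex_cnj_add simp: eq_neg_iff_add_eq_0)
      have "R x + R x' = 0 \<or> R x + R z = 0 \<or> R x + R z' = 0"
        by (rule unit_sum4[OF _ _ _ _ ou]) (use Rj inn zz in auto)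
      then consider "R x + R x' = 0" | "R x' = R x" "R z = - R x" "R z' = - R x"
      proof (elim disjE)
        assume e: "R x + R z = 0"
        have "(R x - R x') * (cnj (r x) - cnj (r z)) = 0" using e ou ov by Groebner_Basis.algebra
        then have f: "R x' = R x" using rcz by simp
        moreover have "R z = - R x" using e by (simp add: eq_neg_iff_add_eq_0 add.commute)
        moreover have "R z' = - R x" using e f ou by (simp add: eq_neg_iff_add_eq_0) Groebner_Basis.algebra
        ultimately show ?thesis using that by blast
      next
        assume e: "R x + R z' = 0"
        have "(R x - R x') * (cnj (r x) + cnj (r z)) = 0" using e ou ov by Groebner_Basis.algebra
        then have f: "R x' = R x" using rcz by simp
        moreover have "R z' = - R x" using e by (simp add: eq_neg_iff_add_eq_0 add.commute)
        moreover have "R z = - R x" using e f ou by (simp add: eq_neg_iff_add_eq_0) Groebner_Basis.algebra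
        ultimately show ?thesis using that by blast
      qed (use that in blast)
      then show ?thesis
      proof cases
        case 1
        have e: "R z + R z' = 0" using 1 ou by Groebner_Basis.algebra
        have "2 * (R x * cnj (r x) + R z * cnj (r z)) = 0" using 1 e ov by Groebner_Basis.algebra
        then have f: "R x * cnj (r x) + R z * cnj (r z) = 0" by (simp only: mult_eq_0_iff) simp
        define k where "k = R x * cnj (r x)"
        have pvj: "a p j = R j * cnj (r j) * a v j" if "j \<in> nb u" for j
          using Rj(2)[OF that] rj(2,3)[OF that] by (simp add: mult_ac)
        have kk: "R x * cnj (r x) = k" "R x' * cnj (r x') = k" "R z * cnj (r z) = - k"
            "R z' * cnj (r z') = - k"
        proof -
          have R': "R x' = - R x" "R z' = - R z" using 1 e by (simp_all add: eq_neg_iff_add_eq_0 add.commute)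
          show "R x * cnj (r x) = k" by (simp add: k_def)
          show "R x' * cnj (r x') = k" by (simp add: k_def R' rx')
          show f': "R z * cnj (r z) = - k" using f by (simp add: k_def eq_neg_iff_add_eq_0 add.commute)
          show "R z' * cnj (r z') = - k" using f' by (simp add: R' zz)
        qed
        have "good v p {x, x'} {z, z'}"
          unfolding good_def using uv p pq nbp zz(11) ne zz pvj[OF inn(1)] pvj[OF inn(2)] pvj[OF zz(1)]
              pvj[OF zz(2)] kk
          by (intro conjI exI[of _ k]) auto
        then show ?thesis using ne zz by blast
      next
        case 2
        have "good u p {x, x'} {z, z'}"
          unfolding good_def using uv p pq nbp zz(11) ne zz Rj(2)[OF inn(1)] Rj(2)[OF inn(2)] Rj(2)[OF
              zz(1)] Rj(2)[OF zz(2)] 2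
          by (intro conjI exI[of _ "R x"]) auto
        then show ?thesis using ne zz by blast
      qed
    qed
    show ?thesis
    proof (cases "(r x)\<^sup>2 + r x * r y + (r y)\<^sup>2 = 0")
      case False
      have "nb x = nb y" by (rule sub4[OF inn(1,3) ne(2) 3(2) False])
      moreover have "- r x \<noteq> r y" using 3(2) by (metis minus_minus)
      then have "nb x' = nb y'" by (intro sub4[OF inn(2,4) ne(5)]) (use False in \<open>simp_all add: rx'\<close>)
      ultimately show ?thesis using main by blast
    next
      case True
      have n': "(r x)\<^sup>2 - r x * r y + (r y)\<^sup>2 \<noteq> 0"
      proof
        assume "(r x)\<^sup>2 - r x * r y + (r y)\<^sup>2 = 0"
        then have "2 * (r x * r y) = 0" using True by Groebner_Basis.algebra
        then show False using r0 inn by simp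
      qed
      have "nb x = nb y'" by (rule sub4[OF inn(1,4) ne(3)]) (use 3 rx' n' in auto)
      moreover have "nb x' = nb y" by (rule sub4[OF inn(2,3) ne(4)]) (use 3 rx' n' in auto)
      ultimately show ?thesis using main by blast
    qed
  qed
qed

end

text \<open>The common form of the two tessellations, with twist 1 or omega. Vertices are numbered
  from 1, as in \<open>T_omega_graph\<close>; \<open>T_graph\<close> differs by a shift.\<close>

fun T_twisted :: "complex \<Rightarrow> int \<Rightarrow> tb_vertex \<Rightarrow> tb_vertex \<Rightarrow> complex" where
  "T_twisted z k (Vt i) (Vt j) = (if i < k \<and> j = i + 1 then 1 else if i = k \<and> j = 1 then z else 0)"
| "T_twisted z k (Vt i) (Vb j) = (if i < k \<and> j = i + 1 then 1 else if i = k \<and> j = 1 then z else 0)"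
| "T_twisted z k (Vb i) (Vt j) = (if i < k \<and> j = i + 1 then -1 else if i = k \<and> j = 1 then - z else 0)"
| "T_twisted z k (Vb i) (Vb j) = (if i < k \<and> j = i + 1 then -1 else if i = k \<and> j = 1 then - z else 0)"

definition T_vertices :: "int \<Rightarrow> tb_vertex set" where
  "T_vertices k = Vt ` {1..k} \<union> Vb ` {1..k}"

lemma T_omega_listed_eq: "T_omega_listed k = T_twisted omega k"
proof (intro ext)
  fix x y show "T_omega_listed k x y = T_twisted omega k x y"
    by (cases x; cases y) simp_all
qed

text \<open>From k = 3 on, the level after a given one differs from the level before it.\<close>

lemma T_twisted_asym:
  assumes "k \<ge> 3" "x \<in> T_vertices k" "y \<in> T_vertices k" "T_twisted z k x y \<noteq> 0"
  shows "T_twisted z k y x = 0"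
  using assms by (cases x; cases y) (auto simp: T_vertices_def split: if_splits)

lemma T_twisted_degree:
  assumes k: "k \<ge> 3" and x: "x \<in> T_vertices k" and z: "z \<noteq> 0"
  shows "card {y \<in> T_vertices k. T_twisted z k x y \<noteq> 0 \<or> T_twisted z k y x \<noteq> 0} = 4"
proof -
  obtain i where i: "x = Vt i \<or> x = Vb i" "1 \<le> i" "i \<le> k" using x by (auto simp: T_vertices_def)
  define s where "s = (if i = k then 1 else i + 1)"
  define p where "p = (if i = 1 then k else i - 1)"
  have sp: "s \<noteq> p" "1 \<le> s" "s \<le> k" "1 \<le> p" "p \<le> k" using i k by (auto simp: s_def p_def)
  have "{y \<in> T_vertices k. T_twisted z k x y \<noteq> 0 \<or> T_twisted z k y x \<noteq> 0} = {Vt s, Vb s, Vt p, Vb p}"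
  proof (rule Set.set_eqI)
    fix y
    have adj: "T_twisted z k x y \<noteq> 0 \<longleftrightarrow> j = s" "T_twisted z k y x \<noteq> 0 \<longleftrightarrow> j = p"
      if "y = Vt j \<or> y = Vb j" "1 \<le> j" "j \<le> k" for j
      using i that z k by (auto simp: s_def p_def split: if_splits)
    show "y \<in> {y \<in> T_vertices k. T_twisted z k x y \<noteq> 0 \<or> T_twisted z k y x \<noteq> 0} \<longleftrightarrow> y \<in> {Vt s, Vb s, Vt p,
        Vb p}"
    proof (cases y)
      case (Vt j)
      then show ?thesis using adj[of j] sp by (auto simp: T_vertices_def)
    next
      case (Vb j)
      then show ?thesis using adj[of j] sp by (auto simp: T_vertices_def)
    qed
  qed
  then show ?thesis using sp by simp
qed

lemma T_twisted_values: "T_twisted z k x y \<in> {0, 1, -1, z, - z}"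
  by (cases x; cases y) auto

section \<open>Recovering a twisted tessellation from twins\<close>

context unit_form
begin

text \<open>A numbering \<open>g\<close>, a switching \<open>d\<close> and a twist \<open>z\<close>
  that match the listed edges; by \<open>graph_equiv\<close> the other entries follow.\<close>

definition T_data :: "int \<Rightarrow> (tb_vertex \<Rightarrow> nat) \<Rightarrow> (tb_vertex \<Rightarrow> complex) \<Rightarrow> complex \<Rightarrow> bool" where
  "T_data k g d z \<longleftrightarrow> k \<ge> 3 \<and> bij_betw g (T_vertices k) {..<n} \<and> z \<in> Z_omega \<and> cmod z = 1 \<and>
     (\<forall>x \<in> T_vertices k. d x \<in> Z_omega \<and> cmod (d x) = 1) \<and>
     (\<forall>x \<in> T_vertices k. \<forall>y \<in> T_vertices k. T_twisted z k x y \<noteq> 0 \<longrightarrow>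
        a (g x) (g y) = d x * T_twisted z k x y * cnj (d y))"

lemma T_data_weights:
  assumes A: "A \<in> R_mat n" "\<And>i j. i < n \<Longrightarrow> j < n \<Longrightarrow> A $$ (i, j) = a i j" and T: "T_data k g d z"
  shows "x \<in> T_vertices k \<Longrightarrow> y \<in> T_vertices k \<Longrightarrow> a (g x) (g y) = d x * hermitian_weight (T_twisted z k) x y
      * cnj (d y)"
    and "equivalent_to_graph A (T_vertices k, hermitian_weight (T_twisted z k))"
proof -
  have k: "k \<ge> 3" and g: "bij_betw g (T_vertices k) {..<n}" and z: "z \<in> Z_omega" "z \<noteq> 0"
    and d: "\<And>x. x \<in> T_vertices k \<Longrightarrow> d x \<in> Z_omega" "\<And>x. x \<in> T_vertices k \<Longrightarrow> cmod (d x) = 1"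
    and E: "\<And>x y. x \<in> T_vertices k \<Longrightarrow> y \<in> T_vertices k \<Longrightarrow> T_twisted z k x y \<noteq> 0 \<Longrightarrow>
        a (g x) (g y) = d x * T_twisted z k x y * cnj (d y)"
    using T unfolding T_data_def by auto
  have fin: "finite (T_vertices k)" by (simp add: T_vertices_def)
  have vals: "T_twisted z k x y \<in> Z_omega" for x y
    using T_twisted_values[of z k x y] z Z_omega_unary(1)[OF z(1)] by auto
  note ge = graph_equiv[OF A fin g T_twisted_asym[OF k] T_twisted_degree[OF k _ z(2)] vals d E]
  show "x \<in> T_vertices k \<Longrightarrow> y \<in> T_vertices k \<Longrightarrow> a (g x) (g y) = d x * hermitian_weight (T_twisted z k) x y
      * cnj (d y)"
    by (rule ge(1))
  show "equivalent_to_graph A (T_vertices k, hermitian_weight (T_twisted z k))"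
    by (rule ge(2))
qed

text \<open>Exchanging \<open>t\<^sub>1\<close> and \<open>b\<^sub>1\<close> with a change of both signs replaces the twist by its negative.\<close>

lemma T_data_minus:
  assumes T: "T_data k g d z"
  shows "\<exists>g' d'. T_data k g' d' (- z)"
proof -
  define sw where "sw = (\<lambda>x. if x = Vt 1 then Vb 1 else if x = Vb 1 then Vt 1 else x)"
  define s where "s = (\<lambda>x. if x = Vt 1 \<or> x = Vb 1 then - 1 else 1 :: complex)"
  have k: "k \<ge> 3" using T by (simp add: T_data_def)
  have sw: "sw x \<in> T_vertices k" if "x \<in> T_vertices k" for x
    using that k by (auto simp: sw_def T_vertices_def)
  have sw2: "sw (sw x) = x" for x by (simp add: sw_def)
  have "bij_betw sw (T_vertices k) (T_vertices k)"
    by (rule bij_betw_byWitness[of _ sw]) (use sw sw2 in auto)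
  then have bij: "bij_betw (g \<circ> sw) (T_vertices k) {..<n}"
    using T by (auto simp: T_data_def intro: bij_betw_trans)
  have tw: "T_twisted z k (sw x) (sw y) = s x * T_twisted (- z) k x y * cnj (s y)"
    if "x \<in> T_vertices k" "y \<in> T_vertices k" for x y
    using that k by (cases x; cases y) (auto simp: sw_def s_def T_vertices_def)
  have s: "s x \<in> Z_omega" "cmod (s x) = 1" "s x \<noteq> 0" for x by (auto simp: s_def)
  have "T_data k (g \<circ> sw) (\<lambda>x. d (sw x) * s x) (- z)"
    unfolding T_data_def
  proof (intro conjI ballI impI)
    fix x y assume xy: "x \<in> T_vertices k" "y \<in> T_vertices k" "T_twisted (- z) k x y \<noteq> 0"
    then have "T_twisted z k (sw x) (sw y) \<noteq> 0" using tw s by simp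
    then have "a (g (sw x)) (g (sw y)) = d (sw x) * T_twisted z k (sw x) (sw y) * cnj (d (sw y))"
      using T sw xy unfolding T_data_def by blast
    then show "a ((g \<circ> sw) x) ((g \<circ> sw) y) = d (sw x) * s x * T_twisted (- z) k x y * cnj (d (sw y) * s y)"
      unfolding tw[OF xy(1,2)] by (simp add: mult_ac)
  qed (use T sw s bij in \<open>auto simp: T_data_def norm_mult intro!: Z_omega_algebra(3) Z_omega_unary(1)\<close>)
  then show ?thesis by blast
qed

text \<open>Of the six possible twists, \<open>T_data_minus\<close> leaves 1, omega and 1 - omega.
  The last is the conjugate of omega and is handled by conjugating all entries.\<close>

lemma T_data_final:
  assumes A: "A \<in> R_mat n" "\<And>i j. i < n \<Longrightarrow> j < n \<Longrightarrow> A $$ (i, j) = a i j" and T: "T_data k g d z"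
  shows "equivalent_to_graph A (T_graph k) \<or> equivalent_to_graph A (T_omega_graph k)"
proof -
  have z: "z \<in> {1, omega, omega - 1, - 1, - omega, 1 - omega}"
    using T Z_omega_units unfolding T_data_def by blast
  have Tom: "T_omega_graph k = (T_vertices k, hermitian_weight (T_twisted omega k))"
    by (simp add: T_omega_graph_def T_vertices_def T_omega_listed_eq)
  have one: "equivalent_to_graph A (T_graph k)" if T: "T_data k g d 1" for g d
  proof -
    \<comment> \<open>The vertices of \<open>T_graph\<close> are numbered from 0.\<close>
    define h where "h = (\<lambda>x. case x of Vt i \<Rightarrow> Vt (i + 1) | Vb i \<Rightarrow> Vb (i + 1))"
    define V where "V = Vt ` {0..<k} \<union> Vb ` {0..<k}"
    have k: "k \<ge> 3" and g: "bij_betw g (T_vertices k) {..<n}"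
      and d: "\<And>x. x \<in> T_vertices k \<Longrightarrow> d x \<in> Z_omega" "\<And>x. x \<in> T_vertices k \<Longrightarrow> cmod (d x) = 1"
      using T unfolding T_data_def by auto
    have hV: "h x \<in> T_vertices k" if "x \<in> V" for x using that by (auto simp: h_def V_def T_vertices_def)
    have "bij_betw h V (T_vertices k)"
      by (rule bij_betw_byWitness[of _ "\<lambda>x. case x of Vt i \<Rightarrow> Vt (i - 1) | Vb i \<Rightarrow> Vb (i - 1)"])
        (auto simp: h_def V_def T_vertices_def)
    then have gh: "bij_betw (g \<circ> h) V {..<n}" using g by (rule bij_betw_trans)
    have md: "j = (i + 1) mod k \<longleftrightarrow> (i + 1 < k \<and> j = i + 1) \<or> (i + 1 = k \<and> j = 0)"
      if "0 \<le> i" "i < k" for i j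
      using that by (cases "i + 1 = k") auto
    have tl: "T_listed k x y = T_twisted 1 k (h x) (h y)" if "x \<in> V" "y \<in> V" for x y
      using that by (cases x; cases y) (auto simp: h_def V_def md)
    have hw: "hermitian_weight (T_listed k) x y = hermitian_weight (T_twisted 1 k) (h x) (h y)"
        if "x \<in> V" "y \<in> V" for x y
      using that by (simp add: hermitian_weight_def tl)
    have vals: "hermitian_weight (T_twisted 1 k) x y \<in> Z_omega" for x y
      using T_twisted_values[of 1 k x y] T_twisted_values[of 1 k y x] by (auto simp: hermitian_weight_def)
    have "equivalent_to_graph A (V, hermitian_weight (T_listed k))"
    proof (rule equivalent_to_graph_intro[OF A(1) gh, of _ "d \<circ> h" id])
      fix x y assume xy: "x \<in> V" "y \<in> V"
      have "A $$ (g (h x), g (h y)) = a (g (h x)) (g (h y))"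
        using A(2) bij_betwE[OF g] hV xy by auto
      also have "\<dots> = d (h x) * hermitian_weight (T_twisted 1 k) (h x) (h y) * cnj (d (h y))"
        by (rule T_data_weights(1)[OF A T]) (use hV xy in auto)
      finally show "A $$ ((g \<circ> h) x, (g \<circ> h) y) = id ((d \<circ> h) x * hermitian_weight (T_listed k) x y * cnj
          ((d \<circ> h) y))"
        using hw xy by simp
    qed (use d hV hw vals in auto)
    then show ?thesis by (simp add: T_graph_def V_def)
  qed
  have om: "equivalent_to_graph A (T_omega_graph k)" if T: "T_data k g d omega" for g d
    using T_data_weights(2)[OF A T] by (simp add: Tom)
  have cm: "equivalent_to_graph A (T_omega_graph k)" if T: "T_data k g d (1 - omega)" for g d
  proof -
    have k: "k \<ge> 3" and g: "bij_betw g (T_vertices k) {..<n}"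
      and d: "\<And>x. x \<in> T_vertices k \<Longrightarrow> d x \<in> Z_omega" "\<And>x. x \<in> T_vertices k \<Longrightarrow> cmod (d x) = 1"
      using T unfolding T_data_def by auto
    have tl: "T_twisted (1 - omega) k x y = cnj (T_twisted omega k x y)" for x y
      using omega_facts(4) by (cases x; cases y) simp_all
    have hw: "hermitian_weight (T_twisted (1 - omega) k) x y = cnj (hermitian_weight (T_twisted omega k)
        x y)" for x y
      by (simp add: hermitian_weight_def tl)
    have vals: "hermitian_weight (T_twisted omega k) x y \<in> Z_omega" for x y
      using T_twisted_values[of omega k x y] T_twisted_values[of omega k y x] omega_facts(2)
          Z_omega_unary[OF omega_facts(2)]
        Z_omega_unary(2)[OF Z_omega_unary(1)[OF omega_facts(2)]]
      by (auto simp: hermitian_weight_def)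
    have "equivalent_to_graph A (T_vertices k, hermitian_weight (T_twisted omega k))"
    proof (rule equivalent_to_graph_intro[OF A(1) g, of _ "\<lambda>x. cnj (d x)" cnj])
      fix x y assume xy: "x \<in> T_vertices k" "y \<in> T_vertices k"
      have "A $$ (g x, g y) = a (g x) (g y)"
        using A(2) bij_betwE[OF g] xy by auto
      also have "\<dots> = d x * hermitian_weight (T_twisted (1 - omega) k) x y * cnj (d y)"
        by (rule T_data_weights(1)[OF A T]) (use xy in auto)
      finally show "A $$ (g x, g y) = cnj (cnj (d x) * hermitian_weight (T_twisted omega k) x y * cnj
          (cnj (d y)))"
        by (simp add: hw)
    qed (use d vals Z_omega_unary(2) in auto)
    then show ?thesis by (simp add: Tom)
  qed
  from z T_data_minus[OF T] T show ?thesis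
    using one om cm by (elim insertE emptyE exE) auto
qed

text \<open>An infinite walk through the levels, obtained by iterating \<open>good_step\<close>;
  that it returns in a finite graph is used only later.\<close>

lemma good_sequence:
  assumes "good t b {x, y} {z, w}" "x \<noteq> y" "z \<noteq> w"
  shows "\<exists>T B. (\<forall>j. T j \<noteq> B j) \<and>
    (\<forall>j. good (T (Suc j)) (B (Suc j)) {T j, B j} {T (Suc (Suc j)), B (Suc (Suc j))})"
proof -
  \<comment> \<open>A state consists of three consecutive levels; the step number is
    ignored.\<close>
  define P where "P = (\<lambda>(n::nat) (s :: (nat \<times> nat) \<times> (nat \<times> nat) \<times> (nat \<times> nat)).
     case s of ((x, y), (t, b), (z, w)) \<Rightarrow> good t b {x, y} {z, w} \<and> x \<noteq> y \<and> z \<noteq> w)"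
  define Q where "Q = (\<lambda>(n::nat) (s :: (nat \<times> nat) \<times> (nat \<times> nat) \<times> (nat \<times> nat))
     (s' :: (nat \<times> nat) \<times> (nat \<times> nat) \<times> (nat \<times> nat)).
     fst s' = fst (snd s) \<and> fst (snd s') = snd (snd s) )"
  have "\<exists>f. \<forall>j. P j (f j) \<and> Q j (f j) (f (Suc j))"
  proof (rule dependent_nat_choice)
    show "\<exists>s. P 0 s" using assms by (intro exI[of _ "((x, y), (t, b), (z, w))"]) (simp add: P_def)
    fix s j assume s: "P j s"
    obtain x y t b z w where se: "s = ((x, y), (t, b), (z, w))" by (metis prod.collapse)
    have g: "good t b {x, y} {z, w}" "z \<noteq> w" using s by (auto simp: se P_def)
    obtain t'' b'' where "t'' \<noteq> b''" "good z w {t, b} {t'', b''}" using good_step[OF g] by blast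
    moreover have "t \<noteq> b" using g by (simp add: good_def)
    ultimately have "P (Suc j) ((t, b), (z, w), (t'', b''))" by (simp add: P_def)
    then show "\<exists>s'. P (Suc j) s' \<and> Q j s s'"
      by (intro exI[of _ "((t, b), (z, w), (t'', b''))"]) (simp add: Q_def se)
  qed
  then obtain f where f: "\<And>j. P j (f j)" "\<And>j. Q j (f j) (f (Suc j))" by blast
  define T where "T j = fst (fst (f j))" for j
  define B where "B j = snd (fst (f j))" for j
  have e1: "fst (snd (f j)) = (T (Suc j), B (Suc j))" for j using f(2)[of j] by (simp add: Q_def T_def B_def)
  have e2: "snd (snd (f j)) = (T (Suc (Suc j)), B (Suc (Suc j)))" for j
    using f(2)[of j] e1[of "Suc j"] by (simp add: Q_def)
  have "f j = ((T j, B j), (T (Suc j), B (Suc j)), (T (Suc (Suc j)), B (Suc (Suc j))))" for j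
    using e1[of j] e2[of j] by (simp add: T_def B_def prod_eq_iff)
  then have "good (T (Suc j)) (B (Suc j)) {T j, B j} {T (Suc (Suc j)), B (Suc (Suc j))} \<and> T j \<noteq> B j" for j
    using f(1)[of j] by (simp add: P_def)
  then show ?thesis by blast
qed

text \<open>Finiteness makes the walk of levels meet itself, and minimality of the first meeting
  makes it close up into a cycle. Switching along the path of the T j then moves all weights other
  than signs into the closing edges, where they appear as the twist.\<close>

lemma twins_T_data:
  assumes uv: "u < n" "v < n" "u \<noteq> v" "nb u = nb v"
  shows "\<exists>k g d z. T_data k g d z"
proof -
  obtain T B where ne: "\<And>j. T j \<noteq> B j" and
    gd: "\<And>j. good (T (Suc j)) (B (Suc j)) {T j, B j} {T (Suc (Suc j)), B (Suc (Suc j))}"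
    using good_of_twins[OF uv] good_sequence by metis
  define G where "G j = {T j, B j}" for j
  have lt: "x < n" if "x \<in> G (Suc j)" for x j using gd[of j] that by (auto simp: good_def G_def)
  have nbG: "nb x = G j \<union> G (Suc (Suc j))" if "x \<in> G (Suc j)" for x j
    using gd[of j] that by (auto simp: good_def G_def)
  have dis: "G j \<inter> G (Suc (Suc j)) = {}" for j using gd[of j] by (simp add: good_def G_def)
  have cG: "card (G j) = 2" "finite (G j)" "G j \<noteq> {}" for j using ne by (simp_all add: G_def)
  have irr: "G j \<inter> G (Suc j) = {}" for j
  proof (rule ccontr)
    assume "G j \<inter> G (Suc j) \<noteq> {}"
    then obtain x where x: "x \<in> G j" "x \<in> G (Suc j)" by blast
    then have "x \<in> nb x" using nbG[OF x(2)] by blast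
    then show False using nb_irrefl[OF lt[OF x(2)]] by simp
  qed
  \<comment> \<open>Level 0 is left out because neighbourhoods are known only from level 1
    on.\<close>
  define bad where "bad m \<longleftrightarrow> (\<exists>i. 1 \<le> i \<and> i < m \<and> G i \<inter> G m \<noteq> {})" for m
  have "\<exists>m. bad m"
  proof (rule ccontr)
    assume no: "\<not> ?thesis"
    have "inj (\<lambda>j. T (Suc j))"
    proof (rule linorder_injI)
      fix i j :: nat assume "i < j"
      then have "G (Suc i) \<inter> G (Suc j) = {}" using no by (auto simp: bad_def)
      then show "T (Suc i) \<noteq> T (Suc j)" by (auto simp: G_def)
    qed
    moreover have "range (\<lambda>j. T (Suc j)) \<subseteq> {..<n}" using lt by (auto simp: G_def)
    ultimately show False by (meson finite_imageD finite_lessThan finite_subset infinite_UNIV_nat)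
  qed
  then obtain m where m: "bad m" "\<And>l. l < m \<Longrightarrow> \<not> bad l" by (metis exists_least_iff)
  obtain i where i: "1 \<le> i" "i < m" "G i \<inter> G m \<noteq> {}" using m(1) by (auto simp: bad_def)
  have disj: "G i \<inter> G j = {}" if "1 \<le> i" "i < j" "j < m" for i j using m(2)[of j] that by (auto simp: bad_def)
  obtain x where x: "x \<in> G i" "x \<in> G m" using i by blast
  obtain i' where i': "i = Suc i'" using i by (cases i) auto
  obtain m' where m': "m = Suc m'" using i by (cases m) auto
  have "i \<noteq> m'" using irr[of m'] x m' by auto
  moreover have "Suc i \<noteq> m'" using dis[of i] x m' by auto
  ultimately have im: "Suc i < m'" using i m' by simp
  have eqn: "G i' \<union> G (Suc i) = G m' \<union> G (Suc m)"
    using nbG[of x i'] nbG[of x m'] x unfolding i' m' by auto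
  have d1: "G (Suc i) \<inter> G m' = {}" using disj[of "Suc i" m'] im m' by auto
  \<comment> \<open>The level before the first repetition lies in the two levels around the earlier
    one. It is disjoint from every earlier level with positive index, so the level it coincides with
    is level 0.\<close>
  have i'0: "i' = 0"
  proof (rule ccontr)
    assume "i' \<noteq> 0"
    then have "G i' \<inter> G m' = {}" using disj[of i' m'] im m' i' by auto
    then have "G m' = {}" using eqn d1 by blast
    then show False using cG by blast
  qed
  define k where "k = m'"
  have k3: "k \<ge> 3" using im i' i'0 by (simp add: k_def)
  have Gk0: "G k = G 0"
  proof (rule card_seteq)
    show "G k \<subseteq> G 0" using eqn d1 unfolding i'0 k_def by blast
  qed (simp_all add: cG)
  have Gk1: "G (Suc k) = G 1"
  proof -
    define k'' where "k'' = k - 2"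
    have k'': "k = Suc (Suc k'')" using k3 by (simp add: k''_def)
    have "T 0 \<in> G k" unfolding Gk0 by (simp add: G_def)
    then have nT: "nb (T 0) = G (Suc k'') \<union> G (Suc k)" "T 0 < n"
      using nbG[of "T 0" "Suc k''"] lt[of "T 0" "Suc k''"] by (simp_all add: k'')
    have "G 1 \<subseteq> nb (T 0)"
    proof
      fix y assume y: "y \<in> G 1"
      have "T 0 \<in> nb y" using nbG[of y 0] y by (simp add: G_def)
      then show "y \<in> nb (T 0)" using nbs[of "T 0" y] lt[of y 0] y by simp
    qed
    moreover have "G 1 \<inter> G (Suc k'') = {}" using disj[of 1 "Suc k''"] k'' k3 m' by (simp add: k_def)
    ultimately have "G 1 \<subseteq> G (Suc k)" using nT by blast
    then show ?thesis using cG by (intro card_seteq[symmetric]) auto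
  qed
  have disjk: "G i \<inter> G j = {}" if "1 \<le> i" "i < j" "j \<le> k" for i j using disj[OF that(1,2)] that m'
      by (simp add: k_def)
  have cover: "(\<Union>j\<in>{1..k}. G j) = {..<n}"
  proof (rule closed_eq_UNIV)
    show "(\<Union>j\<in>{1..k}. G j) \<subseteq> {..<n}"
    proof
      fix x assume "x \<in> (\<Union>j\<in>{1..k}. G j)"
      then obtain j where "x \<in> G j" "1 \<le> j" by auto
      then show "x \<in> {..<n}" using lt[of x "j - 1"] by simp
    qed
    show "(\<Union>j\<in>{1..k}. G j) \<noteq> {}" using k3 cG(3)[of 1] by auto
    fix x assume "x \<in> (\<Union>j\<in>{1..k}. G j)"
    then obtain j0 where j0: "x \<in> G j0" "1 \<le> j0" "j0 \<le> k" by auto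
    then obtain j where "j0 = Suc j" by (cases j0) auto
    then have j: "x \<in> G (Suc j)" "Suc j \<le> k" using j0 by auto
    have "G j \<subseteq> (\<Union>j\<in>{1..k}. G j)"
      using Gk0 k3 j(2) by (cases "j = 0") force+
    moreover have "G (Suc (Suc j)) \<subseteq> (\<Union>j\<in>{1..k}. G j)"
      using Gk1 k3 j(2) by (cases "Suc j = k") force+
    ultimately show "nb x \<subseteq> (\<Union>j\<in>{1..k}. G j)" using nbG[OF j(1)] by blast
  qed
  have ltT: "T (Suc j) < n" "B (Suc j) < n" for j using lt[of _ j] by (auto simp: G_def)
  have lt0: "T j < n" "B j < n" for j
  proof -
    have "T 0 \<in> G k" "B 0 \<in> G k" unfolding Gk0 by (simp_all add: G_def)
    then have "T 0 < n" "B 0 < n" using lt[of _ "k - 1"] k3 by auto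
    then show "T j < n" "B j < n" using ltT by (cases j; simp)+
  qed
  have adj: "y \<in> nb x \<and> x \<in> nb y" if "x \<in> G j" "y \<in> G (Suc j)" for x y j
  proof -
    have "x \<in> nb y" using nbG[OF that(2)] that by blast
    then show ?thesis using nbs[of x y] lt[OF that(2)] by blast
  qed
  have TG: "T j \<in> G j" "B j \<in> G j" for j by (auto simp: G_def)
  \<comment> \<open>The product of weights along the path of the T j, so that edges from one T j to
    the next get weight 1; \<open>dB\<close> normalises the edge from the preceding T. At j = 0 the
    subtraction truncates, and only the values of \<open>dB\<close> from 1 on are used.\<close>
  define dT where "dT j = (\<Prod>i<j. a (T (Suc i)) (T i))" for j
  define dB where "dB j = a (B j) (T (j - 1)) * dT (j - 1)" for j
  have uT: "cmod (dT j) = 1 \<and> dT j \<in> Z_omega" for j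
  proof (induction j)
    case (Suc j)
    have "T j \<in> nb (T (Suc j))" using adj[OF TG(1) TG(1)] by blast
    then show ?case using Suc unit_nb(3,4)[OF ltT(1)]
      by (auto simp: dT_def norm_mult mult.commute intro!: Z_omega_algebra(3))
  qed (simp add: dT_def)
  have uB: "cmod (dB (Suc j)) = 1 \<and> dB (Suc j) \<in> Z_omega" for j
  proof -
    have "T j \<in> nb (B (Suc j))" using adj[OF TG(1) TG(2)] by blast
    then show ?thesis using uT[of j] unit_nb(3,4)[OF ltT(2)]
      by (auto simp: dB_def norm_mult intro!: Z_omega_algebra(3))
  qed
  have uu: "dT j * cnj (dT j) = 1" "dB (Suc j) * cnj (dB (Suc j)) = 1" for j
    using unit_cnj uT uB by auto
  have dTS: "dT (Suc j) = a (T (Suc j)) (T j) * dT j" and dBS: "dB (Suc j) = a (B (Suc j)) (T j) * dT j" for j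
    by (simp_all add: dT_def dB_def mult.commute)
  have ratio: "(\<forall>x\<in>G j. a (B (Suc j)) x = dB (Suc j) * cnj (dT (Suc j)) * a (T (Suc j)) x) \<and>
    (\<forall>x\<in>G (Suc (Suc j)). a (B (Suc j)) x = - (dB (Suc j) * cnj (dT (Suc j)) * a (T (Suc j)) x))" for j
  proof -
    obtain r where r: "\<forall>x\<in>G j. a (B (Suc j)) x = r * a (T (Suc j)) x"
      "\<forall>x\<in>G (Suc (Suc j)). a (B (Suc j)) x = - (r * a (T (Suc j)) x)"
      using gd[of j] by (auto simp: good_def G_def)
    have "T j \<in> nb (T (Suc j))" using adj[OF TG(1) TG(1)] by blast
    then have U: "a (T (Suc j)) (T j) * cnj (a (T (Suc j)) (T j)) = 1" by (rule unit_nb(1)[OF ltT(1)])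
    have "a (B (Suc j)) (T j) = r * a (T (Suc j)) (T j)" using r(1) TG by blast
    then have "dB (Suc j) * cnj (dT (Suc j)) = r * (a (T (Suc j)) (T j) * cnj (a (T (Suc j)) (T j))) *
        (dT j * cnj (dT j))"
      unfolding dTS dBS by simp
    also have "\<dots> = r" unfolding U uu by simp
    finally show ?thesis using r by simp
  qed
  have eTT: "a (T j) (T (Suc j)) = dT j * cnj (dT (Suc j))" for j
  proof -
    have "a (T j) (T (Suc j)) = cnj (a (T (Suc j)) (T j))" using herm[OF ltT(1) lt0(1)] by blast
    then show ?thesis using uu(1)[of j] by (simp add: dTS mult.left_commute)
  qed
  have eTB: "a (T j) (B (Suc j)) = dT j * cnj (dB (Suc j))" for j
  proof -
    have "a (T j) (B (Suc j)) = cnj (a (B (Suc j)) (T j))" using herm[OF ltT(2) lt0(1)] by blast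
    then show ?thesis using uu(1)[of j] by (simp add: dBS mult.left_commute)
  qed
  have eB: "a (B (Suc j)) x = - (dB (Suc j) * cnj (dT (Suc j)) * a (T (Suc j)) x)"
      if "x \<in> G (Suc (Suc j))" for x j
    using ratio that by blast
  have eBT: "a (B (Suc j)) (T (Suc (Suc j))) = - (dB (Suc j) * cnj (dT (Suc (Suc j))))"
    and eBB: "a (B (Suc j)) (B (Suc (Suc j))) = - (dB (Suc j) * cnj (dB (Suc (Suc j))))" for j
    using uu(1)[of "Suc j"] by (simp_all add: eB[OF TG(1)] eB[OF TG(2)] eTT eTB mult.left_commute[of
        "cnj (dT (Suc j))"])
  obtain k' where k': "k = Suc k'" using k3 by (cases k) auto
  \<comment> \<open>The weight of the closing edge after switching, which is the holonomy around the
    cycle.\<close>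
  define z where "z = a (T k) (T 1) * cnj (dT k) * dT 1"
  have Tk1: "T 1 \<in> G (Suc k)" "B 1 \<in> G (Suc k)" unfolding Gk1 using TG by auto
  have zT: "a (T k) (T 1) = dT k * z * cnj (dT 1)"
    using uu(1)[of k] uu(1)[of 1] unfolding z_def by Groebner_Basis.algebra
  have zB: "a (T k) (B 1) = dT k * z * cnj (dB 1)"
  proof -
    \<comment> \<open>Levels k and 0 agree only as sets, possibly with T and B exchanged, so the
      proportionality of rows \<open>B 1\<close> and \<open>T 1\<close> on the whole level is used
      instead of a comparison with \<open>T 0\<close>.\<close>
    have "T k \<in> G 0" unfolding Gk0[symmetric] by (rule TG)
    then have "a (B (Suc 0)) (T k) = dB (Suc 0) * cnj (dT (Suc 0)) * a (T (Suc 0)) (T k)"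
        using ratio[of 0] by blast
    then have "cnj (a (B 1) (T k)) = cnj (dB 1) * dT 1 * cnj (a (T 1) (T k))" by simp
    then have "a (T k) (B 1) = cnj (dB 1) * dT 1 * a (T k) (T 1)"
      using herm[OF lt0(1)[of k] lt0(2)[of 1]] herm[OF lt0(1)[of k] lt0(1)[of 1]] by simp
    then show ?thesis unfolding zT using uu(1)[of 1] by (simp add: mult_ac)
  qed
  have zBT: "a (B k) (T 1) = - (dB k * z * cnj (dT 1))" and zBB: "a (B k) (B 1) = - (dB k * z * cnj (dB 1))"
    using eB[of "T 1" k'] eB[of "B 1" k'] Tk1 uu(1)[of k] unfolding k'[symmetric] zT zB
    by (simp_all add: mult.left_commute[of "cnj (dT k)"])
  have "T k \<in> G k" "T 1 \<in> nb (T k)" using adj[of "T k" k "T 1"] TG Tk1 by auto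
  then have z1: "cmod z = 1" "z \<in> Z_omega"
    using unit_nb(3,4)[OF lt0(1)] uT[of k] uT[of 1] Z_omega_unary(2)
        by (auto simp: z_def norm_mult intro!: Z_omega_algebra(3))
  define g where "g = (\<lambda>x. case x of Vt i \<Rightarrow> T (nat i) | Vb i \<Rightarrow> B (nat i))"
  define d where "d = (\<lambda>x. case x of Vt i \<Rightarrow> dT (nat i) | Vb i \<Rightarrow> dB (nat i))"
  have lev: "g x \<in> G j" if "x = Vt (int j) \<or> x = Vb (int j)" for x j using that TG by (auto simp: g_def)
  have lv: "\<exists>i. (x = Vt (int i) \<or> x = Vb (int i)) \<and> 1 \<le> i \<and> i \<le> k" if x: "x \<in> T_vertices (int k)" for x
  proof -
    obtain l where "x = Vt l \<or> x = Vb l" "1 \<le> l" "l \<le> int k" using x by (auto simp: T_vertices_def)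
    then show ?thesis by (intro exI[of _ "nat l"]) auto
  qed
  have "T_data (int k) g d z"
    unfolding T_data_def
  proof (intro conjI ballI impI)
    show "bij_betw g (T_vertices (int k)) {..<n}"
    proof (rule bij_betwI')
      fix x y assume xy: "x \<in> T_vertices (int k)" "y \<in> T_vertices (int k)"
      obtain i where i: "x = Vt (int i) \<or> x = Vb (int i)" "1 \<le> i" "i \<le> k"
        using lv[OF xy(1)] by blast
      obtain j where j: "y = Vt (int j) \<or> y = Vb (int j)" "1 \<le> j" "j \<le> k"
        using lv[OF xy(2)] by blast
      show "(g x = g y) = (x = y)"
      proof
        assume gxy: "g x = g y"
        have "i = j"
        proof (rule ccontr)
          assume "i \<noteq> j"
          then have "G i \<inter> G j = {}" using disjk[of i j] disjk[of j i] i j by (cases "i < j") auto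
          then show False using lev[OF i(1)] lev[OF j(1)] gxy by auto
        qed
        then show "x = y" using gxy i j ne[of j] by (auto simp: g_def)
      qed simp
    next
      fix x assume x: "x \<in> T_vertices (int k)"
      then show "g x \<in> {..<n}" using lt0 by (auto simp: g_def T_vertices_def)
    next
      fix y assume "y \<in> {..<n}"
      then obtain j where j: "y \<in> G j" "1 \<le> j" "j \<le> k" unfolding cover[symmetric] by auto
      then have "y = g (Vt (int j)) \<or> y = g (Vb (int j))" by (auto simp: g_def G_def)
      moreover have "Vt (int j) \<in> T_vertices (int k)" "Vb (int j) \<in> T_vertices (int k)" using j
          by (auto simp: T_vertices_def)
      ultimately show "\<exists>x\<in>T_vertices (int k). y = g x" by blast
    qed
    fix x assume x: "x \<in> T_vertices (int k)"
    have pos: "\<exists>l. nat i = Suc l" if "1 \<le> i" for i :: int using that by (cases "nat i") auto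
    obtain l where "x = Vt (int (Suc l)) \<or> x = Vb (int (Suc l))"
      using lv[OF x] by (metis Suc_le_D One_nat_def)
    then show "d x \<in> Z_omega" "cmod (d x) = 1"
      using uT[of "Suc l"] uB[of l] by (auto simp: d_def nat_add_distrib)
    fix y assume y: "y \<in> T_vertices (int k)" and nz: "T_twisted z (int k) x y \<noteq> 0"
    have step: "nat (i + 1) = Suc (Suc l)" if "nat i = Suc l" for i l using that by simp
    show "a (g x) (g y) = d x * T_twisted z (int k) x y * cnj (d y)"
    proof -
      consider i where "x = Vt i" "y = Vt (i + 1)" "1 \<le> i" "i < int k" | i
          where "x = Vt i" "y = Vb (i + 1)" "1 \<le> i" "i < int k"
        | i where "x = Vb i" "y = Vt (i + 1)" "1 \<le> i" "i < int k" | i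
            where "x = Vb i" "y = Vb (i + 1)" "1 \<le> i" "i < int k"
        | "x = Vt (int k)" "y = Vt 1" | "x = Vt (int k)" "y = Vb 1" | "x = Vb (int k)" "y = Vt 1" |
            "x = Vb (int k)" "y = Vb 1"
        using x y nz by (cases x; cases y) (auto simp: T_vertices_def split: if_splits)
      then show ?thesis
      proof cases
        case (1 i)
        obtain l where l: "nat i = Suc l" using pos 1 by blast
        show ?thesis using 1 step[OF l] l eTT by (simp add: g_def d_def)
      next
        case (2 i)
        obtain l where l: "nat i = Suc l" using pos 2 by blast
        show ?thesis using 2 step[OF l] l eTB by (simp add: g_def d_def)
      next
        case (3 i)
        obtain l where l: "nat i = Suc l" using pos 3 by blast
        show ?thesis using 3 step[OF l] l eBT by (simp add: g_def d_def)
      next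
        case (4 i)
        obtain l where l: "nat i = Suc l" using pos 4 by blast
        show ?thesis using 4 step[OF l] l eBB by (simp add: g_def d_def)
      qed (use zT zB zBT zBB in \<open>simp_all add: g_def d_def\<close>)
    qed
  qed (use k3 z1 in simp_all)
  then show ?thesis by blast
qed

end

section \<open>The graphs with 10, 12, 14 and 16 vertices\<close>

lemma omega_arith:
  "omega * omega = omega - 1" "cnj omega = 1 - omega" "cmod omega = 1" "cmod (1 - omega) = 1"
      "cmod (omega - 1) = 1"
  "omega \<in> Z_omega" "- omega \<in> Z_omega" "1 - omega \<in> Z_omega" "omega - 1 \<in> Z_omega"
  "omega * (1 - omega) = 1" "(1 - omega) * omega = 1" "(omega - 1) * omega = -1" "omega * (omega - 1) = -1"
  "(1 - omega) * (1 - omega) = - omega" "(omega - 1) * (omega - 1) = - omega"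
  "(1 - omega) * (omega - 1) = omega" "(omega - 1) * (1 - omega) = omega"
proof -
  show oo: "omega * omega = omega - 1" and c: "cnj omega = 1 - omega" and u: "cmod omega = 1"
    and Z: "omega \<in> Z_omega" by (rule omega_facts)+
  show "cmod (1 - omega) = 1" using u c by (metis complex_mod_cnj)
  then show "cmod (omega - 1) = 1" by (simp add: norm_minus_commute)
  show "- omega \<in> Z_omega" "1 - omega \<in> Z_omega" "omega - 1 \<in> Z_omega"
    using Z by (auto intro: Z_omega_unary Z_omega_algebra)
  show "omega * (1 - omega) = 1" "(1 - omega) * omega = 1" "(omega - 1) * omega = -1"
      "omega * (omega - 1) = -1"
    "(1 - omega) * (1 - omega) = - omega" "(omega - 1) * (omega - 1) = - omega"
    "(1 - omega) * (omega - 1) = omega" "(omega - 1) * (1 - omega) = omega"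
    using oo by (simp_all add: algebra_simps)
qed

lemma set_simps: "set [] = {}" "set (x # xs) = insert x (set xs)"
  by simp_all

section \<open>Finite checks on the four sporadic graphs\<close>

definition on_vertex_nth :: "'b list \<Rightarrow> 'b list \<Rightarrow> on_vertex \<Rightarrow> 'b" where
  "on_vertex_nth xs ys v = (case v of Vo j \<Rightarrow> xs ! nat j | Vn j \<Rightarrow> ys ! nat j)"

lemma on_vertex_nth_simps [simp]:
  "on_vertex_nth xs ys (Vo j) = xs ! nat j" "on_vertex_nth xs ys (Vn j) = ys ! nat j"
  by (simp_all add: on_vertex_nth_def)

lemma card_filter: "distinct ys \<Longrightarrow> card {y \<in> set ys. P y} = length (filter P ys)"
  by (simp add: distinct_length_filter Int_def conj_commute)

lemma on_vertices_5: "on_vertices 5 = set [Vo 0, Vo 1, Vo 2, Vo 3, Vo 4, Vn 0, Vn 1, Vn 2, Vn 3, Vn 4]"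
    "distinct [Vo 0, Vo 1, Vo 2, Vo 3, Vo 4, Vn 0, Vn 1, Vn 2, Vn 3, Vn 4]"
proof -
  have "{0..<5::int} = {0, 1, 2, 3, 4}" by auto
  then show "on_vertices 5 = set [Vo 0, Vo 1, Vo 2, Vo 3, Vo 4, Vn 0, Vn 1, Vn 2, Vn 3, Vn 4]"
      by (auto simp: on_vertices_def)
  show "distinct [Vo 0, Vo 1, Vo 2, Vo 3, Vo 4, Vn 0, Vn 1, Vn 2, Vn 3, Vn 4]" by simp
qed

lemma on_vertices_6: "on_vertices 6 = set [Vo 0, Vo 1, Vo 2, Vo 3, Vo 4, Vo 5, Vn 0, Vn 1, Vn 2, Vn 3,
    Vn 4, Vn 5]" "distinct [Vo 0, Vo 1, Vo 2, Vo 3, Vo 4, Vo 5, Vn 0, Vn 1, Vn 2, Vn 3, Vn 4, Vn 5]"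
proof -
  have "{0..<6::int} = {0, 1, 2, 3, 4, 5}" by auto
  then show "on_vertices 6 = set [Vo 0, Vo 1, Vo 2, Vo 3, Vo 4, Vo 5, Vn 0, Vn 1, Vn 2, Vn 3, Vn 4,
      Vn 5]" by (auto simp: on_vertices_def)
  show "distinct [Vo 0, Vo 1, Vo 2, Vo 3, Vo 4, Vo 5, Vn 0, Vn 1, Vn 2, Vn 3, Vn 4, Vn 5]" by simp
qed

lemma on_vertices_7: "on_vertices 7 = set [Vo 0, Vo 1, Vo 2, Vo 3, Vo 4, Vo 5, Vo 6, Vn 0, Vn 1, Vn 2,
    Vn 3, Vn 4, Vn 5, Vn 6]" "distinct [Vo 0, Vo 1, Vo 2, Vo 3, Vo 4, Vo 5, Vo 6, Vn 0, Vn 1, Vn 2, Vn 3,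
    Vn 4, Vn 5, Vn 6]"
proof -
  have "{0..<7::int} = {0, 1, 2, 3, 4, 5, 6}" by auto
  then show "on_vertices 7 = set [Vo 0, Vo 1, Vo 2, Vo 3, Vo 4, Vo 5, Vo 6, Vn 0, Vn 1, Vn 2, Vn 3, Vn 4,
      Vn 5, Vn 6]" by (auto simp: on_vertices_def)
  show "distinct [Vo 0, Vo 1, Vo 2, Vo 3, Vo 4, Vo 5, Vo 6, Vn 0, Vn 1, Vn 2, Vn 3, Vn 4, Vn 5, Vn 6]" by simp
qed

lemma on_vertices_8: "on_vertices 8 = set [Vo 0, Vo 1, Vo 2, Vo 3, Vo 4, Vo 5, Vo 6, Vo 7, Vn 0, Vn 1,
    Vn 2, Vn 3, Vn 4, Vn 5, Vn 6, Vn 7]" "distinct [Vo 0, Vo 1, Vo 2, Vo 3, Vo 4, Vo 5, Vo 6, Vo 7, Vn 0,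
    Vn 1, Vn 2, Vn 3, Vn 4, Vn 5, Vn 6, Vn 7]"
proof -
  have "{0..<8::int} = {0, 1, 2, 3, 4, 5, 6, 7}" by auto
  then show "on_vertices 8 = set [Vo 0, Vo 1, Vo 2, Vo 3, Vo 4, Vo 5, Vo 6, Vo 7, Vn 0, Vn 1, Vn 2, Vn 3,
      Vn 4, Vn 5, Vn 6, Vn 7]" by (auto simp: on_vertices_def)
  show "distinct [Vo 0, Vo 1, Vo 2, Vo 3, Vo 4, Vo 5, Vo 6, Vo 7, Vn 0, Vn 1, Vn 2, Vn 3, Vn 4, Vn 5,
      Vn 6, Vn 7]" by simp
qed

text \<open>An explicit list covering all nonzero listed weights, so that claims about edges reduce
  to finitely many evaluations. The lists for the other three graphs serve the same purpose.\<close>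

definition S10_edges :: "(on_vertex \<times> on_vertex) list" where
  "S10_edges = [(Vo 0, Vn 0), (Vo 0, Vn 1), (Vo 0, Vn 3), (Vo 0, Vn 4), (Vo 1, Vn 0), (Vo 1, Vn 1),
      (Vo 1, Vn 2), (Vo 1, Vn 4), (Vo 2, Vn 0), (Vo 2, Vn 1), (Vo 2, Vn 2), (Vo 2, Vn 3), (Vo 3, Vn 1),
      (Vo 3, Vn 2), (Vo 3, Vn 3), (Vo 3, Vn 4), (Vo 4, Vn 0), (Vo 4, Vn 2), (Vo 4, Vn 3), (Vo 4, Vn 4)]"

lemma S10_edges_complete:
    "x \<in> on_vertices 5 \<Longrightarrow> y \<in> on_vertices 5 \<Longrightarrow> S10_listed x y \<noteq> 0 \<Longrightarrow> (x, y) \<in> set S10_edges"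
  unfolding on_vertices_5(1) S10_edges_def set_simps by (elim insertE emptyE; simp)

lemma S10_asym: "x \<in> on_vertices 5 \<Longrightarrow> y \<in> on_vertices 5 \<Longrightarrow> S10_listed x y \<noteq> 0 \<Longrightarrow> S10_listed y x = 0"
  by (drule (2) S10_edges_complete) (simp only: S10_edges_def set_simps insert_iff empty_iff prod.inject,
      elim disjE conjE FalseE; simp)

lemma S10_degree: "x \<in> on_vertices 5 \<Longrightarrow> card {y \<in> on_vertices 5. S10_listed x y \<noteq> 0 \<or> S10_listed y x \<noteq> 0} = 4"
  unfolding on_vertices_5(1) card_filter[OF on_vertices_5(2)] unfolding set_simps
      by (elim insertE emptyE; simp add: omega_facts(5))

lemma S10_values: "S10_listed x y \<in> Z_omega"
  using omega_facts(2) Z_omega_unary(1)[OF omega_facts(2)] by (cases x; cases y) auto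

definition S12_edges :: "(on_vertex \<times> on_vertex) list" where
  "S12_edges = [(Vo 0, Vn 0), (Vo 0, Vn 1), (Vo 0, Vn 3), (Vo 0, Vn 5), (Vo 1, Vn 1), (Vo 1, Vn 2),
      (Vo 1, Vn 4), (Vo 2, Vn 1), (Vo 2, Vn 2), (Vo 2, Vn 3), (Vo 2, Vn 5), (Vo 3, Vn 0), (Vo 3, Vn 3),
      (Vo 3, Vn 4), (Vo 4, Vn 1), (Vo 4, Vn 3), (Vo 4, Vn 4), (Vo 4, Vn 5), (Vo 5, Vn 0), (Vo 5,
      Vn 2), (Vo 5, Vn 5), (Vn 0, Vo 1), (Vn 2, Vo 3), (Vn 4, Vo 5)]"

lemma S12_edges_complete:
    "x \<in> on_vertices 6 \<Longrightarrow> y \<in> on_vertices 6 \<Longrightarrow> S12_listed x y \<noteq> 0 \<Longrightarrow> (x, y) \<in> set S12_edges"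
  unfolding on_vertices_6(1) S12_edges_def set_simps by (elim insertE emptyE; simp)

lemma S12_asym: "x \<in> on_vertices 6 \<Longrightarrow> y \<in> on_vertices 6 \<Longrightarrow> S12_listed x y \<noteq> 0 \<Longrightarrow> S12_listed y x = 0"
  by (drule (2) S12_edges_complete) (simp only: S12_edges_def set_simps insert_iff empty_iff prod.inject,
      elim disjE conjE FalseE; simp)

lemma S12_degree: "x \<in> on_vertices 6 \<Longrightarrow> card {y \<in> on_vertices 6. S12_listed x y \<noteq> 0 \<or> S12_listed y x \<noteq> 0} = 4"
  unfolding on_vertices_6(1) card_filter[OF on_vertices_6(2)] unfolding set_simps
      by (elim insertE emptyE; simp add: omega_facts(5))

lemma S12_values: "S12_listed x y \<in> Z_omega"
  using omega_facts(2) Z_omega_unary(1)[OF omega_facts(2)] by (cases x; cases y) auto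

definition S14_edges :: "(on_vertex \<times> on_vertex) list" where
  "S14_edges = [(Vo 0, Vn 0), (Vo 0, Vn 1), (Vo 0, Vn 3), (Vo 0, Vn 6), (Vo 1, Vn 0), (Vo 1, Vn 1),
      (Vo 1, Vn 2), (Vo 1, Vn 4), (Vo 2, Vn 1), (Vo 2, Vn 2), (Vo 2, Vn 3), (Vo 2, Vn 5), (Vo 3, Vn 2),
      (Vo 3, Vn 3), (Vo 3, Vn 4), (Vo 3, Vn 6), (Vo 4, Vn 0), (Vo 4, Vn 3), (Vo 4, Vn 4), (Vo 4,
      Vn 5), (Vo 5, Vn 1), (Vo 5, Vn 4), (Vo 5, Vn 5), (Vo 5, Vn 6), (Vo 6, Vn 0), (Vo 6, Vn 2),
      (Vo 6, Vn 5), (Vo 6, Vn 6)]"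

lemma S14_edges_complete:
    "x \<in> on_vertices 7 \<Longrightarrow> y \<in> on_vertices 7 \<Longrightarrow> S14_listed x y \<noteq> 0 \<Longrightarrow> (x, y) \<in> set S14_edges"
  unfolding on_vertices_7(1) S14_edges_def set_simps by (elim insertE emptyE; simp)

lemma S14_asym: "x \<in> on_vertices 7 \<Longrightarrow> y \<in> on_vertices 7 \<Longrightarrow> S14_listed x y \<noteq> 0 \<Longrightarrow> S14_listed y x = 0"
  by (drule (2) S14_edges_complete) (simp only: S14_edges_def set_simps insert_iff empty_iff prod.inject,
      elim disjE conjE FalseE; simp)

lemma S14_degree: "x \<in> on_vertices 7 \<Longrightarrow> card {y \<in> on_vertices 7. S14_listed x y \<noteq> 0 \<or> S14_listed y x \<noteq> 0} = 4"
  unfolding on_vertices_7(1) card_filter[OF on_vertices_7(2)] unfolding set_simps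
      by (elim insertE emptyE; simp add: omega_facts(5))

lemma S14_values: "S14_listed x y \<in> Z_omega"
  using omega_facts(2) Z_omega_unary(1)[OF omega_facts(2)] by (cases x; cases y) auto

definition S16_edges :: "(on_vertex \<times> on_vertex) list" where
  "S16_edges = [(Vo 0, Vo 1), (Vo 0, Vn 1), (Vo 0, Vn 7), (Vo 1, Vo 2), (Vo 1, Vn 0), (Vo 1, Vn 2),
      (Vo 2, Vo 3), (Vo 2, Vn 1), (Vo 2, Vn 3), (Vo 3, Vo 4), (Vo 3, Vn 2), (Vo 3, Vn 4), (Vo 4, Vo 5),
      (Vo 4, Vn 3), (Vo 4, Vn 5), (Vo 5, Vo 6), (Vo 5, Vn 4), (Vo 5, Vn 6), (Vo 6, Vo 7), (Vo 6,
      Vn 5), (Vo 6, Vn 7), (Vo 7, Vo 0), (Vo 7, Vn 0), (Vo 7, Vn 6), (Vn 0, Vn 3), (Vn 1, Vn 4),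
      (Vn 2, Vn 5), (Vn 3, Vn 6), (Vn 4, Vn 7), (Vn 5, Vn 0), (Vn 6, Vn 1), (Vn 7, Vn 2)]"

lemma S16_edges_complete:
    "x \<in> on_vertices 8 \<Longrightarrow> y \<in> on_vertices 8 \<Longrightarrow> S16_listed x y \<noteq> 0 \<Longrightarrow> (x, y) \<in> set S16_edges"
  unfolding on_vertices_8(1) S16_edges_def set_simps by (elim insertE emptyE; simp)

lemma S16_asym: "x \<in> on_vertices 8 \<Longrightarrow> y \<in> on_vertices 8 \<Longrightarrow> S16_listed x y \<noteq> 0 \<Longrightarrow> S16_listed y x = 0"
  by (drule (2) S16_edges_complete) (simp only: S16_edges_def set_simps insert_iff empty_iff prod.inject,
      elim disjE conjE FalseE; simp)

lemma S16_degree: "x \<in> on_vertices 8 \<Longrightarrow> card {y \<in> on_vertices 8. S16_listed x y \<noteq> 0 \<or> S16_listed y x \<noteq> 0} = 4"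
  unfolding on_vertices_8(1) card_filter[OF on_vertices_8(2)] unfolding set_simps
      by (elim insertE emptyE; simp add: omega_facts(5))

lemma S16_values: "S16_listed x y \<in> Z_omega"
  using omega_facts(2) Z_omega_unary(1)[OF omega_facts(2)] by (cases x; cases y) auto

section \<open>Weights forced by a spanning tree and orthogonality\<close>

context unit_form
begin

text \<open>Along an edge of a spanning tree the scaling \<open>g\<close> of the newly reached
  vertex is free, so the edge can be given any prescribed unit weight \<open>w\<close>. In
  \<open>edge_tree_row\<close> the new vertex is the row.\<close>

lemma edge_tree_col:
  assumes p: "p < n" "c \<in> nb p" and f: "cmod f = 1" "f \<in> Z_omega" and w: "cmod w = 1" "w \<in> Z_omega"
  shows "\<exists>g. a p c = f * w * cnj g \<and> cmod g = 1 \<and> g \<in> Z_omega"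
proof (intro exI conjI)
  define g where "g = f * w * cnj (a p c)"
  show "a p c = f * w * cnj g" using unit_cnj[OF f(1)] unit_cnj[OF w(1)] unfolding g_def
    by simp (Groebner_Basis.algebra)
  show "cmod g = 1" "g \<in> Z_omega" using unit_nb(3,4)[OF p] f w unfolding g_def
    by (auto simp: norm_mult intro!: Z_omega_algebra(3) Z_omega_unary(2))
qed

lemma edge_tree_row:
  assumes p: "p < n" "c \<in> nb p" and g: "cmod g = 1" "g \<in> Z_omega" and w: "cmod w = 1" "w \<in> Z_omega"
  shows "\<exists>f. a p c = f * w * cnj g \<and> cmod f = 1 \<and> f \<in> Z_omega"
proof (intro exI conjI)
  define f where "f = a p c * cnj w * g"
  show "a p c = f * w * cnj g" using unit_cnj[OF g(1)] unit_cnj[OF w(1)] unfolding f_def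
    by Groebner_Basis.algebra
  show "cmod f = 1" "f \<in> Z_omega" using unit_nb(3,4)[OF p] g w unfolding f_def
    by (auto simp: norm_mult intro!: Z_omega_algebra(3) Z_omega_unary(2))
qed

lemma edge_swap:
  assumes "a p c = f * w * cnj g" "p < n" "c < n" "cnj w = w'"
  shows "a c p = g * w' * cnj f"
  using assms herm[of p c] by (simp add: mult_ac)

text \<open>Two rows with two common columns form a 4-cycle, and orthogonality makes its fourth
  normalised weight minus the product of the other three, one of them conjugated. The scalings drop
  out.\<close>

lemma edge2:
  assumes pq: "p < n" "q < n" "p \<noteq> q" and i: "nb p \<inter> nb q = {x, y} \<and> x \<noteq> y"
    and e: "a p x = f * w1 * cnj gx" "a q x = f' * w2 * cnj gx" "a p y = f * w3 * cnj gy"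
    and u: "cmod f = 1" "f \<in> Z_omega" "cmod gx = 1" "gx \<in> Z_omega" "cmod gy = 1" "gy \<in> Z_omega"
  shows "a q y = f' * (- (cnj w1 * w2 * w3)) * cnj gy"
proof -
  have "a p x * cnj (a q x) + a p y * cnj (a q y) = 0"
    using orth2[OF pq(1) degree[OF pq(1)] pq(2)] pq i by auto
  then have "cnj (a p x * cnj (a q x) + a p y * cnj (a q y)) = 0" by simp
  then have o: "cnj (a p x) * a q x + cnj (a p y) * a q y = 0" by simp
  have "y \<in> nb p" using i by auto
  then have "a p y * cnj (a p y) = 1" by (rule unit_nb(1)[OF pq(1)])
  then have "a q y = - (a p y * (cnj (a p x) * a q x))" using o by Groebner_Basis.algebra
  then have q: "a q y = - (f * w3 * cnj gy * ((cnj f * cnj w1 * gx) * (f' * w2 * cnj gx)))" unfolding e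
      by simp
  show ?thesis using q unit_cnj[OF u(1)] unit_cnj[OF u(3)] by Groebner_Basis.algebra
qed

text \<open>With three common columns, five normalised weights determine the sixth in the same
  way.\<close>

lemma edge3:
  assumes pq: "p < n" "q < n" "p \<noteq> q" and i: "nb p \<inter> nb q = {x, y, z} \<and> x \<noteq> y \<and> x \<noteq> z \<and> y \<noteq> z"
    and e: "a p x = f * w1 * cnj gx" "a q x = f' * w2 * cnj gx" "a p y = f * w3 * cnj gy"
      "a q y = f' * w4 * cnj gy" "a p z = f * w5 * cnj gz"
    and u: "cmod f = 1" "f \<in> Z_omega" "cmod gx = 1" "gx \<in> Z_omega" "cmod gy = 1" "gy \<in> Z_omega"
      "cmod gz = 1" "gz \<in> Z_omega"
  shows "a q z = f' * (- ((cnj w1 * w2 + cnj w3 * w4) * w5)) * cnj gz"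
proof -
  have "a p x * cnj (a q x) + a p y * cnj (a q y) + a p z * cnj (a q z) = 0"
    using orth3[OF pq(1) degree[OF pq(1)] pq(2)] pq i by auto
  then have "cnj (a p x * cnj (a q x) + a p y * cnj (a q y) + a p z * cnj (a q z)) = 0" by simp
  then have o: "cnj (a p x) * a q x + cnj (a p y) * a q y + cnj (a p z) * a q z = 0" by simp
  have "z \<in> nb p" using i by auto
  then have "a p z * cnj (a p z) = 1" by (rule unit_nb(1)[OF pq(1)])
  then have "a q z = - (a p z * (cnj (a p x) * a q x + cnj (a p y) * a q y))" using o
      by Groebner_Basis.algebra
  then have q:
      "a q z = - (f * w5 * cnj gz * ((cnj f * cnj w1 * gx) * (f' * w2 * cnj gx) + (cnj f * cnj w3 * gy) *
      (f' * w4 * cnj gy)))"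
    unfolding e by simp
  show ?thesis using q unit_cnj[OF u(1)] unit_cnj[OF u(3)] unit_cnj[OF u(5)] by Groebner_Basis.algebra
qed

text \<open>As \<open>edge3\<close>, with orthogonality of two columns that have three common
  rows.\<close>

lemma edge3_col:
  assumes xy: "x < n" "y < n" "x \<noteq> y" and i: "nb x \<inter> nb y = {p, q, s} \<and> p \<noteq> q \<and> p \<noteq> s \<and> q \<noteq> s"
    and e: "a p x = f * w1 * cnj gx" "a p y = f * w2 * cnj gy" "a q x = f' * w3 * cnj gx"
      "a q y = f' * w4 * cnj gy" "a s x = f'' * w5 * cnj gx"
    and u: "cmod gx = 1" "gx \<in> Z_omega" "cmod f = 1" "f \<in> Z_omega" "cmod f' = 1" "f' \<in> Z_omega"
        "cmod f'' = 1" "f'' \<in> Z_omega"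
  shows "a s y = f'' * (- ((cnj w1 * w2 + cnj w3 * w4) * w5)) * cnj gy"
proof -
  have lt: "p < n" "q < n" "s < n" using i nbD(1)[of _ x] by auto
  have h: "a x p = cnj (a p x)" "a y p = cnj (a p y)" "a x q = cnj (a q x)" "a y q = cnj (a q y)"
    "a x s = cnj (a s x)" "a y s = cnj (a s y)" using herm lt xy by blast+
  have "a x p * cnj (a y p) + a x q * cnj (a y q) + a x s * cnj (a y s) = 0"
    using orth3[OF xy(1) degree[OF xy(1)] xy(2)] xy i by auto
  then have o: "cnj (a p x) * a p y + cnj (a q x) * a q y + cnj (a s x) * a s y = 0" by (simp add: h)
  have "s \<in> nb x" using i by auto
  then have "x \<in> nb s" using nbs xy by blast
  then have "a s x * cnj (a s x) = 1" by (rule unit_nb(1)[OF lt(3)])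
  then have "a s y = - (a s x * (cnj (a p x) * a p y + cnj (a q x) * a q y))" using o
      by Groebner_Basis.algebra
  then have q:
      "a s y = - (f'' * w5 * cnj gx * ((cnj f * cnj w1 * gx) * (f * w2 * cnj gy) + (cnj f' * cnj w3 * gx)
      * (f' * w4 * cnj gy)))"
    unfolding e by simp
  show ?thesis using q unit_cnj[OF u(1)] unit_cnj[OF u(3)] unit_cnj[OF u(5)] by Groebner_Basis.algebra
qed

text \<open>Where orthogonality leaves a choice between two cube roots of unity, the known ratio
  \<open>r\<close> settles the weight.\<close>

lemma edge_ratio:
  assumes p: "p < n" "y \<in> nb p" and r: "a q y * cnj (a p y) = r * (a q x * cnj (a p x))"
    and e: "a p x = f * w1 * cnj gx" "a p y = f * w2 * cnj gy" "a q x = f' * w3 * cnj gx"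
    and u: "cmod f = 1" "f \<in> Z_omega" "cmod gx = 1" "gx \<in> Z_omega" "cmod gy = 1" "gy \<in> Z_omega"
  shows "a q y = f' * (r * w3 * cnj w1 * w2) * cnj gy"
proof -
  have "a p y * cnj (a p y) = 1" by (rule unit_nb(1)[OF p])
  then have "a q y = r * (a q x * cnj (a p x)) * a p y" using r by Groebner_Basis.algebra
  then have q: "a q y = r * ((f' * w3 * cnj gx) * (cnj f * cnj w1 * gx)) * (f * w2 * cnj gy)" unfolding e
      by simp
  show ?thesis using q unit_cnj[OF u(1)] unit_cnj[OF u(3)] by Groebner_Basis.algebra
qed

lemma on_graph_equiv:
  assumes A: "A \<in> R_mat n" "\<And>i j. i < n \<Longrightarrow> j < n \<Longrightarrow> A $$ (i, j) = a i j"
    and E: "\<And>x y. (x, y) \<in> set es \<Longrightarrow> a (on_vertex_nth os ns x) (on_vertex_nth os ns y) =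
       on_vertex_nth ds fs x * l x y * cnj (on_vertex_nth ds fs y)"
    and len: "length os = nat m" "length ns = nat m" "length ds = nat m" "length fs = nat m"
    and V: "set os \<union> set ns = {..<n}" "set os \<inter> set ns = {}" "distinct os" "distinct ns"
    and d: "\<And>x. x \<in> set ds \<union> set fs \<Longrightarrow> x \<in> Z_omega" "\<And>x. x \<in> set ds \<union> set fs \<Longrightarrow> cmod x = 1"
    and es: "\<And>x y. x \<in> on_vertices m \<Longrightarrow> y \<in> on_vertices m \<Longrightarrow> l x y \<noteq> 0 \<Longrightarrow> (x, y) \<in> set es"
    and asym: "\<And>x y. x \<in> on_vertices m \<Longrightarrow> y \<in> on_vertices m \<Longrightarrow> l x y \<noteq> 0 \<Longrightarrow> l y x = 0"
    and deg: "\<And>x. x \<in> on_vertices m \<Longrightarrow> card {y \<in> on_vertices m. l x y \<noteq> 0 \<or> l y x \<noteq> 0} = 4"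
    and vals: "\<And>x y. l x y \<in> Z_omega"
  shows "equivalent_to_graph A (on_vertices m, hermitian_weight l)"
proof (rule graph_equiv(2)[OF A, of _ "on_vertex_nth os ns" l "on_vertex_nth ds fs"])
  show "finite (on_vertices m)" by (simp add: on_vertices_def)
  show "bij_betw (on_vertex_nth os ns) (on_vertices m) {..<n}"
    unfolding bij_betw_def
  proof
    show "inj_on (on_vertex_nth os ns) (on_vertices m)"
    proof (rule inj_onI)
      fix x y assume xy: "x \<in> on_vertices m" "y \<in> on_vertices m"
          "on_vertex_nth os ns x = on_vertex_nth os ns y"
      have mem: "os ! nat i \<in> set os" "ns ! nat i \<in> set ns" if "0 \<le> i" "i < m" for i
        using that len by auto
      have inj: "os ! nat i = os ! nat j \<Longrightarrow> i = j" "ns ! nat i = ns ! nat j \<Longrightarrow> i = j"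
        if "0 \<le> i" "i < m" "0 \<le> j" "j < m" for i j
        using that len nth_eq_iff_index_eq[OF V(3), of "nat i" "nat j"] nth_eq_iff_index_eq[OF V(4), of
            "nat i" "nat j"]
        by auto
      have d: "os ! nat i \<noteq> ns ! nat j" if "0 \<le> i" "i < m" "0 \<le> j" "j < m" for i j
        using mem[OF that(1,2)] mem[OF that(3,4)] V(2) by (metis disjoint_iff)
      show "x = y"
      proof (cases x; cases y)
        fix i j assume "x = Vo i" "y = Vo j"
        then show ?thesis using xy inj(1)[of i j] by (auto simp: on_vertices_def)
      next
        fix i j assume "x = Vn i" "y = Vn j"
        then show ?thesis using xy inj(2)[of i j] by (auto simp: on_vertices_def)
      next
        fix i j assume "x = Vo i" "y = Vn j"
        then show ?thesis using xy d[of i j] by (auto simp: on_vertices_def)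
      next
        fix i j assume "x = Vn i" "y = Vo j"
        then show ?thesis using xy d[of j i] by (auto simp: on_vertices_def)
      qed
    qed
    show "on_vertex_nth os ns ` on_vertices m = {..<n}"
    proof -
      have "(\<lambda>j. xs ! nat j) ` {0..<m} = set xs" if "length xs = nat m" for xs :: "nat list"
      proof
        show "(\<lambda>j. xs ! nat j) ` {0..<m} \<subseteq> set xs" using that by auto
        show "set xs \<subseteq> (\<lambda>j. xs ! nat j) ` {0..<m}"
        proof
          fix x assume "x \<in> set xs"
          then obtain i where "i < length xs" "xs ! i = x" by (auto simp: in_set_conv_nth)
          then show "x \<in> (\<lambda>j. xs ! nat j) ` {0..<m}" using that by (intro image_eqI[of _ _ "int i"]) auto
        qed
      qed
      then have "on_vertex_nth os ns ` on_vertices m = set os \<union> set ns"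
        using len by (simp add: on_vertices_def image_Un image_image)
      then show ?thesis using V by simp
    qed
  qed
  have mem: "on_vertex_nth ds fs x \<in> set ds \<union> set fs" if "x \<in> on_vertices m" for x
    using that len by (auto simp: on_vertices_def)
  show "on_vertex_nth ds fs x \<in> Z_omega" "cmod (on_vertex_nth ds fs x) = 1" if "x \<in> on_vertices m" for x
    using d mem[OF that] by blast+
  show "l x y \<in> Z_omega" for x y by (rule vals)
qed (use E es asym deg in blast)+

text \<open>Nine tree edges receive their weights from \<open>S10_listed\<close> under the numbering
  given at the end. The hypothesis on the ratio chooses a cube root once; all other weights are then
  forced by orthogonality.\<close>

lemma S10_case:
  assumes A: "A \<in> R_mat n" "\<And>i j. i < n \<Longrightarrow> j < n \<Longrightarrow> A $$ (i, j) = a i j"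
    and V: "set [p1, p2, p3, p4, p5] \<union> set [c1, c2, c3, c4, c5] = {..<n}"
        "set [p1, p2, p3, p4, p5] \<inter> set [c1, c2, c3, c4, c5] = {}"
    and dist: "distinct [p1, p2, p3, p4, p5]" "distinct [c1, c2, c3, c4, c5]"
    and N1: "nb p1 = {c1, c2, c3, c4}"
    and N2: "nb p2 = {c1, c2, c3, c5}"
    and N3: "nb p3 = {c1, c2, c4, c5}"
    and N4: "nb p4 = {c1, c3, c4, c5}"
    and N5: "nb p5 = {c2, c3, c4, c5}"
    and M1: "nb c1 = {p1, p2, p3, p4}"
    and M2: "nb c2 = {p1, p2, p3, p5}"
    and M3: "nb c3 = {p1, p2, p4, p5}"
    and ratio: "a p2 c2 * cnj (a p1 c2) = (omega - 1) * (a p2 c1 * cnj (a p1 c1))"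
  shows "equivalent_to_graph A S10_graph"
proof -
  note D = dist[simplified]
  have P: "p1 < n" "p2 < n" "p3 < n" "p4 < n" "p5 < n"
      and C: "c1 < n" "c2 < n" "c3 < n" "c4 < n" "c5 < n" using V(1) by auto
  note P1 = P(1) and P2 = P(2) and P3 = P(3) and P4 = P(4) and P5 = P(5) and C1 = C(1) and C2 = C(2)
      and C3 = C(3)
  define f1 :: complex where "f1 = 1"
  have F1: "cmod f1 = 1" "f1 \<in> Z_omega" by (simp_all add: f1_def)
  obtain g1 where e11: "a p1 c1 = f1 * 1 * cnj g1" and G1: "cmod g1 = 1" "g1 \<in> Z_omega"
    using edge_tree_col[OF P1 _ F1, where c = c1 and w = "1"] by (auto simp: N1 omega_arith)
  obtain g2 where e12: "a p1 c2 = f1 * -omega * cnj g2" and G2: "cmod g2 = 1" "g2 \<in> Z_omega"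
    using edge_tree_col[OF P1 _ F1, where c = c2 and w = "-omega"] by (auto simp: N1 omega_arith)
  obtain g3 where e13: "a p1 c3 = f1 * 1 * cnj g3" and G3: "cmod g3 = 1" "g3 \<in> Z_omega"
    using edge_tree_col[OF P1 _ F1, where c = c3 and w = "1"] by (auto simp: N1 omega_arith)
  obtain g4 where e14: "a p1 c4 = f1 * -omega * cnj g4" and G4: "cmod g4 = 1" "g4 \<in> Z_omega"
    using edge_tree_col[OF P1 _ F1, where c = c4 and w = "-omega"] by (auto simp: N1 omega_arith)
  obtain f2 where e21: "a p2 c1 = f2 * 1 * cnj g1" and F2: "cmod f2 = 1" "f2 \<in> Z_omega"
    using edge_tree_row[OF P2 _ G1, where c = c1 and w = "1"] by (auto simp: N2 omega_arith)
  have e22: "a p2 c2 = f2 * 1 * cnj g2"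
    using edge_ratio[OF P1 _ ratio e11 e12 e21 F1 G1 G2] by (simp add: N1 omega_arith)
  have e23: "a p2 c3 = f2 * -omega * cnj g3"
    using edge3[OF P1 P2 _ _ e11 e21 e12 e22 e13 F1 G1 G2 G3] D by (simp add: N1 N2 omega_arith)
  obtain g5 where e25: "a p2 c5 = f2 * -omega * cnj g5" and G5: "cmod g5 = 1" "g5 \<in> Z_omega"
    using edge_tree_col[OF P2 _ F2, where c = c5 and w = "-omega"] by (auto simp: N2 omega_arith)
  obtain f3 where e31: "a p3 c1 = f3 * -omega * cnj g1" and F3: "cmod f3 = 1" "f3 \<in> Z_omega"
    using edge_tree_row[OF P3 _ G1, where c = c1 and w = "-omega"] by (auto simp: N3 omega_arith)
  have e32: "a p3 c2 = f3 * 1 * cnj g2"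
    using edge3_col[OF C1 C2 _ _ e11 e12 e21 e22 e31 G1 F1 F2 F3] D by (simp add: M1 M2 omega_arith)
  have e34: "a p3 c4 = f3 * -omega * cnj g4"
    using edge3[OF P1 P3 _ _ e11 e31 e12 e32 e14 F1 G1 G2 G4] D by (simp add: N1 N3 omega_arith)
  have e35: "a p3 c5 = f3 * 1 * cnj g5"
    using edge3[OF P2 P3 _ _ e21 e31 e22 e32 e25 F2 G1 G2 G5] D by (simp add: N2 N3 omega_arith)
  obtain f4 where e41: "a p4 c1 = f4 * -omega * cnj g1" and F4: "cmod f4 = 1" "f4 \<in> Z_omega"
    using edge_tree_row[OF P4 _ G1, where c = c1 and w = "-omega"] by (auto simp: N4 omega_arith)
  have e43: "a p4 c3 = f4 * 1 * cnj g3"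
    using edge3_col[OF C1 C3 _ _ e11 e13 e21 e23 e41 G1 F1 F2 F4] D by (simp add: M1 M3 omega_arith)
  have e44: "a p4 c4 = f4 * 1 * cnj g4"
    using edge3[OF P1 P4 _ _ e11 e41 e13 e43 e14 F1 G1 G3 G4] D by (simp add: N1 N4 omega_arith)
  have e45: "a p4 c5 = f4 * -omega * cnj g5"
    using edge3[OF P2 P4 _ _ e21 e41 e23 e43 e25 F2 G1 G3 G5] D by (simp add: N2 N4 omega_arith)
  obtain f5 where e52: "a p5 c2 = f5 * -omega * cnj g2" and F5: "cmod f5 = 1" "f5 \<in> Z_omega"
    using edge_tree_row[OF P5 _ G2, where c = c2 and w = "-omega"] by (auto simp: N5 omega_arith)
  have e53: "a p5 c3 = f5 * -omega * cnj g3"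
    using edge3_col[OF C2 C3 _ _ e12 e13 e22 e23 e52 G2 F1 F2 F5] D by (simp add: M2 M3 omega_arith)
  have e54: "a p5 c4 = f5 * 1 * cnj g4"
    using edge3[OF P1 P5 _ _ e12 e52 e13 e53 e14 F1 G2 G3 G4] D by (simp add: N1 N5 omega_arith)
  have e55: "a p5 c5 = f5 * 1 * cnj g5"
    using edge3[OF P2 P5 _ _ e22 e52 e23 e53 e25 F2 G2 G3 G5] D by (simp add: N2 N5 omega_arith)
  show ?thesis unfolding S10_graph_def
  proof (rule on_graph_equiv[OF A, where es = S10_edges and os = "[p1, p2, p3, p5, p4]"
      and ns = "[c1, c2, c5, c4, c3]"
        and ds = "[f1, f2, f3, f5, f4]" and fs = "[g1, g2, g5, g4, g3]"])
    show "a (on_vertex_nth [p1, p2, p3, p5, p4] [c1, c2, c5, c4, c3] x) (on_vertex_nth [p1, p2, p3, p5,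
        p4] [c1, c2, c5, c4, c3] y) =
      on_vertex_nth [f1, f2, f3, f5, f4] [g1, g2, g5, g4, g3] x * S10_listed x y * cnj (on_vertex_nth
          [f1, f2, f3, f5, f4] [g1, g2, g5, g4, g3] y)" if "(x, y) \<in> set S10_edges" for x y
      using that unfolding S10_edges_def
          by (simp only: set_simps insert_iff empty_iff) (elim disjE FalseE; simp add:
          e11 e12 e13 e14 e21 e22 e23 e25 e31 e32 e34 e35 e41 e43 e44 e45 e52 e53 e54 e55)
  qed (use V dist F1 G1 F2 G2 F3 G3 F4 G4 F5 G5 S10_edges_complete S10_asym S10_degree S10_values in auto)
qed

text \<open>As for \<open>S10_case\<close>, with eleven tree edges. The overlaps within the first
  three rows, and within their columns, have size three; the other weights come from overlaps of
  size two.\<close>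

lemma S12_case:
  assumes A: "A \<in> R_mat n" "\<And>i j. i < n \<Longrightarrow> j < n \<Longrightarrow> A $$ (i, j) = a i j"
    and V: "set [p1, p2, p3, p4, p5, p6] \<union> set [c1, c2, c3, c4, c5, c6] = {..<n}"
        "set [p1, p2, p3, p4, p5, p6] \<inter> set [c1, c2, c3, c4, c5, c6] = {}"
    and dist: "distinct [p1, p2, p3, p4, p5, p6]" "distinct [c1, c2, c3, c4, c5, c6]"
    and N1: "nb p1 = {c1, c2, c3, c4}"
    and N2: "nb p2 = {c1, c2, c3, c5}"
    and N3: "nb p3 = {c1, c2, c3, c6}"
    and N4: "nb p4 = {c1, c4, c5, c6}"
    and N5: "nb p5 = {c2, c4, c5, c6}"
    and N6: "nb p6 = {c3, c4, c5, c6}"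
    and M1: "nb c1 = {p1, p2, p3, p4}"
    and M2: "nb c2 = {p1, p2, p3, p5}"
    and ratio: "a p2 c2 * cnj (a p1 c2) = (omega - 1) * (a p2 c1 * cnj (a p1 c1))"
  shows "equivalent_to_graph A S12_graph"
proof -
  note D = dist[simplified]
  have P: "p1 < n" "p2 < n" "p3 < n" "p4 < n" "p5 < n" "p6 < n"
      and C: "c1 < n" "c2 < n" "c3 < n" "c4 < n" "c5 < n" "c6 < n" using V(1) by auto
  note P1 = P(1) and P2 = P(2) and P3 = P(3) and P4 = P(4) and P5 = P(5) and P6 = P(6) and C1 = C(1)
      and C2 = C(2)
  define f1 :: complex where "f1 = 1"
  have F1: "cmod f1 = 1" "f1 \<in> Z_omega" by (simp_all add: f1_def)
  obtain g1 where e11: "a p1 c1 = f1 * omega * cnj g1" and G1: "cmod g1 = 1" "g1 \<in> Z_omega"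
    using edge_tree_col[OF P1 _ F1, where c = c1 and w = "omega"] by (auto simp: N1 omega_arith)
  obtain g2 where e12: "a p1 c2 = f1 * -1 * cnj g2" and G2: "cmod g2 = 1" "g2 \<in> Z_omega"
    using edge_tree_col[OF P1 _ F1, where c = c2 and w = "-1"] by (auto simp: N1 omega_arith)
  obtain g3 where e13: "a p1 c3 = f1 * -1 * cnj g3" and G3: "cmod g3 = 1" "g3 \<in> Z_omega"
    using edge_tree_col[OF P1 _ F1, where c = c3 and w = "-1"] by (auto simp: N1 omega_arith)
  obtain g4 where e14: "a p1 c4 = f1 * 1 * cnj g4" and G4: "cmod g4 = 1" "g4 \<in> Z_omega"
    using edge_tree_col[OF P1 _ F1, where c = c4 and w = "1"] by (auto simp: N1 omega_arith)
  obtain f2 where e21: "a p2 c1 = f2 * -1 * cnj g1" and F2: "cmod f2 = 1" "f2 \<in> Z_omega"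
    using edge_tree_row[OF P2 _ G1, where c = c1 and w = "-1"] by (auto simp: N2 omega_arith)
  have e22: "a p2 c2 = f2 * omega * cnj g2"
    using edge_ratio[OF P1 _ ratio e11 e12 e21 F1 G1 G2] by (simp add: N1 omega_arith)
  have e23: "a p2 c3 = f2 * -1 * cnj g3"
    using edge3[OF P1 P2 _ _ e11 e21 e12 e22 e13 F1 G1 G2 G3] D by (simp add: N1 N2 omega_arith)
  obtain g5 where e25: "a p2 c5 = f2 * 1 * cnj g5" and G5: "cmod g5 = 1" "g5 \<in> Z_omega"
    using edge_tree_col[OF P2 _ F2, where c = c5 and w = "1"] by (auto simp: N2 omega_arith)
  obtain f3 where e31: "a p3 c1 = f3 * -1 * cnj g1" and F3: "cmod f3 = 1" "f3 \<in> Z_omega"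
    using edge_tree_row[OF P3 _ G1, where c = c1 and w = "-1"] by (auto simp: N3 omega_arith)
  have e32: "a p3 c2 = f3 * -1 * cnj g2"
    using edge3_col[OF C1 C2 _ _ e11 e12 e21 e22 e31 G1 F1 F2 F3] D by (simp add: M1 M2 omega_arith)
  have e33: "a p3 c3 = f3 * omega * cnj g3"
    using edge3[OF P1 P3 _ _ e11 e31 e12 e32 e13 F1 G1 G2 G3] D by (simp add: N1 N3 omega_arith)
  obtain g6 where e36: "a p3 c6 = f3 * 1 * cnj g6" and G6: "cmod g6 = 1" "g6 \<in> Z_omega"
    using edge_tree_col[OF P3 _ F3, where c = c6 and w = "1"] by (auto simp: N3 omega_arith)
  obtain f4 where e41: "a p4 c1 = f4 * 1 * cnj g1" and F4: "cmod f4 = 1" "f4 \<in> Z_omega"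
    using edge_tree_row[OF P4 _ G1, where c = c1 and w = "1"] by (auto simp: N4 omega_arith)
  have e44: "a p4 c4 = f4 * (omega - 1) * cnj g4"
    using edge2[OF P1 P4 _ _ e11 e41 e14 F1 G1 G4] D by (simp add: N1 N4 omega_arith)
  have e45: "a p4 c5 = f4 * 1 * cnj g5"
    using edge2[OF P2 P4 _ _ e21 e41 e25 F2 G1 G5] D by (simp add: N2 N4 omega_arith)
  have e46: "a p4 c6 = f4 * 1 * cnj g6"
    using edge2[OF P3 P4 _ _ e31 e41 e36 F3 G1 G6] D by (simp add: N3 N4 omega_arith)
  obtain f5 where e52: "a p5 c2 = f5 * 1 * cnj g2" and F5: "cmod f5 = 1" "f5 \<in> Z_omega"
    using edge_tree_row[OF P5 _ G2, where c = c2 and w = "1"] by (auto simp: N5 omega_arith)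
  have e54: "a p5 c4 = f5 * 1 * cnj g4"
    using edge2[OF P1 P5 _ _ e12 e52 e14 F1 G2 G4] D by (simp add: N1 N5 omega_arith)
  have e55: "a p5 c5 = f5 * (omega - 1) * cnj g5"
    using edge2[OF P2 P5 _ _ e22 e52 e25 F2 G2 G5] D by (simp add: N2 N5 omega_arith)
  have e56: "a p5 c6 = f5 * 1 * cnj g6"
    using edge2[OF P3 P5 _ _ e32 e52 e36 F3 G2 G6] D by (simp add: N3 N5 omega_arith)
  obtain f6 where e63: "a p6 c3 = f6 * 1 * cnj g3" and F6: "cmod f6 = 1" "f6 \<in> Z_omega"
    using edge_tree_row[OF P6 _ G3, where c = c3 and w = "1"] by (auto simp: N6 omega_arith)
  have e64: "a p6 c4 = f6 * 1 * cnj g4"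
    using edge2[OF P1 P6 _ _ e13 e63 e14 F1 G3 G4] D by (simp add: N1 N6 omega_arith)
  have e65: "a p6 c5 = f6 * 1 * cnj g5"
    using edge2[OF P2 P6 _ _ e23 e63 e25 F2 G3 G5] D by (simp add: N2 N6 omega_arith)
  have e66: "a p6 c6 = f6 * (omega - 1) * cnj g6"
    using edge2[OF P3 P6 _ _ e33 e63 e36 F3 G3 G6] D by (simp add: N3 N6 omega_arith)
  \<comment> \<open>\<open>S12_listed\<close> gives these three weights in the direction from column
    to row.\<close>
  have h44: "a c4 p4 = g4 * -omega * cnj f4"
    by (rule edge_swap[OF e44 P(4) C(4)]) (simp add: omega_arith)
  have h55: "a c5 p5 = g5 * -omega * cnj f5"
    by (rule edge_swap[OF e55 P(5) C(5)]) (simp add: omega_arith)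
  have h66: "a c6 p6 = g6 * -omega * cnj f6"
    by (rule edge_swap[OF e66 P(6) C(6)]) (simp add: omega_arith)
  show ?thesis unfolding S12_graph_def
  proof (rule on_graph_equiv[OF A, where es = S12_edges and os = "[p1, p4, p2, p5, p3, p6]"
      and ns = "[c4, c1, c5, c2, c6, c3]"
        and ds = "[f1, f4, f2, f5, f3, f6]" and fs = "[g4, g1, g5, g2, g6, g3]"])
    show "a (on_vertex_nth [p1, p4, p2, p5, p3, p6] [c4, c1, c5, c2, c6, c3] x) (on_vertex_nth [p1, p4,
        p2, p5, p3, p6] [c4, c1, c5, c2, c6, c3] y) =
      on_vertex_nth [f1, f4, f2, f5, f3, f6] [g4, g1, g5, g2, g6, g3] x * S12_listed x y * cnj
          (on_vertex_nth [f1, f4, f2, f5, f3, f6] [g4, g1, g5, g2, g6, g3] y)" if "(x, y) \<in> set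
          S12_edges" for x y
      using that unfolding S12_edges_def
          by (simp only: set_simps insert_iff empty_iff) (elim disjE FalseE; simp add:
          e11 e12 e13 e14 e21 e22 e23 e25 e31 e32 e33 e36 e41 e44 e45 e46 e52 e54 e55 e56 e63 e64 e65
          e66 h44 h55 h66)
  qed (use V dist F1 G1 F2 G2 F3 G3 F4 G4 F5 G5 F6 G6 S12_edges_complete S12_asym S12_degree S12_values
      in auto)
qed

text \<open>Any two rows meet in two columns, so \<open>edge2\<close> decides every weight outside a
  tree of thirteen edges, and only signs occur.\<close>

lemma S14_case:
  assumes A: "A \<in> R_mat n" "\<And>i j. i < n \<Longrightarrow> j < n \<Longrightarrow> A $$ (i, j) = a i j"
    and V: "set [p1, p2, p3, p4, p5, p6, p7] \<union> set [c1, c2, c3, c4, c5, c6, c7] = {..<n}"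
        "set [p1, p2, p3, p4, p5, p6, p7] \<inter> set [c1, c2, c3, c4, c5, c6, c7] = {}"
    and dist: "distinct [p1, p2, p3, p4, p5, p6, p7]" "distinct [c1, c2, c3, c4, c5, c6, c7]"
    and N1: "nb p1 = {c1, c2, c3, c4}"
    and N2: "nb p2 = {c1, c2, c5, c7}"
    and N3: "nb p3 = {c1, c3, c5, c6}"
    and N4: "nb p4 = {c1, c4, c6, c7}"
    and N5: "nb p5 = {c2, c3, c6, c7}"
    and N6: "nb p6 = {c2, c4, c5, c6}"
    and N7: "nb p7 = {c3, c4, c5, c7}"
  shows "equivalent_to_graph A S14_graph"
proof -
  note D = dist[simplified]
  have P: "p1 < n" "p2 < n" "p3 < n" "p4 < n" "p5 < n" "p6 < n" "p7 < n" using V(1) by auto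
  note P1 = P(1) and P2 = P(2) and P3 = P(3) and P4 = P(4) and P5 = P(5) and P6 = P(6) and P7 = P(7)
  define f1 :: complex where "f1 = 1"
  have F1: "cmod f1 = 1" "f1 \<in> Z_omega" by (simp_all add: f1_def)
  obtain g1 where e11: "a p1 c1 = f1 * 1 * cnj g1" and G1: "cmod g1 = 1" "g1 \<in> Z_omega"
    using edge_tree_col[OF P1 _ F1, where c = c1 and w = "1"] by (auto simp: N1 omega_arith)
  obtain g2 where e12: "a p1 c2 = f1 * 1 * cnj g2" and G2: "cmod g2 = 1" "g2 \<in> Z_omega"
    using edge_tree_col[OF P1 _ F1, where c = c2 and w = "1"] by (auto simp: N1 omega_arith)
  obtain g3 where e13: "a p1 c3 = f1 * 1 * cnj g3" and G3: "cmod g3 = 1" "g3 \<in> Z_omega"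
    using edge_tree_col[OF P1 _ F1, where c = c3 and w = "1"] by (auto simp: N1 omega_arith)
  obtain g4 where e14: "a p1 c4 = f1 * -1 * cnj g4" and G4: "cmod g4 = 1" "g4 \<in> Z_omega"
    using edge_tree_col[OF P1 _ F1, where c = c4 and w = "-1"] by (auto simp: N1 omega_arith)
  obtain f2 where e21: "a p2 c1 = f2 * -1 * cnj g1" and F2: "cmod f2 = 1" "f2 \<in> Z_omega"
    using edge_tree_row[OF P2 _ G1, where c = c1 and w = "-1"] by (auto simp: N2 omega_arith)
  have e22: "a p2 c2 = f2 * 1 * cnj g2"
    using edge2[OF P1 P2 _ _ e11 e21 e12 F1 G1 G2] D by (simp add: N1 N2 omega_arith)
  obtain g5 where e25: "a p2 c5 = f2 * 1 * cnj g5" and G5: "cmod g5 = 1" "g5 \<in> Z_omega"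
    using edge_tree_col[OF P2 _ F2, where c = c5 and w = "1"] by (auto simp: N2 omega_arith)
  obtain g7 where e27: "a p2 c7 = f2 * 1 * cnj g7" and G7: "cmod g7 = 1" "g7 \<in> Z_omega"
    using edge_tree_col[OF P2 _ F2, where c = c7 and w = "1"] by (auto simp: N2 omega_arith)
  obtain f3 where e31: "a p3 c1 = f3 * 1 * cnj g1" and F3: "cmod f3 = 1" "f3 \<in> Z_omega"
    using edge_tree_row[OF P3 _ G1, where c = c1 and w = "1"] by (auto simp: N3 omega_arith)
  have e33: "a p3 c3 = f3 * -1 * cnj g3"
    using edge2[OF P1 P3 _ _ e11 e31 e13 F1 G1 G3] D by (simp add: N1 N3 omega_arith)
  have e35: "a p3 c5 = f3 * 1 * cnj g5"
    using edge2[OF P2 P3 _ _ e21 e31 e25 F2 G1 G5] D by (simp add: N2 N3 omega_arith)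
  obtain g6 where e36: "a p3 c6 = f3 * 1 * cnj g6" and G6: "cmod g6 = 1" "g6 \<in> Z_omega"
    using edge_tree_col[OF P3 _ F3, where c = c6 and w = "1"] by (auto simp: N3 omega_arith)
  obtain f4 where e41: "a p4 c1 = f4 * 1 * cnj g1" and F4: "cmod f4 = 1" "f4 \<in> Z_omega"
    using edge_tree_row[OF P4 _ G1, where c = c1 and w = "1"] by (auto simp: N4 omega_arith)
  have e44: "a p4 c4 = f4 * 1 * cnj g4"
    using edge2[OF P1 P4 _ _ e11 e41 e14 F1 G1 G4] D by (simp add: N1 N4 omega_arith)
  have e46: "a p4 c6 = f4 * -1 * cnj g6"
    using edge2[OF P3 P4 _ _ e31 e41 e36 F3 G1 G6] D by (simp add: N3 N4 omega_arith)
  have e47: "a p4 c7 = f4 * 1 * cnj g7"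
    using edge2[OF P2 P4 _ _ e21 e41 e27 F2 G1 G7] D by (simp add: N2 N4 omega_arith)
  obtain f5 where e52: "a p5 c2 = f5 * -1 * cnj g2" and F5: "cmod f5 = 1" "f5 \<in> Z_omega"
    using edge_tree_row[OF P5 _ G2, where c = c2 and w = "-1"] by (auto simp: N5 omega_arith)
  have e53: "a p5 c3 = f5 * 1 * cnj g3"
    using edge2[OF P1 P5 _ _ e12 e52 e13 F1 G2 G3] D by (simp add: N1 N5 omega_arith)
  have e56: "a p5 c6 = f5 * 1 * cnj g6"
    using edge2[OF P3 P5 _ _ e33 e53 e36 F3 G3 G6] D by (simp add: N3 N5 omega_arith)
  have e57: "a p5 c7 = f5 * 1 * cnj g7"
    using edge2[OF P2 P5 _ _ e22 e52 e27 F2 G2 G7] D by (simp add: N2 N5 omega_arith)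
  obtain f6 where e62: "a p6 c2 = f6 * 1 * cnj g2" and F6: "cmod f6 = 1" "f6 \<in> Z_omega"
    using edge_tree_row[OF P6 _ G2, where c = c2 and w = "1"] by (auto simp: N6 omega_arith)
  have e64: "a p6 c4 = f6 * 1 * cnj g4"
    using edge2[OF P1 P6 _ _ e12 e62 e14 F1 G2 G4] D by (simp add: N1 N6 omega_arith)
  have e65: "a p6 c5 = f6 * -1 * cnj g5"
    using edge2[OF P2 P6 _ _ e22 e62 e25 F2 G2 G5] D by (simp add: N2 N6 omega_arith)
  have e66: "a p6 c6 = f6 * 1 * cnj g6"
    using edge2[OF P3 P6 _ _ e35 e65 e36 F3 G5 G6] D by (simp add: N3 N6 omega_arith)
  obtain f7 where e73: "a p7 c3 = f7 * 1 * cnj g3" and F7: "cmod f7 = 1" "f7 \<in> Z_omega"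
    using edge_tree_row[OF P7 _ G3, where c = c3 and w = "1"] by (auto simp: N7 omega_arith)
  have e74: "a p7 c4 = f7 * 1 * cnj g4"
    using edge2[OF P1 P7 _ _ e13 e73 e14 F1 G3 G4] D by (simp add: N1 N7 omega_arith)
  have e75: "a p7 c5 = f7 * 1 * cnj g5"
    using edge2[OF P3 P7 _ _ e33 e73 e35 F3 G3 G5] D by (simp add: N3 N7 omega_arith)
  have e77: "a p7 c7 = f7 * -1 * cnj g7"
    using edge2[OF P2 P7 _ _ e25 e75 e27 F2 G5 G7] D by (simp add: N2 N7 omega_arith)
  show ?thesis unfolding S14_graph_def
  proof (rule on_graph_equiv[OF A, where es = S14_edges and os = "[p1, p2, p5, p7, p3, p6, p4]"
      and ns = "[c1, c2, c7, c3, c5, c6, c4]"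
        and ds = "[f1, f2, f5, f7, f3, f6, f4]" and fs = "[g1, g2, g7, g3, g5, g6, g4]"])
    show "a (on_vertex_nth [p1, p2, p5, p7, p3, p6, p4] [c1, c2, c7, c3, c5, c6,
        c4] x) (on_vertex_nth [p1, p2, p5, p7, p3, p6, p4] [c1, c2, c7, c3, c5, c6, c4] y) =
      on_vertex_nth [f1, f2, f5, f7, f3, f6, f4] [g1, g2, g7, g3, g5, g6, g4] x * S14_listed x y * cnj
          (on_vertex_nth [f1, f2, f5, f7, f3, f6, f4] [g1, g2, g7, g3, g5, g6, g4] y)" if "(x, y) \<in> set
          S14_edges" for x y
      using that unfolding S14_edges_def
          by (simp only: set_simps insert_iff empty_iff) (elim disjE FalseE; simp add:
          e11 e12 e13 e14 e21 e22 e25 e27 e31 e33 e35 e36 e41 e44 e46 e47 e52 e53 e56 e57 e62 e64 e65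
          e66 e73 e74 e75 e77)
  qed (use V dist F1 G1 F2 G2 F3 G3 F4 G4 F5 G5 F6 G6 F7 G7 S14_edges_complete S14_asym S14_degree
      S14_values in auto)
qed

text \<open>Rows meet in no or two columns. Fifteen tree edges are prescribed, and
  \<open>edge2\<close> again yields the remaining signs.\<close>

lemma S16_case:
  assumes A: "A \<in> R_mat n" "\<And>i j. i < n \<Longrightarrow> j < n \<Longrightarrow> A $$ (i, j) = a i j"
    and V: "set [p1, p2, p3, p4, p5, p6, p7, p8] \<union> set [c1, c2, c3, c4, c5, c6, c7, c8] = {..<n}"
        "set [p1, p2, p3, p4, p5, p6, p7, p8] \<inter> set [c1, c2, c3, c4, c5, c6, c7, c8] = {}"
    and dist: "distinct [p1, p2, p3, p4, p5, p6, p7, p8]" "distinct [c1, c2, c3, c4, c5, c6, c7, c8]"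
    and N1: "nb p1 = {c1, c2, c3, c4}"
    and N2: "nb p2 = {c1, c2, c5, c6}"
    and N3: "nb p3 = {c1, c3, c5, c7}"
    and N4: "nb p4 = {c1, c4, c6, c7}"
    and N5: "nb p5 = {c2, c3, c5, c8}"
    and N6: "nb p6 = {c2, c4, c6, c8}"
    and N7: "nb p7 = {c3, c4, c7, c8}"
    and N8: "nb p8 = {c5, c6, c7, c8}"
  shows "equivalent_to_graph A S16_graph"
proof -
  note D = dist[simplified]
  have P: "p1 < n" "p2 < n" "p3 < n" "p4 < n" "p5 < n" "p6 < n" "p7 < n" "p8 < n"
      and C: "c1 < n" "c2 < n" "c3 < n" "c4 < n" "c5 < n" "c6 < n" "c7 < n" "c8 < n" using V(1) by auto
  note P1 = P(1) and P2 = P(2) and P3 = P(3) and P4 = P(4) and P5 = P(5) and P6 = P(6) and P7 = P(7)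
      and P8 = P(8)
  define f1 :: complex where "f1 = 1"
  have F1: "cmod f1 = 1" "f1 \<in> Z_omega" by (simp_all add: f1_def)
  obtain g1 where e11: "a p1 c1 = f1 * 1 * cnj g1" and G1: "cmod g1 = 1" "g1 \<in> Z_omega"
    using edge_tree_col[OF P1 _ F1, where c = c1 and w = "1"] by (auto simp: N1 omega_arith)
  obtain g2 where e12: "a p1 c2 = f1 * -1 * cnj g2" and G2: "cmod g2 = 1" "g2 \<in> Z_omega"
    using edge_tree_col[OF P1 _ F1, where c = c2 and w = "-1"] by (auto simp: N1 omega_arith)
  obtain g3 where e13: "a p1 c3 = f1 * 1 * cnj g3" and G3: "cmod g3 = 1" "g3 \<in> Z_omega"
    using edge_tree_col[OF P1 _ F1, where c = c3 and w = "1"] by (auto simp: N1 omega_arith)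
  obtain g4 where e14: "a p1 c4 = f1 * 1 * cnj g4" and G4: "cmod g4 = 1" "g4 \<in> Z_omega"
    using edge_tree_col[OF P1 _ F1, where c = c4 and w = "1"] by (auto simp: N1 omega_arith)
  obtain f2 where e21: "a p2 c1 = f2 * 1 * cnj g1" and F2: "cmod f2 = 1" "f2 \<in> Z_omega"
    using edge_tree_row[OF P2 _ G1, where c = c1 and w = "1"] by (auto simp: N2 omega_arith)
  have e22: "a p2 c2 = f2 * 1 * cnj g2"
    using edge2[OF P1 P2 _ _ e11 e21 e12 F1 G1 G2] D by (simp add: N1 N2 omega_arith)
  obtain g5 where e25: "a p2 c5 = f2 * -1 * cnj g5" and G5: "cmod g5 = 1" "g5 \<in> Z_omega"
    using edge_tree_col[OF P2 _ F2, where c = c5 and w = "-1"] by (auto simp: N2 omega_arith)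
  obtain g6 where e26: "a p2 c6 = f2 * 1 * cnj g6" and G6: "cmod g6 = 1" "g6 \<in> Z_omega"
    using edge_tree_col[OF P2 _ F2, where c = c6 and w = "1"] by (auto simp: N2 omega_arith)
  obtain f3 where e31: "a p3 c1 = f3 * 1 * cnj g1" and F3: "cmod f3 = 1" "f3 \<in> Z_omega"
    using edge_tree_row[OF P3 _ G1, where c = c1 and w = "1"] by (auto simp: N3 omega_arith)
  have e33: "a p3 c3 = f3 * -1 * cnj g3"
    using edge2[OF P1 P3 _ _ e11 e31 e13 F1 G1 G3] D by (simp add: N1 N3 omega_arith)
  have e35: "a p3 c5 = f3 * 1 * cnj g5"
    using edge2[OF P2 P3 _ _ e21 e31 e25 F2 G1 G5] D by (simp add: N2 N3 omega_arith)
  obtain g7 where e37: "a p3 c7 = f3 * 1 * cnj g7" and G7: "cmod g7 = 1" "g7 \<in> Z_omega"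
    using edge_tree_col[OF P3 _ F3, where c = c7 and w = "1"] by (auto simp: N3 omega_arith)
  obtain f4 where e41: "a p4 c1 = f4 * -1 * cnj g1" and F4: "cmod f4 = 1" "f4 \<in> Z_omega"
    using edge_tree_row[OF P4 _ G1, where c = c1 and w = "-1"] by (auto simp: N4 omega_arith)
  have e44: "a p4 c4 = f4 * 1 * cnj g4"
    using edge2[OF P1 P4 _ _ e11 e41 e14 F1 G1 G4] D by (simp add: N1 N4 omega_arith)
  have e46: "a p4 c6 = f4 * 1 * cnj g6"
    using edge2[OF P2 P4 _ _ e21 e41 e26 F2 G1 G6] D by (simp add: N2 N4 omega_arith)
  have e47: "a p4 c7 = f4 * 1 * cnj g7"
    using edge2[OF P3 P4 _ _ e31 e41 e37 F3 G1 G7] D by (simp add: N3 N4 omega_arith)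
  obtain f5 where e52: "a p5 c2 = f5 * 1 * cnj g2" and F5: "cmod f5 = 1" "f5 \<in> Z_omega"
    using edge_tree_row[OF P5 _ G2, where c = c2 and w = "1"] by (auto simp: N5 omega_arith)
  have e53: "a p5 c3 = f5 * 1 * cnj g3"
    using edge2[OF P1 P5 _ _ e12 e52 e13 F1 G2 G3] D by (simp add: N1 N5 omega_arith)
  have e55: "a p5 c5 = f5 * 1 * cnj g5"
    using edge2[OF P2 P5 _ _ e22 e52 e25 F2 G2 G5] D by (simp add: N2 N5 omega_arith)
  obtain g8 where e58: "a p5 c8 = f5 * -1 * cnj g8" and G8: "cmod g8 = 1" "g8 \<in> Z_omega"
    using edge_tree_col[OF P5 _ F5, where c = c8 and w = "-1"] by (auto simp: N5 omega_arith)
  obtain f6 where e62: "a p6 c2 = f6 * 1 * cnj g2" and F6: "cmod f6 = 1" "f6 \<in> Z_omega"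
    using edge_tree_row[OF P6 _ G2, where c = c2 and w = "1"] by (auto simp: N6 omega_arith)
  have e64: "a p6 c4 = f6 * 1 * cnj g4"
    using edge2[OF P1 P6 _ _ e12 e62 e14 F1 G2 G4] D by (simp add: N1 N6 omega_arith)
  have e66: "a p6 c6 = f6 * -1 * cnj g6"
    using edge2[OF P2 P6 _ _ e22 e62 e26 F2 G2 G6] D by (simp add: N2 N6 omega_arith)
  have e68: "a p6 c8 = f6 * 1 * cnj g8"
    using edge2[OF P5 P6 _ _ e52 e62 e58 F5 G2 G8] D by (simp add: N5 N6 omega_arith)
  obtain f7 where e73: "a p7 c3 = f7 * 1 * cnj g3" and F7: "cmod f7 = 1" "f7 \<in> Z_omega"
    using edge_tree_row[OF P7 _ G3, where c = c3 and w = "1"] by (auto simp: N7 omega_arith)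
  have e74: "a p7 c4 = f7 * -1 * cnj g4"
    using edge2[OF P1 P7 _ _ e13 e73 e14 F1 G3 G4] D by (simp add: N1 N7 omega_arith)
  have e77: "a p7 c7 = f7 * 1 * cnj g7"
    using edge2[OF P3 P7 _ _ e33 e73 e37 F3 G3 G7] D by (simp add: N3 N7 omega_arith)
  have e78: "a p7 c8 = f7 * 1 * cnj g8"
    using edge2[OF P5 P7 _ _ e53 e73 e58 F5 G3 G8] D by (simp add: N5 N7 omega_arith)
  obtain f8 where e85: "a p8 c5 = f8 * 1 * cnj g5" and F8: "cmod f8 = 1" "f8 \<in> Z_omega"
    using edge_tree_row[OF P8 _ G5, where c = c5 and w = "1"] by (auto simp: N8 omega_arith)
  have e86: "a p8 c6 = f8 * 1 * cnj g6"
    using edge2[OF P2 P8 _ _ e25 e85 e26 F2 G5 G6] D by (simp add: N2 N8 omega_arith)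
  have e87: "a p8 c7 = f8 * -1 * cnj g7"
    using edge2[OF P3 P8 _ _ e35 e85 e37 F3 G5 G7] D by (simp add: N3 N8 omega_arith)
  have e88: "a p8 c8 = f8 * 1 * cnj g8"
    using edge2[OF P5 P8 _ _ e55 e85 e58 F5 G5 G8] D by (simp add: N5 N8 omega_arith)
  have h31: "a c3 p1 = g3 * 1 * cnj f1"
    by (rule edge_swap[OF e13 P(1) C(3)]) (simp add: omega_arith)
  have h12: "a c1 p2 = g1 * 1 * cnj f2"
    by (rule edge_swap[OF e21 P(2) C(1)]) (simp add: omega_arith)
  have h13: "a c1 p3 = g1 * 1 * cnj f3"
    by (rule edge_swap[OF e31 P(3) C(1)]) (simp add: omega_arith)
  have h33: "a c3 p3 = g3 * -1 * cnj f3"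
    by (rule edge_swap[OF e33 P(3) C(3)]) (simp add: omega_arith)
  have h73: "a c7 p3 = g7 * 1 * cnj f3"
    by (rule edge_swap[OF e37 P(3) C(7)]) (simp add: omega_arith)
  have h14: "a c1 p4 = g1 * -1 * cnj f4"
    by (rule edge_swap[OF e41 P(4) C(1)]) (simp add: omega_arith)
  have h44: "a c4 p4 = g4 * 1 * cnj f4"
    by (rule edge_swap[OF e44 P(4) C(4)]) (simp add: omega_arith)
  have h64: "a c6 p4 = g6 * 1 * cnj f4"
    by (rule edge_swap[OF e46 P(4) C(6)]) (simp add: omega_arith)
  have h35: "a c3 p5 = g3 * 1 * cnj f5"
    by (rule edge_swap[OF e53 P(5) C(3)]) (simp add: omega_arith)
  have h55: "a c5 p5 = g5 * 1 * cnj f5"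
    by (rule edge_swap[OF e55 P(5) C(5)]) (simp add: omega_arith)
  have h85: "a c8 p5 = g8 * -1 * cnj f5"
    by (rule edge_swap[OF e58 P(5) C(8)]) (simp add: omega_arith)
  have h26: "a c2 p6 = g2 * 1 * cnj f6"
    by (rule edge_swap[OF e62 P(6) C(2)]) (simp add: omega_arith)
  have h66: "a c6 p6 = g6 * -1 * cnj f6"
    by (rule edge_swap[OF e66 P(6) C(6)]) (simp add: omega_arith)
  have h86: "a c8 p6 = g8 * 1 * cnj f6"
    by (rule edge_swap[OF e68 P(6) C(8)]) (simp add: omega_arith)
  have h87: "a c8 p7 = g8 * 1 * cnj f7"
    by (rule edge_swap[OF e78 P(7) C(8)]) (simp add: omega_arith)
  have h68: "a c6 p8 = g6 * 1 * cnj f8"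
    by (rule edge_swap[OF e86 P(8) C(6)]) (simp add: omega_arith)
  show ?thesis unfolding S16_graph_def
  \<comment> \<open>In both cycles of \<open>S16_graph\<close> rows stand at the even indices and
    columns at the odd ones; hence the swapped weights above.\<close>
  proof (rule on_graph_equiv[OF A, where es = S16_edges and os = "[p1, c1, p2, c6, p8, c8, p7, c3]"
      and ns = "[p3, c2, p4, c5, p6, c7, p5, c4]"
        and ds = "[f1, g1, f2, g6, f8, g8, f7, g3]" and fs = "[f3, g2, f4, g5, f6, g7, f5, g4]"])
    show "a (on_vertex_nth [p1, c1, p2, c6, p8, c8, p7, c3] [p3, c2, p4, c5, p6, c7, p5,
        c4] x) (on_vertex_nth [p1, c1, p2, c6, p8, c8, p7, c3] [p3, c2, p4, c5, p6, c7, p5, c4] y) =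
      on_vertex_nth [f1, g1, f2, g6, f8, g8, f7, g3] [f3, g2, f4, g5, f6, g7, f5, g4] x * S16_listed x y
          * cnj (on_vertex_nth [f1, g1, f2, g6, f8, g8, f7, g3] [f3, g2, f4, g5, f6, g7, f5, g4]
          y)" if "(x, y) \<in> set S16_edges" for x y
      using that unfolding S16_edges_def
          by (simp only: set_simps insert_iff empty_iff) (elim disjE FalseE; simp add:
          e11 e12 e13 e14 e21 e22 e25 e26 e31 e33 e35 e37 e41 e44 e46 e47 e52 e53 e55 e58 e62 e64 e66
          e68 e73 e74 e77 e78 e85 e86 e87 e88 h31 h12 h13 h33 h73 h14 h44 h64 h35 h55 h85 h26 h66
          h86 h87 h68)
  qed (use V dist F1 G1 F2 G2 F3 G3 F4 G4 F5 G5 F6 G6 F7 G7 F8 G8 S16_edges_complete S16_asym S16_degree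
      S16_values in auto)
qed

section \<open>Overlaps of rows\<close>

text \<open>Both the union and the intersection of \<open>R\<close> and \<open>C\<close> are closed
  under adjacency, so each is empty or everything.\<close>

lemma bipartite_or_equal:
  assumes R: "R \<subseteq> {..<n}" "C \<subseteq> {..<n}" "R \<noteq> {}" "\<And>r. r \<in> R \<Longrightarrow> nb r \<subseteq> C" "\<And>c. c \<in> C \<Longrightarrow> nb c \<subseteq> R"
  shows "R \<union> C = {..<n}" "R \<inter> C = {} \<or> R = C"
proof -
  show "R \<union> C = {..<n}" by (rule closed_eq_UNIV) (use R in blast)+
  show "R \<inter> C = {} \<or> R = C"
  proof (cases "R \<inter> C = {}")
    case False
    have "R \<inter> C = {..<n}" by (rule closed_eq_UNIV) (use R False in blast)+
    then show ?thesis using R by blast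
  qed simp
qed

text \<open>On the 2 by 2 block of rows p, q and columns i, j, the row overlap of size two makes the
  two products opposite, while a column overlap of size three makes their ratio a primitive cube
  root of unity.\<close>

lemma overlap_dual:
  assumes "p < n" "q < n" "p \<noteq> q" "i \<noteq> j" and pq: "nb p \<inter> nb q = {i, j}" and ij: "nb i \<inter> nb j = {p, q, s}"
    and s: "s \<noteq> p" "s \<noteq> q"
  shows False
proof -
  have lt: "i < n" "j < n" using pq nbD(1)[of _ p] by auto
  have h: "a i p = cnj (a p i)" "a i q = cnj (a q i)" "a j p = cnj (a p j)" "a j q = cnj (a q j)"
    using herm assms lt by blast+
  have inn: "i \<in> nb p" "j \<in> nb p" "i \<in> nb q" "j \<in> nb q" "s \<in> nb i" "s \<in> nb j" using pq ij by auto
  have o: "a p i * cnj (a q i) + a p j * cnj (a q j) = 0"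
    by (rule orth2[OF assms(1) degree[OF assms(1)] assms(2) _ pq assms(4)]) (use assms in auto)
  have "a i p * cnj (a j p) + a i q * cnj (a j q) + a i s * cnj (a j s) = 0"
    by (rule orth3[OF lt(1) degree[OF lt(1)] lt(2) _ ij]) (use assms in auto)
  moreover have "cmod (a i p * cnj (a j p)) = 1" "cmod (a i q * cnj (a j q)) = 1"
      "cmod (a i s * cnj (a j s)) = 1"
    using inn unit_nb(3) assms(1,2) lt by (simp_all add: h norm_mult)
  ultimately have e:
      "(a i p * cnj (a j p))\<^sup>2 + a i p * cnj (a j p) * (a i q * cnj (a j q)) + (a i q * cnj (a j q))\<^sup>2 = 0"
    by (intro unit_sum3(1)) auto
  have U: "a p i * cnj (a p i) = 1" "a p j * cnj (a p j) = 1" "a q i * cnj (a q i) = 1"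
      "a q j * cnj (a q j) = 1"
    using inn unit_nb(1) assms(1,2) by blast+
  have "cnj (a p i) * a p j + cnj (a q i) * a q j = 0" using o U by Groebner_Basis.algebra
  moreover have "(cnj (a p i) * a p j)\<^sup>2 + cnj (a p i) * a p j * (cnj (a q i) * a q j) + (cnj (a q i) * a
      q j)\<^sup>2 = 0"
    using e by (simp only: h complex_cnj_cnj)
  ultimately have "(cnj (a p i) * a p j)\<^sup>2 = 0" by Groebner_Basis.algebra
  then show False using U by auto
qed

text \<open>Triangle weights through \<open>p\<close> turn out to have square 1, but three numbers 1
  or -1 never sum to 0, as orthogonality demands.\<close>

lemma no_K5:
  assumes nb: "nb p = {q, r, s, t}" "nb q = {p, r, s, t}" "nb r = {p, q, s, t}" "nb s = {p, q, r, t}"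
      "nb t = {p, q, r, s}"
    and d: "distinct [p, q, r, s, t]" and lt: "p < n" "q < n" "r < n" "s < n" "t < n"
  shows False
proof -
  \<comment> \<open>The weight of the triangle p, i, j, which is that of the edge from
    \<open>i\<close> to \<open>j\<close> once all edges at \<open>p\<close> are switched to weight
    1.\<close>
  define b where "b i j = a p i * a i j * a j p" for i j
  have un: "a i j * a j i = 1" "cmod (a i j) = 1" "a j i = cnj (a i j)"
    if "i \<noteq> j" "i \<in> {p, q, r, s, t}" "j \<in> {p, q, r, s, t}" for i j
  proof -
    have i: "i < n" "j < n" "j \<in> nb i" using that nb lt by auto
    show h: "a j i = cnj (a i j)" using herm i by blast
    show "cmod (a i j) = 1" "a i j * a j i = 1" using unit_nb(1,3)[OF i(1,3)] h by auto
  qed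
  have o: "a i k1 * a k1 j + a i k2 * a k2 j + a i k3 * a k3 j = 0"
    if "distinct [i, j, k1, k2, k3]" "set [i, j, k1, k2, k3] = {p, q, r, s, t}" for i j k1 k2 k3
  proof -
    have m: "i \<in> {p, q, r, s, t}" "j \<in> {p, q, r, s, t}" "k1 \<in> {p, q, r, s, t}" "k2 \<in> {p, q, r, s, t}"
        "k3 \<in> {p, q, r, s, t}"
      unfolding that(2)[symmetric] by simp_all
    have nbx: "nb x = {p, q, r, s, t} - {x}" if "x \<in> {p, q, r, s, t}" for x using that nb d
        by (elim insertE emptyE) (simp_all, (blast+)?)
    have "nb i \<inter> nb j = {k1, k2, k3}" unfolding nbx[OF m(1)] nbx[OF m(2)] that(2)[symmetric]
        using that(1) by auto
    then have "a i k1 * cnj (a j k1) + a i k2 * cnj (a j k2) + a i k3 * cnj (a j k3) = 0"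
      by (intro orth3[OF _ degree]) (use that(1) m lt in auto)
    then show ?thesis using un(3)[of j k1] un(3)[of j k2] un(3)[of j k3] that(1) m by simp
  qed
  have p0: "p \<in> {p, q, r, s, t}" by simp
  have b1: "cmod (b i j) = 1" and bc: "b j i = cnj (b i j)"
    if h: "i \<noteq> j" "i \<noteq> p" "j \<noteq> p" "i \<in> {p, q, r, s, t}" "j \<in> {p, q, r, s, t}" for i j
  proof -
    note 1 = un[OF h(2)[symmetric] p0 h(4)] and 2 = un[OF h(1,4,5)] and 3 = un[OF h(3,5) p0]
    show "cmod (b i j) = 1" unfolding b_def norm_mult 1(2) 2(2) 3(2) by simp
    show "b j i = cnj (b i j)" unfolding b_def complex_cnj_mult 1(3) 2(3) 3(3) by (simp only: mult_ac)
  qed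
  have sq: "(b x y)\<^sup>2 = 1" if P: "set [p, x, y, z, w] = {p, q, r, s, t}" "distinct [p, x, y, z, w]" for x y z w
  proof -
    have m: "x \<in> {p, q, r, s, t}" "y \<in> {p, q, r, s, t}" "z \<in> {p, q, r, s, t}" "w \<in> {p, q, r, s, t}"
        "p \<in> {p, q, r, s, t}"
      unfolding P(1)[symmetric] by simp_all
    have D: "p \<noteq> x" "p \<noteq> y" "p \<noteq> z" "p \<noteq> w" "x \<noteq> y" "x \<noteq> z" "x \<noteq> w" "y \<noteq> z" "y \<noteq> w" "z \<noteq> w" using P(2) by auto
    note ne = D D[symmetric]
    have B: "cmod (b x y) = 1" "cmod (b x z) = 1" "cmod (b x w) = 1" "cmod (b y z) = 1" "cmod (b y w) = 1"
      by (rule b1; fact ne m)+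
    have bc': "b y x = cnj (b x y)" "b z y = cnj (b y z)" "b w y = cnj (b y w)"
      by (rule bc; fact ne m)+
    have e1: "b x y + b x z + b x w = 0"
    proof -
      have "a x y * a y p + a x z * a z p + a x w * a w p = 0" by (rule o) (simp add: ne, simp only:
          P(1)[symmetric] set_simps insert_commute)
      then show ?thesis unfolding b_def by Groebner_Basis.algebra
    qed
    have e2: "cnj (b x y) + b y z + b y w = 0"
    proof -
      have "a y x * a x p + a y z * a z p + a y w * a w p = 0" by (rule o) (simp add: ne, simp only:
          P(1)[symmetric] set_simps insert_commute)
      then have "b y x + b y z + b y w = 0" unfolding b_def by Groebner_Basis.algebra
      then show ?thesis using bc' by simp
    qed
    have e3: "1 + b x z * cnj (b y z) + b x w * cnj (b y w) = 0"
    proof -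
      have "a x p * a p y + a x z * a z y + a x w * a w y = 0" by (rule o) (simp add: ne, simp only:
          P(1)[symmetric] set_simps insert_commute)
      moreover have "a p x * a x p = 1" "a p y * a y p = 1" "a z p * a p z = 1" "a w p * a p w = 1"
        by (rule un(1); fact ne m)+
      ultimately have "1 + b x z * b z y + b x w * b w y = 0" unfolding b_def by Groebner_Basis.algebra
      then show ?thesis using bc' by simp
    qed
    \<comment> \<open>Here \<open>u\<close> and \<open>v\<close> are primitive cube roots of unity,
      hence equal or conjugate. Equality would give 2 X^2 = -1, against |X| = 1; conjugacy gives X^2
      = 1.\<close>
    define X where "X = b x y"
    define u where "u = b x z * cnj X"
    define v where "v = b y z * X"
    have U: "X * cnj X = 1" "b x z * cnj (b x z) = 1" "b y z * cnj (b y z) = 1"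
      unfolding X_def by (rule unit_cnj; fact B)+
    have "X\<^sup>2 + X * b x z + (b x z)\<^sup>2 = 0"
      unfolding X_def by (rule unit_sum3(1)[OF B(1-3) e1])
    then have u0: "u\<^sup>2 + u + 1 = 0" unfolding u_def using U(1) by Groebner_Basis.algebra
    have "(cnj X)\<^sup>2 + cnj X * b y z + (b y z)\<^sup>2 = 0"
      unfolding X_def by (rule unit_sum3(1)[OF _ B(4,5) e2]) (simp add: B)
    then have v0: "v\<^sup>2 + v + 1 = 0" unfolding v_def using U(1) by Groebner_Basis.algebra
    have bw: "b x w = - X - b x z" "b y w = - cnj X - b y z" using e1 e2 unfolding X_def
        by (Groebner_Basis.algebra)+
    then have "1 + b x z * cnj (b y z) + (X + b x z) * (X + cnj (b y z)) = 0"
      using e3 unfolding bw by (simp add: algebra_simps)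
    moreover have "b x z = u * X" "cnj (b y z) = cnj v * X"
      using U unfolding u_def v_def by (simp_all add: mult_ac)
    ultimately have e: "1 + u * cnj v * X\<^sup>2 + (1 + u) * (1 + cnj v) * X\<^sup>2 = 0" by Groebner_Basis.algebra
    have "v * cnj v = 1" unfolding v_def using U by simp Groebner_Basis.algebra
    have "(v - u) * (v + u + 1) = 0" using u0 v0 by Groebner_Basis.algebra
    then consider "v - u = 0" | "v + u + 1 = 0" by (simp only: mult_eq_0_iff) blast
    then show ?thesis
    proof cases
      case 1
      then have "v = u" by simp
      then have "u * cnj v = 1" using \<open>v * cnj v = 1\<close> by simp
      then have "2 * X\<^sup>2 = - 1" using e u0 v0 \<open>v = u\<close> by Groebner_Basis.algebra
      then have "cmod (2 * X\<^sup>2) = 1" by simp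
      then show ?thesis using B(1) by (simp add: X_def norm_mult norm_power)
    next
      case 2
      have "X\<^sup>2 = 1" using e u0 v0 2 \<open>v * cnj v = 1\<close> by Groebner_Basis.algebra
      then show ?thesis by (simp add: X_def)
    qed
  qed
  have b1': "cmod (b q r) = 1" "cmod (b q s) = 1" "cmod (b q t) = 1"
    by (rule b1; use d in force)+
  have "a q r * a r p + a q s * a s p + a q t * a t p = 0" by (rule o) (use d in force, simp only:
      set_simps insert_commute)
  then have "b q r + b q s + b q t = 0" unfolding b_def by Groebner_Basis.algebra
  then have "(b q r)\<^sup>2 + b q r * b q s + (b q s)\<^sup>2 = 0" by (rule unit_sum3(1)[OF b1'])
  moreover have "(b q r)\<^sup>2 = 1" by (rule sq[of q r s t]) (simp only: set_simps insert_commute, use d in force)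
  moreover have "(b q s)\<^sup>2 = 1" by (rule sq[of q s r t]) (simp only: set_simps insert_commute, use d in force)
  ultimately have "b q r * b q s = - 2" by Groebner_Basis.algebra
  then have "cmod (b q r * b q s) = 2" by simp
  then show False using b1' by (simp add: norm_mult)
qed

text \<open>Three common columns of \<open>u\<close> and \<open>v\<close> again meet pairwise in
  three rows, so each pair of columns has one further common row. If these rows coincide the graph
  grows into S12, otherwise into S10.\<close>

lemma overlap3_case:
  assumes A: "A \<in> R_mat n" "\<And>i j. i < n \<Longrightarrow> j < n \<Longrightarrow> A $$ (i, j) = a i j"
    and notwin: "\<And>u v. u < n \<Longrightarrow> v < n \<Longrightarrow> u \<noteq> v \<Longrightarrow> nb u \<noteq> nb v"
    and uv: "u < n" "v < n" "u \<noteq> v" and xyz: "{x, y, z} \<subseteq> nb u \<inter> nb v" "x \<noteq> y" "x \<noteq> z" "y \<noteq> z"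
  shows "equivalent_to_graph A S10_graph \<or> equivalent_to_graph A S12_graph"
proof -
  define r where "r j = a v j * cnj (a u j)" for j
  have xyz': "nb v \<inter> nb u = {x, y, z}"
  proof -
    obtain w where w: "nb u = {x, y, z, w}" "x \<noteq> w" "y \<noteq> w" "z \<noteq> w"
      using card4_three[OF degree[OF uv(1)], of x y z] xyz by auto
    have "w \<notin> nb v"
    proof
      assume "w \<in> nb v"
      then have "nb v = {x, y, z, w}" using card4_four[OF degree[OF uv(2)], of x y z w] xyz w by auto
      then show False using notwin[OF uv] w by simp
    qed
    then show ?thesis using w xyz by auto
  qed
  have r1: "cmod (r j) = 1" if "j \<in> {x, y, z}" for j
    using that xyz unit_nb(3)[OF uv(1)] unit_nb(3)[OF uv(2)] by (auto simp: r_def norm_mult)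
  have sum: "r x + r y + r z = 0"
    unfolding r_def by (rule orth3[OF uv(2) degree[OF uv(2)] uv(1,3) xyz']) (use xyz in auto)
  have "(r x)\<^sup>2 + r x * r y + (r y)\<^sup>2 = 0" by (rule unit_sum3(1)[OF r1 r1 r1 sum]) auto
  \<comment> \<open>omega - 1 is a primitive cube root of unity, so one of the other two ratios is
    omega - 1 times \<open>r x\<close>. The columns are named so that this one is
    \<open>c2\<close>.\<close>
  then have "(r y - (omega - 1) * r x) * (r z - (omega - 1) * r x) = 0"
    using sum omega_facts(3) by Groebner_Basis.algebra
  then obtain c1 c2 c3 where c: "{c1, c2, c3} = {x, y, z}" "c1 \<noteq> c2" "c1 \<noteq> c3" "c2 \<noteq> c3"
      and ratio: "r c2 = (omega - 1) * r c1"
  proof -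
    assume "(r y - (omega - 1) * r x) * (r z - (omega - 1) * r x) = 0"
      and that: "\<And>c1 c2 c3. {c1, c2, c3} = {x, y, z} \<Longrightarrow> c1 \<noteq> c2 \<Longrightarrow> c1 \<noteq> c3 \<Longrightarrow> c2 \<noteq> c3 \<Longrightarrow> r c2 =
          (omega - 1) * r c1 \<Longrightarrow> thesis"
    then have "r y = (omega - 1) * r x \<or> r z = (omega - 1) * r x" by simp
    then show thesis using that[of x y z] that[of x z y] xyz by auto
  qed
  have rat: "a v c2 * cnj (a u c2) = (omega - 1) * (a v c1 * cnj (a u c1))" using ratio by (simp add: r_def)
  have cu: "c1 \<in> nb u" "c2 \<in> nb u" "c3 \<in> nb u" and cv: "c1 \<in> nb v" "c2 \<in> nb v" "c3 \<in> nb v" using c xyz by auto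
  have int: "nb u \<inter> nb v = {c1, c2, c3}" using c xyz' by auto
  have cn: "c1 < n" "c2 < n" "c3 < n" and uc: "u \<in> nb c1" "u \<in> nb c2" "u \<in> nb c3"
    using nbs[OF cu(1) uv(1)] nbs[OF cu(2) uv(1)] nbs[OF cu(3) uv(1)] by auto
  have vc: "v \<in> nb c1" "v \<in> nb c2" "v \<in> nb c3"
    using nbs[OF cv(1) uv(2)] nbs[OF cv(2) uv(2)] nbs[OF cv(3) uv(2)] by auto
  obtain c4 where nu: "nb u = {c1, c2, c3, c4}" "c1 \<noteq> c4" "c2 \<noteq> c4" "c3 \<noteq> c4"
    using card4_three[OF degree[OF uv(1)] cu c(2,3,4)] by metis
  obtain c5 where nv: "nb v = {c1, c2, c3, c5}" "c1 \<noteq> c5" "c2 \<noteq> c5" "c3 \<noteq> c5"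
    using card4_three[OF degree[OF uv(2)] cv c(2,3,4)] by metis
  have c45: "c4 \<noteq> c5" using notwin[OF uv] nu nv by auto
  have c4n: "c4 < n" "u \<in> nb c4" using nbs[of c4 u] nu uv by auto
  have c5n: "c5 < n" "v \<in> nb c5" using nbs[of c5 v] nv uv by auto
  \<comment> \<open>An overlap of just {u, v} contradicts \<open>overlap_dual\<close>, and a full
    overlap would produce twins.\<close>
  have third: "\<exists>w. w \<noteq> u \<and> w \<noteq> v \<and> nb i \<inter> nb j = {u, v, w}"
    if ij: "i < n" "j < n" "i \<noteq> j" "u \<in> nb i" "u \<in> nb j" "v \<in> nb i" "v \<in> nb j"
        and k: "nb u \<inter> nb v = {i, j, k}" "k \<noteq> i" "k \<noteq> j" for i j k
  proof -
    obtain p q where ni: "nb i = {u, v, p, q}" and d: "u \<noteq> p" "u \<noteq> q" "v \<noteq> p" "v \<noteq> q" "p \<noteq> q"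
      using card4_two[OF degree[OF ij(1)] ij(4,6) uv(3)] by metis
    have nij: "nb i \<inter> nb j \<noteq> {u, v}"
    proof
      assume "nb i \<inter> nb j = {u, v}"
      then show False using overlap_dual[OF ij(1,2,3) uv(3) _ k] by blast
    qed
    have "\<not> (p \<in> nb j \<and> q \<in> nb j)"
    proof
      assume pq: "p \<in> nb j \<and> q \<in> nb j"
      then have "nb j = {u, v, p, q}" using card4_four[OF degree[OF ij(2)] ij(5,7), of p q] d uv by auto
      then show False using ni notwin[OF ij(1-3)] by simp
    qed
    then consider "p \<in> nb j" "q \<notin> nb j" | "p \<notin> nb j" "q \<in> nb j" | "p \<notin> nb j" "q \<notin> nb j" by blast
    then show ?thesis
    proof cases
      case 1 then have "nb i \<inter> nb j = {u, v, p}" using ni ij by auto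
      then show ?thesis using d by (intro exI[of _ p]) auto
    next
      case 2 then have "nb i \<inter> nb j = {u, v, q}" using ni ij by auto
      then show ?thesis using d by (intro exI[of _ q]) auto
    next
      case 3 then have "nb i \<inter> nb j = {u, v}" using ni ij by auto
      then show ?thesis using nij by blast
    qed
  qed
  have perm: "nb u \<inter> nb v = {c1, c3, c2}" "nb u \<inter> nb v = {c2, c3, c1}" using int by auto
  obtain w12 where w12: "w12 \<noteq> u" "w12 \<noteq> v" "nb c1 \<inter> nb c2 = {u, v, w12}"
    using third[OF cn(1,2) c(2) uc(1,2) vc(1,2) int] c by metis
  obtain w13 where w13: "w13 \<noteq> u" "w13 \<noteq> v" "nb c1 \<inter> nb c3 = {u, v, w13}"
    using third[OF cn(1,3) c(3) uc(1,3) vc(1,3) perm(1)] c by metis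
  obtain w23 where w23: "w23 \<noteq> u" "w23 \<noteq> v" "nb c2 \<inter> nb c3 = {u, v, w23}"
    using third[OF cn(2,3) c(4) uc(2,3) vc(2,3) perm(2)] c by metis
  have m12: "w12 \<in> nb c1" "w12 \<in> nb c2" and m13: "w13 \<in> nb c1" "w13 \<in> nb c3"
      and m23: "w23 \<in> nb c2" "w23 \<in> nb c3"
    using w12 w13 w23 by auto
  have wn: "w12 < n" "w13 < n" "w23 < n" "c1 \<in> nb w12" "c2 \<in> nb w12" "c1 \<in> nb w13" "c3 \<in> nb w13"
      "c2 \<in> nb w23" "c3 \<in> nb w23"
    using nbs[OF m12(1) cn(1)] nbs[OF m12(2) cn(2)] nbs[OF m13(1) cn(1)] nbs[OF m13(2) cn(3)] nbs[OF
        m23(1) cn(2)] nbs[OF m23(2) cn(3)] by auto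
  show ?thesis
  proof (cases "w12 \<in> nb c3")
    case True
    have "w12 \<in> nb c1 \<inter> nb c3" "w12 \<in> nb c2 \<inter> nb c3" using m12 True by auto
    then have e: "w13 = w12" "w23 = w12" using w13 w23 w12 by auto
    define w where "w = w12"
    have wuv: "w \<noteq> u" "w \<noteq> v" "w < n" using w12 wn by (auto simp: w_def)
    have cw: "c1 \<in> nb w" "c2 \<in> nb w" "c3 \<in> nb w" using wn e by (auto simp: w_def)
    have wc: "w \<in> nb c1" "w \<in> nb c2" "w \<in> nb c3" using m12 True by (auto simp: w_def)
    obtain c6 where nw: "nb w = {c1, c2, c3, c6}" "c1 \<noteq> c6" "c2 \<noteq> c6" "c3 \<noteq> c6"
      using card4_three[OF degree[OF wuv(3)] cw c(2,3,4)] by metis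
    have c6n: "c6 < n" "w \<in> nb c6" using nbs[of c6 w] nw wuv by auto
    have c46: "c4 \<noteq> c6" "c5 \<noteq> c6" using notwin[OF uv(1) wuv(3)] notwin[OF uv(2) wuv(3)] nu nv nw wuv by auto
    obtain x1 where x1: "nb c1 = {u, v, w, x1}" "u \<noteq> x1" "v \<noteq> x1" "w \<noteq> x1"
      using card4_three[OF degree[OF cn(1)] uc(1) vc(1) wc(1) uv(3)] wuv by metis
    obtain x2 where x2: "nb c2 = {u, v, w, x2}" "u \<noteq> x2" "v \<noteq> x2" "w \<noteq> x2"
      using card4_three[OF degree[OF cn(2)] uc(2) vc(2) wc(2) uv(3)] wuv by metis
    obtain x3 where x3: "nb c3 = {u, v, w, x3}" "u \<noteq> x3" "v \<noteq> x3" "w \<noteq> x3"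
      using card4_three[OF degree[OF cn(3)] uc(3) vc(3) wc(3) uv(3)] wuv by metis
    have xne: "x1 \<noteq> x2" "x1 \<noteq> x3" "x2 \<noteq> x3"
      using notwin[OF cn(1,2) c(2)] notwin[OF cn(1,3) c(3)] notwin[OF cn(2,3) c(4)] x1 x2 x3 by auto
    \<comment> \<open>The fourth row \<open>xi\<close> of column \<open>ci\<close> shares
      \<open>ci\<close> with each of \<open>u\<close>, \<open>v\<close>, \<open>w\<close>, hence a
      second column too. It misses the other two common columns, so this is the fourth column of
      that row.\<close>
    have ext: "ck \<in> nb xi"
      if t: "t < n" "nb t = {c1, c2, c3, ck}" "t \<in> {u, v, w}"
          and xi: "(ci, xi) \<in> {(c1, x1), (c2, x2), (c3, x3)}" for t ck ci xi
    proof -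
      have "xi \<in> nb ci" "ci < n" using xi x1 x2 x3 cn by auto
      then have xin: "xi < n" "ci \<in> nb xi" using nbs[of xi ci] by auto
      have "xi \<noteq> t" using xi t x1 x2 x3 by auto
      moreover have "ci \<in> nb t" using xi t by auto
      ultimately obtain y where y: "y \<noteq> ci" "y \<in> nb t" "y \<in> nb xi" using cover[of ci t xi] t(1) xin by metis
      have "xi \<notin> nb c" if "c \<in> {c1, c2, c3}" "c \<noteq> ci" for c
        using that xi x1 x2 x3 xne by auto
      then have "c \<notin> nb xi" if "c \<in> {c1, c2, c3}" "c \<noteq> ci" for c using that nb_iff[of c xi] cn xin by auto
      then show ?thesis using y t by auto
    qed
    have xk: "c4 \<in> nb xi \<and> c5 \<in> nb xi \<and> c6 \<in> nb xi" if "(ci, xi) \<in> {(c1, x1), (c2, x2), (c3, x3)}" for ci xi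
      using ext[OF uv(1) nu(1) _ that] ext[OF uv(2) nv(1) _ that] ext[OF wuv(3) nw(1) _ that] by auto
    have xn: "x1 < n" "x2 < n" "x3 < n" "c1 \<in> nb x1" "c2 \<in> nb x2" "c3 \<in> nb x3"
      using nbs[of x1 c1] nbs[of x2 c2] nbs[of x3 c3] x1 x2 x3 cn by auto
    have X1: "c4 \<in> nb x1" "c5 \<in> nb x1" "c6 \<in> nb x1" and X2: "c4 \<in> nb x2" "c5 \<in> nb x2" "c6 \<in> nb x2"
      and X3: "c4 \<in> nb x3" "c5 \<in> nb x3" "c6 \<in> nb x3" using xk by auto
    have nx1: "nb x1 = {c1, c4, c5, c6}"
        by (rule card4_four[OF degree[OF xn(1)] xn(4) X1]) (use nu nv nw c45 c46 in auto)
    have nx2: "nb x2 = {c2, c4, c5, c6}"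
        by (rule card4_four[OF degree[OF xn(2)] xn(5) X2]) (use nu nv nw c45 c46 in auto)
    have nx3: "nb x3 = {c3, c4, c5, c6}"
        by (rule card4_four[OF degree[OF xn(3)] xn(6) X3]) (use nu nv nw c45 c46 in auto)
    have nc4: "nb c4 = {u, x1, x2, x3}"
    proof (rule card4_four[OF degree[OF c4n(1)] c4n(2)])
      show "x1 \<in> nb c4" "x2 \<in> nb c4" "x3 \<in> nb c4"
        using nbs[OF X1(1) xn(1)] nbs[OF X2(1) xn(2)] nbs[OF X3(1) xn(3)] by simp_all
    qed (fact x1 x2 x3 xne)+
    have nc5: "nb c5 = {v, x1, x2, x3}"
    proof (rule card4_four[OF degree[OF c5n(1)] c5n(2)])
      show "x1 \<in> nb c5" "x2 \<in> nb c5" "x3 \<in> nb c5"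
        using nbs[OF X1(2) xn(1)] nbs[OF X2(2) xn(2)] nbs[OF X3(2) xn(3)] by simp_all
    qed (fact x1 x2 x3 xne)+
    have nc6: "nb c6 = {w, x1, x2, x3}"
    proof (rule card4_four[OF degree[OF c6n(1)] c6n(2)])
      show "x1 \<in> nb c6" "x2 \<in> nb c6" "x3 \<in> nb c6"
        using nbs[OF X1(3) xn(1)] nbs[OF X2(3) xn(2)] nbs[OF X3(3) xn(3)] by simp_all
    qed (fact x1 x2 x3 xne)+
    define R where "R = {u, v, w, x1, x2, x3}"
    define C where "C = {c1, c2, c3, c4, c5, c6}"
    have rows: "nb t \<subseteq> C" if "t \<in> R" for t
      using that unfolding R_def by (elim insertE emptyE) (simp_all add: C_def nu(1) nv(1) nw(1) nx1 nx2 nx3)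
    have cols: "nb t \<subseteq> R" if "t \<in> C" for t
      using that unfolding C_def by (elim insertE emptyE) (simp_all add: R_def x1(1) x2(1) x3(1) nc4 nc5 nc6)
    have sub: "R \<subseteq> {..<n}" "C \<subseteq> {..<n}" "R \<noteq> {}"
      unfolding R_def C_def using uv wuv xn cn c4n c5n c6n by simp_all
    note RC = bipartite_or_equal[OF sub rows cols]
    \<comment> \<open>If rows and columns coincided, \<open>u\<close>, \<open>v\<close>,
      \<open>w\<close> would be \<open>c4\<close>, \<open>c5\<close>, \<open>c6\<close> cyclically
      permuted, and then the row and column descriptions of one neighbourhood would
      disagree.\<close>
    have "R \<noteq> C"
    proof
      assume eq: "R = C"
      have irr: "t \<notin> nb t" if "t \<in> R" for t using nb_irrefl that RC by blast
      have "u \<in> C" "v \<in> C" "w \<in> C" using eq by (auto simp: R_def)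
      moreover have "u \<noteq> c1" "u \<noteq> c2" "u \<noteq> c3" "u \<noteq> c4" "v \<noteq> c1" "v \<noteq> c2" "v \<noteq> c3" "v \<noteq> c5" "w \<noteq> c1"
          "w \<noteq> c2" "w \<noteq> c3" "w \<noteq> c6"
        using irr[of u] irr[of v] irr[of w] nb_irrefl cn uc vc wc c4n c5n c6n by blast+
      ultimately have mem: "u = c5 \<or> u = c6" "v = c4 \<or> v = c6" "w = c4 \<or> w = c5" by (auto simp: C_def)
      then show False
      proof (elim disjE)
        assume "u = c5" "v = c6" "w = c4"
        then have "v \<in> nb u" using nc5 by simp
        then show False using nu \<open>v = c6\<close> nw c46 by auto
      next
        assume "u = c6" "v = c4" "w = c5"
        then have "w \<in> nb u" using nc6 by simp
        then show False using nu \<open>w = c5\<close> nv c45 by auto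
      qed (use uv wuv in auto)
    qed
    then have disj: "R \<inter> C = {}" using RC by blast
    have "equivalent_to_graph A S12_graph"
    proof (rule S12_case[OF A _ _ _ _ nu(1) nv(1) nw(1) nx1 nx2 nx3 x1(1) x2(1) rat])
      show "set [u, v, w, x1, x2, x3] \<union> set [c1, c2, c3, c4, c5, c6] = {..<n}" using RC(1)
          unfolding R_def C_def set_simps .
      show "set [u, v, w, x1, x2, x3] \<inter> set [c1, c2, c3, c4, c5, c6] = {}" using disj
          unfolding R_def C_def set_simps .
      show "distinct [u, v, w, x1, x2, x3]" using uv(3) wuv(1,2) x1(2-4) x2(2-4) x3(2-4) xne by simp
      show "distinct [c1, c2, c3, c4, c5, c6]" using c(2-4) nu(2-4) nv(2-4) nw(2-4) c45 c46 by simp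
    qed
    then show ?thesis ..
  next
    case False
    have w12c3: "c3 \<notin> nb w12" using False nb_iff[of c3 w12] cn wn by auto
    have n13: "w13 \<notin> nb c2"
    proof
      assume "w13 \<in> nb c2"
      then have "w13 = w12" using w12 w13 m13 by auto
      then show False using False m13 by simp
    qed
    have n23: "w23 \<notin> nb c1"
    proof
      assume "w23 \<in> nb c1"
      then have "w23 = w12" using w12 w23 m23 by auto
      then show False using False m23 by simp
    qed
    have w13c2: "c2 \<notin> nb w13" and w23c1: "c1 \<notin> nb w23"
        using n13 n23 nb_iff[of c2 w13] nb_iff[of c1 w23] cn wn by auto
    have wne: "w12 \<noteq> w13" "w12 \<noteq> w23" "w13 \<noteq> w23" using False m13 m23 n13 by auto
    note wuv = w12(1,2)[symmetric] w13(1,2)[symmetric] w23(1,2)[symmetric]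
    have nc1: "nb c1 = {u, v, w12, w13}"
        by (rule card4_four[OF degree[OF cn(1)] uc(1) vc(1) m12(1) m13(1) uv(3)]) (fact wuv wne)+
    have nc2: "nb c2 = {u, v, w12, w23}"
        by (rule card4_four[OF degree[OF cn(2)] uc(2) vc(2) m12(2) m23(1) uv(3)]) (fact wuv wne)+
    have nc3: "nb c3 = {u, v, w13, w23}"
        by (rule card4_four[OF degree[OF cn(3)] uc(3) vc(3) m13(2) m23(2) uv(3)]) (fact wuv wne)+
    \<comment> \<open>Otherwise rows \<open>t\<close> and \<open>w\<close> meet in exactly two
      columns, which themselves meet in three rows, against \<open>overlap_dual\<close>.\<close>
    have mem: "ck \<in> nb w"
      if t: "t < n" "nb t = {i, j, k, ck}" "w < n" "t \<noteq> w" and ij: "i \<noteq> j" "i \<in> nb w" "j \<in> nb w" "k \<notin> nb w"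
        and over: "nb i \<inter> nb j = {t, w, t'}" "t' \<noteq> t" "t' \<noteq> w" for t i j k ck w t'
    proof (rule ccontr)
      assume "ck \<notin> nb w"
      then have "nb t \<inter> nb w = {i, j}" using t ij by auto
      then show False using overlap_dual[OF t(1,3,4) ij(1) _ over] by blast
    qed
    have W12: "c4 \<in> nb w12" "c5 \<in> nb w12"
      using mem[OF uv(1) nu(1) wn(1) _ c(2) wn(4,5) w12c3, of v] mem[OF uv(2) nv(1) wn(1) _ c(2) wn(4,5)
          w12c3, of u] w12 uv
      by (auto simp: insert_commute)
    have nu': "nb u = {c1, c3, c2, c4}" "nb u = {c2, c3, c1, c4}"
        and nv': "nb v = {c1, c3, c2, c5}" "nb v = {c2, c3, c1, c5}"
      using nu nv by auto
    have W13: "c4 \<in> nb w13" "c5 \<in> nb w13"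
      using mem[OF uv(1) nu'(1) wn(2) _ c(3) wn(6,7) w13c2, of v] mem[OF uv(2) nv'(1) wn(2) _ c(3)
          wn(6,7) w13c2, of u] w13 uv
      by (auto simp: insert_commute)
    have W23: "c4 \<in> nb w23" "c5 \<in> nb w23"
      using mem[OF uv(1) nu'(2) wn(3) _ c(4) wn(8,9) w23c1, of v] mem[OF uv(2) nv'(2) wn(3) _ c(4)
          wn(8,9) w23c1, of u] w23 uv
      by (auto simp: insert_commute)
    have nw12: "nb w12 = {c1, c2, c4, c5}"
        by (rule card4_four[OF degree[OF wn(1)] wn(4,5) W12]) (use c nu nv c45 in auto)
    have nw13: "nb w13 = {c1, c3, c4, c5}"
        by (rule card4_four[OF degree[OF wn(2)] wn(6,7) W13]) (use c nu nv c45 in auto)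
    have nw23: "nb w23 = {c2, c3, c4, c5}"
        by (rule card4_four[OF degree[OF wn(3)] wn(8,9) W23]) (use c nu nv c45 in auto)
    have nc4: "nb c4 = {u, w12, w13, w23}"
    proof (rule card4_four[OF degree[OF c4n(1)] c4n(2)])
      show "w12 \<in> nb c4" "w13 \<in> nb c4" "w23 \<in> nb c4"
        using nbs[OF W12(1) wn(1)] nbs[OF W13(1) wn(2)] nbs[OF W23(1) wn(3)] by simp_all
    qed (fact wne w12(1)[symmetric] w13(1)[symmetric] w23(1)[symmetric] w12(2)[symmetric]
        w13(2)[symmetric] w23(2)[symmetric])+
    have nc5: "nb c5 = {v, w12, w13, w23}"
    proof (rule card4_four[OF degree[OF c5n(1)] c5n(2)])
      show "w12 \<in> nb c5" "w13 \<in> nb c5" "w23 \<in> nb c5"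
        using nbs[OF W12(2) wn(1)] nbs[OF W13(2) wn(2)] nbs[OF W23(2) wn(3)] by simp_all
    qed (fact wne w12(1)[symmetric] w13(1)[symmetric] w23(1)[symmetric] w12(2)[symmetric]
        w13(2)[symmetric] w23(2)[symmetric])+
    define R where "R = {u, v, w12, w13, w23}"
    define C where "C = {c1, c2, c3, c4, c5}"
    have rows: "nb t \<subseteq> C" if "t \<in> R" for t
      using that unfolding R_def by (elim insertE emptyE) (simp_all add: C_def nu(1) nv(1) nw12 nw13 nw23)
    have cols: "nb t \<subseteq> R" if "t \<in> C" for t
      using that unfolding C_def by (elim insertE emptyE) (simp_all add: R_def nc1 nc2 nc3 nc4 nc5)
    have sub: "R \<subseteq> {..<n}" "C \<subseteq> {..<n}" "R \<noteq> {}"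
      unfolding R_def C_def using uv wn cn c4n c5n by simp_all
    note RC = bipartite_or_equal[OF sub rows cols]
    have dR: "distinct [u, v, w12, w13, w23]" using uv w12 w13 w23 wne by auto
    \<comment> \<open>Coinciding rows and columns would make the graph complete on five
      vertices.\<close>
    have "R \<noteq> C"
    proof
      assume eq: "R = C"
      have nbR: "nb t = R - {t}" if "t \<in> R" for t
      proof (rule card_seteq)
        have tn: "t < n" using that RC by auto
        show "nb t \<subseteq> R - {t}" using rows[OF that] eq nb_irrefl[OF tn] by auto
        show "card (R - {t}) \<le> card (nb t)" using that dR degree[OF tn] by (simp add: R_def)
      qed (simp add: R_def)
      show False
      proof (rule no_K5[OF _ _ _ _ _ dR uv(1,2) wn(1-3)])
        have Rm: "u \<in> R" "v \<in> R" "w12 \<in> R" "w13 \<in> R" "w23 \<in> R" by (simp_all add: R_def)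
        show "nb u = {v, w12, w13, w23}" "nb v = {u, w12, w13, w23}" "nb w12 = {u, v, w13, w23}"
          "nb w13 = {u, v, w12, w23}" "nb w23 = {u, v, w12, w13}"
          unfolding nbR[OF Rm(1)] nbR[OF Rm(2)] nbR[OF Rm(3)] nbR[OF Rm(4)] nbR[OF Rm(5)] using dR
              by (auto simp: R_def)
      qed
    qed
    then have disj: "R \<inter> C = {}" using RC by blast
    have "equivalent_to_graph A S10_graph"
    proof (rule S10_case[OF A _ _ dR _ nu(1) nv(1) nw12 nw13 nw23 nc1 nc2 nc3 rat])
      show "set [u, v, w12, w13, w23] \<union> set [c1, c2, c3, c4, c5] = {..<n}" using RC(1)
          unfolding R_def C_def set_simps .
      show "set [u, v, w12, w13, w23] \<inter> set [c1, c2, c3, c4, c5] = {}" using disj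
          unfolding R_def C_def set_simps .
      show "distinct [c1, c2, c3, c4, c5]" using c(2-4) nu(2-4) nv(2-4) c45 by simp
    qed
    then show ?thesis ..
  qed
qed

text \<open>\<open>A\<close>, \<open>B\<close>, \<open>C\<close> are the weights of the three
  triangles through \<open>p\<close>. The orthogonality relations of row \<open>p\<close> make
  \<open>A\<close> purely imaginary, but no unit of Z[omega] is.\<close>

lemma no_K4:
  assumes nb: "nb p \<inter> nb q = {r, s}" "nb p \<inter> nb r = {q, s}" "nb p \<inter> nb s = {q, r}" "nb q \<inter> nb r = {p, s}"
    and lt: "p < n" "q < n" "r < n" "s < n" and d: "distinct [p, q, r, s]" and pq: "q \<in> nb p"
  shows False
proof -
  have D: "p \<noteq> q" "p \<noteq> r" "p \<noteq> s" "q \<noteq> r" "q \<noteq> s" "r \<noteq> s" using d by auto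
  have mem: "r \<in> nb p" "s \<in> nb p" "r \<in> nb q" "s \<in> nb q" "s \<in> nb r" using nb by auto
  have h: "a q p = cnj (a p q)" "a r p = cnj (a p r)" "a s p = cnj (a p s)" "a r q = cnj (a q r)"
    "a s q = cnj (a q s)" "a s r = cnj (a r s)"
    using herm lt by blast+
  have o1: "a p r * cnj (a q r) + a p s * cnj (a q s) = 0"
    by (rule orth2[OF lt(1) degree[OF lt(1)] lt(2) _ nb(1)]) (use D in auto)
  have o2: "a p q * cnj (a r q) + a p s * cnj (a r s) = 0"
    by (rule orth2[OF lt(1) degree[OF lt(1)] lt(3) _ nb(2)]) (use D in auto)
  have o3: "a p q * cnj (a s q) + a p r * cnj (a s r) = 0"
    by (rule orth2[OF lt(1) degree[OF lt(1)] lt(4) _ nb(3)]) (use D in auto)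
  define A where "A = a p q * a q r * cnj (a p r)"
  define B where "B = a p q * a q s * cnj (a p s)"
  define C where "C = a p r * a r s * cnj (a p s)"
  have "cnj (a p r * cnj (a q r) + a p s * cnj (a q s)) = 0" unfolding o1 by simp
  then have "A + B = 0" unfolding A_def B_def by simp Groebner_Basis.algebra
  moreover have "cnj A + C = 0"
  proof -
    have "cnj (a p q * cnj (a r q) + a p s * cnj (a r s)) = 0" unfolding o2 by simp
    then have "cnj (a p q) * cnj (a q r) + cnj (a p s) * a r s = 0" by (simp add: h)
    then show ?thesis unfolding A_def C_def by simp Groebner_Basis.algebra
  qed
  moreover have "cnj B + cnj C = 0"
  proof -
    have "cnj (a p q * cnj (a s q) + a p r * cnj (a s r)) = 0" unfolding o3 by simp
    then have "cnj (a p q) * cnj (a q s) + cnj (a p r) * cnj (a r s) = 0" by (simp add: h)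
    then show ?thesis unfolding B_def C_def by simp Groebner_Basis.algebra
  qed
  then have "cnj (B + C) = 0" by simp
  then have "B + C = 0" by (simp only: complex_cnj_zero_iff)
  ultimately have "cnj A = - A" by Groebner_Basis.algebra
  then have "Re (cnj A) = Re (- A)" by simp
  then have "Re A = 0" by simp
  moreover have "A \<in> {1, omega, omega - 1, - 1, - omega, 1 - omega}"
  proof (rule Z_omega_units)
    show "A \<in> Z_omega" unfolding A_def
      using unit_nb(4)[OF lt(1) pq] unit_nb(4)[OF lt(2) mem(3)] unit_nb(4)[OF lt(1) mem(1)]
      by (intro Z_omega_algebra(3) Z_omega_unary(2))
    show "cmod A = 1" unfolding A_def
      using unit_nb(3)[OF lt(1) pq] unit_nb(3)[OF lt(2) mem(3)] unit_nb(3)[OF lt(1) mem(1)]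
      by (simp add: norm_mult)
  qed
  ultimately show False by (auto simp: omega_def)
qed

section \<open>Rows with at most two common neighbours\<close>

definition no_triple :: bool where
  "no_triple \<longleftrightarrow> (\<forall>u v x y z. u < n \<longrightarrow> v < n \<longrightarrow> u \<noteq> v \<longrightarrow> {x, y, z} \<subseteq> nb u \<inter> nb v \<longrightarrow> x \<noteq> y \<longrightarrow> x \<noteq> z \<longrightarrow> y = z)"

lemma no_tripleD:
  "no_triple \<Longrightarrow> u < n \<Longrightarrow> v < n \<Longrightarrow> u \<noteq> v \<Longrightarrow> {x, y, z} \<subseteq> nb u \<inter> nb v \<Longrightarrow> x \<noteq> y \<Longrightarrow> x \<noteq> z \<Longrightarrow> y \<noteq> z \<Longrightarrow> False"
  unfolding no_triple_def by blast

lemma overlap_pair: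
  assumes nt: no_triple
    and "u < n" "v < n" "u \<noteq> v" "x \<in> nb u" "x \<in> nb v"
  obtains y where "nb u \<inter> nb v = {x, y}" "y \<noteq> x"
proof -
  obtain y where y: "y \<noteq> x" "y \<in> nb u" "y \<in> nb v" using cover[of x u v] assms(2-6) by metis
  have "nb u \<inter> nb v = {x, y}"
  proof
    show "nb u \<inter> nb v \<subseteq> {x, y}"
    proof
      fix z assume "z \<in> nb u \<inter> nb v"
      then show "z \<in> {x, y}" using no_tripleD[OF nt assms(2-4), of x y z] y assms(5,6) by auto
    qed
  qed (use y assms in auto)
  then show ?thesis using that y by blast
qed

text \<open>Each pair of corners has one common neighbour besides the third corner. If two of these
  agree, all three do and the configuration is that of \<open>no_K4\<close>. If not,
  \<open>x\<close> and \<open>z\<close> are adjacent, and \<open>p\<close> and \<open>z\<close> have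
  the three common neighbours \<open>q\<close>, \<open>r\<close>, \<open>x\<close>.\<close>

lemma triangle_free:
  assumes nt: no_triple
    and t: "p < n" "q \<in> nb p" "r \<in> nb p" "r \<in> nb q"
  shows False
proof -
  have lt: "q < n" "r < n" "p \<in> nb q" "p \<in> nb r" "q \<in> nb r" "p \<noteq> q" "p \<noteq> r" "q \<noteq> r"
    using nbs[OF t(2) t(1)] nbs[OF t(3) t(1)] nbs[OF t(4)] by auto
  note no3 = no_tripleD[OF nt]
  note pair = overlap_pair[OF nt]
  obtain x where x: "nb p \<inter> nb q = {r, x}" "x \<noteq> r" using pair[OF t(1) lt(1) lt(6) t(3,4)] by blast
  obtain y where y: "nb p \<inter> nb r = {q, y}" "y \<noteq> q" using pair[OF t(1) lt(2) lt(7) t(2) lt(5)] by blast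
  obtain z where z: "nb q \<inter> nb r = {p, z}" "z \<noteq> p" using pair[OF lt(1,2,8,3,4)] by blast
  have mx: "x \<in> nb p" "x \<in> nb q" "y \<in> nb p" "y \<in> nb r" "z \<in> nb q" "z \<in> nb r" using x y z by auto
  have xn: "x < n" "p \<in> nb x" "q \<in> nb x" "x \<noteq> p" "x \<noteq> q" using nbs[OF mx(1) t(1)] nbs[OF mx(2) lt(1)] by auto
  have yn: "y < n" "p \<in> nb y" "r \<in> nb y" "y \<noteq> p" "y \<noteq> r" using nbs[OF mx(3) t(1)] nbs[OF mx(4) lt(2)] by auto
  have zn: "z < n" "q \<in> nb z" "r \<in> nb z" "z \<noteq> q" "z \<noteq> r" using nbs[OF mx(5) lt(1)] nbs[OF mx(6) lt(2)] by auto
  show False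
  proof (cases "x = y")
    case True
    have "x \<in> nb q \<inter> nb r" using mx True by auto
    then have "x = z" using z xn by auto
    have "nb p \<inter> nb x = {q, r}"
    proof -
      obtain w where w: "nb p \<inter> nb x = {q, w}" "w \<noteq> q"
          using pair[OF t(1) xn(1) xn(4)[symmetric] t(2) xn(3)] by blast
      have "r \<in> nb x" using yn True by simp
      then have "r \<in> {q, w}" using w t by auto
      then show ?thesis using w lt by auto
    qed
    then show False
      using no_K4[of p q r x] x y z True \<open>x = z\<close> t lt xn by auto
  next
    case False
    have xz: "x \<noteq> z"
    proof
      assume "x = z"
      then have "x \<in> nb p \<inter> nb r" using mx by auto
      then show False using y False xn by auto
    qed
    have yz: "y \<noteq> z"
    proof
      assume "y = z"
      then have "y \<in> nb p \<inter> nb q" using mx by auto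
      then show False using x False yn by auto
    qed
    have nq: "nb q = {p, r, x, z}"
      by (rule card4_four[OF degree[OF lt(1)] lt(3) t(4) mx(2,5) lt(7)]) (use xn zn x z xz in auto)
    have nr: "nb r = {p, q, y, z}"
      by (rule card4_four[OF degree[OF lt(2)] lt(4,5) mx(4,6) lt(6)]) (use yn zn y z yz in auto)
    have "x \<in> nb z"
    proof -
      obtain w where w: "w \<noteq> p" "w \<in> nb q" "w \<in> nb x" using cover[OF lt(3) xn(2) _ lt(1) xn(1)] xn by metis
      have "x \<notin> nb r" using nr xn False xz by auto
      then have "w \<noteq> r" using w nb_iff[OF lt(2) xn(1)] by auto
      moreover have "w \<noteq> x" using w nb_irrefl[OF xn(1)] by auto
      ultimately have "z \<in> nb x" using w nq by auto
      then show ?thesis using nb_iff[OF xn(1) zn(1)] by simp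
    qed
    then show False using no3[OF t(1) zn(1) z(2)[symmetric], of q r x] t mx zn lt xn x by auto
  qed
qed

text \<open>The four columns of a row \<open>u\<close> meet pairwise in one further row each, which
  gives six distinct rows \<open>w12\<close> to \<open>w34\<close>. How these share the remaining
  columns is determined up to one alternative, which separates S14 from S16.\<close>

lemma overlap2_case:
  assumes A: "A \<in> R_mat n" "\<And>i j. i < n \<Longrightarrow> j < n \<Longrightarrow> A $$ (i, j) = a i j"
    and nt: no_triple
  shows "equivalent_to_graph A S14_graph \<or> equivalent_to_graph A S16_graph"
proof -
  note no3 = no_tripleD[OF nt]
  note pair = overlap_pair[OF nt] and tri = triangle_free[OF nt]
  define u where "u = (0::nat)"
  have un: "u < n" using n_pos by (simp add: u_def)
  obtain c1 where c1u: "c1 \<in> nb u" using degree[OF un] by fastforce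
  obtain c2 c3 c4 where nu: "nb u = {c1, c2, c3, c4}"
      and c: "c1 \<noteq> c2" "c1 \<noteq> c3" "c1 \<noteq> c4" "c2 \<noteq> c3" "c2 \<noteq> c4" "c3 \<noteq> c4"
    using card4_one[OF degree[OF un] c1u] by metis
  have cu: "c1 \<in> nb u" "c2 \<in> nb u" "c3 \<in> nb u" "c4 \<in> nb u" using nu by auto
  have cn: "c1 < n" "c2 < n" "c3 < n" "c4 < n" and uc: "u \<in> nb c1" "u \<in> nb c2" "u \<in> nb c3" "u \<in> nb c4"
    using nbs[OF cu(1) un] nbs[OF cu(2) un] nbs[OF cu(3) un] nbs[OF cu(4) un] by auto
  \<comment> \<open>The further common row of two columns of \<open>u\<close> contains no third
    column of \<open>u\<close>, by \<open>no_triple\<close>.\<close>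
  have other: "\<exists>w. nb ci \<inter> nb cj = {u, w} \<and> w \<noteq> u \<and> w \<in> nb ci \<and> w \<in> nb cj \<and> w < n \<and> ci \<in> nb w \<and> cj \<in> nb w \<and>
      (\<forall>ck \<in> nb u. ck \<noteq> ci \<longrightarrow> ck \<noteq> cj \<longrightarrow> w \<notin> nb ck \<and> ck \<notin> nb w)"
    if ij: "ci \<in> nb u" "cj \<in> nb u" "ci \<noteq> cj" for ci cj
  proof -
    have i: "ci < n" "u \<in> nb ci" "cj < n" "u \<in> nb cj" using nbs[OF ij(1) un] nbs[OF ij(2) un] by auto
    obtain w where w: "nb ci \<inter> nb cj = {u, w}" "w \<noteq> u" using pair[OF i(1,3) ij(3) i(2,4)] by blast
    have m: "w \<in> nb ci" "w \<in> nb cj" using w by auto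
    have wn: "w < n" "ci \<in> nb w" "cj \<in> nb w" using nbs[OF m(1) i(1)] nbs[OF m(2) i(3)] by auto
    have "ck \<notin> nb w" if k: "ck \<in> nb u" "ck \<noteq> ci" "ck \<noteq> cj" for ck
    proof
      assume "ck \<in> nb w"
      then show False using no3[OF un wn(1) w(2)[symmetric], of ci cj ck] ij k wn by auto
    qed
    moreover have "ck < n" if "ck \<in> nb u" for ck using nbD that by blast
    ultimately show ?thesis using w m wn nb_iff[OF _ wn(1)] by (intro exI[of _ w]) auto
  qed
  obtain w12 where w12: "nb c1 \<inter> nb c2 = {u, w12}" "w12 \<noteq> u" "w12 \<in> nb c1" "w12 \<in> nb c2" "w12 < n"
      "c1 \<in> nb w12" "c2 \<in> nb w12"
     "w12 \<notin> nb c3" "c3 \<notin> nb w12" "w12 \<notin> nb c4" "c4 \<notin> nb w12" using other[OF cu(1,2) c(1)] cu c by metis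
  obtain w13 where w13: "nb c1 \<inter> nb c3 = {u, w13}" "w13 \<noteq> u" "w13 \<in> nb c1" "w13 \<in> nb c3" "w13 < n"
      "c1 \<in> nb w13" "c3 \<in> nb w13"
     "w13 \<notin> nb c2" "c2 \<notin> nb w13" "w13 \<notin> nb c4" "c4 \<notin> nb w13" using other[OF cu(1,3) c(2)] cu c by metis
  obtain w14 where w14: "nb c1 \<inter> nb c4 = {u, w14}" "w14 \<noteq> u" "w14 \<in> nb c1" "w14 \<in> nb c4" "w14 < n"
      "c1 \<in> nb w14" "c4 \<in> nb w14"
     "w14 \<notin> nb c2" "c2 \<notin> nb w14" "w14 \<notin> nb c3" "c3 \<notin> nb w14" using other[OF cu(1,4) c(3)] cu c by metis
  obtain w23 where w23: "nb c2 \<inter> nb c3 = {u, w23}" "w23 \<noteq> u" "w23 \<in> nb c2" "w23 \<in> nb c3" "w23 < n"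
      "c2 \<in> nb w23" "c3 \<in> nb w23"
     "w23 \<notin> nb c1" "c1 \<notin> nb w23" "w23 \<notin> nb c4" "c4 \<notin> nb w23" using other[OF cu(2,3) c(4)] cu c by metis
  obtain w24 where w24: "nb c2 \<inter> nb c4 = {u, w24}" "w24 \<noteq> u" "w24 \<in> nb c2" "w24 \<in> nb c4" "w24 < n"
      "c2 \<in> nb w24" "c4 \<in> nb w24"
     "w24 \<notin> nb c1" "c1 \<notin> nb w24" "w24 \<notin> nb c3" "c3 \<notin> nb w24" using other[OF cu(2,4) c(5)] cu c by metis
  obtain w34 where w34: "nb c3 \<inter> nb c4 = {u, w34}" "w34 \<noteq> u" "w34 \<in> nb c3" "w34 \<in> nb c4" "w34 < n"
      "c3 \<in> nb w34" "c4 \<in> nb w34"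
     "w34 \<notin> nb c1" "c1 \<notin> nb w34" "w34 \<notin> nb c2" "c2 \<notin> nb w34" using other[OF cu(3,4) c(6)] cu c by metis
  note wn = w12(5) w13(5) w14(5) w23(5) w24(5) w34(5)
  have wu: "u \<noteq> w12" "u \<noteq> w13" "u \<noteq> w14" "u \<noteq> w23" "u \<noteq> w24" "u \<noteq> w34"
    using w12(2) w13(2) w14(2) w23(2) w24(2) w34(2) by metis+
  have d12: "w12 \<noteq> w13" "w12 \<noteq> w14" "w12 \<noteq> w23" "w12 \<noteq> w24" "w12 \<noteq> w34"
      using w12(8,10) w13(4) w14(4) w23(4) w24(4) w34(4) by metis+
  have d13: "w13 \<noteq> w14" "w13 \<noteq> w23" "w13 \<noteq> w24" "w13 \<noteq> w34" using w13(8,10) w14(4) w23(3) w24(3) w34(4)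
      by metis+
  have d14: "w14 \<noteq> w23" "w14 \<noteq> w24" "w14 \<noteq> w34" using w14(8,10) w23(3) w24(3) w34(3) by metis+
  have d23: "w23 \<noteq> w24" "w23 \<noteq> w34" "w24 \<noteq> w34" using w23(10) w24(4) w34(4) w24(10) w34(3) by metis+
  note dw = d12 d13 d14 d23
  have nc1: "nb c1 = {u, w12, w13, w14}"
      by (rule card4_four[OF degree[OF cn(1)] uc(1) w12(3) w13(3) w14(3)]) (fact wu dw)+
  have nc2: "nb c2 = {u, w12, w23, w24}"
      by (rule card4_four[OF degree[OF cn(2)] uc(2) w12(4) w23(3) w24(3)]) (fact wu dw)+
  have nc3: "nb c3 = {u, w13, w23, w34}"
      by (rule card4_four[OF degree[OF cn(3)] uc(3) w13(4) w23(4) w34(3)]) (fact wu dw)+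
  have nc4: "nb c4 = {u, w14, w24, w34}"
      by (rule card4_four[OF degree[OF cn(4)] uc(4) w14(4) w24(4) w34(4)]) (fact wu dw)+
  have meet: "\<exists>x. x \<noteq> c \<and> x \<in> nb w \<and> x \<in> nb w'" if "w < n" "w' < n" "w \<noteq> w'" "c \<in> nb w" "c \<in> nb w'" for w w' c
    using pair[OF that] by blast
  \<comment> \<open>Three rows through \<open>c\<close> have no second common vertex, since it would
    share all three with \<open>c\<close>.\<close>
  have only: "\<not> (x \<in> nb w \<and> x \<in> nb w' \<and> x \<in> nb w'')"
    if "w \<in> nb c" "w' \<in> nb c" "w'' \<in> nb c" "w \<noteq> w'" "w \<noteq> w''" "w' \<noteq> w''" "c < n" "x \<noteq> c" "w < n"
        for w w' w'' c x
  proof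
    assume xx: "x \<in> nb w \<and> x \<in> nb w' \<and> x \<in> nb w''"
    have xn: "x < n" "w \<in> nb x" using nbs[of x w] xx that by auto
    have "w' < n" "w'' < n" using nbD that by blast+
    then have "w' \<in> nb x" "w'' \<in> nb x" using nb_iff[OF _ xn(1)] xx by blast+
    then show False using no3[OF that(7) xn(1) that(8)[symmetric], of w w' w''] xn that by auto
  qed
  \<comment> \<open>\<open>x\<close> is the second column shared by \<open>w12\<close> and
    \<open>w13\<close>; the remaining column \<open>y\<close> of \<open>w12\<close> then has to be
    the one shared with \<open>w14\<close>.\<close>
  obtain x y where nw12: "nb w12 = {c1, c2, x, y}" and xy: "c1 \<noteq> x" "c1 \<noteq> y" "c2 \<noteq> x" "c2 \<noteq> y" "x \<noteq> y"
      and x13: "x \<in> nb w13"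
  proof -
    obtain x where x: "x \<noteq> c1" "x \<in> nb w12" "x \<in> nb w13" using meet[OF wn(1,2) dw(1) w12(6) w13(6)] by blast
    have x2: "x \<noteq> c2" using x w13(9) by metis
    obtain y where "nb w12 = {c1, c2, x, y}" "c1 \<noteq> y" "c2 \<noteq> y" "x \<noteq> y"
      using card4_three[OF degree[OF wn(1)] w12(6,7) x(2) c(1) x(1)[symmetric] x2[symmetric]] by metis
    then show thesis using that[of x y] x x2 by metis
  qed
  have xyw: "x \<in> nb w12" "y \<in> nb w12" using nw12 by auto
  have xn: "x < n" "y < n" "w12 \<in> nb x" "w12 \<in> nb y" using nbs[OF xyw(1) wn(1)] nbs[OF xyw(2) wn(1)] by auto
  have xc: "x \<noteq> c3" "x \<noteq> c4" "y \<noteq> c3" "y \<noteq> c4" using xyw w12(9,11) by metis+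
  have x14: "x \<notin> nb w14" using only[OF w12(3) w13(3) w14(3) dw(1,2,6) cn(1) xy(1)[symmetric] wn(1)] xyw
      x13 by blast
  have y13: "y \<notin> nb w13" using no3[OF wn(1,2) dw(1), of c1 x y] w12 w13 xyw x13 xy by auto
  have y14: "y \<in> nb w14"
  proof -
    obtain t where "t \<noteq> c1" "t \<in> nb w12" "t \<in> nb w14" using meet[OF wn(1,3) dw(2) w12(6) w14(6)] by blast
    then show ?thesis using nw12 x14 w14(9) by auto
  qed
  obtain s where nw13: "nb w13 = {c1, c3, x, s}" and s: "c1 \<noteq> s" "c3 \<noteq> s" "x \<noteq> s"
    using card4_three[OF degree[OF wn(2)] w13(6,7) x13 c(2) xy(1) xc(1)[symmetric]] by metis
  have s13: "s \<in> nb w13" using nw13 by auto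
  have sy: "s \<noteq> y" using s13 y13 by metis
  have sc: "s \<noteq> c2" "s \<noteq> c4" using s13 w13(9,11) by metis+
  have s14: "s \<in> nb w14"
  proof -
    obtain t where "t \<noteq> c1" "t \<in> nb w13" "t \<in> nb w14" using meet[OF wn(2,3) dw(6) w13(6) w14(6)] by blast
    then show ?thesis using nw13 x14 w14(11) by auto
  qed
  have nw14: "nb w14 = {c1, c4, y, s}"
    by (rule card4_four[OF degree[OF wn(3)] w14(6,7) y14 s14]) (use c xy xc s sc sy in auto)
  have sn: "s < n" "w13 \<in> nb s" "w14 \<in> nb s" using nbs[OF s13 wn(2)] nbs[OF s14 wn(3)] by auto
  have s12: "s \<notin> nb w12" using nw12 s sc sy by auto
  have e23: "x \<in> nb w23 \<or> y \<in> nb w23"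
  proof -
    obtain t where "t \<noteq> c2" "t \<in> nb w12" "t \<in> nb w23" using meet[OF wn(1,4) dw(3) w12(7) w23(6)] by blast
    then show ?thesis using nw12 w23(9) by auto
  qed
  have e24: "x \<in> nb w24 \<or> y \<in> nb w24"
  proof -
    obtain t where "t \<noteq> c2" "t \<in> nb w12" "t \<in> nb w24" using meet[OF wn(1,5) dw(4) w12(7) w24(6)] by blast
    then show ?thesis using nw12 w24(9) by auto
  qed
  have nb4: "\<not> (x \<in> nb w23 \<and> y \<in> nb w23)" "\<not> (x \<in> nb w24 \<and> y \<in> nb w24)"
    "\<not> (x \<in> nb w23 \<and> x \<in> nb w24)" "\<not> (y \<in> nb w23 \<and> y \<in> nb w24)"
  proof -
    show "\<not> (x \<in> nb w23 \<and> y \<in> nb w23)" using no3[OF wn(1,4) dw(3), of c2 x y] w12 w23 xyw xy by auto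
    show "\<not> (x \<in> nb w24 \<and> y \<in> nb w24)" using no3[OF wn(1,5) dw(4), of c2 x y] w12 w24 xyw xy by auto
    show "\<not> (x \<in> nb w23 \<and> x \<in> nb w24)" "\<not> (y \<in> nb w23 \<and> y \<in> nb w24)"
      using only[OF w12(4) w23(3) w24(3) dw(3,4,13) cn(2) xy(3)[symmetric] wn(1)]
        only[OF w12(4) w23(3) w24(3) dw(3,4,13) cn(2) xy(4)[symmetric] wn(1)] xyw by blast+
  qed
  have iff: "w12 \<in> nb t \<longleftrightarrow> t \<in> nb w12" "w13 \<in> nb t \<longleftrightarrow> t \<in> nb w13" "w14 \<in> nb t \<longleftrightarrow> t \<in> nb w14"
      "w23 \<in> nb t \<longleftrightarrow> t \<in> nb w23"
    "w24 \<in> nb t \<longleftrightarrow> t \<in> nb w24" "w34 \<in> nb t \<longleftrightarrow> t \<in> nb w34" if "t < n" for t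
    using nb_iff[OF wn(1) that] nb_iff[OF wn(2) that] nb_iff[OF wn(3) that] nb_iff[OF wn(4) that]
        nb_iff[OF wn(5) that] nb_iff[OF wn(6) that]
    by blast+
  have dc: "distinct [c1, c2, c3, c4]" using c by simp
  have dwl: "distinct [u, w12, w13, w14, w23, w24, w34]" using wu dw by simp
  show ?thesis
  \<comment> \<open>The rows \<open>w12\<close>, \<open>w13\<close>, \<open>w14\<close> pairwise
    share \<open>x\<close>, \<open>y\<close> and \<open>s\<close> besides \<open>c1\<close>. If
    \<open>x\<close> also lies in \<open>w23\<close>, an eighth row arises as in the 4-cube; if not,
    the seven rows close up to the complement of the Fano plane.\<close>
  proof (cases "x \<in> nb w23")
    case True
    have y23: "y \<notin> nb w23" and x24: "x \<notin> nb w24" and y24: "y \<in> nb w24" using True nb4 e24 by blast+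
    obtain t where nw23: "nb w23 = {c2, c3, x, t}" and t: "c2 \<noteq> t" "c3 \<noteq> t" "x \<noteq> t"
      using card4_three[OF degree[OF wn(4)] w23(6,7) True c(4) xy(3) xc(1)[symmetric]] by metis
    have t23: "t \<in> nb w23" using nw23 by auto
    have tc: "t \<noteq> c1" "t \<noteq> c4" using t23 w23(9,11) by metis+
    have ty: "t \<noteq> y" using t23 y23 by metis
    have t24: "t \<in> nb w24"
    proof -
      obtain l where "l \<noteq> c2" "l \<in> nb w23" "l \<in> nb w24" using meet[OF wn(4,5) dw(13) w23(6) w24(6)] by blast
      then show ?thesis using nw23 x24 w24(11) by auto
    qed
    have nw24: "nb w24 = {c2, c4, y, t}"
      by (rule card4_four[OF degree[OF wn(5)] w24(6,7) y24 t24]) (use c xy xc t tc ty in auto)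
    have x34: "x \<notin> nb w34" using only[OF w13(4) w23(4) w34(3) dw(7,9,14) cn(3) xc(1) wn(2)] x13 True by blast
    have s34: "s \<in> nb w34"
    proof -
      obtain l where "l \<noteq> c3" "l \<in> nb w13" "l \<in> nb w34" using meet[OF wn(2,6) dw(9) w13(7) w34(6)] by blast
      then show ?thesis using nw13 x34 w34(9) by auto
    qed
    have t34: "t \<in> nb w34"
    proof -
      obtain l where "l \<noteq> c3" "l \<in> nb w23" "l \<in> nb w34" using meet[OF wn(4,6) dw(14) w23(7) w34(6)] by blast
      then show ?thesis using nw23 x34 w34(11) by auto
    qed
    have st: "s \<noteq> t" using no3[OF wn(2,4) dw(7), of c3 x s] w13 w23 x13 True s13 t23 s xc by auto
    have nw34: "nb w34 = {c3, c4, s, t}"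
      by (rule card4_four[OF degree[OF wn(6)] w34(6,7) s34 t34]) (use c s sc t tc st in auto)
    have tn: "t < n" using nbD t23 by blast
    have xw: "w13 \<in> nb x" "w23 \<in> nb x" using iff[OF xn(1)] x13 True by auto
    \<comment> \<open>The fourth row through \<open>x\<close> is the missing one: \<open>x\<close>
      shares a second row with each of \<open>y\<close>, \<open>s\<close>, \<open>t\<close>, and
      only \<open>z\<close> is left for it.\<close>
    obtain z where nx: "nb x = {w12, w13, w23, z}" and z: "w12 \<noteq> z" "w13 \<noteq> z" "w23 \<noteq> z"
      using card4_three[OF degree[OF xn(1)] xn(3) xw dw(1,3,7)] by metis
    have zx: "z \<in> nb x" using nx by auto
    have zn: "z < n" "x \<in> nb z" using nbs[OF zx xn(1)] by auto
    have yw: "w14 \<in> nb y" "w24 \<in> nb y" "w13 \<notin> nb y" "w23 \<notin> nb y" using iff[OF xn(2)] y14 y24 y13 y23 by auto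
    have sw: "w34 \<in> nb s" "w12 \<notin> nb s" "w23 \<notin> nb s" using iff[OF sn(1)] s34 s12 nw23 s st sc by auto
    have tw: "w23 \<in> nb t" "w24 \<in> nb t" "w34 \<in> nb t" "w12 \<notin> nb t" "w13 \<notin> nb t"
      using iff[OF tn] t23 t24 t34 nw12 nw13 t tc ty st by auto
    have zy: "z \<in> nb y"
    proof -
      obtain l where "l \<noteq> w12" "l \<in> nb x" "l \<in> nb y" using meet[OF xn(1,2) xy(5) xn(3,4)] by blast
      then show ?thesis using nx yw by auto
    qed
    have zs: "z \<in> nb s"
    proof -
      obtain l where "l \<noteq> w13" "l \<in> nb x" "l \<in> nb s" using meet[OF xn(1) sn(1) s(3) xw(1) sn(2)] by blast
      then show ?thesis using nx sw by auto
    qed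
    have zt: "z \<in> nb t"
    proof -
      obtain l where "l \<noteq> w23" "l \<in> nb x" "l \<in> nb t" using meet[OF xn(1) tn t(3) xw(2) tw(1)] by blast
      then show ?thesis using nx tw by auto
    qed
    have zi: "y \<in> nb z" "s \<in> nb z" "t \<in> nb z" using nbs[OF zy xn(2)] nbs[OF zs sn(1)] nbs[OF zt tn] by auto
    have nz: "nb z = {x, y, s, t}"
        by (rule card4_four[OF degree[OF zn(1)] zn(2) zi]) (use xy s sy t ty st in auto)
    have zz: "z \<noteq> w14" "z \<noteq> w24" "z \<noteq> w34" "z \<noteq> u"
      using zn(2) x14 x24 x34 nu xy xc by auto
    have ny: "nb y = {w12, w14, w24, z}"
        by (rule card4_four[OF degree[OF xn(2)] xn(4) yw(1,2) zy]) (use dw z zz in auto)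
    have ns: "nb s = {w13, w14, w34, z}"
        by (rule card4_four[OF degree[OF sn(1)] sn(2,3) sw(1) zs]) (use dw z zz in auto)
    have nt: "nb t = {w23, w24, w34, z}"
        by (rule card4_four[OF degree[OF tn] tw(1-3) zt]) (use dw z zz in auto)
    define R where "R = {u, w12, w13, w14, w23, w24, w34, z}"
    define C where "C = {c1, c2, c3, c4, x, y, s, t}"
    have rows: "nb l \<subseteq> C" if "l \<in> R" for l
      using that unfolding R_def by (elim insertE emptyE) (simp_all add:
          C_def nu nw12 nw13 nw14 nw23 nw24 nw34 nz)
    have cols: "nb l \<subseteq> R" if "l \<in> C" for l
      using that unfolding C_def by (elim insertE emptyE) (simp_all add: R_def nc1 nc2 nc3 nc4 nx ny ns nt)
    have sub: "R \<subseteq> {..<n}" "C \<subseteq> {..<n}" "R \<noteq> {}"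
      unfolding R_def C_def using un wn zn cn xn sn tn by simp_all
    have RC: "R \<union> C = {..<n}" "R \<inter> C = {} \<or> R = C" using bipartite_or_equal[OF sub rows cols] by auto
    \<comment> \<open>Each \<open>w\<close> row is adjacent to some column of \<open>u\<close>, so a
      column \<open>c1\<close> or \<open>c2\<close> equal to it would create a triangle with
      \<open>u\<close>. Both columns would have to be \<open>z\<close>.\<close>
    have "R \<noteq> C"
    proof
      assume eq: "R = C"
      have isz: "ci = z" if ci: "ci \<in> {c1, c2}" for ci
      proof -
        have ciu: "ci \<in> nb u" "ci < n" using ci cu cn by auto
        have "ci \<in> R" using ci eq by (auto simp: C_def)
        moreover have "ci \<noteq> u" using ciu nb_irrefl[OF un] by auto
        moreover have no: "w \<noteq> ci" if "w < n" "cj \<in> nb w" "cj \<in> nb u" for w cj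
        proof
          assume "w = ci"
          then show False using tri[OF un ciu(1) that(3)] that(2) by simp
        qed
        ultimately show ?thesis
          using no[OF wn(1) w12(6) cu(1)] no[OF wn(2) w13(6) cu(1)] no[OF wn(3) w14(6) cu(1)]
            no[OF wn(4) w23(6) cu(2)] no[OF wn(5) w24(6) cu(2)] no[OF wn(6) w34(6) cu(3)]
          unfolding R_def by blast
      qed
      then show False using isz[of c1] isz[of c2] c by simp
    qed
    then have disj: "R \<inter> C = {}" using RC by blast
    have "equivalent_to_graph A S16_graph"
    proof (rule S16_case[OF A _ _ _ _ nu nw12 nw13 nw14 nw23 nw24 nw34 nz])
      show "set [u, w12, w13, w14, w23, w24, w34, z] \<union> set [c1, c2, c3, c4, x, y, s, t] = {..<n}"
        using RC(1) unfolding R_def C_def set_simps .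
      show "set [u, w12, w13, w14, w23, w24, w34, z] \<inter> set [c1, c2, c3, c4, x, y, s, t] = {}"
        using disj unfolding R_def C_def set_simps .
      show "distinct [u, w12, w13, w14, w23, w24, w34, z]" using dwl z zz by auto
      show "distinct [c1, c2, c3, c4, x, y, s, t]" using dc xy xc s sc sy t tc ty st by auto
    qed
    then show ?thesis ..
  next
    case False
    have y23: "y \<in> nb w23" and y24: "y \<notin> nb w24" and x24: "x \<in> nb w24" using False nb4 e23 e24 by blast+
    have s23: "s \<in> nb w23"
    proof -
      obtain l where "l \<noteq> c3" "l \<in> nb w13" "l \<in> nb w23" using meet[OF wn(2,4) dw(7) w13(7) w23(7)] by blast
      then show ?thesis using nw13 False w23(9) by auto
    qed
    have nw23: "nb w23 = {c2, c3, y, s}"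
      by (rule card4_four[OF degree[OF wn(4)] w23(6,7) y23 s23]) (use c xy xc s sc sy in auto)
    have s24: "s \<in> nb w24"
    proof -
      obtain l where "l \<noteq> c4" "l \<in> nb w14" "l \<in> nb w24" using meet[OF wn(3,5) dw(11) w14(7) w24(7)] by blast
      then show ?thesis using nw14 y24 w24(9) by auto
    qed
    have nw24: "nb w24 = {c2, c4, x, s}"
      by (rule card4_four[OF degree[OF wn(5)] w24(6,7) x24 s24]) (use c xy xc s sc sy in auto)
    have ns: "nb s = {w13, w14, w23, w24}"
      by (rule card4_four[OF degree[OF sn(1)] sn(2,3)]) (use iff[OF sn(1)] s23 s24 dw in auto)
    have s34: "s \<notin> nb w34" using iff(6)[OF sn(1)] ns dw by auto
    have x34: "x \<in> nb w34"
    proof -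
      obtain l where "l \<noteq> c3" "l \<in> nb w13" "l \<in> nb w34" using meet[OF wn(2,6) dw(9) w13(7) w34(6)] by blast
      then show ?thesis using nw13 s34 w34(9) by auto
    qed
    have y34: "y \<in> nb w34"
    proof -
      obtain l where "l \<noteq> c4" "l \<in> nb w14" "l \<in> nb w34" using meet[OF wn(3,6) dw(12) w14(7) w34(7)] by blast
      then show ?thesis using nw14 s34 w34(9) by auto
    qed
    have nw34: "nb w34 = {c3, c4, x, y}"
      by (rule card4_four[OF degree[OF wn(6)] w34(6,7) x34 y34]) (use c xy xc in auto)
    have nx: "nb x = {w12, w13, w24, w34}"
      by (rule card4_four[OF degree[OF xn(1)] xn(3)]) (use iff[OF xn(1)] x13 x24 x34 dw in auto)
    have ny: "nb y = {w12, w14, w23, w34}"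
      by (rule card4_four[OF degree[OF xn(2)] xn(4)]) (use iff[OF xn(2)] y14 y23 y34 dw in auto)
    define R where "R = {u, w12, w13, w14, w23, w24, w34}"
    define C where "C = {c1, c2, c3, c4, x, s, y}"
    have rows: "nb l \<subseteq> C" if "l \<in> R" for l
      using that unfolding R_def by (elim insertE emptyE) (simp_all add:
          C_def nu nw12 nw13 nw14 nw23 nw24 nw34)
    have cols: "nb l \<subseteq> R" if "l \<in> C" for l
      using that unfolding C_def by (elim insertE emptyE) (simp_all add: R_def nc1 nc2 nc3 nc4 nx ny ns)
    have sub: "R \<subseteq> {..<n}" "C \<subseteq> {..<n}" "R \<noteq> {}"
      unfolding R_def C_def using un wn cn xn sn by simp_all
    have RC: "R \<union> C = {..<n}" "R \<inter> C = {} \<or> R = C" using bipartite_or_equal[OF sub rows cols] by auto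
    \<comment> \<open>Again triangle-freeness prevents the column \<open>c1\<close> from being one
      of the rows.\<close>
    have "R \<noteq> C"
    proof
      assume eq: "R = C"
      have "c1 \<in> R" using eq by (simp add: C_def)
      moreover have "c1 \<noteq> u" using cu nb_irrefl[OF un] by auto
      moreover have no: "w \<noteq> c1" if "w < n" "cj \<in> nb w" "cj \<in> nb u" for w cj
      proof
        assume "w = c1"
        then show False using tri[OF un cu(1) that(3)] that(2) by simp
      qed
      ultimately show False
        using no[OF wn(1) w12(6) cu(1)] no[OF wn(2) w13(6) cu(1)] no[OF wn(3) w14(6) cu(1)]
          no[OF wn(4) w23(6) cu(2)] no[OF wn(5) w24(6) cu(2)] no[OF wn(6) w34(6) cu(3)]
        unfolding R_def by blast
    qed
    then have disj: "R \<inter> C = {}" using RC by blast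
    have n': "nb w12 = {c1, c2, x, y}" "nb w14 = {c1, c4, s, y}" "nb w23 = {c2, c3, s, y}"
        "nb w24 = {c2, c4, x, s}" "nb w34 = {c3, c4, x, y}"
      using nw12 nw14 nw23 nw24 nw34 by auto
    have "equivalent_to_graph A S14_graph"
    proof (rule S14_case[OF A _ _ _ _ nu n'(1) nw13 n'(2-5)])
      show "set [u, w12, w13, w14, w23, w24, w34] \<union> set [c1, c2, c3, c4, x, s, y] = {..<n}"
        using RC(1) unfolding R_def C_def set_simps .
      show "set [u, w12, w13, w14, w23, w24, w34] \<inter> set [c1, c2, c3, c4, x, s, y] = {}"
        using disj unfolding R_def C_def set_simps .
      show "distinct [u, w12, w13, w14, w23, w24, w34]" by (rule dwl)
      show "distinct [c1, c2, c3, c4, x, s, y]" using dc xy xc s sc sy by auto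
    qed
    then show ?thesis ..
  qed
qed

end

theorem theorem3p5:
  fixes A :: "complex mat"
  assumes "maximal_indecomposable_cyclotomic_mat A"
    and "\<forall>i < dim_row A. A $$ (i, i) = 0"
  shows "(\<exists>k \<ge> 3. equivalent_to_graph A (T_graph k)) \<or>
         (\<exists>k \<ge> 3. equivalent_to_graph A (T_omega_graph k)) \<or>
         equivalent_to_graph A S2_graph \<or>
         equivalent_to_graph A S4_graph \<or>
         equivalent_to_graph A S10_graph \<or>
         equivalent_to_graph A S12_graph \<or>
         equivalent_to_graph A S14_graph \<or>
         equivalent_to_graph A S16_graph"
proof -
  define n where "n = dim_row A"
  define a where "a i j = A $$ (i, j)" for i j
  have R: "A \<in> R_mat n"
    using assms(1) by (simp add: maximal_indecomposable_cyclotomic_mat_def cyclotomic_mat_def n_def)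
  have ent: "A $$ (i, j) = a i j" for i j by (simp add: a_def)
  interpret maximal_form n a
    using maximal_form_of_maximal[OF assms] by (simp add: n_def a_def[abs_def])
  show ?thesis
  proof (cases "\<exists>u v. u < n \<and> v < n \<and> (cmod (a u v))\<^sup>2 \<in> {3, 4}")
    case True
    then show ?thesis using S2_case[OF R ent] S4_case[OF R ent] by blast
  next
    case False
    interpret unit_form n a
    proof unfold_locales
      fix u v assume "u < n" "v < n" "a u v \<noteq> 0"
      then have "(cmod (a u v))\<^sup>2 = 1" using False norm_values[of u v] by auto
      then show "cmod (a u v) = 1" by (simp add: abs_square_eq_1)
    qed
    show ?thesis
    proof (cases "\<exists>u v. u < n \<and> v < n \<and> u \<noteq> v \<and> nb u = nb v")
      case True
      then obtain k g d z where "T_data k g d z" using twins_T_data by blast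
      then show ?thesis using T_data_final[OF R ent] by (auto simp: T_data_def)
    next
      case twins: False
      show ?thesis
      proof (cases no_triple)
        case True
        then show ?thesis using overlap2_case[OF R ent] by blast
      next
        case False
        then obtain u v x y z where uv: "u < n" "v < n" "u \<noteq> v"
          and xyz: "{x, y, z} \<subseteq> nb u \<inter> nb v" "x \<noteq> y" "x \<noteq> z" "y \<noteq> z"
          unfolding no_triple_def by blast
        have "equivalent_to_graph A S10_graph \<or> equivalent_to_graph A S12_graph"
          by (rule overlap3_case[OF R ent _ uv xyz]) (use twins in blast)
        then show ?thesis by blast
      qed
    qed
  qed
qed

end
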